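(* Let $r\in[0,2)$ and $A>0$. Define, for integers $n\ge 2$, $$\rho_n=\begin{cases}\sqrt{n}, & \text{if } r\le 1,\\ (n\log n)^{(2-r)/2}, & \text{if } r>1.\end{cases}$$ Let $\mathcal S^{r}_A$ be the class of Itô semimartingales and $\mathcal S^{r,L}_A\subset\mathcal S^r_A$ the subclass of Lévy processes defined in the context. Let $(w_n)$ be a sequence of positive reals with $w_n\to\infty$ which is a uniform rate for estimating $C(X)_1$ within the class $\mathcal S^{r,L}_A$, in the sense that some sequence of estimators achieves the uniform rate $w_n$ on $\mathcal S^{r,L}_A$. Then there is a constant $K<\infty$ such that $$w_n\le K\rho_n\qquad\text{for all } n\ge 2.$$ Consequently the same conclusion holds for any uniform rate $(w_n)$ for estimating $C(X)_1$ within the bigger class $\mathcal S^r_A$.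
   Context: **Itô semimartingales.** A one-dimensional Itô semimartingale $X$ on a filtered probability space $(\Omega,\mathcal F,(\mathcal F_t)_{t\ge0},\mathbb P)$ is a real càdlàg semimartingale whose characteristics $(B,C,\nu)$, relative to the truncation function $x\mapsto x1_{\{|x|\le1\}}$, have the form $$B_t=\int_0^t b_s\,ds,\qquad C_t=\int_0^t c_s\,ds,\qquad \nu(dt,dx)=dt\,F_t(dx),$$ where $b_t$ and $c_t\ge0$ are optional (or predictable) processes and $F_t=F_{\omega,t}(dx)$ is an optional random measure on $\mathbb R$ with $F_t(\{0\})=0$ (the Lévy measure). The continuous martingale part of $X$ has quadratic variation $C$; write $C(X)_1=C_1=\int_0^1c_s\,ds$ (integrated volatility at time 1), the quantity to be estimated. **Classes.** For $r\in[0,2)$ and $A>0$, $\mathcal S^r_A$ is the set of all Itô semimartingales (each defined on its own filtered probability space) such that $$|b_t|+c_t+\int(|x|^r\wedge1)\,F_t(dx)\le A\quad\text{for all } t$$ (for $r=0$, $|x|^0\wedge1=1$ for $x\ne0$). $\mathcal S^{r,L}_A$ is the subclass of all Lévy processes belonging to $\mathcal S^r_A$; for these $b,c,F$ are non-random and constant in time, and $C(X)_1=c$. **Estimators and uniform rates.** At stage $n$ the process is observed at the times $i/n$, $i=0,1,\dots,n$. Let $\mathbb D^1$ be the Skorokhod space of càdlàg functions $x:\mathbb R_+\to\mathbb R$ and $\mathcal D_n=\sigma(x(i/n):i=0,1,\dots,n)$. An estimator at stage $n$ is a real $\mathcal D_n$-measurable function $X\mapsto\widehat C(X)^n_1$ on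 $\mathbb D^1$ (i.e. a measurable function of the observations $X_0,X_{1/n},\dots,X_1$, the same function for all processes). Given a class $\mathcal S$ of Itô semimartingales and positive reals $w_n\to\infty$, a sequence of estimators $\widehat C^n_1$ achieves the uniform rate $w_n$ on $\mathcal S$ for estimating $C_1$ if $|\widehat C(X)^n_1-C(X)_1|=O_P(w_n^{-1})$ uniformly in $X\in\mathcal S$ as $n\to\infty$, that is, $$\lim_{M\to\infty}\ \limsup_{n\to\infty}\ \sup_{X\in\mathcal S}\ \mathbb P\big(w_n|\widehat C(X)^n_1-C(X)_1|>M\big)=0,$$ where $\mathbb P$ denotes the probability on the space on which $X$ is defined. *)

theory Defs
  imports "HOL-Probability.Probability" "HOL-Library.Equipollence"
begin

text \<open>
  Time runs through the nonnegative reals. Processes are functions of type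
  \<open>real \<Rightarrow> 'a \<Rightarrow> real\<close> whose values at negative times are irrelevant. Filtrations are
  indexed by \<open>real\<close> in order to use the library's \<open>filtration\<close> and \<open>stopping_time\<close>; the
  members with a negative index play no role. Neither right-continuity nor completeness of
  filtrations is assumed.
\<close>

section \<open>Paths\<close>

definition cadlag :: "(real \<Rightarrow> real) \<Rightarrow> bool" where
  "cadlag x \<longleftrightarrow> (\<forall>t\<ge>0. continuous (at_right t) x) \<and> (\<forall>t>0. \<exists>l. (x \<longlongrightarrow> l) (at_left t))"

definition left_continuous :: "(real \<Rightarrow> real) \<Rightarrow> bool" where
  "left_continuous x \<longleftrightarrow> (\<forall>t>0. continuous (at_left t) x)"

definition finite_variation :: "(real \<Rightarrow> real) \<Rightarrow> bool" where
  "finite_variation x \<longleftrightarrow>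
     (\<forall>t\<ge>0. \<exists>K. \<forall>(s :: nat \<Rightarrow> real) m. mono s \<longrightarrow> range s \<subseteq> {0..t} \<longrightarrow>
        (\<Sum>i<m. \<bar>x (s (Suc i)) - x (s i)\<bar>) \<le> K)"

definition jump :: "(real \<Rightarrow> real) \<Rightarrow> real \<Rightarrow> real" where
  "jump x t = x t - Lim (at_left t) x"

section \<open>Processes on a filtered probability space\<close>

definition filtered_prob_space :: "'a measure \<Rightarrow> (real \<Rightarrow> 'a measure) \<Rightarrow> bool" where
  "filtered_prob_space M F \<longleftrightarrow>
     prob_space M \<and> filtration (space M) F \<and> (\<forall>t. subalgebra M (F t))"

definition adapted :: "(real \<Rightarrow> 'a measure) \<Rightarrow> (real \<Rightarrow> 'a \<Rightarrow> real) \<Rightarrow> bool" where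
  "adapted F X \<longleftrightarrow> (\<forall>t\<ge>0. X t \<in> borel_measurable (F t))"

definition cadlag_adapted :: "'a measure \<Rightarrow> (real \<Rightarrow> 'a measure) \<Rightarrow> (real \<Rightarrow> 'a \<Rightarrow> real) \<Rightarrow> bool" where
  "cadlag_adapted M F X \<longleftrightarrow> adapted F X \<and> (\<forall>\<omega>\<in>space M. cadlag (\<lambda>t. X t \<omega>))"

definition optional_sigma :: "'a measure \<Rightarrow> (real \<Rightarrow> 'a measure) \<Rightarrow> ('a \<times> real) measure" where
  "optional_sigma M F = sigma (space M \<times> {0..})
     {{(\<omega>, t). \<omega> \<in> space M \<and> 0 \<le> t \<and> Y t \<omega> \<in> D} | Y D.
        cadlag_adapted M F Y \<and> D \<in> sets borel}"

definition predictable_sigma :: "'a measure \<Rightarrow> (real \<Rightarrow> 'a measure) \<Rightarrow> ('a \<times> real) measure" where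
  "predictable_sigma M F = sigma (space M \<times> {0..})
     {{(\<omega>, t). \<omega> \<in> space M \<and> 0 \<le> t \<and> Y t \<omega> \<in> D} | Y D.
        adapted F Y \<and> (\<forall>\<omega>\<in>space M. left_continuous (\<lambda>t. Y t \<omega>)) \<and> D \<in> sets borel}"

definition optional_process ::
    "'a measure \<Rightarrow> (real \<Rightarrow> 'a measure) \<Rightarrow> (real \<Rightarrow> 'a \<Rightarrow> 'b::topological_space) \<Rightarrow> bool" where
  "optional_process M F Y \<longleftrightarrow> (\<lambda>(\<omega>, t). Y t \<omega>) \<in> borel_measurable (optional_sigma M F)"

definition predictable_process ::
    "'a measure \<Rightarrow> (real \<Rightarrow> 'a measure) \<Rightarrow> (real \<Rightarrow> 'a \<Rightarrow> 'b::topological_space) \<Rightarrow> bool" where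
  "predictable_process M F Y \<longleftrightarrow> (\<lambda>(\<omega>, t). Y t \<omega>) \<in> borel_measurable (predictable_sigma M F)"

definition fv_process :: "'a measure \<Rightarrow> (real \<Rightarrow> 'a measure) \<Rightarrow> (real \<Rightarrow> 'a \<Rightarrow> real) \<Rightarrow> bool" where
  "fv_process M F A \<longleftrightarrow> cadlag_adapted M F A \<and>
     (\<forall>\<omega>\<in>space M. A 0 \<omega> = 0 \<and> finite_variation (\<lambda>t. A t \<omega>))"

section \<open>Local martingales\<close>

definition martingale :: "'a measure \<Rightarrow> (real \<Rightarrow> 'a measure) \<Rightarrow> (real \<Rightarrow> 'a \<Rightarrow> real) \<Rightarrow> bool" where
  "martingale M F X \<longleftrightarrow> adapted F X \<and> (\<forall>t\<ge>0. integrable M (X t)) \<and>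
     (\<forall>s\<ge>0. \<forall>t\<ge>s. AE \<omega> in M. real_cond_exp M (F s) (X t) \<omega> = X s \<omega>)"

text \<open>
  The stopping times of a localising sequence may be taken finite: replace \<open>T k\<close> by its
  minimum with \<open>k\<close>.
\<close>

definition local_martingale :: "'a measure \<Rightarrow> (real \<Rightarrow> 'a measure) \<Rightarrow> (real \<Rightarrow> 'a \<Rightarrow> real) \<Rightarrow> bool" where
  "local_martingale M F X \<longleftrightarrow> cadlag_adapted M F X \<and>
     (\<exists>T :: nat \<Rightarrow> 'a \<Rightarrow> real.
        (\<forall>k. stopping_time F (T k) \<and> (\<forall>\<omega>\<in>space M. 0 \<le> T k \<omega>)) \<and>
        (AE \<omega> in M. mono (\<lambda>k. T k \<omega>) \<and> filterlim (\<lambda>k. T k \<omega>) at_top sequentially) \<and>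
        (\<forall>k. martingale M F (\<lambda>t \<omega>. X (min (T k \<omega>) t) \<omega>)))"

definition local_martingale0 :: "'a measure \<Rightarrow> (real \<Rightarrow> 'a measure) \<Rightarrow> (real \<Rightarrow> 'a \<Rightarrow> real) \<Rightarrow> bool" where
  "local_martingale0 M F X \<longleftrightarrow> local_martingale M F X \<and> (\<forall>\<omega>\<in>space M. X 0 \<omega> = 0)"

definition continuous_local_martingale ::
    "'a measure \<Rightarrow> (real \<Rightarrow> 'a measure) \<Rightarrow> (real \<Rightarrow> 'a \<Rightarrow> real) \<Rightarrow> bool" where
  "continuous_local_martingale M F X \<longleftrightarrow> local_martingale M F X \<and>
     (\<forall>\<omega>\<in>space M. continuous_on {0..} (\<lambda>t. X t \<omega>))"

definition purely_discontinuous ::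
    "'a measure \<Rightarrow> (real \<Rightarrow> 'a measure) \<Rightarrow> (real \<Rightarrow> 'a \<Rightarrow> real) \<Rightarrow> bool" where
  "purely_discontinuous M F X \<longleftrightarrow> local_martingale0 M F X \<and>
     (\<forall>N. continuous_local_martingale M F N \<longrightarrow> local_martingale M F (\<lambda>t \<omega>. X t \<omega> * N t \<omega>))"

text \<open>\<open>C\<close> is the predictable quadratic variation (angle bracket) of \<open>N\<close>.\<close>

definition quadratic_variation ::
    "'a measure \<Rightarrow> (real \<Rightarrow> 'a measure) \<Rightarrow> (real \<Rightarrow> 'a \<Rightarrow> real) \<Rightarrow> (real \<Rightarrow> 'a \<Rightarrow> real) \<Rightarrow> bool" where
  "quadratic_variation M F N C \<longleftrightarrow>
     predictable_process M F C \<and> fv_process M F C \<and>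
     (\<forall>\<omega>\<in>space M. mono_on {0..} (\<lambda>t. C t \<omega>)) \<and>
     local_martingale M F (\<lambda>t \<omega>. (N t \<omega>)\<^sup>2 - C t \<omega>)"

section \<open>Semimartingales and their characteristics\<close>

definition semimartingale :: "'a measure \<Rightarrow> (real \<Rightarrow> 'a measure) \<Rightarrow> (real \<Rightarrow> 'a \<Rightarrow> real) \<Rightarrow> bool" where
  "semimartingale M F X \<longleftrightarrow> cadlag_adapted M F X \<and>
     (\<exists>N A. local_martingale0 M F N \<and> fv_process M F A \<and>
        (AE \<omega> in M. \<forall>t\<ge>0. X t \<omega> = X 0 \<omega> + N t \<omega> + A t \<omega>))"

definition continuous_martingale_part ::
    "'a measure \<Rightarrow> (real \<Rightarrow> 'a measure) \<Rightarrow> (real \<Rightarrow> 'a \<Rightarrow> real) \<Rightarrow> (real \<Rightarrow> 'a \<Rightarrow> real) \<Rightarrow> bool" where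
  "continuous_martingale_part M F X Xc \<longleftrightarrow>
     continuous_local_martingale M F Xc \<and> (\<forall>\<omega>\<in>space M. Xc 0 \<omega> = 0) \<and>
     (\<exists>N A. purely_discontinuous M F N \<and> fv_process M F A \<and>
        (AE \<omega> in M. \<forall>t\<ge>0. X t \<omega> = X 0 \<omega> + Xc t \<omega> + N t \<omega> + A t \<omega>))"

text \<open>
  \<open>X\<close> minus the sum of its jumps of size larger than one; the sum is finite because paths
  are cadlag. It corresponds to the truncation function \<open>x \<mapsto> x * indicator {-1..1} x\<close>.
\<close>

definition truncated :: "(real \<Rightarrow> 'a \<Rightarrow> real) \<Rightarrow> real \<Rightarrow> 'a \<Rightarrow> real" where
  "truncated X t \<omega> = X t \<omega> -
     (\<Sum>s \<in> {s. 0 < s \<and> s \<le> t \<and> 1 < \<bar>jump (\<lambda>u. X u \<omega>) s\<bar>}. jump (\<lambda>u. X u \<omega>) s)"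

text \<open>The sum over jump times \<open>s > 0\<close> of the Dirac masses at \<open>(s, jump at s)\<close>.\<close>

definition jump_measure :: "(real \<Rightarrow> 'a \<Rightarrow> real) \<Rightarrow> 'a \<Rightarrow> (real \<times> real) measure" where
  "jump_measure X \<omega> =
     distr (count_space {s. 0 < s \<and> jump (\<lambda>u. X u \<omega>) s \<noteq> 0}) borel
       (\<lambda>s. (s, jump (\<lambda>u. X u \<omega>) s))"

text \<open>
  \<open>\<nu>\<close> is the predictable compensator of the random measure \<open>\<mu>\<close>; the integrands are the
  nonnegative functions of \<open>((\<omega>, s), x)\<close> measurable for the product of the predictable and
  the Borel \<open>\<sigma>\<close>-algebra.
\<close>

definition compensator ::
    "'a measure \<Rightarrow> (real \<Rightarrow> 'a measure) \<Rightarrow> ('a \<Rightarrow> (real \<times> real) measure) \<Rightarrow>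
     ('a \<Rightarrow> (real \<times> real) measure) \<Rightarrow> bool" where
  "compensator M F \<mu> \<nu> \<longleftrightarrow>
     (\<forall>\<omega>\<in>space M. sets (\<nu> \<omega>) = sets borel \<and> emeasure (\<nu> \<omega>) ({..0} \<times> UNIV) = 0) \<and>
     (\<forall>W :: ('a \<times> real) \<times> real \<Rightarrow> ennreal.
        W \<in> borel_measurable (predictable_sigma M F \<Otimes>\<^sub>M borel) \<longrightarrow>
          predictable_process M F
            (\<lambda>t \<omega>. \<integral>\<^sup>+ (s, x). W ((\<omega>, s), x) * indicator {0..t} s \<partial>\<nu> \<omega>) \<and>
          (\<integral>\<^sup>+ \<omega>. (\<integral>\<^sup>+ (s, x). W ((\<omega>, s), x) \<partial>\<nu> \<omega>) \<partial>M) =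
          (\<integral>\<^sup>+ \<omega>. (\<integral>\<^sup>+ (s, x). W ((\<omega>, s), x) \<partial>\<mu> \<omega>) \<partial>M))"

definition characteristics ::
    "'a measure \<Rightarrow> (real \<Rightarrow> 'a measure) \<Rightarrow> (real \<Rightarrow> 'a \<Rightarrow> real) \<Rightarrow>
     (real \<Rightarrow> 'a \<Rightarrow> real) \<Rightarrow> (real \<Rightarrow> 'a \<Rightarrow> real) \<Rightarrow> ('a \<Rightarrow> (real \<times> real) measure) \<Rightarrow> bool" where
  "characteristics M F X B C \<nu> \<longleftrightarrow>
     (predictable_process M F B \<and> fv_process M F B \<and>
        (\<exists>N. local_martingale0 M F N \<and>
           (AE \<omega> in M. \<forall>t\<ge>0. truncated X t \<omega> = X 0 \<omega> + N t \<omega> + B t \<omega>))) \<and>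
     (\<exists>Xc. continuous_martingale_part M F X Xc \<and> quadratic_variation M F Xc C) \<and>
     compensator M F (jump_measure X) \<nu>"

section \<open>Ito semimartingales\<close>

text \<open>
  A process together with the filtered probability space carrying it and with a version of
  its spot characteristics \<open>b\<close>, \<open>c\<close>, \<open>F\<close>. Each process has its own space, whose carrier is
  a subset of the sample type \<open>'a\<close>; a class of such processes is rich enough only if \<open>'a\<close> has
  at least the cardinality of the continuum.
\<close>

record 'a semimart =
  sp :: "'a measure"
  filt :: "real \<Rightarrow> 'a measure"
  proc :: "real \<Rightarrow> 'a \<Rightarrow> real"
  drift :: "real \<Rightarrow> 'a \<Rightarrow> real"
  vol :: "real \<Rightarrow> 'a \<Rightarrow> real"
  levy :: "real \<Rightarrow> 'a \<Rightarrow> real measure"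

definition ito_semimartingale :: "'a semimart \<Rightarrow> bool" where
  "ito_semimartingale X \<longleftrightarrow>
     filtered_prob_space (sp X) (filt X) \<and>
     semimartingale (sp X) (filt X) (proc X) \<and>
     optional_process (sp X) (filt X) (drift X) \<and>
     optional_process (sp X) (filt X) (vol X) \<and>
     (\<forall>D\<in>sets borel. optional_process (sp X) (filt X) (\<lambda>t \<omega>. emeasure (levy X t \<omega>) D)) \<and>
     (\<forall>\<omega>\<in>space (sp X). \<forall>t\<ge>0. 0 \<le> vol X t \<omega> \<and>
        sets (levy X t \<omega>) = sets borel \<and> emeasure (levy X t \<omega>) {0} = 0) \<and>
     (\<exists>B C \<nu>. characteristics (sp X) (filt X) (proc X) B C \<nu> \<and>
        (AE \<omega> in sp X.
           (\<forall>t\<ge>0. set_integrable lborel {0..t} (\<lambda>s. drift X s \<omega>) \<and>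
              B t \<omega> = (LBINT s:{0..t}. drift X s \<omega>)) \<and>
           (\<forall>t\<ge>0. set_integrable lborel {0..t} (\<lambda>s. vol X s \<omega>) \<and>
              C t \<omega> = (LBINT s:{0..t}. vol X s \<omega>)) \<and>
           (\<forall>D\<in>sets borel. emeasure (\<nu> \<omega>) D =
              (\<integral>\<^sup>+ s\<in>{0..}. emeasure (levy X s \<omega>) {x. (s, x) \<in> D} \<partial>lborel))))"

definition integrated_volatility :: "'a semimart \<Rightarrow> 'a \<Rightarrow> real" where
  "integrated_volatility X \<omega> = (LBINT s:{0..1}. vol X s \<omega>)"

definition levy_process :: "'a measure \<Rightarrow> (real \<Rightarrow> 'a measure) \<Rightarrow> (real \<Rightarrow> 'a \<Rightarrow> real) \<Rightarrow> bool" where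
  "levy_process M F X \<longleftrightarrow> cadlag_adapted M F X \<and> (AE \<omega> in M. X 0 \<omega> = 0) \<and>
     (\<forall>s\<ge>0. \<forall>t\<ge>s.
        prob_space.indep_set M (sets (F s))
          {(\<lambda>\<omega>. X t \<omega> - X s \<omega>) -` D \<inter> space M | D. D \<in> sets borel} \<and>
        distr M borel (\<lambda>\<omega>. X t \<omega> - X s \<omega>) = distr M borel (X (t - s)))"

text \<open>
  Since \<open>0 powr r = 0\<close> for every \<open>r\<close>, the integrand below is the indicator of \<open>x \<noteq> 0\<close> when
  \<open>r = 0\<close>.
\<close>

definition ito_class :: "real \<Rightarrow> real \<Rightarrow> 'a semimart set" where
  "ito_class r A = {X. ito_semimartingale X \<and>
     (\<forall>\<omega>\<in>space (sp X). \<forall>t\<ge>0.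
        ennreal \<bar>drift X t \<omega>\<bar> + ennreal (vol X t \<omega>) +
        (\<integral>\<^sup>+ x. ennreal (min (\<bar>x\<bar> powr r) 1) \<partial>levy X t \<omega>) \<le> ennreal A)}"

definition levy_class :: "real \<Rightarrow> real \<Rightarrow> 'a semimart set" where
  "levy_class r A = {X \<in> ito_class r A. levy_process (sp X) (filt X) (proc X)}"

section \<open>Estimators and uniform rates\<close>

definition skorokhod_space :: "(real \<Rightarrow> real) set" where
  "skorokhod_space = {x. cadlag x}"

definition obs_sigma :: "nat \<Rightarrow> (real \<Rightarrow> real) measure" where
  "obs_sigma n = sigma skorokhod_space
     {{x \<in> skorokhod_space. x (real i / real n) \<in> D} | i D. i \<le> n \<and> D \<in> sets borel}"

definition estimators :: "(nat \<Rightarrow> (real \<Rightarrow> real) \<Rightarrow> real) \<Rightarrow> bool" where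
  "estimators E \<longleftrightarrow> (\<forall>n\<ge>1. E n \<in> borel_measurable (obs_sigma n))"

definition achieves_rate ::
    "(nat \<Rightarrow> (real \<Rightarrow> real) \<Rightarrow> real) \<Rightarrow> (nat \<Rightarrow> real) \<Rightarrow> 'a semimart set \<Rightarrow> bool" where
  "achieves_rate E w S \<longleftrightarrow>
     ((\<lambda>m :: real. limsup (\<lambda>n. SUP X\<in>S.
         emeasure (sp X) {\<omega> \<in> space (sp X).
           w n * \<bar>E n (\<lambda>t. proc X t \<omega>) - integrated_volatility X \<omega>\<bar> > m})) \<longlongrightarrow> 0) at_top"

definition uniform_rate :: "(nat \<Rightarrow> real) \<Rightarrow> 'a semimart set \<Rightarrow> bool" where
  "uniform_rate w S \<longleftrightarrow> (\<exists>E. estimators E \<and> achieves_rate E w S)"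

definition rho :: "real \<Rightarrow> nat \<Rightarrow> real" where
  "rho r n = (if r \<le> 1 then sqrt (real n) else (real n * ln (real n)) powr ((2 - r) / 2))"

end

theory Submission
  imports Defs
begin

text \<open>
  Two Levy processes whose volatilities differ by a multiple of \<open>1 / rho r n\<close> are exhibited such that
  their \<open>n\<close> increments cannot be told apart by a test; no estimator can then be faster than
  \<open>rho r n\<close>. For \<open>r \<le> 1\<close> both are Brownian motions. For \<open>r > 1\<close> both are a Brownian motion plus a
  compound Poisson process whose jump law has a cubic B-spline as its characteristic function
  \<open>\<phi>\<close>. As \<open>8 (1 - \<phi> x) - (1 - \<phi> (2 x))\<close> is exactly quadratic near \<open>0\<close>, a change of the volatility
  can be compensated by rescaling the jumps, so that the characteristic functions of the increments
  agree up to frequencies of order \<open>sqrt (n * ln n)\<close>; beyond these the common Gaussian factor is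
  negligible.
\<close>

section \<open>Independence from characteristic functions\<close>

text \<open>The rate is a balance. Jumps of size \<open>1 / u\<close> and intensity of order
  \<open>\<delta> * u^2\<close> imitate a change \<open>\<delta>\<close> of the volatility at
  frequencies up to \<open>u\<close>. Their share in the class bound is of order
  \<open>\<delta> * u^2 * u powr (- r)\<close>, so \<open>\<delta>\<close> may be a multiple of
  \<open>u powr (r - 2)\<close>. The Gaussian factor decides about \<open>u\<close>: with volatility
  \<open>A / 2\<close> over time \<open>1 / n\<close> it is
  \<open>exp (- A * u^2 / (4 * n))\<close>, and as \<open>n\<close> increments are compared it has
  to beat a power of \<open>n\<close>; hence \<open>u^2\<close> is of order \<open>n * ln n\<close>.
  For \<open>r \<le> 1\<close> this perturbation would be no larger than what two Gaussian laws
  allow. The spline is cubic because its Fourier transform decays like a fourth power: the jump law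
  then has a second moment, which controls the class bound under rescaling. Most of the labour lies
  elsewhere. The class is defined through local martingales, brackets and compensators, so the
  processes have to be built together with their filtrations. Finite activity keeps all jump sums
  finite, and symmetric jumps make the drift vanish.\<close>

lemma (in prob_space) complex_density_unique:
  fixes Q :: "'a \<Rightarrow> complex" and X :: "'a \<Rightarrow> real"
  assumes X[measurable]: "X \<in> borel_measurable M" and Q: "integrable M Q"
    and cf: "\<And>u. (CLINT \<omega>|M. Q \<omega> * iexp (u * X \<omega>)) = 0"
    and D[measurable]: "D \<in> sets borel"
  shows "(CLINT \<omega>|M. Q \<omega> * indicator D (X \<omega>)) = 0"
proof -
  have [measurable]: "Q \<in> borel_measurable M" using Q by auto
  \<comment> \<open>The core is a signed real weight \<open>q\<close>. Its positive and negative
    parts, normalised, are densities of two probability measures under which \<open>X\<close> has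
    the same characteristic function, so the two laws of \<open>X\<close> coincide.\<close>
  have real_case: "(\<integral>\<omega>. q \<omega> * indicator D (X \<omega>) \<partial>M) = 0"
    if q: "integrable M q" and cfq: "\<And>u. (CLINT \<omega>|M. of_real (q \<omega>) * iexp (u * X \<omega>)) = 0"
    for q :: "'a \<Rightarrow> real"
  proof -
    have [measurable]: "q \<in> borel_measurable M" using q by auto
    define m where "m = (\<integral>\<omega>. max 0 (q \<omega>) \<partial>M)"
    have ip: "integrable M (\<lambda>\<omega>. max 0 (q \<omega>))" and im: "integrable M (\<lambda>\<omega>. max 0 (- q \<omega>))"
      using q by auto
    have split: "max 0 (q \<omega>) - max 0 (- q \<omega>) = q \<omega>" for \<omega> by auto
    \<comment> \<open>Frequency zero shows that both parts of \<open>q\<close> have the same mass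
      \<open>m\<close>, so a single normalisation serves both. If \<open>m = 0\<close>, then
      \<open>q\<close> vanishes almost everywhere.\<close>
    have "(CLINT \<omega>|M. of_real (q \<omega>) * iexp (0 * X \<omega>)) = 0" by (rule cfq)
    then have "(\<integral>\<omega>. q \<omega> \<partial>M) = 0" by simp
    then have m': "m = (\<integral>\<omega>. max 0 (- q \<omega>) \<partial>M)"
      unfolding m_def using Bochner_Integration.integral_diff[OF ip im] split by simp
    have m0: "m \<ge> 0" unfolding m_def by simp
    show ?thesis
    proof (cases "m = 0")
      case True
      have "AE \<omega> in M. max 0 (q \<omega>) = 0" 
        using integral_nonneg_eq_0_iff_AE[OF ip] True m_def by simp
      moreover have "AE \<omega> in M. max 0 (- q \<omega>) = 0" 
        using integral_nonneg_eq_0_iff_AE[OF im] True m' by simp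
      ultimately have "AE \<omega> in M. q \<omega> * indicator D (X \<omega>) = 0"
        by eventually_elim (use split in \<open>auto simp: max_def split: if_splits\<close>)
      then show ?thesis by (rule integral_eq_zero_AE)
    next
      case False
      with m0 have mpos: "m > 0" by simp
      \<comment> \<open>The sign \<open>s\<close> selects the positive or the negative part of
        \<open>q\<close>, so that both laws are handled by one computation.\<close>
      have law: "real_distribution (distr (density M (\<lambda>\<omega>. ennreal (max 0 (s * q \<omega>) / m))) borel X)"
        and cff: "char (distr (density M (\<lambda>\<omega>. ennreal (max 0 (s * q \<omega>) / m))) borel X) u 
          = (CLINT \<omega>|M. of_real (max 0 (s * q \<omega>)) * iexp (u * X \<omega>)) / m"
        and ms: "measure (distr (density M (\<lambda>\<omega>. ennreal (max 0 (s * q \<omega>) / m))) borel X) D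
          = (\<integral>\<omega>. max 0 (s * q \<omega>) * indicator D (X \<omega>) \<partial>M) / m"
        if s: "s = 1 \<or> s = -1" for s u :: real
      proof -
        let ?d = "\<lambda>\<omega>. max 0 (s * q \<omega>) / m"
        have id: "integrable M ?d" using q by auto
        have one: "(\<integral>\<omega>. ?d \<omega> \<partial>M) = 1" using s m' m_def mpos by auto
        have d0: "?d \<omega> \<ge> 0" for \<omega> using mpos by auto
        have emass: "emeasure (density M ?d) (space M) = 1"
          using nn_integral_eq_integral[OF id] d0 one by (subst emeasure_density) (auto simp: cong: nn_integral_cong)
        then interpret D: prob_space "density M ?d" by (intro prob_spaceI) auto
        show "real_distribution (distr (density M ?d) borel X)"
          by (intro D.real_distribution_distr) simp
        show "char (distr (density M ?d) borel X) u 
          = (CLINT \<omega>|M. of_real (max 0 (s * q \<omega>)) * iexp (u * X \<omega>)) / m"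
          unfolding char_def 
          by (subst integral_distr, simp, simp, subst integral_density) 
            (use d0 in \<open>auto simp: scaleR_conv_of_real field_simps simp flip: integral_divide_zero\<close>)
        have "measure (distr (density M ?d) borel X) D = (\<integral>x. indicator D x \<partial>(distr (density M ?d) borel X))"
          by simp
        also have "\<dots> = (\<integral>\<omega>. max 0 (s * q \<omega>) * indicator D (X \<omega>) \<partial>M) / m"
          by (subst integral_distr, simp, simp, subst integral_density) 
            (use d0 in \<open>auto simp: field_simps simp flip: integral_divide_zero\<close>)
        finally show "measure (distr (density M ?d) borel X) D
          = (\<integral>\<omega>. max 0 (s * q \<omega>) * indicator D (X \<omega>) \<partial>M) / m" .
      qed
      have ipc: "integrable M (\<lambda>\<omega>. of_real (max 0 (q \<omega>)) * iexp (u * X \<omega>))" 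
        and imc: "integrable M (\<lambda>\<omega>. of_real (max 0 (- q \<omega>)) * iexp (u * X \<omega>))" for u
        by (rule Bochner_Integration.integrable_bound[OF ip]; simp add: norm_mult)
          (rule Bochner_Integration.integrable_bound[OF im]; simp add: norm_mult)
      have "(CLINT \<omega>|M. of_real (max 0 (q \<omega>)) * iexp (u * X \<omega>)) = 
         (CLINT \<omega>|M. of_real (max 0 (- q \<omega>)) * iexp (u * X \<omega>))" for u
      proof -
        have "(CLINT \<omega>|M. of_real (max 0 (q \<omega>)) * iexp (u * X \<omega>)) - 
         (CLINT \<omega>|M. of_real (max 0 (- q \<omega>)) * iexp (u * X \<omega>)) = (CLINT \<omega>|M. of_real (q \<omega>) * iexp (u * X \<omega>))"
          by (subst Bochner_Integration.integral_diff[symmetric, OF ipc imc])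
            (auto intro!: Bochner_Integration.integral_cong simp flip: left_diff_distrib of_real_diff simp: split)
        then show ?thesis using cfq by simp
      qed
      then have "distr (density M (\<lambda>\<omega>. ennreal (max 0 (1 * q \<omega>) / m))) borel X = 
          distr (density M (\<lambda>\<omega>. ennreal (max 0 ((-1) * q \<omega>) / m))) borel X"
        by (intro Levy_uniqueness law ext) (auto simp: cff[of 1, simplified] cff[of "-1", simplified])
      then have "(\<integral>\<omega>. max 0 (q \<omega>) * indicator D (X \<omega>) \<partial>M) = (\<integral>\<omega>. max 0 (- q \<omega>) * indicator D (X \<omega>) \<partial>M)"
        using ms[of 1] ms[of "-1"] mpos by simp
      moreover have "integrable M (\<lambda>\<omega>. max 0 (q \<omega>) * indicator D (X \<omega>))" 
          "integrable M (\<lambda>\<omega>. max 0 (- q \<omega>) * indicator D (X \<omega>))"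
        by (rule Bochner_Integration.integrable_bound[OF ip]; simp add: indicator_def)
          (rule Bochner_Integration.integrable_bound[OF im]; simp add: indicator_def)
      ultimately have "(\<integral>\<omega>. max 0 (q \<omega>) * indicator D (X \<omega>) - max 0 (- q \<omega>) * indicator D (X \<omega>) \<partial>M) = 0"
        by simp
      then show ?thesis by (simp flip: left_diff_distrib add: split)
    qed
  qed
  have intc: "integrable M (\<lambda>\<omega>. Q \<omega> * iexp (u * X \<omega>))" for u
    by (auto intro!: Bochner_Integration.integrable_bound[OF Q] simp: norm_mult)
  \<comment> \<open>Conjugation reverses the frequency. As the hypothesis holds for all
    \<open>u\<close>, it passes to the conjugate weight, and sum and difference isolate the real and
    the imaginary part.\<close>
  have cf': "(CLINT \<omega>|M. cnj (Q \<omega>) * iexp (u * X \<omega>)) = 0" for u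
  proof -
    have "(CLINT \<omega>|M. cnj (Q \<omega>) * iexp (u * X \<omega>)) = (CLINT \<omega>|M. cnj (Q \<omega> * iexp ((-u) * X \<omega>)))"
      by (auto intro!: Bochner_Integration.integral_cong simp: exp_cnj)
    also have "\<dots> = cnj (CLINT \<omega>|M. Q \<omega> * iexp ((-u) * X \<omega>))" 
      using intc[of "-u"] by (rule integral_bounded_linear[OF bounded_linear_cnj])
    finally show ?thesis using cf[of "-u"] by simp
  qed
  have intc': "integrable M (\<lambda>\<omega>. cnj (Q \<omega>) * iexp (u * X \<omega>))" for u
    using integrable_bounded_linear[OF bounded_linear_cnj intc[of "-u"]]
    by (simp add: exp_cnj)
  have "(\<integral>\<omega>. Re (Q \<omega>) * indicator D (X \<omega>) \<partial>M) = 0"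
  proof (rule real_case)
    fix u
    have "(CLINT \<omega>|M. Q \<omega> * iexp (u * X \<omega>) + cnj (Q \<omega>) * iexp (u * X \<omega>)) = 0"
      using intc intc' cf cf' by (simp add: Bochner_Integration.integral_add)
    moreover have "Q \<omega> * iexp (u * X \<omega>) + cnj (Q \<omega>) * iexp (u * X \<omega>) = 2 * (of_real (Re (Q \<omega>)) * iexp (u * X \<omega>))" for \<omega>
      by (simp flip: distrib_right add: complex_add_cnj)
    ultimately show "(CLINT \<omega>|M. of_real (Re (Q \<omega>)) * iexp (u * X \<omega>)) = 0" by simp
  qed (use Q in auto)
  moreover have "(\<integral>\<omega>. Im (Q \<omega>) * indicator D (X \<omega>) \<partial>M) = 0"
  proof (rule real_case)
    fix u
    have "(CLINT \<omega>|M. Q \<omega> * iexp (u * X \<omega>) - cnj (Q \<omega>) * iexp (u * X \<omega>)) = 0"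
      using intc intc' cf cf' by (simp add: Bochner_Integration.integral_diff)
    moreover have "Q \<omega> * iexp (u * X \<omega>) - cnj (Q \<omega>) * iexp (u * X \<omega>) = (2 * \<i>) * (of_real (Im (Q \<omega>)) * iexp (u * X \<omega>))" for \<omega>
      by (simp flip: left_diff_distrib add: complex_diff_cnj)
    ultimately show "(CLINT \<omega>|M. of_real (Im (Q \<omega>)) * iexp (u * X \<omega>)) = 0" by simp
  qed (use Q in auto)
  moreover have "integrable M (\<lambda>\<omega>. Q \<omega> * indicator D (X \<omega>))"
    by (auto intro!: Bochner_Integration.integrable_bound[OF Q] simp: norm_mult indicator_def)
  ultimately show ?thesis
  proof -
    assume *: "(\<integral>\<omega>. Re (Q \<omega>) * indicator D (X \<omega>) \<partial>M) = 0" "(\<integral>\<omega>. Im (Q \<omega>) * indicator D (X \<omega>) \<partial>M) = 0"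
      and i: "integrable M (\<lambda>\<omega>. Q \<omega> * indicator D (X \<omega>))"
    have r: "Re (Q \<omega> * indicator D (X \<omega>)) = Re (Q \<omega>) * indicator D (X \<omega>)"
      "Im (Q \<omega> * indicator D (X \<omega>)) = Im (Q \<omega>) * indicator D (X \<omega>)" for \<omega>
      by (simp_all add: indicator_def)
    show ?thesis using integral_Re[OF i] integral_Im[OF i]
      unfolding r * complex_eq_iff by simp
  qed
qed

text \<open>
  Weighting by a density turns independence of vectors into repeated one-dimensional uniqueness
  of characteristic functions.
\<close>

lemma (in prob_space) indep_from_char:
  fixes V :: "('a \<Rightarrow> real) set" and Y :: "'a \<Rightarrow> real"
  assumes V: "\<And>X. X \<in> V \<Longrightarrow> X \<in> borel_measurable M"
    and add: "\<And>X X'. X \<in> V \<Longrightarrow> X' \<in> V \<Longrightarrow> (\<lambda>\<omega>. X \<omega> + X' \<omega>) \<in> V"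
    and scale: "\<And>X a. X \<in> V \<Longrightarrow> (\<lambda>\<omega>. a * X \<omega>) \<in> V"
    and zero: "(\<lambda>\<omega>. 0) \<in> V"
    and Y[measurable]: "Y \<in> borel_measurable M"
    and cf: "\<And>X v. X \<in> V \<Longrightarrow> (CLINT \<omega>|M. iexp (X \<omega> + v * Y \<omega>)) = 
       (CLINT \<omega>|M. iexp (X \<omega>)) * (CLINT \<omega>|M. iexp (v * Y \<omega>))"
    and D[measurable]: "D \<in> sets borel"
    and G: "G \<in> sigma_sets (space M) {X -` A \<inter> space M | X A. X \<in> V \<and> A \<in> sets borel}"
  shows "prob (G \<inter> (Y -` D \<inter> space M)) = prob G * prob (Y -` D \<inter> space M)"
proof -
  note V[measurable]
  define c where "c v = (CLINT \<omega>|M. iexp (v * Y \<omega>))" for v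
  have int_bounded: "integrable M f" if [measurable]: "f \<in> borel_measurable M" and "\<And>\<omega>. norm (f \<omega>) \<le> B" for f :: "'a \<Rightarrow> complex" and B
    using that by (intro integrable_const_bound[where B=B]) auto
  have cn: "cmod (c v) \<le> 1" for v
  proof -
    interpret YY: real_distribution "distr M borel Y" by (rule real_distribution_distr) simp
    have "c v = char (distr M borel Y) v" unfolding c_def char_def by (subst integral_distr) auto
    then show ?thesis using YY.cmod_char_le_1 by simp
  qed
  \<comment> \<open>Induction on the list of constraints. Multiplying the weight for the remaining
    list by \<open>iexp (u * X \<omega>)\<close> gives the same expression with
    \<open>L + u * X\<close> instead of \<open>L\<close>; so its transform in \<open>X\<close>
    vanishes and the uniqueness lemma trades the exponential for an indicator. This is where closure
    of \<open>V\<close> under linear combinations enters and why \<open>L\<close> has to be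
    arbitrary.\<close>
  have main: "(\<integral>\<omega>. (\<Prod>(X,A)\<leftarrow>xs. indicator A (X \<omega>)) * iexp (L \<omega>) * (iexp (v * Y \<omega>) - c v) \<partial>M) = 0"
    if "set xs \<subseteq> V \<times> sets borel" and "L \<in> V" for xs L v
    using that
  proof (induction xs arbitrary: L)
    case Nil
    note [measurable] = V[OF Nil(2)]
    have "(CLINT \<omega>|M. iexp (L \<omega>) * (iexp (v * Y \<omega>) - c v)) = (CLINT \<omega>|M. iexp (L \<omega> + v * Y \<omega>) - c v * iexp (L \<omega>))"
      by (intro Bochner_Integration.integral_cong) (auto simp: ring_distribs exp_add)
    also have "\<dots> = (CLINT \<omega>|M. iexp (L \<omega> + v * Y \<omega>)) - c v * (CLINT \<omega>|M. iexp (L \<omega>))"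
      using int_bounded[of "\<lambda>\<omega>. iexp (L \<omega> + v * Y \<omega>)" 1] int_bounded[of "\<lambda>\<omega>. iexp (L \<omega>)" 1]
      by (subst Bochner_Integration.integral_diff) auto
    also have "\<dots> = 0" using cf[OF Nil(2), of v] by (simp add: c_def mult.commute)
    finally show ?case by simp
  next
    case (Cons xa xs)
    obtain X A where xa: "xa = (X,A)" by force
    with Cons.prems have XV: "X \<in> V" and A: "A \<in> sets borel" and xs: "set xs \<subseteq> V \<times> sets borel" by auto
    note [measurable] = V[OF Cons.prems(2)] V[OF XV] A
    have [measurable]: "(\<lambda>\<omega>. \<Prod>(X,A)\<leftarrow>xs. indicator A (X \<omega>) :: complex) \<in> borel_measurable M"
      using xs
    proof (induction xs)
      case (Cons a xs)
      have [measurable]: "fst a \<in> borel_measurable M" "snd a \<in> sets borel" using Cons.prems V by auto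
      show ?case using Cons by (auto simp: case_prod_beta)
    qed simp
    have pb: "cmod (\<Prod>(X,A)\<leftarrow>xs. indicator A (X \<omega>)) \<le> 1" for \<omega>
      by (induction xs) (auto simp: norm_mult indicator_def)
    let ?Q = "\<lambda>\<omega>. (\<Prod>(X,A)\<leftarrow>xs. indicator A (X \<omega>)) * iexp (L \<omega>) * (iexp (v * Y \<omega>) - c v)"
    have Qb: "cmod (?Q \<omega>) \<le> 2" for \<omega>
    proof -
      have "cmod (iexp (v * Y \<omega>) - c v) \<le> 2" 
        using norm_triangle_ineq4[of "iexp (v * Y \<omega>)" "c v"] cn[of v] by simp
      then show ?thesis using pb[of \<omega>] mult_mono[of "cmod (\<Prod>(X,A)\<leftarrow>xs. indicator A (X \<omega>))" 1 _ 2]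
        by (simp add: norm_mult)
    qed
    have "(CLINT \<omega>|M. ?Q \<omega> * indicator A (X \<omega>)) = 0"
    proof (rule complex_density_unique)
      show "integrable M ?Q" by (rule int_bounded[OF _ Qb]) measurable
      fix u
      have "(CLINT \<omega>|M. (\<Prod>(X,A)\<leftarrow>xs. indicator A (X \<omega>)) * iexp (L \<omega> + u * X \<omega>) * (iexp (v * Y \<omega>) - c v)) = 0"
        using Cons.IH[OF xs add[OF Cons.prems(2) scale[OF XV]], of u] .
      then show "(CLINT \<omega>|M. ?Q \<omega> * iexp (u * X \<omega>)) = 0"
        by (simp add: exp_add ring_distribs mult_ac)
    qed auto
    then show ?case by (simp add: xa mult_ac)
  qed
  \<comment> \<open>The generators alone need not be stable under intersection. Finite lists of
    constraints are: concatenate the lists.\<close>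
  let ?E = "{{\<omega>\<in>space M. \<forall>(X,A)\<in>set xs. X \<omega> \<in> A} | xs. set xs \<subseteq> V \<times> sets borel}"
  have boxes: "prob (G \<inter> (Y -` D \<inter> space M)) = prob G * prob (Y -` D \<inter> space M) \<and> G \<in> sets M" if "G \<in> ?E" for G
  proof -
    from that obtain xs where xs: "set xs \<subseteq> V \<times> sets borel" and G: "G = {\<omega>\<in>space M. \<forall>(X,A)\<in>set xs. X \<omega> \<in> A}" by auto
    have Gs[measurable]: "G \<in> sets M" unfolding G using xs
    proof (induction xs)
      case (Cons a xs)
      have [measurable]: "fst a \<in> borel_measurable M" "snd a \<in> sets borel" using Cons.prems V by auto
      have "{\<omega>\<in>space M. \<forall>(X,A)\<in>set (a # xs). X \<omega> \<in> A} = {\<omega>\<in>space M. fst a \<omega> \<in> snd a} \<inter> {\<omega>\<in>space M. \<forall>(X,A)\<in>set xs. X \<omega> \<in> A}"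
        by (auto simp: case_prod_beta)
      also have "\<dots> \<in> sets M" using Cons by (intro sets.Int) auto
      finally show ?case .
    qed simp
    have ind: "(\<Prod>(X,A)\<leftarrow>xs. indicator A (X \<omega>)) = (indicator G \<omega> :: complex)" if "\<omega> \<in> space M" for \<omega>
      unfolding G using that by (induction xs) (auto simp: indicator_def)
    have z: "(CLINT \<omega>|M. indicator G \<omega> * (iexp (v * Y \<omega>) - c v)) = 0" for v
      using main[OF xs zero, of v] ind by (simp cong: Bochner_Integration.integral_cong)
    \<comment> \<open>Centring the indicator by \<open>prob G\<close> makes the transform in
      \<open>Y\<close> vanish identically, so that uniqueness replaces the exponential by the
      indicator of an arbitrary Borel set \<open>D\<close>.\<close>
    have c1: "(CLINT \<omega>|M. (indicator G \<omega> - of_real (prob G)) * iexp (u * Y \<omega>)) = 0" for u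
    proof -
      have "(CLINT \<omega>|M. indicator G \<omega> * (iexp (u * Y \<omega>) - c u)) = (CLINT \<omega>|M. indicator G \<omega> * iexp (u * Y \<omega>)) - (CLINT \<omega>|M. indicator G \<omega> * c u)"
        unfolding right_diff_distrib
        using cn by (intro Bochner_Integration.integral_diff int_bounded[of _ 1]) (auto simp: indicator_def)
      moreover have "(CLINT \<omega>|M. (indicator G \<omega> - of_real (prob G)) * iexp (u * Y \<omega>)) = 
         (CLINT \<omega>|M. indicator G \<omega> * iexp (u * Y \<omega>)) - (CLINT \<omega>|M. of_real (prob G) * iexp (u * Y \<omega>))"
        unfolding left_diff_distrib
        by (intro Bochner_Integration.integral_diff int_bounded[of _ 1]) (auto simp: indicator_def norm_mult)
      moreover have "(CLINT \<omega>|M. indicator G \<omega>) = complex_of_real (prob G)"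
      proof -
        have "(CLINT \<omega>|M. indicator G \<omega>) = (CLINT \<omega>|M. complex_of_real (indicator G \<omega>))"
          by (intro Bochner_Integration.integral_cong) (auto simp: indicator_def)
        then show ?thesis by (simp only: integral_complex_of_real) simp
      qed
      ultimately show ?thesis using z[of u] by (simp add: c_def)
    qed
    have b1: "cmod (indicator G \<omega> - of_real (prob G)) \<le> 2" for \<omega>
    proof -
      have "cmod (indicator G \<omega>) \<le> 1" "cmod (complex_of_real (prob G)) \<le> 1" by (auto simp: indicator_def)
      then show ?thesis using norm_triangle_ineq4[of "indicator G \<omega>" "complex_of_real (prob G)"] by linarith
    qed
    have "0 = (CLINT \<omega>|M. (indicator G \<omega> - of_real (prob G)) * indicator D (Y \<omega>))"
      by (rule complex_density_unique[OF Y _ c1 D, symmetric], rule int_bounded[OF _ b1]) simp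
    also have "\<dots> = (CLINT \<omega>|M. of_real (indicator (G \<inter> (Y -` D \<inter> space M)) \<omega> - prob G * indicator (Y -` D \<inter> space M) \<omega>))"
      by (rule Bochner_Integration.integral_cong) (auto simp: indicator_def)
    also have "\<dots> = of_real (\<integral>\<omega>. indicator (G \<inter> (Y -` D \<inter> space M)) \<omega> - prob G * indicator (Y -` D \<inter> space M) \<omega> \<partial>M)"
      by (rule integral_complex_of_real)
    also have "(\<integral>\<omega>. indicator (G \<inter> (Y -` D \<inter> space M)) \<omega> - prob G * indicator (Y -` D \<inter> space M) \<omega> \<partial>M)
      = prob (G \<inter> (Y -` D \<inter> space M)) - prob G * prob (Y -` D \<inter> space M)"
      by (subst Bochner_Integration.integral_diff) (auto simp: emeasure_eq_measure)
    finally show ?thesis by (simp flip: of_real_mult of_real_diff add: Gs)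
  qed
  have IS: "Int_stable ?E"
  proof (rule Int_stableI)
    fix a b assume "a \<in> ?E" "b \<in> ?E"
    then obtain xs ys where "set xs \<subseteq> V \<times> sets borel" "set ys \<subseteq> V \<times> sets borel" 
     "a = {\<omega>\<in>space M. \<forall>(X,A)\<in>set xs. X \<omega> \<in> A}" "b = {\<omega>\<in>space M. \<forall>(X,A)\<in>set ys. X \<omega> \<in> A}" by auto
    then show "a \<inter> b \<in> ?E" by (intro CollectI exI[of _ "xs @ ys"]) auto
  qed
  have sub: "{X -` A \<inter> space M | X A. X \<in> V \<and> A \<in> sets borel} \<subseteq> ?E"
  proof clarify
    fix X A assume "X \<in> V" "A \<in> sets (borel :: real measure)"
    then show "\<exists>xs. X -` A \<inter> space M = {\<omega>\<in>space M. \<forall>(X,A)\<in>set xs. X \<omega> \<in> A} \<and> set xs \<subseteq> V \<times> sets borel"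
      by (intro exI[of _ "[(X,A)]"]) auto
  qed
  have EP: "?E \<subseteq> Pow (space M)" by auto
  have Esets: "sigma_sets (space M) ?E \<subseteq> sets M" using boxes by (intro sets.sigma_sets_subset) blast
  let ?Y = "Y -` D \<inter> space M"
  have "G \<in> sigma_sets (space M) ?E" using G sigma_sets_mono'[OF sub] by auto
  from IS EP this show ?thesis
  proof (induction rule: sigma_sets_induct_disjoint)
    case (basic A) then show ?case using boxes by auto
  next
    case empty show ?case by simp
  next
    case (compl A)
    have A: "A \<in> sets M" using compl(1) Esets by auto
    have "(space M - A) \<inter> ?Y = ?Y - A \<inter> ?Y" by auto
    then have "prob ((space M - A) \<inter> ?Y) = prob ?Y - prob (A \<inter> ?Y)"
      using A by (auto intro!: finite_measure_Diff)
    then show ?case using compl(2) A by (simp add: prob_compl left_diff_distrib)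
  next
    case (union A)
    have A: "A i \<in> sets M" for i using union(2) Esets by auto
    have "(\<lambda>i. prob (A i \<inter> ?Y)) sums prob (\<Union>i. A i \<inter> ?Y)"
      using union(1) A by (intro finite_measure_UNION) (auto simp: disjoint_family_on_def)
    moreover have "(\<lambda>i. prob (A i) * prob ?Y) sums (prob (\<Union>i. A i) * prob ?Y)"
      using union(1) A by (intro sums_mult2 finite_measure_UNION) auto
    moreover have "(\<Union>i. A i \<inter> ?Y) = (\<Union>i. A i) \<inter> ?Y" by auto
    ultimately show ?case using union(3) sums_unique2 by auto
  qed
qed

section \<open>Gaussian smoothing\<close>

text \<open>The Gaussian is its own Fourier transform up to scaling: substitute
  \<open>x = s * u\<close> in the characteristic function of the standard normal law.\<close>

lemma gauss_fourier:
  assumes s: "s > (0::real)"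
  shows "(CLBINT u. of_real (exp (-(s*u)\<^sup>2/2)) * iexp (u*y)) = of_real (2 * pi * normal_density 0 s y)"
    and "integrable lborel (\<lambda>u. exp (-(s*u)\<^sup>2/2))"
    and "(\<integral>u. exp (-(s*u)\<^sup>2/2) \<partial>lborel) = sqrt (2 * pi) / s"
proof -
  have eq: "normal_density 0 (1/s) u = s / sqrt (2 * pi) * exp (-(s*u)\<^sup>2/2)" for u
    using s by (simp add: normal_density_def real_sqrt_divide real_sqrt_mult power_divide power_mult_distrib field_simps)
  have eq': "exp (-(s*u)\<^sup>2/2) = sqrt (2 * pi) / s * normal_density 0 (1/s) u" for u
    unfolding eq using s by simp
  show i: "integrable lborel (\<lambda>u. exp (-(s*u)\<^sup>2/2))"
    unfolding eq' using s by (intro integrable_mult_right integrable_normal_density) simp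
  show "(\<integral>u. exp (-(s*u)\<^sup>2/2) \<partial>lborel) = sqrt (2 * pi) / s"
    unfolding eq' using s by simp
  have "complex_of_real (exp (-((y/s)\<^sup>2)/2)) = char std_normal_distribution (y/s)"
    by (simp add: char_std_normal_distribution)
  also have "\<dots> = (CLBINT x. std_normal_density x *\<^sub>R iexp (y/s * x))"
    unfolding char_def by (subst integral_density) auto
  also have "\<dots> = s *\<^sub>R (CLBINT u. std_normal_density (0 + s * u) *\<^sub>R iexp (y/s * (0 + s * u)))"
    using s by (subst lborel_integral_real_affine[of s _ 0]) auto
  also have "(CLBINT u. std_normal_density (0 + s * u) *\<^sub>R iexp (y/s * (0 + s * u))) = 
      (CLBINT u. of_real (1 / sqrt (2*pi)) * (of_real (exp (-(s*u)\<^sup>2/2)) * iexp (u*y)))"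
    using s by (intro Bochner_Integration.integral_cong) 
      (auto simp: std_normal_density_def scaleR_conv_of_real mult_ac)
  also have "\<dots> = of_real (1 / sqrt (2*pi)) * (CLBINT u. of_real (exp (-(s*u)\<^sup>2/2)) * iexp (u*y))"
    by (rule integral_mult_right_zero)
  finally have "(CLBINT u. of_real (exp (-(s*u)\<^sup>2/2)) * iexp (u*y)) = of_real (sqrt (2*pi) / s * exp (-((y/s)\<^sup>2)/2))"
    using s by (simp add: field_simps scaleR_conv_of_real)
  also have "sqrt (2*pi) / s * exp (-((y/s)\<^sup>2)/2) = 2 * pi * normal_density 0 s y"
  proof -
    have "sqrt (2*pi) * sqrt (2*pi) = 2*pi" by simp
    then have "sqrt (2*pi) / s = 2 * pi / sqrt (2 * pi * s\<^sup>2)"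
      using s by (simp add: real_sqrt_mult field_simps del: real_sqrt_mult_self)
    moreover have "-((y/s)\<^sup>2)/2 = - (y - 0)\<^sup>2 / (2 * s\<^sup>2)" by (simp add: power_divide)
    ultimately show ?thesis unfolding normal_density_def by simp
  qed
  finally show "(CLBINT u. of_real (exp (-(s*u)\<^sup>2/2)) * iexp (u*y)) = of_real (2 * pi * normal_density 0 s y)" .
qed

text \<open>Density of the convolution of \<open>\<mu>\<close> with the centred normal law of
  standard deviation \<open>s\<close>. The Gaussian component shared by both hypotheses is split off
  in this form.\<close>

definition smooth :: "real \<Rightarrow> real measure \<Rightarrow> real \<Rightarrow> real" where
  "smooth s \<mu> x = (\<integral>z. normal_density 0 s (x - z) \<partial>\<mu>)"

lemma normal_density_le: "s > 0 \<Longrightarrow> normal_density m s x \<le> 1 / s"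
proof -
  assume s: "s > 0"
  have "1 \<le> sqrt (2 * pi)" using pi_ge_two by (simp add: real_le_rsqrt)
  then have "s \<le> sqrt (2 * pi * s\<^sup>2)" using s by (simp add: real_sqrt_mult)
  then have "1 / sqrt (2 * pi * s\<^sup>2) \<le> 1 / s" using s by (intro divide_left_mono) auto
  moreover have "normal_density m s x \<le> 1 / sqrt (2 * pi * s\<^sup>2)"
    unfolding normal_density_def using s by (intro mult_left_le) auto
  ultimately show ?thesis by linarith
qed

lemma (in real_distribution) smooth_measurable[measurable]: "smooth s M \<in> borel_measurable borel"
  unfolding smooth_def by measurable

lemma (in real_distribution) smooth_integrable: "s > 0 \<Longrightarrow> integrable M (\<lambda>z. normal_density 0 s (x - z))"
  by (rule integrable_const_bound[where B="1/s"]) (auto simp: normal_density_le)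

lemma (in real_distribution) smooth_nonneg: "smooth s M x \<ge> 0"
  unfolding smooth_def by simp

text \<open>Fourier inversion: the normal density is replaced by its own Fourier integral and the
  integrals are exchanged. The Gaussian factor makes this legitimate for every law \<open>M\<close>,
  whatever the decay of \<open>char M\<close>.\<close>

lemma (in real_distribution) smooth_fourier:
  assumes s: "s > 0"
  shows "complex_of_real (smooth s M x) = 
     of_real (1 / (2 * pi)) * (CLBINT u. of_real (exp (-(s*u)\<^sup>2/2)) * iexp (u * x) * char M (-u))"
proof -
  interpret P: pair_sigma_finite lborel M ..
  let ?f = "\<lambda>u z. of_real (exp (-(s*u)\<^sup>2/2)) * iexp (u * (x - z)) :: complex"
  have nf: "norm (?f u z) = exp (-(s*u)\<^sup>2/2)" for u z by (simp add: norm_mult)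
  have int: "integrable (lborel \<Otimes>\<^sub>M M) (\<lambda>(u,z). ?f u z)"
  proof (rule P.Fubini_integrable)
    show "integrable lborel (\<lambda>x. \<integral>y. norm (case (x, y) of (u, z) \<Rightarrow> ?f u z) \<partial>M)"
      using gauss_fourier(2)[OF s] by (simp only: prod.case nf) (simp add: prob_space)
    show "AE u in lborel. integrable M (\<lambda>y. case (u, y) of (u, z) \<Rightarrow> ?f u z)"
    proof (rule AE_I2)
      fix u show "integrable M (\<lambda>y. case (u, y) of (u, z) \<Rightarrow> ?f u z)"
        by (rule integrable_const_bound[where B="exp (-(s*u)\<^sup>2/2)"]) (auto intro!: AE_I2 simp only: nf prod.case, measurable)
    qed
  qed measurable
  have "complex_of_real (smooth s M x) = (CLINT z|M. of_real (normal_density 0 s (x - z)))"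
    unfolding smooth_def by simp
  also have "\<dots> = (CLINT z|M. of_real (1 / (2 * pi)) * (CLBINT u. ?f u z))"
    by (subst gauss_fourier(1)[OF s]) simp
  also have "\<dots> = of_real (1 / (2 * pi)) * (CLINT z|M. (CLBINT u. ?f u z))"
    by (rule integral_mult_right_zero)
  also have "(CLINT z|M. (CLBINT u. ?f u z)) = (CLBINT u. (CLINT z|M. ?f u z))"
    using int by (rule P.Fubini_integral)
  also have "\<dots> = (CLBINT u. of_real (exp (-(s*u)\<^sup>2/2)) * iexp (u * x) * char M (-u))"
  proof (intro Bochner_Integration.integral_cong refl)
    fix u
    have "(CLINT z|M. ?f u z) = (CLINT z|M. (of_real (exp (-(s*u)\<^sup>2/2)) * iexp (u * x)) * iexp ((-u) * z))"
      by (intro Bochner_Integration.integral_cong refl) (simp add: mult.assoc mult_exp_exp ring_distribs)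
    also have "\<dots> = of_real (exp (-(s*u)\<^sup>2/2)) * iexp (u * x) * char M (-u)"
      unfolding char_def by (rule integral_mult_right_zero)
    finally show "(CLINT z|M. ?f u z) = of_real (exp (-(s*u)\<^sup>2/2)) * iexp (u * x) * char M (-u)" .
  qed
  finally show ?thesis .
qed

text \<open>Counterpart of the inversion formula: a law whose characteristic function is this
  product must have the density \<open>smooth s M\<close>. The densities of the increments are
  identified in this way.\<close>

lemma (in real_distribution) smooth_distribution:
  assumes s: "s > 0"
  shows "real_distribution (density lborel (smooth s M))"
    and "char (density lborel (smooth s M)) u = of_real (exp (-(s*u)\<^sup>2/2)) * char M u"
proof -
  interpret P: pair_sigma_finite lborel M ..
  have n1: "(\<integral>\<^sup>+x. ennreal (normal_density 0 s (x - z)) \<partial>lborel) = 1" for z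
  proof -
    have "(\<integral>\<^sup>+x. ennreal (normal_density 0 s (x - z)) \<partial>lborel) = (\<integral>\<^sup>+x. ennreal (normal_density z s x) \<partial>lborel)"
      by (simp add: normal_density_def)
    also have "\<dots> = ennreal (\<integral>x. normal_density z s x \<partial>lborel)"
      using s by (intro nn_integral_eq_integral) auto
    also have "\<dots> = 1" using s by simp
    finally show ?thesis .
  qed
  have "(\<integral>\<^sup>+x. ennreal (smooth s M x) \<partial>lborel) = (\<integral>\<^sup>+x. \<integral>\<^sup>+z. ennreal (normal_density 0 s (x - z)) \<partial>M \<partial>lborel)"
    unfolding smooth_def by (intro nn_integral_cong nn_integral_eq_integral[symmetric] smooth_integrable s) auto
  also have "\<dots> = (\<integral>\<^sup>+z. \<integral>\<^sup>+x. ennreal (normal_density 0 s (x - z)) \<partial>lborel \<partial>M)"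
    by (rule P.Fubini'[symmetric]) measurable
  also have "\<dots> = 1" using emeasure_space_1 by (simp add: n1)
  finally have "emeasure (density lborel (smooth s M)) (space (density lborel (smooth s M))) = 1"
    by (simp add: emeasure_density)
  then show "real_distribution (density lborel (smooth s M))"
    by (intro real_distribution.intro prob_spaceI real_distribution_axioms.intro) auto
  let ?f = "\<lambda>x z. of_real (normal_density 0 s (x - z)) * iexp (u * x) :: complex"
  have int: "integrable (lborel \<Otimes>\<^sub>M M) (\<lambda>(x,z). ?f x z)"
  proof (subst integrable_iff_bounded, safe)
    have "(\<integral>\<^sup>+ p. ennreal (norm (case p of (x,z) \<Rightarrow> ?f x z)) \<partial>(lborel \<Otimes>\<^sub>M M)) = 
      (\<integral>\<^sup>+ p. (case p of (x,z) \<Rightarrow> ennreal (normal_density 0 s (x - z))) \<partial>(lborel \<Otimes>\<^sub>M M))"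
      by (intro nn_integral_cong) (auto simp: norm_mult)
    also have "\<dots> = (\<integral>\<^sup>+z. \<integral>\<^sup>+x. ennreal (normal_density 0 s (x - z)) \<partial>lborel \<partial>M)"
      by (subst P.nn_integral_snd[symmetric]) auto
    also have "\<dots> = 1" using emeasure_space_1 by (simp add: n1)
    finally show "(\<integral>\<^sup>+ p. ennreal (norm (case p of (x,z) \<Rightarrow> ?f x z)) \<partial>(lborel \<Otimes>\<^sub>M M)) < \<infinity>" by simp
  qed measurable
  have "char (density lborel (smooth s M)) u = (CLBINT x. of_real (smooth s M x) * iexp (u * x))"
    unfolding char_def by (subst integral_density) (auto simp: smooth_nonneg scaleR_conv_of_real)
  also have "\<dots> = (CLBINT x. (CLINT z|M. ?f x z))"
    unfolding smooth_def by (intro Bochner_Integration.integral_cong refl) (simp flip: integral_complex_of_real)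
  also have "\<dots> = (CLINT z|M. (CLBINT x. ?f x z))"
    using int by (rule P.Fubini_integral[symmetric])
  also have "\<dots> = (CLINT z|M. of_real (exp (-(s*u)\<^sup>2/2)) * iexp (u * z))"
  proof (intro Bochner_Integration.integral_cong refl)
    fix z
    have "(CLBINT x. ?f x z) = \<bar>s\<bar> *\<^sub>R (CLBINT x. ?f (z + s * x) z)"
      by (rule lborel_integral_real_affine) (use s in simp)
    also have "\<dots> = (CLBINT x. s *\<^sub>R ?f (z + s * x) z)" using s by simp
    also have "\<dots> = (CLBINT x. iexp (u * z) * (std_normal_density x *\<^sub>R iexp ((s * u) * x)))"
      using s by (intro Bochner_Integration.integral_cong refl)
        (auto simp: normal_density_def scaleR_conv_of_real real_sqrt_mult power_mult_distrib exp_add ring_distribs mult_ac)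
    also have "\<dots> = iexp (u * z) * (CLBINT x. std_normal_density x *\<^sub>R iexp ((s * u) * x))"
      by (rule integral_mult_right_zero)
    also have "(CLBINT x. std_normal_density x *\<^sub>R iexp ((s * u) * x)) = char std_normal_distribution (s * u)"
      unfolding char_def by (subst integral_density) auto
    finally show "(CLBINT x. ?f x z) = of_real (exp (-(s*u)\<^sup>2/2)) * iexp (u * z)"
      by (simp add: char_std_normal_distribution mult_ac)
  qed
  also have "\<dots> = of_real (exp (-(s*u)\<^sup>2/2)) * char M u"
    unfolding char_def by (rule integral_mult_right_zero)
  finally show "char (density lborel (smooth s M)) u = of_real (exp (-(s*u)\<^sup>2/2)) * char M u" .
qed

text \<open>The integrands of the two inversion formulas differ only where
  \<open>L < \<bar>u\<bar>\<close>. There half of the Gaussian exponent is spent on the small factor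
  \<open>exp (-(s*L)^2/4)\<close>; the other half, a Gaussian with parameter
  \<open>s / sqrt 2\<close>, keeps the integral finite.\<close>

lemma smooth_diff_le:
  assumes M: "real_distribution M" and N: "real_distribution N" and s: "s > 0" and L: "L \<ge> 0"
    and eq: "\<And>u. \<bar>u\<bar> \<le> L \<Longrightarrow> char M u = char N u"
  shows "\<bar>smooth s M x - smooth s N x\<bar> \<le> 2 * exp (-(s*L)\<^sup>2/4) / s"
proof -
  interpret M: real_distribution M by fact
  interpret N: real_distribution N by fact
  let ?g = "\<lambda>M u. of_real (exp (-(s*u)\<^sup>2/2)) * iexp (u * x) * char M (-u)"
  have i: "complex_integrable lborel (?g M)" "complex_integrable lborel (?g N)"
    by (rule Bochner_Integration.integrable_bound[OF gauss_fourier(2)[OF s]]; 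
        simp add: norm_mult mult_left_le M.cmod_char_le_1 N.cmod_char_le_1)+
  have s2: "s / sqrt 2 > 0" using s by simp
  let ?h = "\<lambda>u. 2 * exp (-(s*L)\<^sup>2/4) * exp (-((s / sqrt 2)*u)\<^sup>2/2)"
  have ih: "integrable lborel ?h" using gauss_fourier(2)[OF s2] by simp
  have le: "cmod (?g M u - ?g N u) \<le> ?h u" for u
  proof (cases "\<bar>u\<bar> \<le> L")
    case True
    then show ?thesis using eq[of "-u"] by simp
  next
    case False
    have "cmod (char M (-u) - char N (-u)) \<le> 2"
      using norm_triangle_ineq4[of "char M (-u)" "char N (-u)"] M.cmod_char_le_1[of "-u"] N.cmod_char_le_1[of "-u"] by linarith
    moreover have "?g M u - ?g N u = of_real (exp (-(s*u)\<^sup>2/2)) * iexp (u * x) * (char M (-u) - char N (-u))"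
      by (simp add: ring_distribs)
    ultimately have "cmod (?g M u - ?g N u) \<le> exp (-(s*u)\<^sup>2/2) * 2"
      by (simp add: norm_mult)
    also have "\<dots> \<le> 2 * (exp (-(s*L)\<^sup>2/4) * exp (-((s / sqrt 2)*u)\<^sup>2/2))"
    proof -
      have "L\<^sup>2 \<le> u\<^sup>2" using False L by (simp add: abs_le_square_iff[symmetric])
      then have "s\<^sup>2 * L\<^sup>2 \<le> s\<^sup>2 * u\<^sup>2" by (intro mult_left_mono) auto
      then show ?thesis by (simp add: mult_exp_exp power_mult_distrib power_divide field_simps)
    qed
    finally show ?thesis by simp
  qed
  have "complex_of_real (smooth s M x - smooth s N x) = of_real (1 / (2 * pi)) * (CLBINT u. ?g M u - ?g N u)"
    by (subst Bochner_Integration.integral_diff[OF i])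
      (simp add: M.smooth_fourier[OF s] N.smooth_fourier[OF s] right_diff_distrib)
  moreover have "\<bar>smooth s M x - smooth s N x\<bar> = cmod (complex_of_real (smooth s M x - smooth s N x))"
    by (simp only: norm_of_real)
  ultimately have eq1: "\<bar>smooth s M x - smooth s N x\<bar> = 1 / (2 * pi) * cmod (CLBINT u. ?g M u - ?g N u)"
    by (simp only: norm_mult norm_of_real) simp
  have "cmod (CLBINT u. ?g M u - ?g N u) \<le> (\<integral>u. cmod (?g M u - ?g N u) \<partial>lborel)"
    by (rule integral_norm_bound)
  also have "\<dots> \<le> (\<integral>u. ?h u \<partial>lborel)"
    by (rule integral_mono[OF integrable_norm[OF Bochner_Integration.integrable_diff[OF i]] ih le])
  also have "\<dots> = 2 * exp (-(s*L)\<^sup>2/4) * (2 * sqrt pi / s)"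
    using gauss_fourier(3)[OF s2] by (simp add: real_sqrt_mult field_simps)
  finally have "\<bar>smooth s M x - smooth s N x\<bar> \<le> 1 / (2 * pi) * (2 * exp (-(s*L)\<^sup>2/4) * (2 * sqrt pi / s))"
    unfolding eq1 by (intro mult_left_mono) auto
  also have "\<dots> = 2 * exp (-(s*L)\<^sup>2/4) / s * (sqrt pi / pi)" by (simp add: field_simps)
  also have "\<dots> \<le> 2 * exp (-(s*L)\<^sup>2/4) / s"
    using s pi_ge_two by (intro mult_left_le) (auto simp: divide_le_eq_1 intro!: real_le_lsqrt simp: power2_eq_square)
  finally show ?thesis .
qed

section \<open>The cubic B-spline\<close>

text \<open>The density of the sum of four independent variables that are uniform on an interval of
  length one centred at zero; this explains the fourth power in its transform. It is twice
  continuously differentiable, with knots at the integers from -2 to 2.\<close>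

definition bspline :: "real \<Rightarrow> real" where
  "bspline x = (if \<bar>x\<bar> \<le> 1 then 2/3 - x\<^sup>2 + \<bar>x\<bar>^3/2 else if \<bar>x\<bar> \<le> 2 then (2 - \<bar>x\<bar>)^3/6 else 0)"

lemma continuous_bspline: "isCont bspline x"
proof -
  have "continuous_on UNIV bspline"
  proof -
    \<comment> \<open>Only two pieces, agreeing at \<open>\<bar>x\<bar> = 1\<close>: the
      \<open>max\<close> merges the outer cubic with the zero piece.\<close>
    let ?f = "\<lambda>x::real. if \<bar>x\<bar> \<le> 1 then 2/3 - x\<^sup>2 + \<bar>x\<bar>^3/2 else (max 0 (2 - \<bar>x\<bar>))^3/6"
    have "continuous_on ({x. \<bar>x\<bar> \<le> 1} \<union> {x. 1 \<le> \<bar>x\<bar>}) ?f"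
    proof (rule continuous_on_cases)
      show "closed {x::real. \<bar>x\<bar> \<le> 1}" "closed {x::real. 1 \<le> \<bar>x\<bar>}"
        by (auto intro!: closed_Collect_le continuous_intros)
      show "\<forall>x. x \<in> {x. \<bar>x\<bar> \<le> 1} \<and> \<not> \<bar>x\<bar> \<le> 1 \<or> x \<in> {x. 1 \<le> \<bar>x\<bar>} \<and> \<bar>x\<bar> \<le> 1 \<longrightarrow> 
         2/3 - x\<^sup>2 + \<bar>x\<bar>^3/2 = (max 0 (2 - \<bar>x\<bar>))^3/(6::real)"
      proof safe
        fix x :: real assume "1 \<le> \<bar>x\<bar>" "\<bar>x\<bar> \<le> 1"
        then have *: "\<bar>x\<bar> = 1" by simp
        then have "x\<^sup>2 = 1" by (metis power2_abs one_power2)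
        with * show "2/3 - x\<^sup>2 + \<bar>x\<bar>^3/2 = (max 0 (2 - \<bar>x\<bar>))^3/(6::real)" by simp
      qed
    qed (intro continuous_intros; simp)+
    moreover have "{x. \<bar>x\<bar> \<le> 1} \<union> {x. 1 \<le> \<bar>x\<bar>} = (UNIV :: real set)" by auto
    moreover have "?f = bspline" by (auto simp: bspline_def fun_eq_iff max_def)
    ultimately show ?thesis by (simp only:)
  qed
  then show ?thesis by (simp add: continuous_on_eq_continuous_at)
qed

lemma bspline_measurable[measurable]: "bspline \<in> borel_measurable borel"
  using continuous_bspline by (intro borel_measurable_continuous_onI) (simp add: continuous_on_eq_continuous_at)

lemma bspline_nonneg: "0 \<le> bspline x"
proof -
  have "x\<^sup>2 \<le> 2/3 + \<bar>x\<bar>^3/2" if "\<bar>x\<bar> \<le> 1"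
  proof -
    \<comment> \<open>A positivity certificate: the cubic is rewritten as a sum of products whose
      factors are nonnegative on the unit interval.\<close>
    have "0 \<le> (1 - \<bar>x\<bar>) * (4/6) + (\<bar>x\<bar> - 1)\<^sup>2 * (\<bar>x\<bar>/2) + \<bar>x\<bar> * (1 - \<bar>x\<bar>) * 0 + \<bar>x\<bar>/6"
      using that by (intro add_nonneg_nonneg mult_nonneg_nonneg) auto
    also have "\<dots> = 2/3 - \<bar>x\<bar>\<^sup>2 + \<bar>x\<bar>^3/2" by (simp add: power2_eq_square power3_eq_cube field_simps)
    finally show ?thesis by simp
  qed
  then show ?thesis unfolding bspline_def by auto
qed

lemma bspline_le1: "bspline x \<le> 1"
proof -
  have "\<bar>x\<bar>^3/2 \<le> 1/3 + x\<^sup>2" if "\<bar>x\<bar> \<le> 1"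
  proof -
    have "\<bar>x\<bar>^3 = x\<^sup>2 * \<bar>x\<bar>" by (simp add: power3_eq_cube power2_eq_square)
    also have "\<dots> \<le> x\<^sup>2 * 1" using that by (intro mult_left_mono) auto
    finally show ?thesis using zero_le_power2[of x] by linarith
  qed
  moreover have "(2 - \<bar>x\<bar>)^3 \<le> 6" if "\<not> \<bar>x\<bar> \<le> 1" "\<bar>x\<bar> \<le> 2"
  proof -
    have "(2 - \<bar>x\<bar>)^3 \<le> 1" using that by (intro power_le_one) auto
    then show ?thesis by simp
  qed
  ultimately show ?thesis unfolding bspline_def by auto
qed

lemma has_bochner_integral_rhs: "has_bochner_integral M f x \<Longrightarrow> x = y \<Longrightarrow> has_bochner_integral M f y"
  by simp

lemma bspline_even: "bspline (- x) = bspline x"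
  by (simp add: bspline_def)

text \<open>Repeated integration by parts, which stops at the constant third derivative
  \<open>6 * d\<close>. The values of the cubic and of its derivatives at the endpoints are
  parameters, so that numerals can be supplied for each piece.\<close>

lemma cubic_cos_FTC:
  fixes a b c d u :: real
  assumes u: "u \<noteq> 0" and l: "l \<le> m"
    and "a + b*m + c*m^2 + d*m^3 = p" "b + 2*c*m + 3*d*m^2 = p'" "2*c + 6*d*m = p''"
    and "a + b*l + c*l^2 + d*l^3 = q" "b + 2*c*l + 3*d*l^2 = q'" "2*c + 6*d*l = q''"
  shows "has_bochner_integral lborel (\<lambda>x. ((a + b*x + c*x^2 + d*x^3) * cos (u*x)) * indicator {l..m} x) 
    (p * sin (u*m) / u + p' * cos (u*m) / u^2 - p'' * sin (u*m) / u^3 - 6*d * cos (u*m) / u^4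
     - (q * sin (u*l) / u + q' * cos (u*l) / u^2 - q'' * sin (u*l) / u^3 - 6*d * cos (u*l) / u^4))"
proof -
  define F where "F x = (a + b*x + c*x^2 + d*x^3) * sin (u*x) / u + (b + 2*c*x + 3*d*x^2) * cos (u*x) / u^2
      - (2*c + 6*d*x) * sin (u*x) / u^3 - 6*d * cos (u*x) / u^4" for x
  have "has_bochner_integral lborel (\<lambda>x. ((a + b*x + c*x^2 + d*x^3) * cos (u*x)) * indicator {l..m} x) (F m - F l)"
  proof (rule has_bochner_integral_FTC_Icc_real[OF l])
    fix x
    show "(F has_real_derivative (a + b*x + c*x^2 + d*x^3) * cos (u*x)) (at x)"
      unfolding F_def using u
      by (auto intro!: derivative_eq_intros simp: field_simps power2_eq_square power3_eq_cube power4_eq_xxxx)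
  qed (auto intro!: continuous_intros)
  then show ?thesis unfolding F_def assms(3-) .
qed

text \<open>The pieces on the positive half-line are integrated and evenness doubles the result. At
  the knots all terms up to the second derivative cancel or vanish, so only the jumps of the third
  derivative survive; hence the single denominator \<open>u^4\<close>.\<close>

lemma bspline_cos_integral:
  assumes u: "u \<noteq> 0"
  shows "has_bochner_integral lborel (\<lambda>x. bspline x * cos (u * x)) ((2 - 2 * cos u)\<^sup>2 / u^4)"
proof -
  have a: "has_bochner_integral lborel (\<lambda>x. ((2/3 + 0*x + (-1)*x^2 + (1/2)*x^3) * cos (u*x)) * indicator {0..1} x)
     (1/6 * sin (u*1) / u + (-1/2) * cos (u*1) / u^2 - 1 * sin (u*1) / u^3 - 6*(1/2) * cos (u*1) / u^4
     - (2/3 * sin (u*0) / u + 0 * cos (u*0) / u^2 - (-2) * sin (u*0) / u^3 - 6*(1/2) * cos (u*0) / u^4))"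
    by (rule cubic_cos_FTC[OF u]) simp_all
  have b: "has_bochner_integral lborel (\<lambda>x. ((4/3 + (-2)*x + 1*x^2 + (-1/6)*x^3) * cos (u*x)) * indicator {1..2} x) 
     (0 * sin (u*2) / u + 0 * cos (u*2) / u^2 - 0 * sin (u*2) / u^3 - 6*(-1/6) * cos (u*2) / u^4
     - (1/6 * sin (u*1) / u + (-1/2) * cos (u*1) / u^2 - 1 * sin (u*1) / u^3 - 6*(-1/6) * cos (u*1) / u^4))"
    by (rule cubic_cos_FTC[OF u]) simp_all
  have c2: "cos (u*2) = 2 * (cos u)^2 - 1" using cos_double_cos[of u] by (simp only: mult.commute[of u 2])
  have 1: "has_bochner_integral lborel (\<lambda>x. ((2/3 + 0*x + (-1)*x^2 + (1/2)*x^3) * cos (u*x)) * indicator {0..1} x + 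
     ((4/3 + (-2)*x + 1*x^2 + (-1/6)*x^3) * cos (u*x)) * indicator {1..2} x) ((2 - 2 * cos u)\<^sup>2 / u^4 / 2)"
  proof (rule has_bochner_integral_rhs[OF has_bochner_integral_add[OF a b]])
    define q where "q = u^4"
    have "q \<noteq> 0" using u by (simp add: q_def)
    then show "1/6 * sin (u*1) / u + (-1/2) * cos (u*1) / u^2 - 1 * sin (u*1) / u^3 - 6*(1/2) * cos (u*1) / u^4
     - (2/3 * sin (u*0) / u + 0 * cos (u*0) / u^2 - (-2) * sin (u*0) / u^3 - 6*(1/2) * cos (u*0) / u^4) +
      (0 * sin (u*2) / u + 0 * cos (u*2) / u^2 - 0 * sin (u*2) / u^3 - 6*(-1/6) * cos (u*2) / u^4
     - (1/6 * sin (u*1) / u + (-1/2) * cos (u*1) / u^2 - 1 * sin (u*1) / u^3 - 6*(-1/6) * cos (u*1) / u^4)) = 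
      (2 - 2 * cos u)\<^sup>2 / u^4 / 2"
      unfolding c2 q_def[symmetric] by (simp add: field_simps power2_eq_square)
  qed
  have 2: "has_bochner_integral lborel (\<lambda>x. indicator {0..} x *\<^sub>R (bspline x * cos (u * x))) ((2 - 2 * cos u)\<^sup>2 / u^4 / 2)"
  proof (rule has_bochner_integral_cong_AE[THEN iffD1, OF _ _ _ 1])
    show "AE x in lborel. (2/3 + 0*x + (-1)*x^2 + (1/2)*x^3) * cos (u*x) * indicator {0..1} x + 
     (4/3 + (-2)*x + 1*x^2 + (-1/6)*x^3) * cos (u*x) * indicator {1..2} x = indicator {0..} x *\<^sub>R (bspline x * cos (u * x))"
    proof (rule AE_mp[OF AE_lborel_singleton[of 1]], rule AE_I2, rule impI)
      fix x :: real assume "x \<noteq> 1"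
      then show "(2/3 + 0*x + (-1)*x^2 + (1/2)*x^3) * cos (u*x) * indicator {0..1} x + 
     (4/3 + (-2)*x + 1*x^2 + (-1/6)*x^3) * cos (u*x) * indicator {1..2} x = indicator {0..} x *\<^sub>R (bspline x * cos (u * x))"
        by (auto simp: bspline_def indicator_def power2_eq_square power3_eq_cube field_simps)
    qed
  qed measurable
  show ?thesis
    using has_bochner_integral_even_function[OF 2] by (simp add: bspline_even)
qed

lemma bspline_integral: "has_bochner_integral lborel bspline 1"
proof -
  have F: "has_bochner_integral lborel (\<lambda>x. (a + b*x + c*x^2 + d*x^3) * indicator {l..m} x) 
     ((a*m + b*m^2/2 + c*m^3/3 + d*m^4/4) - (a*l + b*l^2/2 + c*l^3/3 + d*l^4/4))" if "l \<le> m" for a b c d l m :: real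
    using that by (intro has_bochner_integral_FTC_Icc_real) 
      (auto intro!: derivative_eq_intros continuous_intros simp: field_simps power2_eq_square power3_eq_cube)
  have 1: "has_bochner_integral lborel (\<lambda>x::real. (2/3 + 0*x + (-1)*x^2 + (1/2)*x^3) * indicator {0..1} x + 
     (4/3 + (-2)*x + 1*x^2 + (-1/6)*x^3) * indicator {1..2} x) (1/2)"
    by (rule has_bochner_integral_rhs[OF has_bochner_integral_add[OF F F]]) (auto simp: power_def)
  have 2: "has_bochner_integral lborel (\<lambda>x. indicator {0..} x *\<^sub>R bspline x) (1/2)"
  proof (rule has_bochner_integral_cong_AE[THEN iffD1, OF _ _ _ 1])
    show "AE x in lborel. (2/3 + 0*x + (-1)*x^2 + (1/2)*x^3) * indicator {0..1} x + 
     (4/3 + (-2)*x + 1*x^2 + (-1/6)*x^3) * indicator {1..2} x = indicator {0..} x *\<^sub>R bspline x"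
    proof (rule AE_mp[OF AE_lborel_singleton[of 1]], rule AE_I2, rule impI)
      fix x :: real assume "x \<noteq> 1"
      then show "(2/3 + 0*x + (-1)*x^2 + (1/2)*x^3) * indicator {0..1} x + 
     (4/3 + (-2)*x + 1*x^2 + (-1/6)*x^3) * indicator {1..2} x = indicator {0..} x *\<^sub>R bspline x"
        by (auto simp: bspline_def indicator_def power2_eq_square power3_eq_cube field_simps)
    qed
  qed measurable
  show ?thesis
    using has_bochner_integral_even_function[OF 2] by (simp add: bspline_even)
qed

lemma bspline_distribution: "real_distribution (density lborel bspline)"
proof -
  have "emeasure (density lborel bspline) UNIV = 1"
    using bspline_integral bspline_nonneg by (simp add: emeasure_density has_bochner_integral_iff nn_integral_eq_integral)
  then show ?thesis by (intro real_distribution.intro prob_spaceI real_distribution_axioms.intro) auto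
qed

text \<open>The spline is even, so the sine part integrates to its own negative and only the cosine
  integral remains.\<close>

lemma char_bspline: 
  assumes u: "u \<noteq> 0"
  shows "char (density lborel bspline) u = of_real ((2 - 2 * cos u)\<^sup>2 / u^4)"
proof -
  have i: "integrable lborel bspline" using bspline_integral by (simp add: has_bochner_integral_iff)
  have "has_bochner_integral lborel (\<lambda>x. bspline x * sin (u * x)) 0"
  proof -
    have "integrable lborel (\<lambda>x. bspline x * sin (u * x))"
      by (rule Bochner_Integration.integrable_bound[OF i]) (auto simp: abs_mult mult_left_le)
    moreover have "(\<integral>x. bspline x * sin (u * x) \<partial>lborel) = (\<integral>x. bspline (0 + -1 * x) * sin (u * (0 + -1 * x)) \<partial>lborel)"
      using lborel_integral_real_affine[of "-1" "\<lambda>x. bspline x * sin (u * x)" 0] by simp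
    moreover have "bspline (0 + -1 * x) * sin (u * (0 + -1 * x)) = - (bspline x * sin (u * x))" for x
      by (simp add: bspline_even)
    ultimately have "(\<integral>x. bspline x * sin (u * x) \<partial>lborel) = - (\<integral>x. bspline x * sin (u * x) \<partial>lborel)"
      by (simp only: Bochner_Integration.integral_minus)
    then show ?thesis using \<open>integrable lborel (\<lambda>x. bspline x * sin (u * x))\<close> by (simp add: has_bochner_integral_iff)
  qed
  then have s: "has_bochner_integral lborel (\<lambda>x. complex_of_real (bspline x * sin (u * x))) 0"
    using has_bochner_integral_of_real[of lborel "\<lambda>x. bspline x * sin (u * x)" 0] by simp
  have c: "has_bochner_integral lborel (\<lambda>x. complex_of_real (bspline x * cos (u * x))) (of_real ((2 - 2 * cos u)\<^sup>2 / u^4))"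
    using bspline_cos_integral[OF u] by (rule has_bochner_integral_of_real)
  have "char (density lborel bspline) u = (CLBINT x. bspline x *\<^sub>R iexp (u * x))"
    unfolding char_def by (subst integral_density) (auto simp: bspline_nonneg)
  also have "\<dots> = (CLBINT x. complex_of_real (bspline x * cos (u * x)) + \<i> * complex_of_real (bspline x * sin (u * x)))"
    by (intro Bochner_Integration.integral_cong refl) 
      (simp add: exp_Euler scaleR_conv_of_real cos_of_real sin_of_real ring_distribs flip: of_real_mult)
  also have "\<dots> = of_real ((2 - 2 * cos u)\<^sup>2 / u^4)"
    using has_bochner_integral_add[OF c has_bochner_integral_mult_right[OF s, of \<i>]] by (simp add: has_bochner_integral_iff)
  finally show ?thesis .
qed

text \<open>For \<open>u \<noteq> 0\<close> this is \<open>(sin (u/2) / (u/2))^4\<close>. At zero,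
  division by zero yields the value 0 instead of the limit 1, so identities with the characteristic
  function of the spline are used almost everywhere only.\<close>

definition spl :: "real \<Rightarrow> real" where "spl u = (2 - 2 * cos u)\<^sup>2 / u^4"

lemma spl_measurable[measurable]: "spl \<in> borel_measurable borel"
  unfolding spl_def by measurable

lemma spl_nonneg: "0 \<le> spl u" unfolding spl_def by simp

text \<open>Near zero a characteristic function is at most one; far out the numerator is at most 16,
  and \<open>1 + u^2\<close> is below \<open>2 * u^2\<close>, which gives 32. The second inequality
  will become the second moment of the jump law.\<close>

lemma spl_le: "spl u \<le> 32 / (1 + u\<^sup>2)" "u\<^sup>2 * spl u \<le> 32 / (1 + u\<^sup>2)"
proof -
  interpret real_distribution "density lborel bspline" by (rule bspline_distribution)
  have b1: "spl u \<le> 1"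
  proof (cases "u = 0")
    case False
    then show ?thesis using cmod_char_le_1[of u] char_bspline[OF False] spl_nonneg[of u] unfolding spl_def[symmetric] by simp
  qed (simp add: spl_def)
  have pos: "1 + u\<^sup>2 > 0" by (simp add: add_pos_nonneg)
  have "spl u \<le> 32 / (1 + u\<^sup>2) \<and> u\<^sup>2 * spl u \<le> 32 / (1 + u\<^sup>2)"
  proof (cases "u\<^sup>2 \<le> 1")
    case True
    have "1 \<le> 32 / (1 + u\<^sup>2)" using True pos by (simp add: field_simps)
    moreover have "u\<^sup>2 * spl u \<le> 1 * 1" using True b1 spl_nonneg by (intro mult_mono) auto
    ultimately show ?thesis using b1 by auto
  next
    case False
    then have u: "u\<^sup>2 > 1" by simp
    have "(2 - 2 * cos u)\<^sup>2 \<le> 4\<^sup>2" by (rule power_mono) (use cos_ge_minus_one[of u] cos_le_one[of u] in linarith)+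
    then have "spl u \<le> 16 / u^4" unfolding spl_def by (intro divide_right_mono) auto
    then have "u\<^sup>2 * spl u \<le> u\<^sup>2 * (16 / u^4)" by (intro mult_left_mono) auto
    also have "\<dots> = 16 / u\<^sup>2" using u by (simp add: field_simps power2_eq_square power4_eq_xxxx)
    also have "\<dots> \<le> 32 / (1 + u\<^sup>2)"
    proof -
      have "16 / v \<le> 32 / (1 + v)" if "v > 1" for v :: real using that by (simp add: field_simps)
      then show ?thesis using u by blast
    qed
    finally have *: "u\<^sup>2 * spl u \<le> 32 / (1 + u\<^sup>2)" .
    have "1 * spl u \<le> u\<^sup>2 * spl u" using u spl_nonneg by (intro mult_right_mono) auto
    with * show ?thesis by simp
  qed
  then show "spl u \<le> 32 / (1 + u\<^sup>2)" "u\<^sup>2 * spl u \<le> 32 / (1 + u\<^sup>2)" by auto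
qed

lemma integrable_arctan_deriv: "integrable lborel (\<lambda>x::real. 1 / (1 + x\<^sup>2))"
proof -
  have "set_integrable lborel (einterval (-\<infinity>) \<infinity>) (\<lambda>x. 1 / (1 + x\<^sup>2))"
  proof (rule interval_integral_FTC_nonneg(1)[where F=arctan and A="-pi/2" and B="pi/2"])
    show "((arctan \<circ> real_of_ereal) \<longlongrightarrow> -pi/2) (at_right (-\<infinity>))"
      by (simp add: tendsto_arctan_at_bot ereal_tendsto_simps flip: minus_divide_left)
    show "((arctan \<circ> real_of_ereal) \<longlongrightarrow> pi/2) (at_left \<infinity>)"
      by (simp add: tendsto_arctan_at_top ereal_tendsto_simps)
    show "isCont (\<lambda>x. 1 / (1 + x\<^sup>2)) x" for x :: real
      by (intro continuous_intros) (metis add_pos_nonneg less_irrefl zero_le_power2 zero_less_one)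
    show "DERIV arctan x :> 1 / (1 + x\<^sup>2)" for x
      using DERIV_arctan[of x] by (simp add: inverse_eq_divide)
  qed (auto intro!: AE_I2 add_nonneg_nonneg)
  then show ?thesis by (simp add: set_integrable_def)
qed

lemma spl_integrable: "integrable lborel spl" "integrable lborel (\<lambda>u. u\<^sup>2 * spl u)"
proof -
  have i: "integrable lborel (\<lambda>x::real. 32 / (1 + x\<^sup>2))" using integrable_mult_right[OF integrable_arctan_deriv, of 32] by simp
  show "integrable lborel spl" "integrable lborel (\<lambda>u. u\<^sup>2 * spl u)"
    by (rule Bochner_Integration.integrable_bound[OF i]; 
        use spl_nonneg spl_le in \<open>auto simp: abs_mult intro!: AE_I2 order.trans[OF _ abs_ge_self]\<close>)+
qed

lemma AE_lborel_neq: "AE x in lborel. x \<noteq> (c::real)"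
  using AE_lborel_singleton .

text \<open>Gaussian regularisation: smoothing the spline law at scale \<open>e n\<close> gives the
  formula with an additional Gaussian factor. As \<open>e n\<close> tends to zero, one side
  converges by continuity of the spline, the other by domination with the integrable
  \<open>spl\<close>.\<close>

lemma bspline_inversion:
  "(CLBINT u. of_real (spl u) * iexp (u * x)) = of_real (2 * pi * bspline x)"
proof -
  interpret real_distribution "density lborel bspline" by (rule bspline_distribution)
  define e where "e n = 1 / real (Suc n)" for n
  have e: "e n > 0" for n by (simp add: e_def)
  have e0: "e \<longlonglongrightarrow> 0" unfolding e_def using LIMSEQ_inverse_real_of_nat by (simp add: inverse_eq_divide)
  have L: "(\<lambda>n. smooth (e n) (density lborel bspline) x) \<longlonglongrightarrow> bspline x"
  proof -
    have eq: "smooth (e n) (density lborel bspline) x = (\<integral>y. std_normal_density y * bspline (x + e n * y) \<partial>lborel)" for n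
    proof -
      have "smooth (e n) (density lborel bspline) x = (\<integral>z. bspline z * normal_density 0 (e n) (x - z) \<partial>lborel)"
        unfolding smooth_def by (subst integral_density) (auto simp: bspline_nonneg)
      also have "\<dots> = \<bar>e n\<bar> *\<^sub>R (\<integral>y. bspline (x + e n * y) * normal_density 0 (e n) (x - (x + e n * y)) \<partial>lborel)"
        by (rule lborel_integral_real_affine) (use e[of n] in simp)
      also have "\<dots> = (\<integral>y. e n * (bspline (x + e n * y) * normal_density 0 (e n) (x - (x + e n * y))) \<partial>lborel)"
        using e[of n] by simp
      also have "\<dots> = (\<integral>y. std_normal_density y * bspline (x + e n * y) \<partial>lborel)"
        using e[of n] by (intro Bochner_Integration.integral_cong refl) 
          (simp add: normal_density_def real_sqrt_mult power_mult_distrib)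
      finally show ?thesis .
    qed
    have "(\<lambda>n. \<integral>y. std_normal_density y * bspline (x + e n * y) \<partial>lborel) \<longlonglongrightarrow> (\<integral>y. std_normal_density y * bspline x \<partial>lborel)"
    proof (rule integral_dominated_convergence[where w=std_normal_density])
      show "AE y in lborel. (\<lambda>n. std_normal_density y * bspline (x + e n * y)) \<longlonglongrightarrow> std_normal_density y * bspline x"
      proof (rule AE_I2, rule tendsto_mult[OF tendsto_const])
        fix y
        have "(\<lambda>n. x + e n * y) \<longlonglongrightarrow> x + 0 * y" by (intro tendsto_intros e0)
        then show "(\<lambda>n. bspline (x + e n * y)) \<longlonglongrightarrow> bspline x"
          using isCont_tendsto_compose[OF continuous_bspline[of x]] by simp
      qed
      show "\<And>n. AE y in lborel. norm (std_normal_density y * bspline (x + e n * y)) \<le> std_normal_density y"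
        by (auto simp: abs_mult bspline_nonneg bspline_le1 mult_left_le)
    qed (auto simp: integrable_normal_density)
    also have "(\<integral>y. std_normal_density y * bspline x \<partial>lborel) = bspline x"
      by simp
    finally show ?thesis by (simp add: eq)
  qed
  have R: "(\<lambda>n. complex_of_real (smooth (e n) (density lborel bspline) x)) \<longlonglongrightarrow> 
      of_real (1 / (2 * pi)) * (CLBINT u. of_real (exp (-(0*u)\<^sup>2/2)) * iexp (u * x) * of_real (spl u))"
  proof -
    have "complex_of_real (smooth (e n) (density lborel bspline) x) = 
        of_real (1 / (2 * pi)) * (CLBINT u. of_real (exp (-(e n*u)\<^sup>2/2)) * iexp (u * x) * of_real (spl u))" for n
    proof -
      have "(CLBINT u. of_real (exp (-(e n*u)\<^sup>2/2)) * iexp (u * x) * char (density lborel bspline) (-u)) =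
         (CLBINT u. of_real (exp (-(e n*u)\<^sup>2/2)) * iexp (u * x) * of_real (spl u))"
      proof (rule integral_cong_AE)
        show "AE u in lborel. of_real (exp (-(e n*u)\<^sup>2/2)) * iexp (u * x) * char (density lborel bspline) (-u) = 
           of_real (exp (-(e n*u)\<^sup>2/2)) * iexp (u * x) * of_real (spl u)"
          using AE_lborel_neq[of 0] by eventually_elim (simp add: char_bspline spl_def)
      qed auto
      then show ?thesis by (simp only: smooth_fourier[OF e])
    qed
    moreover have "(\<lambda>n. CLBINT u. of_real (exp (-(e n*u)\<^sup>2/2)) * iexp (u * x) * of_real (spl u)) \<longlonglongrightarrow> 
       (CLBINT u. of_real (exp (-(0*u)\<^sup>2/2)) * iexp (u * x) * of_real (spl u))"
    proof (rule integral_dominated_convergence[where w=spl])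
      show "AE u in lborel. (\<lambda>n. of_real (exp (-(e n*u)\<^sup>2/2)) * iexp (u * x) * of_real (spl u)) \<longlonglongrightarrow> 
         of_real (exp (-(0*u)\<^sup>2/2)) * iexp (u * x) * of_real (spl u)"
        by (intro AE_I2 tendsto_intros e0) auto
      show "AE u in lborel. norm (of_real (exp (-(e n*u)\<^sup>2/2)) * iexp (u * x) * complex_of_real (spl u)) \<le> spl u" for n
        by (auto simp: norm_mult spl_nonneg intro!: AE_I2 mult_left_le_one_le)
    qed (auto simp: spl_integrable)
    ultimately show ?thesis by (simp only:) (intro tendsto_intros)
  qed
  have "of_real (bspline x) = of_real (1 / (2 * pi)) * (CLBINT u. of_real (exp (-(0*u)\<^sup>2/2)) * iexp (u * x) * of_real (spl u))"
    by (rule LIMSEQ_unique[OF tendsto_of_real[OF L] R])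
  then show ?thesis by (simp add: mult.commute field_simps)
qed

text \<open>Fourier duality: \<open>spl\<close> is nonnegative and integrable, so a multiple of it
  is a probability density, and inversion shows that the characteristic function of this law is a
  multiple of the spline itself.\<close>

lemma spline_kernel:
  obtains \<kappa> :: "real measure" where "real_distribution \<kappa>" "\<kappa> = distr \<kappa> borel uminus" "emeasure \<kappa> {0} = 0"
    "integrable \<kappa> (\<lambda>x. x\<^sup>2)" "\<And>u. char \<kappa> u = of_real (3/2 * bspline u)"
proof -
  \<comment> \<open>The normalisation: the integral of \<open>spl\<close> is
    \<open>2 * pi * bspline 0 = 4 * pi / 3\<close>.\<close>
  define k where "k u = 3 / (4 * pi) * spl u" for u
  have km[measurable]: "k \<in> borel_measurable borel" unfolding k_def by measurable
  have k0: "0 \<le> k u" for u by (simp add: k_def spl_nonneg)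
  have ki: "integrable lborel k" unfolding k_def using spl_integrable by simp
  have char: "(CLBINT u. of_real (k u) * iexp (x * u)) = of_real (3/2 * bspline x)" for x
  proof -
    have "(CLBINT u. of_real (k u) * iexp (x * u)) = (CLBINT u. of_real (3 / (4 * pi)) * (of_real (spl u) * iexp (u * x)))"
      by (intro Bochner_Integration.integral_cong refl) (simp add: k_def mult_ac)
    also have "\<dots> = of_real (3 / (4 * pi)) * (CLBINT u. (of_real (spl u) * iexp (u * x)))"
      by (rule integral_mult_right_zero)
    finally show ?thesis unfolding bspline_inversion by simp
  qed
  have "complex_of_real (\<integral>u. k u \<partial>lborel) = of_real 1"
    using char[of 0] by (simp add: bspline_def)
  then have "(\<integral>u. k u \<partial>lborel) = 1" by (simp only: of_real_eq_iff)
  then have "emeasure (density lborel k) UNIV = 1"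
    using ki k0 by (simp add: emeasure_density nn_integral_eq_integral)
  then have 1: "real_distribution (density lborel k)"
    by (intro real_distribution.intro prob_spaceI real_distribution_axioms.intro) auto
  have sym: "k (- u) = k u" for u by (simp add: k_def spl_def)
  have 2: "density lborel k = distr (density lborel k) borel uminus"
  proof (rule measure_eqI)
    fix A assume "A \<in> sets (density lborel k)"
    then have [measurable]: "A \<in> sets borel" by simp
    have "emeasure (distr (density lborel k) borel uminus) A = (\<integral>\<^sup>+x. ennreal (k x) * indicator A (- x) \<partial>lborel)"
      by (simp add: emeasure_distr emeasure_density indicator_def vimage_def)
    also have "\<dots> = (\<integral>\<^sup>+x. ennreal (k x) * indicator A x \<partial>(distr lborel borel uminus))"
      by (subst nn_integral_distr) (auto simp: sym)
    also have "\<dots> = emeasure (density lborel k) A" by (simp add: lborel_distr_uminus emeasure_density)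
    finally show "emeasure (density lborel k) A = emeasure (distr (density lborel k) borel uminus) A" by simp
  qed simp
  have "AE x in lborel. ennreal (k x) * indicator {0} x = 0"
    using AE_lborel_neq[of 0] by eventually_elim simp
  then have 3: "emeasure (density lborel k) {0} = 0"
    by (simp add: emeasure_density nn_integral_0_iff_AE)
  have 4: "integrable (density lborel k) (\<lambda>x. x\<^sup>2)"
  proof (subst integrable_density)
    show "integrable lborel (\<lambda>x. k x *\<^sub>R x\<^sup>2)"
      using integrable_mult_right[OF spl_integrable(2), of "3 / (4 * pi)"] by (simp add: k_def mult_ac)
  qed (auto simp: k0)
  have 5: "char (density lborel k) u = of_real (3/2 * bspline u)" for u
    unfolding char_def char[symmetric] by (subst integral_density) (auto simp: k0 scaleR_conv_of_real)
  show thesis using that[OF 1 2 3 4 5] .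
qed

section \<open>Affinity and tests\<close>

lemma PiM_density:
  fixes p :: "real \<Rightarrow> real"
  assumes I: "finite I" and p[measurable]: "p \<in> borel_measurable borel" and p0: "\<And>x. 0 \<le> p x"
    and prob: "prob_space (density lborel p)"
  shows "PiM I (\<lambda>_. density lborel p) = density (PiM I (\<lambda>_. lborel)) (\<lambda>x. ennreal (\<Prod>i\<in>I. p (x i)))"
proof -
  interpret D: product_prob_space "\<lambda>_. density lborel p" I
    using prob by (intro product_prob_spaceI)
  interpret D: finite_product_sigma_finite "\<lambda>_. density lborel p" I 
    by standard (rule I)
  interpret L: finite_product_sigma_finite "\<lambda>_. lborel :: real measure" I 
    by standard (rule I)
  show ?thesis
  proof (rule sym, rule D.PiM_eqI)
    show "sets (density (PiM I (\<lambda>_. lborel)) (\<lambda>x. ennreal (\<Prod>i\<in>I. p (x i)))) = sets (PiM I (\<lambda>_. density lborel p))"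
      by (simp cong: sets_PiM_cong)
    fix A assume A: "\<And>i. i \<in> I \<Longrightarrow> A i \<in> sets (density lborel p)"
    then have [measurable]: "\<And>i. i \<in> I \<Longrightarrow> A i \<in> sets borel" by simp
    have "emeasure (density (PiM I (\<lambda>_. lborel)) (\<lambda>x. ennreal (\<Prod>i\<in>I. p (x i)))) (Pi\<^sub>E I A) = 
        (\<integral>\<^sup>+x. ennreal (\<Prod>i\<in>I. p (x i)) * indicator (Pi\<^sub>E I A) x \<partial>PiM I (\<lambda>_. lborel))"
      using I A by (intro emeasure_density) (auto intro!: sets_PiM_I_finite)
    also have "\<dots> = (\<integral>\<^sup>+x. (\<Prod>i\<in>I. ennreal (p (x i)) * indicator (A i) (x i)) \<partial>PiM I (\<lambda>_. lborel))"
    proof (intro nn_integral_cong)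
      fix x assume "x \<in> space (PiM I (\<lambda>_. lborel :: real measure))"
      then have "indicator (Pi\<^sub>E I A) x = (\<Prod>i\<in>I. indicator (A i) (x i) :: ennreal)"
        using I by (auto simp: indicator_def space_PiM PiE_iff prod_zero_iff)
      then show "ennreal (\<Prod>i\<in>I. p (x i)) * indicator (Pi\<^sub>E I A) x = (\<Prod>i\<in>I. ennreal (p (x i)) * indicator (A i) (x i))"
        by (simp add: prod.distrib prod_ennreal p0)
    qed
    also have "\<dots> = (\<Prod>i\<in>I. \<integral>\<^sup>+x. ennreal (p x) * indicator (A i) x \<partial>lborel)"
      by (rule L.product_nn_integral_prod[OF I]) measurable
    also have "\<dots> = (\<Prod>i\<in>I. emeasure (density lborel p) (A i))"
      by (intro prod.cong refl) (simp add: emeasure_density)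
    finally show "emeasure (density (PiM I (\<lambda>_. lborel)) (\<lambda>x. ennreal (\<Prod>i\<in>I. p (x i)))) (Pi\<^sub>E I A) =
       (\<Prod>i\<in>I. emeasure (density lborel p) (A i))" .
  qed (rule I)
qed

text \<open>Integrates the pointwise bound of \<open>f * g\<close> by
  \<open>t/2 * f^2 + 1/(2*t) * g^2\<close> with the optimal \<open>t\<close>. The bounds are
  enlarged by \<open>e > 0\<close> so that this \<open>t\<close> exists even if \<open>a\<close> or
  \<open>b\<close> is zero; then \<open>e\<close> tends to zero.\<close>

lemma nn_Cauchy_Schwarz:
  assumes [measurable]: "f \<in> borel_measurable M" "g \<in> borel_measurable M" "\<And>x. 0 \<le> f x" "\<And>x. 0 \<le> g x"
    and F: "(\<integral>\<^sup>+x. ennreal ((f x)\<^sup>2) \<partial>M) \<le> ennreal a" and G: "(\<integral>\<^sup>+x. ennreal ((g x)\<^sup>2) \<partial>M) \<le> ennreal b"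
    and a: "0 \<le> a" and b: "0 \<le> b"
  shows "(\<integral>\<^sup>+x. ennreal (f x * g x) \<partial>M) \<le> ennreal (sqrt a * sqrt b)"
proof -
  have *: "(\<integral>\<^sup>+x. ennreal (f x * g x) \<partial>M) \<le> ennreal (sqrt (a+e) * sqrt (b+e))" if e: "e > 0" for e
  proof -
    define t where "t = sqrt (b+e) / sqrt (a+e)"
    have t: "t > 0" using a b e by (auto simp: t_def)
    have "(\<integral>\<^sup>+x. ennreal (f x * g x) \<partial>M) \<le> (\<integral>\<^sup>+x. ennreal (t/2) * ennreal ((f x)\<^sup>2) + ennreal (1/(2*t)) * ennreal ((g x)\<^sup>2) \<partial>M)"
    proof (rule nn_integral_mono)
      fix x
      have "0 \<le> (t * f x - g x)\<^sup>2 / (2*t)" using t by simp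
      also have "\<dots> = t/2 * (f x)\<^sup>2 + 1/(2*t) * (g x)\<^sup>2 - f x * g x" using t by (simp add: power2_eq_square field_simps)
      finally show "ennreal (f x * g x) \<le> ennreal (t/2) * ennreal ((f x)\<^sup>2) + ennreal (1/(2*t)) * ennreal ((g x)\<^sup>2)"
        using t by (simp add: ennreal_leI flip: ennreal_mult' ennreal_plus)
    qed
    also have "\<dots> = ennreal (t/2) * (\<integral>\<^sup>+x. ennreal ((f x)\<^sup>2) \<partial>M) + ennreal (1/(2*t)) * (\<integral>\<^sup>+x. ennreal ((g x)\<^sup>2) \<partial>M)"
      by (subst nn_integral_add) (auto simp: nn_integral_cmult)
    also have "\<dots> \<le> ennreal (t/2) * ennreal (a+e) + ennreal (1/(2*t)) * ennreal (b+e)"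
    proof -
      have "ennreal a \<le> ennreal (a + e)" "ennreal b \<le> ennreal (b + e)" using e by (auto intro!: ennreal_leI)
      then show ?thesis using F G by (intro add_mono mult_left_mono) auto
    qed
    also have "\<dots> = ennreal (t/2 * (a+e) + 1/(2*t) * (b+e))"
      using t a b e by (simp flip: ennreal_mult' ennreal_plus)
    also have "t/2 * (a+e) + 1/(2*t) * (b+e) = sqrt (a+e) * sqrt (b+e)"
    proof -
      define u v where "u = sqrt (a+e)" and "v = sqrt (b+e)"
      have uv: "u > 0" "v > 0" "a + e = u * u" "b + e = v * v" using a b e by (auto simp: u_def v_def)
      show ?thesis unfolding t_def u_def[symmetric] v_def[symmetric] uv(3,4)
        using uv(1,2) by (simp add: field_simps)
    qed
    finally show ?thesis .
  qed
  have "((\<lambda>e. ennreal (sqrt (a+e) * sqrt (b+e))) \<longlongrightarrow> ennreal (sqrt (a+0) * sqrt (b+0))) (at_right 0)"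
    by (intro tendsto_intros)
  moreover have "\<forall>\<^sub>F e in at_right 0. (\<integral>\<^sup>+x. ennreal (f x * g x) \<partial>M) \<le> ennreal (sqrt (a+e) * sqrt (b+e))"
    using eventually_at_right_less[of "0::real"] by eventually_elim (rule *)
  ultimately show ?thesis
    by (intro tendsto_lowerbound[where F="at_right (0::real)"]) auto
qed

text \<open>
  Works because the Hellinger affinity is multiplicative over independent observations.
\<close>

lemma affinity_test_bound:
  fixes p q :: "real \<Rightarrow> real"
  assumes p[measurable]: "p \<in> borel_measurable borel" and p0: "\<And>x. 0 \<le> p x" and pp: "prob_space (density lborel p)"
    and q[measurable]: "q \<in> borel_measurable borel" and q0: "\<And>x. 0 \<le> q x" and qq: "prob_space (density lborel q)"
    and I: "finite I" and S: "S \<in> sets (PiM I (\<lambda>_. borel))"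
    and P: "emeasure (PiM I (\<lambda>_. density lborel p)) S \<le> ennreal e"
    and Q: "emeasure (PiM I (\<lambda>_. density lborel q)) (space (PiM I (\<lambda>_. borel)) - S) \<le> ennreal e" and e: "e \<ge> 0"
    and a: "ennreal a \<le> (\<integral>\<^sup>+x. ennreal (sqrt (p x) * sqrt (q x)) \<partial>lborel)" "0 \<le> a"
  shows "a ^ card I \<le> 2 * sqrt e"
proof -
  interpret L: finite_product_sigma_finite "\<lambda>_. lborel :: real measure" I by standard (rule I)
  let ?L = "PiM I (\<lambda>_. lborel :: real measure)"
  have sL: "sets ?L = sets (PiM I (\<lambda>_. borel))" by (intro sets_PiM_cong) auto
  have [measurable]: "S \<in> sets ?L" using S sL by simp
  have spL: "space ?L = space (PiM I (\<lambda>_. borel :: real measure))" using sL by (rule sets_eq_imp_space_eq)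
  let ?p = "\<lambda>x. \<Prod>i\<in>I. p (x i)" and ?q = "\<lambda>x. \<Prod>i\<in>I. q (x i)"
  have pp0: "0 \<le> ?p x" "0 \<le> ?q x" for x by (auto intro!: prod_nonneg p0 q0)
  have "ennreal (a ^ card I) = (\<Prod>i\<in>I. ennreal a)" using a(2) by (simp add: ennreal_power)
  also have "\<dots> \<le> (\<Prod>i\<in>I. \<integral>\<^sup>+x. ennreal (sqrt (p x) * sqrt (q x)) \<partial>lborel)"
    using a(1) by (intro prod_mono_ennreal) auto
  also have "\<dots> = (\<integral>\<^sup>+x. (\<Prod>i\<in>I. ennreal (sqrt (p (x i)) * sqrt (q (x i)))) \<partial>?L)"
    by (rule L.product_nn_integral_prod[OF I, symmetric]) measurable
  also have "\<dots> = (\<integral>\<^sup>+x. ennreal (sqrt (?p x) * sqrt (?q x)) \<partial>?L)"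
  proof -
    have "sqrt (\<Prod>i\<in>I. r (x i)) = (\<Prod>i\<in>I. sqrt (r (x i)))" for r :: "real \<Rightarrow> real" and x
      using I by (induction I rule: finite_induct) (auto simp: real_sqrt_mult)
    then show ?thesis by (intro nn_integral_cong) (simp add: prod_ennreal p0 q0 prod.distrib)
  qed
  \<comment> \<open>The affinity is split over the test region and its complement. On each of them
    one of the two densities has mass at most \<open>e\<close>, and Cauchy-Schwarz bounds the piece
    by \<open>sqrt e\<close>.\<close>
  also have "\<dots> = (\<integral>\<^sup>+x. ennreal ((sqrt (?p x) * indicator S x) * sqrt (?q x)) + ennreal (sqrt (?p x) * (sqrt (?q x) * indicator (space ?L - S) x)) \<partial>?L)"
    by (intro nn_integral_cong) (auto simp: indicator_def)
  also have "\<dots> = (\<integral>\<^sup>+x. ennreal ((sqrt (?p x) * indicator S x) * sqrt (?q x)) \<partial>?L) + (\<integral>\<^sup>+x. ennreal (sqrt (?p x) * (sqrt (?q x) * indicator (space ?L - S) x)) \<partial>?L)"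
    by (intro nn_integral_add) auto
  also have "\<dots> \<le> ennreal (sqrt e * sqrt 1) + ennreal (sqrt 1 * sqrt e)"
  proof (intro add_mono nn_Cauchy_Schwarz)
    have one: "emeasure (density ?L rr) (space ?L) = 1" if "PiM I (\<lambda>_. density lborel r) = density ?L rr" "prob_space (density lborel r)" for r rr
    proof -
      interpret P: product_prob_space "\<lambda>_. density lborel r" I using that(2) by (intro product_prob_spaceI)
      show ?thesis using P.emeasure_space_1 unfolding that(1) by simp
    qed
    show "(\<integral>\<^sup>+x. ennreal ((sqrt (?q x))\<^sup>2) \<partial>?L) \<le> ennreal 1"
      using one[OF PiM_density[OF I q q0 qq] qq] pp0 by (subst (asm) emeasure_density) (auto cong: nn_integral_cong)
    show "(\<integral>\<^sup>+x. ennreal ((sqrt (?p x))\<^sup>2) \<partial>?L) \<le> ennreal 1"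
      using one[OF PiM_density[OF I p p0 pp] pp] pp0 by (subst (asm) emeasure_density) (auto cong: nn_integral_cong)
    have sq: "ennreal ((sqrt (r x) * indicator T x)\<^sup>2) = ennreal (r x) * indicator T x" if "r x \<ge> 0" for r and x :: "'a \<Rightarrow> real" and T
      using that by (auto simp: indicator_def)
    show "(\<integral>\<^sup>+x. ennreal ((sqrt (?p x) * indicator S x)\<^sup>2) \<partial>?L) \<le> ennreal e"
      using P unfolding PiM_density[OF I p p0 pp]
      by (subst (asm) emeasure_density) (auto simp: sq[of "\<lambda>x. \<Prod>i\<in>I. p (x i)", OF pp0(1)])
    show "(\<integral>\<^sup>+x. ennreal ((sqrt (?q x) * indicator (space ?L - S) x)\<^sup>2) \<partial>?L) \<le> ennreal e"
      using Q unfolding PiM_density[OF I q q0 qq] spL[symmetric]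
      by (subst (asm) emeasure_density) (auto simp: sq[of "\<lambda>x. \<Prod>i\<in>I. q (x i)", OF pp0(2)])
  qed (use e pp0 in auto)
  also have "\<dots> = ennreal (2 * sqrt e)" using e by (simp flip: ennreal_plus)
  finally show ?thesis using e by (simp add: ennreal_le_iff)
qed

text \<open>Pointwise, \<open>p + q\<close> is twice the minimum plus
  \<open>\<bar>p - q\<bar>\<close>, and the minimum is at most the geometric mean; integrating gives
  the bound.\<close>

lemma affinity_ge_L1:
  assumes [measurable]: "p \<in> borel_measurable borel" "q \<in> borel_measurable borel" 
    and p0: "\<And>x. 0 \<le> p x" and pp: "prob_space (density lborel p)"
    and q0: "\<And>x. 0 \<le> q x" and qq: "prob_space (density lborel q)"
    and d: "(\<integral>\<^sup>+x. ennreal \<bar>p x - q x\<bar> \<partial>lborel) \<le> ennreal (2 * d)" and d0: "0 \<le> d"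
  shows "ennreal (1 - d) \<le> (\<integral>\<^sup>+x. ennreal (sqrt (p x) * sqrt (q x)) \<partial>lborel)"
proof -
  have one: "(\<integral>\<^sup>+x. ennreal (p x) \<partial>lborel) = 1" "(\<integral>\<^sup>+x. ennreal (q x) \<partial>lborel) = 1"
    using prob_space.emeasure_space_1[OF pp] prob_space.emeasure_space_1[OF qq] by (auto simp: emeasure_density)
  have "ennreal 2 = (\<integral>\<^sup>+x. ennreal (p x) + ennreal (q x) \<partial>lborel)"
    by (subst nn_integral_add) (auto simp: one)
  also have "\<dots> \<le> (\<integral>\<^sup>+x. 2 * ennreal (sqrt (p x) * sqrt (q x)) + ennreal \<bar>p x - q x\<bar> \<partial>lborel)"
  proof (rule nn_integral_mono)
    fix x
    have min: "min (p x) (q x) \<le> sqrt (p x) * sqrt (q x)"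
      using p0[of x] q0[of x] mult_mono[of "sqrt (min (p x) (q x))" "sqrt (p x)" "sqrt (min (p x) (q x))" "sqrt (q x)"]
      by simp
    have "p x + q x = 2 * min (p x) (q x) + \<bar>p x - q x\<bar>" by auto
    also have "\<dots> \<le> 2 * (sqrt (p x) * sqrt (q x)) + \<bar>p x - q x\<bar>" using min by simp
    finally have "ennreal (p x + q x) \<le> ennreal (2 * (sqrt (p x) * sqrt (q x)) + \<bar>p x - q x\<bar>)" by (rule ennreal_leI)
    then show "ennreal (p x) + ennreal (q x) \<le> 2 * ennreal (sqrt (p x) * sqrt (q x)) + ennreal \<bar>p x - q x\<bar>"
      using p0[of x] q0[of x] by (simp add: ennreal_plus ennreal_mult' )
  qed
  also have "\<dots> = 2 * (\<integral>\<^sup>+x. ennreal (sqrt (p x) * sqrt (q x)) \<partial>lborel) + (\<integral>\<^sup>+x. ennreal \<bar>p x - q x\<bar> \<partial>lborel)"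
    by (subst nn_integral_add) (auto simp: nn_integral_cmult)
  also have "\<dots> \<le> 2 * (\<integral>\<^sup>+x. ennreal (sqrt (p x) * sqrt (q x)) \<partial>lborel) + ennreal (2 * d)"
    using d by (intro add_left_mono)
  finally have *: "ennreal 2 \<le> 2 * (\<integral>\<^sup>+x. ennreal (sqrt (p x) * sqrt (q x)) \<partial>lborel) + ennreal (2 * d)" .
  show ?thesis
  proof (cases "(\<integral>\<^sup>+x. ennreal (sqrt (p x) * sqrt (q x)) \<partial>lborel)")
    case (real r)
    then have "ennreal 2 \<le> ennreal (2 * r + 2 * d)" using * d0 by (simp add: ennreal_plus ennreal_mult')
    then have "2 \<le> 2 * r + 2 * d" using real(1) d0 by (subst (asm) ennreal_le_iff) auto
    then show ?thesis using real by (simp add: ennreal_leI)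
  qed simp
qed

text \<open>The geometric mean of two centred Gaussian densities is a multiple of a third one, whose
  inverse variance is the average of the two; \<open>r\<close> is its standard deviation.\<close>

lemma affinity_gauss:
  assumes s: "0 < s" and t: "0 < t"
  shows "(\<integral>\<^sup>+x. ennreal (sqrt (normal_density 0 s x) * sqrt (normal_density 0 t x)) \<partial>lborel) = ennreal (sqrt (2 * s * t / (s\<^sup>2 + t\<^sup>2)))"
proof -
  define r where "r = sqrt (2 / (1/s\<^sup>2 + 1/t\<^sup>2))"
  have pos: "1/s\<^sup>2 + 1/t\<^sup>2 > 0" using s t by (simp add: add_pos_pos)
  then have r: "r > 0" by (simp add: r_def)
  have r2: "r\<^sup>2 = 2 / (1/s\<^sup>2 + 1/t\<^sup>2)" using pos by (simp add: r_def)
  have "sqrt (normal_density 0 s x) * sqrt (normal_density 0 t x) = sqrt (r\<^sup>2 / (s * t)) * normal_density 0 r x" for x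
  proof (rule power2_eq_imp_eq)
    have e: "- x\<^sup>2 / (2 * s\<^sup>2) + - x\<^sup>2 / (2 * t\<^sup>2) = 2 * (- x\<^sup>2 / (2 * r\<^sup>2))"
      unfolding r2 using s t pos by (simp add: field_simps)
    have "(sqrt (normal_density 0 s x) * sqrt (normal_density 0 t x))\<^sup>2 = normal_density 0 s x * normal_density 0 t x"
      by (simp add: power_mult_distrib)
    also have "\<dots> = 1 / (2 * pi * s * t) * (exp (- x\<^sup>2 / (2 * s\<^sup>2)) * exp (- x\<^sup>2 / (2 * t\<^sup>2)))"
    proof -
      have "sqrt (2 * pi * s\<^sup>2) * sqrt (2 * pi * t\<^sup>2) = 2 * pi * s * t"
        using s t by (simp add: real_sqrt_mult power2_eq_square) 
           (metis mult.assoc mult.left_commute real_sqrt_mult_self abs_of_nonneg pi_ge_zero abs_numeral)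
      then show ?thesis by (simp add: normal_density_def)
    qed
    also have "exp (- x\<^sup>2 / (2 * s\<^sup>2)) * exp (- x\<^sup>2 / (2 * t\<^sup>2)) = (exp (- x\<^sup>2 / (2 * r\<^sup>2)))\<^sup>2"
      by (simp only: exp_add[symmetric] e exp_double)
    also have "1 / (2 * pi * s * t) * (exp (- x\<^sup>2 / (2 * r\<^sup>2)))\<^sup>2 = (sqrt (r\<^sup>2 / (s * t)) * normal_density 0 r x)\<^sup>2"
      using s t r by (simp add: normal_density_def power_mult_distrib power_divide field_simps)
    finally show "(sqrt (normal_density 0 s x) * sqrt (normal_density 0 t x))\<^sup>2 = (sqrt (r\<^sup>2 / (s * t)) * normal_density 0 r x)\<^sup>2" .
  qed (use s t in auto)
  then have "(\<integral>\<^sup>+x. ennreal (sqrt (normal_density 0 s x) * sqrt (normal_density 0 t x)) \<partial>lborel) = 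
     (\<integral>\<^sup>+x. ennreal (sqrt (r\<^sup>2 / (s * t)) * normal_density 0 r x) \<partial>lborel)" by simp
  also have "\<dots> = ennreal (\<integral>x. sqrt (r\<^sup>2 / (s * t)) * normal_density 0 r x \<partial>lborel)"
    using r s t by (intro nn_integral_eq_integral) auto
  also have "\<dots> = ennreal (sqrt (r\<^sup>2 / (s * t)))" using r by simp
  also have "r\<^sup>2 / (s * t) = 2 * s * t / (s\<^sup>2 + t\<^sup>2)"
  proof -
    have "1/s\<^sup>2 + 1/t\<^sup>2 = (s\<^sup>2 + t\<^sup>2) / (s * t)\<^sup>2" using s t by (simp add: field_simps power2_eq_square)
    then show ?thesis unfolding r2 using s t by (simp add: power2_eq_square)
  qed
  finally show ?thesis .
qed

section \<open>Independent families on a large sample type\<close>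

text \<open>A real is coded by a set of naturals, and a countable family of such sets by a single
  one through pairing.\<close>

lemma countable_fun_lepoll_real: "(UNIV :: ('i::countable \<Rightarrow> real) set) \<lesssim> (UNIV :: real set)"
proof -
  have e: "(UNIV::nat set set) \<approx> (UNIV::real set)" by (rule nat_sets_eqpoll_reals)
  then obtain g :: "real \<Rightarrow> nat set" where g: "inj g"
    using eqpoll_imp_lepoll[OF eqpoll_sym[OF e]] by (auto simp: lepoll_def)
  define h where "h F = {prod_encode (to_nat (i::'i), m) | i m. m \<in> g (F i)}" for F :: "'i \<Rightarrow> real"
  have "inj h"
  proof (rule injI)
    fix F F' assume eq: "h F = h F'"
    have mem: "m \<in> g (F i) \<longleftrightarrow> prod_encode (to_nat i, m) \<in> h F" for F i m
      by (auto simp: h_def)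
    have "g (F i) = g (F' i)" for i using mem[of _ F i] mem[of _ F' i] eq by blast
    then show "F = F'" using g by (auto simp: inj_def)
  qed
  then have "(UNIV :: ('i \<Rightarrow> real) set) \<lesssim> (UNIV :: nat set set)" by (auto simp: lepoll_def)
  then show ?thesis using e by (rule lepoll_trans2)
qed

text \<open>
  The product space of countably many copies of \<open>real\<close> is transported to \<open>'a\<close> along an injection.
\<close>

lemma independent_family_exists:
  fixes D :: "'i::countable \<Rightarrow> real measure" and G :: "('i \<Rightarrow> real) \<Rightarrow> bool"
  assumes D: "\<And>i. real_distribution (D i)"
    and type: "(UNIV :: real set) \<lesssim> (UNIV :: 'a set)"
    and G: "\<And>(N :: ('i \<Rightarrow> real) measure) X. prob_space N \<Longrightarrow> prob_space.indep_vars N (\<lambda>_. borel) X UNIV \<Longrightarrow>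
       (\<And>i. distr N borel (X i) = D i) \<Longrightarrow> AE \<omega> in N. G (\<lambda>i. X i \<omega>)"
  obtains M :: "'a measure" and R where "prob_space M" "prob_space.indep_vars M (\<lambda>_. borel) R UNIV"
    "\<And>i. distr M borel (R i) = D i" "\<And>\<omega>. \<omega> \<in> space M \<Longrightarrow> G (\<lambda>i. R i \<omega>)"
proof -
  interpret D: prob_space "D i" for i using D by (auto simp: real_distribution_def)
  have sD: "sets (D i) = sets borel" "space (D i) = UNIV" for i 
    using real_distribution.events_eq_borel[OF D] real_distribution.space_eq_univ[OF D] by auto
  interpret P: product_prob_space D UNIV ..
  let ?P = "PiM UNIV D"
  have sP: "sets ?P = sets (PiM UNIV (\<lambda>_. borel))" by (intro sets_PiM_cong) (auto simp: sD)
  have spP: "space ?P = UNIV" by (auto simp: space_PiM sD)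
  have m[measurable]: "(\<lambda>\<omega>. \<omega> i) \<in> borel_measurable ?P" for i
    using measurable_component_singleton[of i UNIV D] by (simp add: measurable_def sD)
  have compD: "distr ?P borel (\<lambda>\<omega>. \<omega> i) = D i" for i
    using P.PiM_component[of i] by (simp add: sD cong: distr_cong)
  have "P.P.indep_vars (\<lambda>_. borel) (\<lambda>i \<omega>. \<omega> i) UNIV"
  proof (subst P.P.indep_vars_iff_distr_eq_PiM')
    have "distr ?P (PiM UNIV (\<lambda>_. borel)) (\<lambda>x. \<lambda>i\<in>UNIV. x i) = distr ?P ?P (\<lambda>x. x)"
      by (intro distr_cong) (auto simp: sP)
    also have "\<dots> = ?P" by (rule distr_id)
    finally show "distr ?P (PiM UNIV (\<lambda>_. borel)) (\<lambda>x. \<lambda>i\<in>UNIV. x i) = PiM UNIV (\<lambda>i. distr ?P borel (\<lambda>\<omega>. \<omega> i))"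
      by (simp add: compD)
  qed auto
  then have "AE \<omega> in ?P. G \<omega>" using G[OF P.P.prob_space_axioms _ compD] by simp
  then obtain Z where Z: "{\<omega>\<in>space ?P. \<not> G \<omega>} \<subseteq> Z" "emeasure ?P Z = 0" "Z \<in> sets ?P" by (rule AE_E)
  \<comment> \<open>Discarding a measurable null set makes \<open>G\<close> true at every remaining
    point. The definitions of the classes demand path properties on the whole space and not just
    almost surely.\<close>
  let ?\<Omega> = "space ?P - Z"
  have \<Omega>: "?\<Omega> \<in> sets ?P" using Z by auto
  let ?R = "restrict_space ?P ?\<Omega>"
  have spR: "space ?R = ?\<Omega>" using \<Omega> by (simp add: space_restrict_space)
  have "(UNIV :: ('i \<Rightarrow> real) set) \<lesssim> (UNIV :: 'a set)"
    using countable_fun_lepoll_real type by (rule lepoll_trans)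
  then obtain \<iota> :: "('i \<Rightarrow> real) \<Rightarrow> 'a" where \<iota>: "inj \<iota>" by (auto simp: lepoll_def)
  define M where "M = embed_measure ?R \<iota>"
  define R where "R i a = inv \<iota> a i" for i a
  have spM: "space M = \<iota> ` ?\<Omega>" by (simp add: M_def space_embed_measure spR)
  have \<rho>[measurable]: "inv \<iota> \<in> measurable M ?P"
    unfolding M_def using \<iota> by (intro measurable_embed_measure1) (simp add: inv_f_f measurable_restrict_space1)
  have law: "distr M ?P (inv \<iota>) = ?P"
  proof -
    have "distr M ?P (inv \<iota>) = distr (distr ?R M \<iota>) ?P (inv \<iota>)"
    proof -
      have "M = distr ?R M \<iota>" unfolding M_def using \<iota> by (intro embed_measure_eq_distr) (rule inj_on_subset, auto)
      from arg_cong[OF this, of "\<lambda>X. distr X ?P (inv \<iota>)"] show ?thesis .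
    qed
    also have "\<dots> = distr ?R ?P (\<lambda>x. x)"
    proof -
      have "\<iota> \<in> measurable ?R M" unfolding M_def using \<iota> by (rule measurable_embed_measure2)
      from distr_distr[OF \<rho> this] show ?thesis using \<iota> by (simp only: comp_def inv_f_f)
    qed
    also have "\<dots> = ?P"
    proof (rule measure_eqI)
      fix A assume "A \<in> sets (distr ?R ?P (\<lambda>x. x))"
      then have A: "A \<in> sets ?P" by simp
      have "emeasure (distr ?R ?P (\<lambda>x. x)) A = emeasure ?R (A \<inter> ?\<Omega>)"
      proof -
        have "(\<lambda>x. x) \<in> measurable ?R ?P" by (rule measurable_restrict_space1) simp
        from emeasure_distr[OF this A] show ?thesis by (simp only: spR vimage_ident)
      qed
      also have "\<dots> = emeasure ?P (A - Z)"
      proof -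
        have "A \<inter> ?\<Omega> = A - Z" using sets.sets_into_space[OF A] by auto
        then show ?thesis using \<Omega> by (subst emeasure_restrict_space) auto
      qed
      also have "\<dots> = emeasure ?P A" using Z A by (intro emeasure_Diff_null_set) (auto simp: null_sets_def)
      finally show "emeasure (distr ?R ?P (\<lambda>x. x)) A = emeasure ?P A" .
    qed simp
    finally show ?thesis .
  qed
  have M: "prob_space M"
    using prob_space_distrD[OF \<rho>] law P.P.prob_space_axioms by simp
  then interpret M: prob_space M .
  have Rm[measurable]: "R i \<in> borel_measurable M" for i unfolding R_def by measurable
  have lawR: "distr M borel (R i) = D i" for i
  proof -
    have "distr M borel (R i) = distr (distr M ?P (inv \<iota>)) borel (\<lambda>\<omega>. \<omega> i)"
      by (subst distr_distr) (auto simp: comp_def R_def[abs_def])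
    then show ?thesis by (simp add: law compD)
  qed
  have "M.indep_vars (\<lambda>_. borel) R UNIV"
  proof (subst M.indep_vars_iff_distr_eq_PiM')
    have "distr M (PiM UNIV (\<lambda>_. borel)) (\<lambda>x. \<lambda>i\<in>UNIV. R i x) = distr M ?P (inv \<iota>)"
      by (intro distr_cong) (auto simp: sP R_def fun_eq_iff)
    then show "distr M (PiM UNIV (\<lambda>_. borel)) (\<lambda>x. \<lambda>i\<in>UNIV. R i x) = PiM UNIV (\<lambda>i. distr M borel (R i))"
      by (simp add: law lawR)
  qed auto
  moreover have "G (\<lambda>i. R i a)" if "a \<in> space M" for a
    using that Z \<iota> unfolding spM R_def by (auto simp: inv_f_f)
  ultimately show thesis using that[OF M _ lawR] by blast
qed

section \<open>The Levy-Ciesielski construction\<close>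

text \<open>For natural \<open>j\<close> and \<open>t \<ge> 0\<close>, \<open>clamp (t - j)\<close>
  is the length of the part of the interval from \<open>j\<close> to \<open>j + 1\<close> lying
  before \<open>t\<close>. It serves as integral of an indicator and as distribution function of a
  uniform variable.\<close>

definition clamp :: "real \<Rightarrow> real" where "clamp y = max 0 (min 1 y)"

lemma clamp_bounds: "0 \<le> clamp y" "clamp y \<le> 1" by (auto simp: clamp_def)

lemma clamp_eqs: "y \<le> 0 \<Longrightarrow> clamp y = 0" "1 \<le> y \<Longrightarrow> clamp y = 1" "0 \<le> y \<Longrightarrow> y \<le> 1 \<Longrightarrow> clamp y = y"
  by (auto simp: clamp_def)

lemma clamp_mono: "x \<le> y \<Longrightarrow> clamp x \<le> clamp y" by (auto simp: clamp_def)

lemma continuous_on_clamp[continuous_intros]: "continuous_on A f \<Longrightarrow> continuous_on A (\<lambda>x. clamp (f x))"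
  unfolding clamp_def by (intro continuous_intros)

text \<open>An interval is split into its halves; this is the step from one dyadic level to the
  next.\<close>

lemma clamp_double: "clamp y = (clamp (2 * y) + clamp (2 * y - 1)) / 2"
  by (auto simp: clamp_def max_def min_def)

lemma sum_clamp: "0 \<le> y \<Longrightarrow> (\<Sum>j<n. clamp (y - real j)) = min y (real n)"
  by (induction n) (auto simp: clamp_def max_def min_def)

text \<open>At most one summand is nonzero, namely that of the unit interval containing
  \<open>y\<close>. The telescoping bound expresses this without locating \<open>y\<close>.\<close>

lemma sum_clamp_compl: "(\<Sum>j<n. clamp (y - real j) * (1 - clamp (y - real j))) \<le> 1"
proof -
  have "(\<Sum>j<n. clamp (y - real j) * (1 - clamp (y - real j))) \<le> (\<Sum>j<n. clamp (y - real j) - clamp (y - real (Suc j)))"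
  proof (rule sum_mono)
    fix j
    show "clamp (y - real j) * (1 - clamp (y - real j)) \<le> clamp (y - real j) - clamp (y - real (Suc j))"
    proof (cases "y - real j \<ge> 1")
      case True
      then show ?thesis using clamp_bounds[of "y - real (Suc j)"] by (simp add: clamp_eqs)
    next
      case False
      then have "clamp (y - real (Suc j)) = 0" by (intro clamp_eqs) simp
      then show ?thesis using clamp_bounds[of "y - real j"] by (simp add: mult_left_le)
    qed
  qed
  also have "\<dots> = clamp (y - real 0) - clamp (y - real n)" by (rule sum_lessThan_telescope')
  also have "\<dots> \<le> 1" using clamp_bounds[of "y - real 0"] clamp_bounds[of "y - real n"] by linarith
  finally show ?thesis .
qed

lemma sum_double: "(\<Sum>j<2*n. f j) = (\<Sum>j<n. f (2*j) + f (2*j+1))" for f :: "nat \<Rightarrow> 'b::comm_monoid_add"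
  by (induction n) (auto simp: add.assoc)

text \<open>Integrated Haar functions; level \<open>Suc n\<close> consists of the tents over the dyadic intervals of length \<open>2 ^ n\<close>.\<close>

fun schauder :: "nat \<Rightarrow> nat \<Rightarrow> real \<Rightarrow> real" where
  "schauder 0 j t = clamp (t - real j)"
| "schauder (Suc n) j t = sqrt (1/2) ^ n * (clamp (2 ^ Suc n * t - real (2 * j)) - clamp (2 ^ Suc n * t - real (2 * j + 1))) / 2"

lemma schauder_zero: "2 ^ n * t \<le> real j \<Longrightarrow> 0 \<le> t \<Longrightarrow> schauder n j t = 0"
proof (cases n)
  case (Suc m)
  assume *: "2 ^ n * t \<le> real j"
  then have "clamp (2 ^ n * t - real (2 * j)) = 0" "clamp (2 ^ n * t - real (2 * j + 1)) = 0"
    by (auto intro!: clamp_eqs)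
  then show ?thesis using Suc by simp
qed (auto intro!: clamp_eqs)

lemma schauder_nonpos: "t \<le> 0 \<Longrightarrow> schauder n j t = 0"
proof -
  assume "t \<le> 0"
  then have "clamp (2 ^ m * t - real i) = 0" for m i by (intro clamp_eqs) (auto simp: mult_nonneg_nonpos intro: order.trans[of _ 0])
  from this[of 0] this[of n] show ?thesis by (cases n) (simp_all only: schauder.simps power_0 mult_1 diff_self mult_zero_right div_0)
qed

lemma schauder_nonneg: "0 \<le> schauder n j t"
  by (cases n) (auto simp: clamp_bounds intro!: mult_nonneg_nonneg clamp_mono)

lemma continuous_schauder: "continuous_on A (schauder n j)"
  by (cases n) (auto intro!: continuous_intros simp del: power_Suc)

lemma schauder_measurable[measurable]: "schauder n j \<in> borel_measurable borel"
  by (intro borel_measurable_continuous_onI continuous_schauder)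

text \<open>The tents of one level have disjoint supports, so their sum is bounded like a single
  tent; monotonicity of \<open>clamp\<close> turns this into a telescoping sum.\<close>

lemma sum_schauder_le: "(\<Sum>j<m. schauder (Suc n) j t) \<le> sqrt (1/2) ^ n"
proof -
  let ?c = "\<lambda>i. clamp (2 ^ Suc n * t - real i)"
  have "(\<Sum>j<m. ?c (2*j) - ?c (2*j+1)) \<le> (\<Sum>j<m. ?c (2*j) - ?c (2 * Suc j))"
    by (intro sum_mono diff_left_mono clamp_mono) auto
  also have "\<dots> = ?c (2*0) - ?c (2*m)" by (rule sum_lessThan_telescope')
  also have "\<dots> \<le> 1" using clamp_bounds[of "2 ^ Suc n * t - real (2*0)"] clamp_bounds[of "2 ^ Suc n * t - real (2*m)"] by linarith
  finally have "sqrt (1/2) ^ n * ((\<Sum>j<m. ?c (2*j) - ?c (2*j+1)) / 2) \<le> sqrt (1/2) ^ n * 1"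
    by (intro mult_left_mono) auto
  then show ?thesis by (simp add: sum_distrib_left sum_divide_distrib)
qed

lemma sum_schauder_extend:
  assumes "2 ^ n * t \<le> real m" "m \<le> k" "0 \<le> t"
  shows "(\<Sum>j<k. x j * schauder n j t) = (\<Sum>j<m. x j * schauder n j t)"
proof (rule sum.mono_neutral_right)
  show "\<forall>j\<in>{..<k} - {..<m}. x j * schauder n j t = 0"
    using assms by (auto intro!: schauder_zero)
qed (use assms in auto)

text \<open>Covariance at the times \<open>s\<close> and \<open>t\<close> of the random series with
  independent standard normal coefficients, cut after \<open>m\<close> levels. From level one on,
  the range of \<open>j\<close> is twice as long as the time interval up to \<open>N\<close>
  requires; the surplus tents vanish there.\<close>

definition schauder_cov :: "nat \<Rightarrow> nat \<Rightarrow> real \<Rightarrow> real \<Rightarrow> real" where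
  "schauder_cov m N s t = (\<Sum>n<m. \<Sum>j<2^n*N. schauder n j s * schauder n j t)"

text \<open>Parseval's identity for the Haar system: the first \<open>m + 1\<close> levels span the
  step functions on dyadic intervals of length \<open>2 ^ (-m)\<close>, and the right-hand side is
  the inner product of the projections of the indicators of \<open>{0..s}\<close> and
  \<open>{0..t}\<close> onto them.\<close>

lemma schauder_cov_eq:
  "schauder_cov (Suc m) N s t = (\<Sum>j<2^m*N. clamp (2^m * s - real j) * clamp (2^m * t - real j)) / 2^m"
  if st: "0 \<le> s" "s \<le> real N" "0 \<le> t" "t \<le> real N"
proof (induction m)
  case 0
  show ?case by (simp add: schauder_cov_def)
next
  case (Suc m)
  let ?c = "\<lambda>n s j. clamp (2^n * s - real j)"
  have half: "sqrt (1/2) ^ m * sqrt (1/2) ^ m = 1 / 2 ^ m"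
  proof -
    have "sqrt (1/2) * sqrt (1/2) = (1/2::real)" by simp
    then show ?thesis by (simp only: power_mult_distrib[symmetric] power_one_over)
  qed
  \<comment> \<open>Drops the surplus tents, whose supports lie beyond \<open>N\<close>, so that the
    index ranges of the two levels match.\<close>
  have lev: "(\<Sum>j<2^Suc m*N. schauder (Suc m) j s * schauder (Suc m) j t) = 
    (\<Sum>j<2^m*N. schauder (Suc m) j s * schauder (Suc m) j t)"
  proof (rule sum.mono_neutral_right)
    show "\<forall>j\<in>{..<2^Suc m*N} - {..<2^m*N}. schauder (Suc m) j s * schauder (Suc m) j t = 0"
    proof (intro ballI)
      fix j assume "j \<in> {..<2^Suc m*N} - {..<2^m*N}"
      then have "2 ^ m * N \<le> j" by (simp only: Diff_iff lessThan_iff not_less)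
      then have "real (2 ^ m * N) \<le> real j" by (simp only: of_nat_le_iff)
      moreover have "real (2 ^ m * N) = 2 ^ m * real N" by simp
      moreover have "2 ^ m * s \<le> 2 ^ m * real N" using st by (intro mult_left_mono) auto
      ultimately have "2 ^ m * s \<le> real j" by linarith
      then have "clamp (2 ^ Suc m * s - real (2 * j)) = 0" "clamp (2 ^ Suc m * s - real (2 * j + 1)) = 0"
        by (auto intro!: clamp_eqs)
      then show "schauder (Suc m) j s * schauder (Suc m) j t = 0" by simp
    qed
    have "2 ^ m * N \<le> 2 ^ Suc m * N" by (intro mult_right_mono power_increasing) auto
    then show "{..<2^m*N} \<subseteq> {..<2^Suc m*N}" by (simp only: lessThan_subset_iff)
  qed (rule finite_lessThan)
  have "schauder_cov (Suc (Suc m)) N s t = schauder_cov (Suc m) N s t + (\<Sum>j<2^m*N. schauder (Suc m) j s * schauder (Suc m) j t)"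
    unfolding lev[symmetric] by (simp add: schauder_cov_def del: schauder.simps power_Suc)
  also have "\<dots> = (\<Sum>j<2^m*N. ?c m s j * ?c m t j / 2^m + schauder (Suc m) j s * schauder (Suc m) j t)"
    by (simp only: Suc sum.distrib sum_divide_distrib)
  also have "\<dots> = (\<Sum>j<2^m*N. (?c (Suc m) s (2*j) * ?c (Suc m) t (2*j) + ?c (Suc m) s (2*j+1) * ?c (Suc m) t (2*j+1)) / 2^Suc m)"
  proof (rule sum.cong[OF refl])
    fix j
    have d: "?c m s j = (?c (Suc m) s (2*j) + ?c (Suc m) s (2*j+1)) / 2" for s
      using clamp_double[of "2^m * s - real j"] by (simp add: algebra_simps)
    define a a' b b' where "a = ?c (Suc m) s (2*j)" "a' = ?c (Suc m) s (2*j+1)" "b = ?c (Suc m) t (2*j)" "b' = ?c (Suc m) t (2*j+1)"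
    have "schauder (Suc m) j s * schauder (Suc m) j t = (sqrt (1/2) ^ m * sqrt (1/2) ^ m) * ((a - a') * (b - b')) / 4"
      unfolding schauder.simps a_a'_b_b'_def[symmetric] by (simp add: mult_ac)
    also have "\<dots> = (a - a') * (b - b') / 4 / 2^m" unfolding half by simp
    finally have e: "schauder (Suc m) j s * schauder (Suc m) j t = (a - a') * (b - b') / 4 / 2^m" .
    show "?c m s j * ?c m t j / 2^m + schauder (Suc m) j s * schauder (Suc m) j t = 
        (?c (Suc m) s (2*j) * ?c (Suc m) t (2*j) + ?c (Suc m) s (2*j+1) * ?c (Suc m) t (2*j+1)) / 2^Suc m"
      unfolding e d a_a'_b_b'_def[symmetric] by (simp add: field_simps)
  qed
  also have "\<dots> = (\<Sum>j<2*(2^m*N). ?c (Suc m) s j * ?c (Suc m) t j) / 2^Suc m"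
    by (simp only: sum_double sum_divide_distrib)
  finally show ?case by (simp add: mult.assoc)
qed

text \<open>For \<open>s \<le> t\<close> the defect, multiplied by \<open>2^m\<close>, is the sum of
  \<open>a * (1 - b)\<close> with \<open>a \<le> b\<close>. It is at most the sum of
  \<open>a * (1 - a)\<close>, to which only the dyadic interval containing \<open>s\<close>
  contributes.\<close>

lemma schauder_cov_bound:
  assumes st: "0 \<le> s" "s \<le> real N" "0 \<le> t" "t \<le> real N"
  shows "\<bar>schauder_cov (Suc m) N s t - min s t\<bar> \<le> (1/2)^m"
proof -
  have main: "\<bar>schauder_cov (Suc m) N s t - s\<bar> \<le> (1/2)^m" if "s \<le> t" and st: "0 \<le> s" "s \<le> real N" "0 \<le> t" "t \<le> real N" for s t
  proof -
    let ?a = "\<lambda>j. clamp (2^m * s - real j)" and ?b = "\<lambda>j. clamp (2^m * t - real j)"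
    let ?n = "2^m*N"
    have sa: "(\<Sum>j<?n. ?a j) = 2^m * s" using st by (subst sum_clamp) (auto simp: min_def)
    have "(\<Sum>j<?n. ?a j * (1 - ?b j)) \<le> (\<Sum>j<?n. ?a j * (1 - ?a j))"
      using \<open>s \<le> t\<close> by (intro sum_mono mult_left_mono diff_left_mono clamp_mono) (auto simp: clamp_bounds)
    also have "\<dots> \<le> 1" by (rule sum_clamp_compl)
    finally have "(\<Sum>j<?n. ?a j * (1 - ?b j)) \<le> 1" .
    moreover have "0 \<le> (\<Sum>j<?n. ?a j * (1 - ?b j))" by (intro sum_nonneg mult_nonneg_nonneg) (auto simp: clamp_bounds)
    moreover have "(\<Sum>j<?n. ?a j * (1 - ?b j)) = 2^m * s - (\<Sum>j<?n. ?a j * ?b j)"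
      by (simp add: right_diff_distrib sum_subtractf sa)
    moreover have "(\<Sum>j<?n. ?a j * ?b j) = 2^m * schauder_cov (Suc m) N s t"
      using schauder_cov_eq[OF st, of m] by simp
    ultimately have "\<bar>2^m * (schauder_cov (Suc m) N s t - s)\<bar> \<le> 1" by (simp add: right_diff_distrib)
    then have "2^m * \<bar>schauder_cov (Suc m) N s t - s\<bar> \<le> 1" by (simp only: abs_mult power_abs abs_numeral)
    then show ?thesis by (simp add: field_simps power_one_over)
  qed
  show ?thesis
  proof (cases "s \<le> t")
    case True then show ?thesis using main[OF True st] by (simp add: min_def)
  next
    case False
    then have "t \<le> s" by simp
    moreover have "schauder_cov (Suc m) N s t = schauder_cov (Suc m) N t s" by (simp add: schauder_cov_def mult.commute)
    ultimately show ?thesis using main[of t s] st by (simp add: min.absorb2)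
  qed
qed

lemma schauder_cov_tendsto:
  assumes "0 \<le> s" "s \<le> real N" "0 \<le> t" "t \<le> real N"
  shows "(\<lambda>m. schauder_cov m N s t) \<longlonglongrightarrow> min s t"
proof -
  have "(\<lambda>m. schauder_cov (Suc m) N s t - min s t) \<longlonglongrightarrow> 0"
    by (rule tendsto_rabs_zero_cancel, rule tendsto_sandwich[OF _ _ tendsto_const LIMSEQ_power_zero[of "1/2::real"]])
      (use schauder_cov_bound[OF assms] in auto)
  then have "(\<lambda>m. schauder_cov (Suc m) N s t) \<longlonglongrightarrow> min s t" by (simp add: LIM_zero_iff)
  then show ?thesis by (rule LIMSEQ_imp_Suc)
qed

definition bm_level :: "(nat \<Rightarrow> nat \<Rightarrow> real) \<Rightarrow> real \<Rightarrow> nat \<Rightarrow> real" where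
  "bm_level x t n = (\<Sum>j<2^n * nat \<lceil>t\<rceil>. x n j * schauder n j t)"

definition bm :: "(nat \<Rightarrow> nat \<Rightarrow> real) \<Rightarrow> real \<Rightarrow> real" where
  "bm x t = (\<Sum>n. bm_level x t n)"

text \<open>Coefficients may grow like \<open>2 powr (n / 4)\<close>, which the decay
  \<open>2 powr (- n / 2)\<close> of the tents overcomes. The eighth power makes this an almost sure
  property by a first-moment argument: a level has of order \<open>2^n\<close> terms, and the
  weights \<open>4 ^ (-n)\<close> make the sum of their expectations converge.\<close>

definition bm_good :: "(nat \<Rightarrow> nat \<Rightarrow> real) \<Rightarrow> bool" where
  "bm_good x \<longleftrightarrow> (\<forall>N. \<exists>C. \<forall>n. \<forall>j<2^Suc n*N. x (Suc n) j ^ 8 \<le> C * 4 ^ n)"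

lemma bm_level_eq:
  assumes "t \<le> real N"
  shows "bm_level x t n = (\<Sum>j<2^n * N. x n j * schauder n j t)"
proof (cases "t \<le> 0")
  case True
  then show ?thesis by (simp add: bm_level_def schauder_nonpos)
next
  case False
  show ?thesis unfolding bm_level_def
  proof (rule sum_schauder_extend[symmetric])
    show "2 ^ n * t \<le> real (2 ^ n * nat \<lceil>t\<rceil>)" using False by simp
    show "2 ^ n * nat \<lceil>t\<rceil> \<le> 2 ^ n * N" using assms by (simp add: ceiling_le_iff nat_le_iff)
  qed (use False in auto)
qed

lemma bm_level_bound:
  assumes "bm_good x"
  shows "\<exists>C r. 0 \<le> r \<and> r < 1 \<and> (\<forall>n t. t \<le> real N \<longrightarrow> \<bar>bm_level x t (Suc n)\<bar> \<le> C * r ^ n)"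
proof -
  from assms obtain C where C: "\<And>n j. j < 2^Suc n*N \<Longrightarrow> x (Suc n) j ^ 8 \<le> C * 4 ^ n" unfolding bm_good_def by blast
  define D where "D = max 1 C"
  have D: "D \<ge> 1" "D \<ge> C" by (auto simp: D_def)
  \<comment> \<open>The eighth power of the tent height contributes \<open>(1/16)^n\<close> and the
    coefficient \<open>4^n\<close>; the ratio \<open>r\<close> is the eighth root of their
    product.\<close>
  define r where "r = root 8 (1/4)"
  have r: "0 \<le> r" "r < 1" by (auto simp: r_def)
  have r8: "r ^ 8 = 1/4" by (simp add: r_def)
  have b: "\<bar>x (Suc n) j\<bar> * sqrt (1/2) ^ n \<le> D * r ^ n" if "j < 2^Suc n*N" for n j
  proof -
    have s8: "(sqrt (1/2))^8 = 1/16"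
    proof -
      have "(sqrt (1/2))^8 = ((sqrt (1/2))^2)^4" by (simp only: power_mult[symmetric]) simp
      then show ?thesis by (simp add: power_divide)
    qed
    have "(\<bar>x (Suc n) j\<bar> * sqrt (1/2) ^ n) ^ 8 = \<bar>x (Suc n) j\<bar> ^ 8 * (sqrt (1/2) ^ 8) ^ n"
      by (simp add: power_mult_distrib power_mult[symmetric] mult.commute)
    also have "\<bar>x (Suc n) j\<bar> ^ 8 = x (Suc n) j ^ 8" by (rule power_even_abs) simp
    also have "x (Suc n) j ^ 8 * (sqrt (1/2) ^ 8) ^ n \<le> (D * 4 ^ n) * (1/16) ^ n"
      unfolding s8 using C[OF that] D by (intro mult_right_mono order.trans[OF C[OF that]]) auto
    also have "\<dots> = D * (1/4) ^ n"
      by (simp add: power_mult_distrib[symmetric] mult.assoc)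
    also have "\<dots> \<le> D ^ 8 * (r ^ 8) ^ n" unfolding r8
      using D by (intro mult_right_mono) (auto intro: self_le_power)
    also have "\<dots> = (D * r ^ n) ^ 8" by (simp add: power_mult_distrib power_mult[symmetric] mult.commute)
    finally show ?thesis by (rule power_le_imp_le_base[of _ 7, simplified]) (use D r in auto)
  qed
  have "\<bar>bm_level x t (Suc n)\<bar> \<le> D * r ^ n" if t: "t \<le> real N" for n t
  proof -
    let ?K = "D * r ^ n / sqrt (1/2) ^ n"
    have K: "\<bar>x (Suc n) j\<bar> \<le> ?K" if "j < 2^Suc n*N" for j using b[OF that] by (simp add: pos_le_divide_eq)
    have K0: "0 \<le> ?K" using D r by simp
    have "\<bar>bm_level x t (Suc n)\<bar> \<le> (\<Sum>j<2^Suc n * N. \<bar>x (Suc n) j * schauder (Suc n) j t\<bar>)"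
      unfolding bm_level_eq[OF t] by (rule sum_abs)
    also have "\<dots> \<le> (\<Sum>j<2^Suc n * N. ?K * schauder (Suc n) j t)"
    proof (rule sum_mono)
      fix j assume "j \<in> {..<2^Suc n * N}"
      then have "\<bar>x (Suc n) j\<bar> \<le> ?K" using K by simp
      then show "\<bar>x (Suc n) j * schauder (Suc n) j t\<bar> \<le> ?K * schauder (Suc n) j t"
        using schauder_nonneg[of "Suc n" j t] by (simp only: abs_mult abs_of_nonneg mult_right_mono)
    qed
    also have "\<dots> = ?K * (\<Sum>j<2^Suc n * N. schauder (Suc n) j t)" by (rule sum_distrib_left[symmetric])
    also have "\<dots> \<le> ?K * sqrt (1/2) ^ n" using K0 by (intro mult_left_mono sum_schauder_le)
    also have "\<dots> = D * r ^ n" by simp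
    finally show ?thesis .
  qed
  then show ?thesis using r by blast
qed

lemma bm_summable:
  assumes "bm_good x"
  shows "summable (bm_level x t)"
proof -
  obtain C r where *: "0 \<le> r" "r < 1" "\<And>n s. s \<le> real (nat \<lceil>t\<rceil>) \<Longrightarrow> \<bar>bm_level x s (Suc n)\<bar> \<le> C * r ^ n"
    using bm_level_bound[OF assms, of "nat \<lceil>t\<rceil>"] by blast
  have t: "t \<le> real (nat \<lceil>t\<rceil>)" by linarith
  have g: "summable (\<lambda>n. C * r ^ n)" using * by (intro summable_mult summable_geometric) simp
  have "norm (bm_level x t (Suc n)) \<le> C * r ^ n" for n using *(3)[OF t] by simp
  then have "summable (\<lambda>n. bm_level x t (Suc n))"
    by (intro summable_comparison_test'[OF g]) 
  then show ?thesis by (simp add: summable_Suc_iff)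
qed

lemma bm_nonpos: "t \<le> 0 \<Longrightarrow> bm x t = 0"
  by (simp add: bm_def bm_level_def)

text \<open>Uniform convergence by the Weierstrass test on every half-line
  \<open>{..real N}\<close>. Level zero is split off because the growth condition constrains the
  levels from one onwards.\<close>

lemma continuous_on_bm:
  assumes "bm_good x"
  shows "continuous_on UNIV (bm x)"
proof -
  have "continuous_on {..real N} (bm x)" for N
  proof -
    obtain C r where *: "0 \<le> r" "r < 1" "\<And>n t. t \<le> real N \<Longrightarrow> \<bar>bm_level x t (Suc n)\<bar> \<le> C * r ^ n"
      using bm_level_bound[OF assms, of N] by blast
    have lc: "continuous_on {..real N} (\<lambda>t. bm_level x t n)" for n
    proof -
      have "continuous_on {..real N} (\<lambda>t. \<Sum>j<2^n * N. x n j * schauder n j t)"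
        by (intro continuous_intros continuous_schauder)
      then show ?thesis by (rule continuous_on_eq) (simp add: bm_level_eq)
    qed
    have "uniform_limit {..real N} (\<lambda>m t. \<Sum>n<m. bm_level x t (Suc n)) (\<lambda>t. \<Sum>n. bm_level x t (Suc n)) sequentially"
    proof (rule Weierstrass_m_test)
      show "summable (\<lambda>n. C * r ^ n)" using * by (intro summable_mult summable_geometric) simp
    qed (use *(3) in auto)
    then have "continuous_on {..real N} (\<lambda>t. \<Sum>n. bm_level x t (Suc n))"
    proof (rule uniform_limit_theorem[rotated])
      show "\<forall>\<^sub>F m in sequentially. continuous_on {..real N} (\<lambda>t. \<Sum>n<m. bm_level x t (Suc n))"
        by (intro always_eventually allI continuous_on_sum lc)
    qed simp
    then have "continuous_on {..real N} (\<lambda>t. bm_level x t 0 + (\<Sum>n. bm_level x t (Suc n)))"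
      by (intro continuous_on_add lc)
    then show ?thesis
      by (rule continuous_on_eq) (simp add: bm_def suminf_split_head[OF bm_summable[OF assms]])
  qed
  then have "continuous_on {..<real N} (bm x)" for N by (rule continuous_on_subset[of "{..real N}"]) auto
  then have "continuous_on (\<Union>N. {..<real N}) (bm x)" by (intro continuous_on_open_UN) auto
  moreover have "(\<Union>N. {..<real N}) = (UNIV :: real set)" using reals_Archimedean2 by auto
  ultimately show ?thesis by simp
qed

section \<open>The driving noise\<close>

text \<open>Admits rate zero, where no jumps occur. Brownian motion is thereby the case
  \<open>lam = 0\<close> of the same construction.\<close>

definition poisson0 :: "real \<Rightarrow> nat pmf" where
  "poisson0 r = (if 0 < r then poisson_pmf r else return_pmf 0)"

lemma pmf_poisson0: "0 \<le> r \<Longrightarrow> pmf (poisson0 r) k = r ^ k / fact k * exp (- r)"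
  by (cases "r = 0") (auto simp: poisson0_def power_0_left)

text \<open>
  All randomness of a Levy process is coded by one independent family indexed by triples:
  \<open>(0, n, j)\<close> are the normal coefficients of the Brownian motion, \<open>(1, k, 0)\<close> is the number of jumps
  in the time interval from \<open>k\<close> to \<open>k + 1\<close>, and \<open>(2, k, i)\<close>, \<open>(3, k, i)\<close> are the time and the size
  of the \<open>i\<close>-th of them.
\<close>

definition noise_law :: "real \<Rightarrow> real measure \<Rightarrow> nat \<times> nat \<times> nat \<Rightarrow> real measure" where
  "noise_law lam \<mu> = (\<lambda>(a, k, i). if a = 0 then std_normal_distribution
     else if a = 1 then distr (measure_pmf (poisson0 lam)) borel real
     else if a = 2 then uniform_measure lborel {real k .. real k + 1}
     else \<mu>)"

text \<open>What the path arguments need at every sample point: a convergent Brownian series, jump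
  times strictly inside their unit intervals and pairwise distinct, and nonzero jump sizes. Marks
  then correspond exactly to the jumps of the path.\<close>

definition noise_good :: "(nat \<times> nat \<times> nat \<Rightarrow> real) \<Rightarrow> bool" where
  "noise_good x \<longleftrightarrow> bm_good (\<lambda>n j. x (0, n, j)) \<and>
     (\<forall>k i. x (2, k, i) \<in> {real k <..< real k + 1}) \<and>
     (\<forall>k i j. i \<noteq> j \<longrightarrow> x (2, k, i) \<noteq> x (2, k, j)) \<and>
     (\<forall>k i. x (3, k, i) \<noteq> 0)"

lemma noise_law_distribution:
  assumes "real_distribution \<mu>"
  shows "real_distribution (noise_law lam \<mu> p)"
proof -
  obtain a k i where p: "p = (a,k,i)" by (cases p)
  have 1: "real_distribution (distr (measure_pmf (poisson0 lam)) borel real)"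
    by (rule prob_space.real_distribution_distr) (auto intro: measure_pmf.prob_space_axioms)
  have 2: "real_distribution (uniform_measure lborel {real k .. real k + 1})"
    by (intro real_distribution.intro prob_space_uniform_measure real_distribution_axioms.intro) auto
  show ?thesis using assms 1 2 real_dist_normal_dist by (auto simp: p noise_law_def)
qed

lemma std_normal_moment8: "integrable std_normal_distribution (\<lambda>x. x ^ 8)"
  by (rule integrable_std_normal_distribution_moment)

section \<open>Almost sure regularity of the noise\<close>

text \<open>The weighted sum \<open>S\<close> of all eighth powers has finite expectation. Where it
  is finite, its value bounds every single term.\<close>

lemma bm_good_AE:
  fixes X :: "nat \<Rightarrow> nat \<Rightarrow> 'a \<Rightarrow> real"
  assumes M: "prob_space M" and [measurable]: "\<And>n j. X n j \<in> borel_measurable M"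
    and D: "\<And>n j. distr M borel (X n j) = std_normal_distribution"
  shows "AE \<omega> in M. bm_good (\<lambda>n j. X n j \<omega>)"
proof -
  interpret prob_space M by fact
  define c where "c = (\<integral>\<^sup>+x. ennreal (x ^ 8) \<partial>std_normal_distribution)"
  have cfin: "c < \<infinity>"
    using std_normal_moment8 unfolding c_def by (simp add: integrable_iff_bounded)
  have m8: "(\<integral>\<^sup>+\<omega>. ennreal (X n j \<omega> ^ 8) \<partial>M) = c" for n j
    unfolding c_def D[of n j, symmetric] by (subst nn_integral_distr) auto
  have "AE \<omega> in M. \<exists>C. \<forall>n. \<forall>j<2^Suc n*N. X (Suc n) j \<omega> ^ 8 \<le> C * 4 ^ n" for N
  proof -
    define S where "S \<omega> = (\<Sum>n. \<Sum>j<2^Suc n*N. ennreal (X (Suc n) j \<omega> ^ 8) * ennreal ((1/4)^n))" for \<omega>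
    have [measurable]: "S \<in> borel_measurable M" unfolding S_def by measurable
    have "(\<integral>\<^sup>+\<omega>. S \<omega> \<partial>M) = (\<Sum>n. \<Sum>j<2^Suc n*N. c * ennreal ((1/4)^n))"
      unfolding S_def by (subst nn_integral_suminf, measurable, subst nn_integral_sum, measurable) (simp add: nn_integral_multc m8)
    also have "\<dots> = (\<Sum>n. (c * ennreal (2 * real N)) * ennreal ((1/2)^n))"
    proof (rule arg_cong[where f=suminf], rule ext)
      fix n
      have "(\<Sum>j<2^Suc n*N. c * ennreal ((1/4)^n)) = of_nat (2^Suc n*N) * (c * ennreal ((1/4)^n))" by simp
      also have "\<dots> = c * (ennreal (real (2^Suc n*N)) * ennreal ((1/4)^n))" 
        by (simp only: ennreal_of_nat_eq_real_of_nat mult_ac)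
      also have "ennreal (real (2^Suc n*N)) * ennreal ((1/4)^n) = ennreal (2 * real N * (1/2)^n)"
      proof -
        have "(2::real)^n * (1/4)^n = (1/2)^n" by (simp only: power_mult_distrib[symmetric]) simp
        then have "real (2^Suc n*N) * (1/4)^n = 2 * real N * (1/2)^n" by simp
        then show ?thesis by (subst ennreal_mult'[symmetric]) auto
      qed
      also have "\<dots> = ennreal (2 * real N) * ennreal ((1/2)^n)" by (simp add: ennreal_mult')
      finally show "(\<Sum>j<2^Suc n*N. c * ennreal ((1/4)^n)) = (c * ennreal (2 * real N)) * ennreal ((1/2)^n)"
        by (simp only: mult.assoc)
    qed
    also have "\<dots> = (c * ennreal (2 * real N)) * (\<Sum>n. ennreal ((1/2)^n))" by simp
    also have "(\<Sum>n. ennreal ((1/2)^n)) = ennreal 2"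
      by (subst suminf_ennreal2) (auto simp: suminf_geometric)
    finally have "(\<integral>\<^sup>+\<omega>. S \<omega> \<partial>M) < \<infinity>" using cfin by (simp add: ennreal_mult_less_top less_top)
    then have "AE \<omega> in M. S \<omega> \<noteq> \<infinity>" by (intro nn_integral_PInf_AE) auto
    then show ?thesis
    proof eventually_elim
      fix \<omega> assume fin: "S \<omega> \<noteq> \<infinity>"
      show "\<exists>C. \<forall>n. \<forall>j<2^Suc n*N. X (Suc n) j \<omega> ^ 8 \<le> C * 4 ^ n"
      proof (intro exI allI impI)
        fix n j assume j: "j < 2^Suc n*N"
        have "ennreal (X (Suc n) j \<omega> ^ 8 * (1/4)^n) = ennreal (X (Suc n) j \<omega> ^ 8) * ennreal ((1/4)^n)"
          by (simp add: ennreal_mult')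
        also have "\<dots> \<le> (\<Sum>j<2^Suc n*N. ennreal (X (Suc n) j \<omega> ^ 8) * ennreal ((1/4)^n))"
          using j by (intro member_le_sum) auto
        also have "\<dots> \<le> S \<omega>" unfolding S_def
          using sum_le_suminf[of "\<lambda>n. \<Sum>j<2^Suc n*N. ennreal (X (Suc n) j \<omega> ^ 8) * ennreal ((1/4)^n)" "{n}"] by simp
        also have "S \<omega> = ennreal (enn2real (S \<omega>))" using fin by (simp add: less_top)
        finally have "X (Suc n) j \<omega> ^ 8 * (1/4)^n \<le> enn2real (S \<omega>)" by (subst (asm) ennreal_le_iff) auto
        then show "X (Suc n) j \<omega> ^ 8 \<le> enn2real (S \<omega>) * 4 ^ n" by (simp add: power_one_over field_simps)
      qed
    qed
  qed
  then show ?thesis unfolding bm_good_def by (subst AE_all_countable) auto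
qed

lemma noise_good_AE:
  fixes X :: "nat \<times> nat \<times> nat \<Rightarrow> 'a \<Rightarrow> real"
  assumes M: "prob_space M" and ind: "prob_space.indep_vars M (\<lambda>_. borel) X UNIV"
    and D: "\<And>p. distr M borel (X p) = noise_law lam \<mu> p"
    and \<mu>: "real_distribution \<mu>" "emeasure \<mu> {0} = 0"
  shows "AE \<omega> in M. noise_good (\<lambda>p. X p \<omega>)"
proof -
  interpret prob_space M by fact
  interpret mu: real_distribution \<mu> by fact
  have [measurable]: "X p \<in> borel_measurable M" for p using ind unfolding indep_vars_def by blast
  have 1: "AE \<omega> in M. bm_good (\<lambda>n j. X (0,n,j) \<omega>)"
    by (rule bm_good_AE[OF M]) (auto simp: D noise_law_def)
  have law: "AE \<omega> in M. P (X p \<omega>)" if "AE x in noise_law lam \<mu> p. P x" "Measurable.pred borel P" for P p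
  proof -
    have "AE x in distr M borel (X p). P x" unfolding D by (rule that(1))
    then show ?thesis using that(2) by (subst (asm) AE_distr_iff) auto
  qed
  have nU: "noise_law lam \<mu> (2,k,i) = uniform_measure lborel {real k .. real k + 1}" for k i by (simp add: noise_law_def)
  have 2: "AE \<omega> in M. X (2,k,i) \<omega> \<in> {real k <..< real k + 1}" for k i
  proof (rule law)
    have "AE x in uniform_measure lborel {real k .. real k + 1}. x \<in> {real k .. real k + 1} \<and> x \<noteq> real k \<and> x \<noteq> real k + 1"
      by (rule AE_uniform_measureI) 
       (use AE_lborel_singleton[of "real k"] AE_lborel_singleton[of "real k + 1"] in \<open>auto elim: eventually_elim2\<close>)
    then show "AE x in noise_law lam \<mu> (2,k,i). x \<in> {real k <..< real k + 1}"
      unfolding nU by eventually_elim auto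
  qed measurable
  have 4: "AE \<omega> in M. X (3,k,i) \<omega> \<noteq> 0" for k i
  proof (rule law)
    have "noise_law lam \<mu> (3,k,i) = \<mu>" by (simp add: noise_law_def)
    moreover have "AE x in \<mu>. x \<noteq> 0" using \<mu>(2) by (intro AE_I[of _ _ "{0}"]) auto
    ultimately show "AE x in noise_law lam \<mu> (3,k,i). x \<noteq> 0" by (simp only:)
  qed measurable
  \<comment> \<open>Two independent variables with a law free of atoms coincide with probability
    zero.\<close>
  have 3: "AE \<omega> in M. X (2,k,i) \<omega> \<noteq> X (2,k,j) \<omega>" if "i \<noteq> j" for k i j
  proof -
    let ?u = "uniform_measure lborel {real k .. real k + 1}"
    interpret u: real_distribution ?u using noise_law_distribution[OF \<mu>(1), of lam "(2,k,0)"] by (simp add: nU)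
    interpret P: pair_sigma_finite ?u ?u ..
    have iv: "indep_var borel (X (2,k,i)) borel (X (2,k,j))"
    proof -
      have "indep_var (PiM {(2,k,i)} (\<lambda>_. borel)) (\<lambda>\<omega>. restrict (\<lambda>p. X p \<omega>) {(2,k,i)})
         (PiM {(2,k,j)} (\<lambda>_. borel)) (\<lambda>\<omega>. restrict (\<lambda>p. X p \<omega>) {(2,k,j)})"
        using that by (intro indep_var_restrict[OF ind]) auto
      from indep_var_compose[OF this, of "\<lambda>x. x (2,k,i)" borel "\<lambda>x. x (2,k,j)" borel] 
      show ?thesis by (simp add: comp_def)
    qed
    have "distr M (borel \<Otimes>\<^sub>M borel) (\<lambda>\<omega>. (X (2,k,i) \<omega>, X (2,k,j) \<omega>)) = ?u \<Otimes>\<^sub>M ?u"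
      using indep_var_distribution_eq[THEN iffD1, OF iv] by (simp add: D nU)
    moreover have "AE p in ?u \<Otimes>\<^sub>M ?u. fst p \<noteq> snd p"
    proof -
      have "AE y in ?u. x \<noteq> y" for x
        by (rule AE_uniform_measureI) (use AE_lborel_singleton[of x] in \<open>auto elim: eventually_mono\<close>)
      moreover have "{p\<in>space (?u \<Otimes>\<^sub>M ?u). fst p \<noteq> snd p} \<in> sets (?u \<Otimes>\<^sub>M ?u)"
      proof -
        have "{p\<in>space (borel \<Otimes>\<^sub>M borel :: (real \<times> real) measure). fst p \<noteq> snd p} \<in> sets (borel \<Otimes>\<^sub>M borel)" by measurable
        moreover have "sets (?u \<Otimes>\<^sub>M ?u) = sets (borel \<Otimes>\<^sub>M borel)" by (intro sets_pair_measure_cong) auto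
        ultimately show ?thesis by (simp only: space_pair_measure space_uniform_measure space_lborel space_borel)
      qed
      ultimately show ?thesis by (intro P.AE_pair_measure) auto
    qed
    ultimately have "AE p in distr M (borel \<Otimes>\<^sub>M borel) (\<lambda>\<omega>. (X (2,k,i) \<omega>, X (2,k,j) \<omega>)). fst p \<noteq> snd p" by (simp only:)
    then show ?thesis by (subst (asm) AE_distr_iff) auto
  qed
  have "AE \<omega> in M. \<forall>k i. X (2,k,i) \<omega> \<in> {real k <..< real k + 1}" unfolding AE_all_countable using 2 by blast
  moreover have "AE \<omega> in M. \<forall>k i j. i \<noteq> j \<longrightarrow> X (2,k,i) \<omega> \<noteq> X (2,k,j) \<omega>" 
    unfolding AE_all_countable using 3 by (auto intro: AE_impI)
  moreover have "AE \<omega> in M. \<forall>k i. X (3,k,i) \<omega> \<noteq> 0" unfolding AE_all_countable using 4 by blast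
  ultimately show ?thesis using 1 unfolding noise_good_def by eventually_elim blast
qed

section \<open>Counts, marks and Brownian path read off the noise\<close>

text \<open>The sample space stays abstract: the independent family, its laws and
  \<open>noise_good\<close> at every point are all that is assumed of it.\<close>

locale noise = prob_space M + mu: real_distribution \<mu> for M :: "'a measure" and \<mu> :: "real measure" +
  fixes R :: "nat \<times> nat \<times> nat \<Rightarrow> 'a \<Rightarrow> real" and lam :: real
  assumes lam: "0 \<le> lam"
    and indep: "indep_vars (\<lambda>_. borel) R UNIV"
    and law: "\<And>p. distr M borel (R p) = noise_law lam \<mu> p"
    and good: "\<And>\<omega>. \<omega> \<in> space M \<Longrightarrow> noise_good (\<lambda>p. R p \<omega>)"

lemmas (in noise) mu = mu.real_distribution_axioms

text \<open>The coordinate is real-valued and integral only almost surely; the floor turns it into a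
  count at every sample point.\<close>

definition (in noise) K :: "nat \<Rightarrow> 'a \<Rightarrow> nat" where "K k \<omega> = nat \<lfloor>R (1, k, 0) \<omega>\<rfloor>"
definition (in noise) U :: "nat \<Rightarrow> nat \<Rightarrow> 'a \<Rightarrow> real" where "U k i = R (2, k, i)"
definition (in noise) J :: "nat \<Rightarrow> nat \<Rightarrow> 'a \<Rightarrow> real" where "J k i = R (3, k, i)"
definition (in noise) B :: "real \<Rightarrow> 'a \<Rightarrow> real" where "B t \<omega> = bm (\<lambda>n j. R (0, n, j) \<omega>) t"
text \<open>The integral of \<open>f\<close>, a function of time and size, against the point process
  of jumps in the first \<open>N\<close> unit intervals. The type of values is general because real
  and extended nonnegative sums both occur.\<close>

definition (in noise) PI :: "nat \<Rightarrow> (real \<times> real \<Rightarrow> 'b) \<Rightarrow> 'a \<Rightarrow> 'b::comm_monoid_add" where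
  "PI N f \<omega> = (\<Sum>k<N. \<Sum>i<K k \<omega>. f (U k i \<omega>, J k i \<omega>))"

lemma (in noise) R_measurable[measurable]: "R p \<in> borel_measurable M"
  using indep unfolding indep_vars_def by blast

lemma (in noise) K_measurable[measurable]: "K k \<in> measurable M (count_space UNIV)"
  unfolding K_def by measurable

lemma (in noise) U_measurable[measurable]: "U k i \<in> borel_measurable M"
  and J_measurable[measurable]: "J k i \<in> borel_measurable M"
  by (simp_all add: U_def J_def)

lemma (in noise) B_measurable[measurable]: "B t \<in> borel_measurable M"
  unfolding B_def bm_def bm_level_def by measurable

lemma (in noise) PI_measurable[measurable]:
  fixes f :: "real \<times> real \<Rightarrow> 'b::{second_countable_topology, topological_comm_monoid_add}"
  assumes [measurable]: "f \<in> borel_measurable (borel \<Otimes>\<^sub>M borel)"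
  shows "PI N f \<in> borel_measurable M"
proof -
  have "(\<lambda>\<omega>. \<Sum>i<K k \<omega>. f (U k i \<omega>, J k i \<omega>)) \<in> borel_measurable M" for k
    by (rule measurable_compose_countable[where f="\<lambda>n \<omega>. \<Sum>i<n. f (U k i \<omega>, J k i \<omega>)", OF _ K_measurable]) measurable
  then show ?thesis unfolding PI_def by measurable
qed

lemma (in noise) U_bounds: "\<omega> \<in> space M \<Longrightarrow> real k < U k i \<omega>" "\<omega> \<in> space M \<Longrightarrow> U k i \<omega> < real k + 1"
  using good unfolding noise_good_def U_def by auto

lemma (in noise) J_nz: "\<omega> \<in> space M \<Longrightarrow> J k i \<omega> \<noteq> 0"
  using good unfolding noise_good_def J_def by auto

lemma (in noise) U_inj:
  assumes "\<omega> \<in> space M" "U k i \<omega> = U l j \<omega>"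
  shows "k = l" "i = j"
proof -
  show kl: "k = l" using U_bounds[OF assms(1), of k i] U_bounds[OF assms(1), of l j] assms(2) by linarith
  show "i = j" using good[OF assms(1)] assms(2) unfolding kl noise_good_def U_def by blast
qed

lemma (in noise) PI_extend:
  assumes "\<omega> \<in> space M" and "N \<le> N'" and "\<And>u x. real N < u \<Longrightarrow> f (u, x) = 0"
  shows "PI N' f \<omega> = PI N f \<omega>"
  unfolding PI_def
proof (rule sum.mono_neutral_right)
  show "\<forall>k\<in>{..<N'} - {..<N}. (\<Sum>i<K k \<omega>. f (U k i \<omega>, J k i \<omega>)) = 0"
  proof
    fix k assume "k \<in> {..<N'} - {..<N}"
    then have "real N \<le> real k" by auto
    then have "real N < U k i \<omega>" for i using U_bounds(1)[OF assms(1), of k i] by linarith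
    then show "(\<Sum>i<K k \<omega>. f (U k i \<omega>, J k i \<omega>)) = 0" using assms(3) by simp
  qed
qed (use assms in auto)

text \<open>Functions of disjoint groups of coordinates are independent; the various factorisations
  below differ only in the choice of the groups.\<close>

lemma (in noise) group_indep:
  assumes "disjoint_family_on G L" "\<And>l. l \<in> L \<Longrightarrow> Y l \<in> measurable (PiM (G l) (\<lambda>_. borel)) (N l)"
  shows "indep_vars N (\<lambda>l \<omega>. Y l (restrict (\<lambda>p. R p \<omega>) (G l))) L"
  by (rule indep_vars_compose2[OF indep_vars_restrict[OF indep]]) (use assms in auto)

lemma (in noise) law_K: "prob {\<omega>\<in>space M. K k \<omega> = m} = pmf (poisson0 lam) m"
proof -
  have "prob {\<omega>\<in>space M. K k \<omega> = m} = measure (distr M borel (R (1,k,0))) {x. nat \<lfloor>x\<rfloor> = m}"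
    by (subst measure_distr) (auto simp: K_def intro!: arg_cong[where f=prob])
  also have "\<dots> = measure (distr (measure_pmf (poisson0 lam)) borel real) {x. nat \<lfloor>x\<rfloor> = m}"
    by (simp add: law noise_law_def)
  also have "\<dots> = measure (measure_pmf (poisson0 lam)) {m}"
    by (subst measure_distr) (auto intro!: arg_cong[where f="measure (measure_pmf (poisson0 lam))"])
  finally show ?thesis by (simp add: measure_pmf_single)
qed

abbreviation (in noise) mark :: "nat \<Rightarrow> nat \<Rightarrow> 'a \<Rightarrow> real \<times> real" where "mark k i \<omega> \<equiv> (U k i \<omega>, J k i \<omega>)"

lemma (in noise) indep_mark: "indep_var borel (U k i) borel (J k i)"
proof -
  have "indep_var (PiM {(2,k,i)} (\<lambda>_. borel)) (\<lambda>\<omega>. restrict (\<lambda>p. R p \<omega>) {(2,k,i)})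
     (PiM {(3,k,i)} (\<lambda>_. borel)) (\<lambda>\<omega>. restrict (\<lambda>p. R p \<omega>) {(3,k,i)})"
    by (intro indep_var_restrict[OF indep]) auto
  from indep_var_compose[OF this, of "\<lambda>x. x (2,k,i)" borel "\<lambda>x. x (3,k,i)" borel] 
  show ?thesis by (simp add: comp_def U_def J_def)
qed

lemma (in noise) law_mark: "distr M (borel \<Otimes>\<^sub>M borel) (mark k i) = distr M (borel \<Otimes>\<^sub>M borel) (mark k j)"
proof -
  have "distr M borel (U k i) = distr M borel (U k j)" "distr M borel (J k i) = distr M borel (J k j)"
    by (simp_all add: U_def J_def law noise_law_def)
  then show ?thesis
    using indep_var_distribution_eq[THEN iffD1, OF indep_mark[of k i]] indep_var_distribution_eq[THEN iffD1, OF indep_mark[of k j]] by simp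
qed

lemma (in noise) integral_mark:
  fixes h :: "real \<times> real \<Rightarrow> complex"
  assumes [measurable]: "h \<in> borel_measurable (borel \<Otimes>\<^sub>M borel)"
  shows "(\<integral>\<omega>. h (mark k i \<omega>) \<partial>M) = (\<integral>\<omega>. h (mark k 0 \<omega>) \<partial>M)"
proof -
  have "(\<integral>\<omega>. h (mark k i \<omega>) \<partial>M) = (\<integral>p. h p \<partial>distr M (borel \<Otimes>\<^sub>M borel) (mark k i))" for i
    by (subst integral_distr) auto
  then show ?thesis using law_mark[of k i 0] by simp
qed

lemma (in noise) nn_integral_mark:
  assumes [measurable]: "h \<in> borel_measurable (borel \<Otimes>\<^sub>M borel)"
  shows "(\<integral>\<^sup>+\<omega>. h (mark k i \<omega>) \<partial>M) = (\<integral>\<^sup>+\<omega>. h (mark k 0 \<omega>) \<partial>M)"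
proof -
  have "(\<integral>\<^sup>+\<omega>. h (mark k i \<omega>) \<partial>M) = (\<integral>\<^sup>+p. h p \<partial>distr M (borel \<Otimes>\<^sub>M borel) (mark k i))" for i
    by (subst nn_integral_distr) auto
  then show ?thesis using law_mark[of k i 0] by simp
qed

section \<open>Joint characteristic function of the Brownian and the Poissonian part\<close>

text \<open>The exponent, per unit of intensity, of the sum of \<open>f\<close> over the jumps in
  the interval from \<open>k\<close> to \<open>k + 1\<close>. Subtracting one confines the integrand
  to the marks with \<open>f\<close> nonzero, which makes \<open>phi\<close> additive over disjoint
  supports.\<close>

definition (in noise) phi :: "(real \<times> real \<Rightarrow> real) \<Rightarrow> nat \<Rightarrow> complex" where
  "phi f k = (CLINT \<omega>|M. iexp (f (mark k 0 \<omega>)) - 1)"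

lemma (in noise) integrable_bounded_complex: 
  fixes f :: "'a \<Rightarrow> complex"
  shows "f \<in> borel_measurable M \<Longrightarrow> (\<And>\<omega>. cmod (f \<omega>) \<le> C) \<Longrightarrow> integrable M f"
  by (rule integrable_const_bound[where B=C]) auto

lemma (in noise) phi_eq:
  assumes [measurable]: "f \<in> borel_measurable (borel \<Otimes>\<^sub>M borel)"
  shows "(CLINT \<omega>|M. iexp (f (mark k i \<omega>))) = phi f k + 1"
proof -
  have i: "integrable M (\<lambda>\<omega>. iexp (f (mark k 0 \<omega>)))" by (rule integrable_bounded_complex[where C=1]) auto
  have "phi f k = (CLINT \<omega>|M. iexp (f (mark k 0 \<omega>))) - 1"
    unfolding phi_def by (subst Bochner_Integration.integral_diff[OF i]) (auto simp: prob_space)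
  then show ?thesis using integral_mark[of "\<lambda>p. iexp (f p)" k i] by simp
qed

text \<open>A Poisson number of independent, identically distributed terms: on the event that the
  count is \<open>m\<close> the factor is \<open>(phi f k + 1)^m\<close>, and the Poisson generating
  function sums these to an exponential.\<close>

lemma (in noise) block_cf:
  assumes f[measurable]: "f \<in> borel_measurable (borel \<Otimes>\<^sub>M borel)"
  shows "(CLINT \<omega>|M. iexp (\<Sum>i<K k \<omega>. f (mark k i \<omega>))) = exp (lam * phi f k)"
proof -
  let ?z = "phi f k + 1"
  define V where "V i \<omega> = iexp (f (mark k i \<omega>))" for i \<omega>
  have [measurable]: "V i \<in> borel_measurable M" for i unfolding V_def by measurable
  have nV: "cmod (V i \<omega>) = 1" for i \<omega> by (simp add: V_def)
  have trm: "(CLINT \<omega>|M. indicator {\<omega>. K k \<omega> = m} \<omega> * (\<Prod>i<m. V i \<omega>)) = of_real (pmf (poisson0 lam) m) * ?z ^ m" for m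
  proof -
    \<comment> \<open>\<open>None\<close> stands for the count and \<open>Some i\<close> for the
      \<open>i\<close>-th mark. Their coordinates are disjoint, so the indicator of the event
      \<open>K k \<omega> = m\<close> and the factors of the first \<open>m\<close> marks are
      independent.\<close>
    define G :: "nat option \<Rightarrow> (nat \<times> nat \<times> nat) set" where 
      "G l = (case l of None \<Rightarrow> {(1,k,0)} | Some i \<Rightarrow> {(2,k,i),(3,k,i)})" for l
    define Y :: "nat option \<Rightarrow> (nat \<times> nat \<times> nat \<Rightarrow> real) \<Rightarrow> complex" where 
      "Y l x = (case l of None \<Rightarrow> indicator {m} (nat \<lfloor>x (1,k,0)\<rfloor>) | Some i \<Rightarrow> iexp (f (x (2,k,i), x (3,k,i))))" for l x
    let ?L = "insert None (Some ` {..<m})"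
    have ind: "indep_vars (\<lambda>_. borel) (\<lambda>l \<omega>. Y l (restrict (\<lambda>p. R p \<omega>) (G l))) ?L"
    proof (rule group_indep)
      show "disjoint_family_on G ?L" by (auto simp: disjoint_family_on_def G_def split: option.splits)
      fix l show "Y l \<in> borel_measurable (PiM (G l) (\<lambda>_. borel))"
      proof (cases l)
        case None
        have [measurable]: "(\<lambda>x. x (1,k,0)) \<in> borel_measurable (PiM {(1::nat,k,0::nat)} (\<lambda>_. borel :: real measure))"
          by (rule measurable_component_singleton) simp
        show ?thesis unfolding Y_def G_def None option.case by measurable
      next
        case (Some i)
        have [measurable]: "(\<lambda>x. x (2,k,i)) \<in> borel_measurable (PiM {(2::nat,k,i),(3,k,i)} (\<lambda>_. borel :: real measure))"
          "(\<lambda>x. x (3,k,i)) \<in> borel_measurable (PiM {(2::nat,k,i),(3,k,i)} (\<lambda>_. borel :: real measure))"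
          by (rule measurable_component_singleton, simp)+
        show ?thesis unfolding Y_def G_def Some option.case by measurable
      qed
    qed
    have YN: "Y None (restrict (\<lambda>p. R p \<omega>) (G None)) = indicator {\<omega>. K k \<omega> = m} \<omega>" for \<omega>
      by (auto simp: Y_def G_def K_def indicator_def)
    have YS: "Y (Some i) (restrict (\<lambda>p. R p \<omega>) (G (Some i))) = V i \<omega>" for i \<omega>
      by (simp add: Y_def G_def V_def U_def J_def)
    have int: "integrable M (\<lambda>\<omega>. Y l (restrict (\<lambda>p. R p \<omega>) (G l)))" for l
      by (cases l) (auto simp: YN YS nV indicator_def intro!: integrable_bounded_complex[where C=1])
    have pr: "(\<Prod>l\<in>?L. g l) = g None * (\<Prod>i<m. g (Some i))" for g :: "nat option \<Rightarrow> complex"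
      by (subst prod.insert) (auto simp: prod.reindex)
    have "(CLINT \<omega>|M. indicator {\<omega>. K k \<omega> = m} \<omega> * (\<Prod>i<m. V i \<omega>)) = 
       (CLINT \<omega>|M. (\<Prod>l\<in>?L. Y l (restrict (\<lambda>p. R p \<omega>) (G l))))"
      by (simp only: pr YN YS)
    also have "\<dots> = (\<Prod>l\<in>?L. CLINT \<omega>|M. Y l (restrict (\<lambda>p. R p \<omega>) (G l)))"
      by (rule indep_vars_lebesgue_integral[OF _ ind int]) simp
    also have "\<dots> = (CLINT \<omega>|M. indicator {\<omega>. K k \<omega> = m} \<omega>) * (\<Prod>i<m. (CLINT \<omega>|M. V i \<omega>))"
      by (simp only: pr YN YS)
    also have "(CLINT \<omega>|M. indicator {\<omega>. K k \<omega> = m} \<omega>) = of_real (prob {\<omega>\<in>space M. K k \<omega> = m})"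
    proof -
      have "(CLINT \<omega>|M. indicator {\<omega>. K k \<omega> = m} \<omega>) = (CLINT \<omega>|M. complex_of_real (indicator {\<omega>\<in>space M. K k \<omega> = m} \<omega>))"
        by (intro Bochner_Integration.integral_cong) (auto simp: indicator_def)
      then show ?thesis by (simp only: integral_complex_of_real) simp
    qed
    finally show ?thesis by (simp add: law_K V_def phi_eq[OF f])
  qed
  have meas_prod: "(\<lambda>\<omega>. indicator {\<omega>. K k \<omega> = m} \<omega> * (\<Prod>i<m. V i \<omega>)) \<in> borel_measurable M" for m
  proof -
    have "(\<lambda>\<omega>. (if K k \<omega> = m then 1 else 0) * (\<Prod>i<m. V i \<omega>)) \<in> borel_measurable M"
      by (intro borel_measurable_times borel_measurable_prod) measurable
    then show ?thesis by (simp add: indicator_def of_bool_def)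
  qed
  let ?W = "\<lambda>\<omega>. \<Prod>i<K k \<omega>. V i \<omega>"
  have W: "iexp (\<Sum>i<K k \<omega>. f (mark k i \<omega>)) = ?W \<omega>" for \<omega>
    by (simp add: V_def exp_sum sum_distrib_left)
  have part: "(\<Sum>m<n. indicator {\<omega>. K k \<omega> = m} \<omega> * (\<Prod>i<m. V i \<omega>)) = (if K k \<omega> < n then ?W \<omega> else 0)" for n \<omega>
    by (simp add: indicator_def if_distrib[of "\<lambda>x. x * _"] cong: if_cong)
  have nW: "cmod (?W \<omega>) = 1" for \<omega> by (simp add: nV prod_norm[symmetric])
  have "(\<lambda>n. CLINT \<omega>|M. (\<Sum>m<n. indicator {\<omega>. K k \<omega> = m} \<omega> * (\<Prod>i<m. V i \<omega>))) \<longlonglongrightarrow> (CLINT \<omega>|M. ?W \<omega>)"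
  proof (rule integral_dominated_convergence[where w="\<lambda>_. 1"])
    show "?W \<in> borel_measurable M" unfolding W[symmetric] 
      by (rule measurable_compose_countable[where f="\<lambda>n \<omega>. iexp (\<Sum>i<n. f (U k i \<omega>, J k i \<omega>))", OF _ K_measurable]) measurable
    show "(\<lambda>\<omega>. \<Sum>m<n. indicator {\<omega>. K k \<omega> = m} \<omega> * (\<Prod>i<m. V i \<omega>)) \<in> borel_measurable M" for n
      by (intro borel_measurable_sum meas_prod)
    show "AE \<omega> in M. (\<lambda>n. \<Sum>m<n. indicator {\<omega>. K k \<omega> = m} \<omega> * (\<Prod>i<m. V i \<omega>)) \<longlonglongrightarrow> ?W \<omega>"
    proof (rule AE_I2, unfold part)
      fix \<omega>
      show "(\<lambda>n. if K k \<omega> < n then ?W \<omega> else 0) \<longlonglongrightarrow> ?W \<omega>"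
        by (rule tendsto_eventually) (rule eventually_mono[OF eventually_gt_at_top[of "K k \<omega>"]], simp)
    qed
    show "AE \<omega> in M. norm (\<Sum>m<n. indicator {\<omega>. K k \<omega> = m} \<omega> * (\<Prod>i<m. V i \<omega>)) \<le> 1" for n
      unfolding part by (auto simp: nW)
  qed simp
  moreover have "(CLINT \<omega>|M. (\<Sum>m<n. indicator {\<omega>. K k \<omega> = m} \<omega> * (\<Prod>i<m. V i \<omega>))) = (\<Sum>m<n. of_real (pmf (poisson0 lam) m) * ?z ^ m)" for n
  proof -
    have "cmod (indicator {\<omega>. K k \<omega> = m} \<omega> * (\<Prod>i<m. V i \<omega>)) \<le> 1" for m \<omega>
      by (simp add: norm_mult nV prod_norm[symmetric] indicator_def)
    then show ?thesis 
      by (subst Bochner_Integration.integral_sum) (auto simp: trm intro!: integrable_bounded_complex[where C=1] meas_prod)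
  qed
  ultimately have "(\<lambda>m. of_real (pmf (poisson0 lam) m) * ?z ^ m) sums (CLINT \<omega>|M. ?W \<omega>)"
    by (simp only: sums_def)
  moreover have "(\<lambda>m. of_real (pmf (poisson0 lam) m) * ?z ^ m) sums (exp (of_real (- lam)) * exp (of_real lam * ?z))"
  proof -
    have "(\<lambda>m. exp (of_real (- lam)) * ((of_real lam * ?z) ^ m /\<^sub>R fact m)) sums (exp (of_real (- lam)) * exp (of_real lam * ?z))"
      by (intro sums_mult exp_converges)
    moreover have "exp (of_real (- lam)) * ((of_real lam * ?z) ^ m /\<^sub>R fact m) = of_real (pmf (poisson0 lam) m) * ?z ^ m" for m
      by (simp only: power_mult_distrib pmf_poisson0[OF lam] scaleR_conv_of_real) 
        (simp add: exp_of_real[symmetric] field_simps)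
    ultimately show ?thesis by simp
  qed
  ultimately have "(CLINT \<omega>|M. ?W \<omega>) = exp (of_real (- lam)) * exp (of_real lam * ?z)" by (rule sums_unique2)
  also have "\<dots> = exp (of_real (- lam) + of_real lam * ?z)" by (rule exp_add[symmetric])
  also have "of_real (- lam) + of_real lam * ?z = lam * phi f k" by (simp add: algebra_simps)
  finally show ?thesis by (simp only: W)
qed

lemma (in noise) gauss_cf: "(CLINT \<omega>|M. iexp (w * R (0, n, j) \<omega>)) = of_real (exp (- w\<^sup>2 / 2))"
proof -
  have "(CLINT \<omega>|M. iexp (w * R (0, n, j) \<omega>)) = char (distr M borel (R (0,n,j))) w"
    unfolding char_def by (subst integral_distr) auto
  also have "\<dots> = of_real (exp (- w\<^sup>2 / 2))"
    by (simp add: law noise_law_def char_std_normal_distribution)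
  finally show ?thesis .
qed

text \<open>One factor for each Gaussian coefficient and one for each unit time interval. Grouping a
  count with all marks of its interval leaves disjoint groups of coordinates, so the expectation is
  a product.\<close>

lemma (in noise) joint_cf_finite:
  assumes f[measurable]: "f \<in> borel_measurable (borel \<Otimes>\<^sub>M borel)" and S: "finite S"
  shows "(CLINT \<omega>|M. iexp ((\<Sum>(n,j)\<in>S. w (n,j) * R (0, n, j) \<omega>) + PI N f \<omega>)) = 
    of_real (exp (- (\<Sum>p\<in>S. (w p)\<^sup>2) / 2)) * exp (lam * (\<Sum>k<N. phi f k))"
proof -
  define G :: "(nat \<times> nat) + nat \<Rightarrow> (nat \<times> nat \<times> nat) set" where 
    "G l = (case l of Inl p \<Rightarrow> {(0,p)} | Inr k \<Rightarrow> insert (1,k,0) ({(2,k,i) | i. True} \<union> {(3,k,i) | i. True}))" for l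
  define Y :: "(nat \<times> nat) + nat \<Rightarrow> (nat \<times> nat \<times> nat \<Rightarrow> real) \<Rightarrow> complex" where 
    "Y l x = (case l of Inl p \<Rightarrow> iexp (w p * x (0,p)) | Inr k \<Rightarrow> iexp (\<Sum>i<nat \<lfloor>x (1,k,0)\<rfloor>. f (x (2,k,i), x (3,k,i))))" for l x
  let ?L = "Inl ` S \<union> Inr ` {..<N}"
  have ind: "indep_vars (\<lambda>_. borel) (\<lambda>l \<omega>. Y l (restrict (\<lambda>p. R p \<omega>) (G l))) ?L"
  proof (rule group_indep)
    show "disjoint_family_on G ?L" by (auto simp: disjoint_family_on_def G_def split: sum.splits)
    fix l show "Y l \<in> borel_measurable (PiM (G l) (\<lambda>_. borel))"
    proof (cases l)
      case (Inl p)
      have [measurable]: "(\<lambda>x. x (0,p)) \<in> borel_measurable (PiM {(0::nat,p)} (\<lambda>_. borel :: real measure))"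
        by (rule measurable_component_singleton) simp
      show ?thesis unfolding Y_def G_def Inl sum.case by measurable
    next
      case (Inr k)
      let ?P = "PiM (G (Inr k)) (\<lambda>_. borel :: real measure)"
      have [measurable]: "(\<lambda>x. x (1,k,0)) \<in> borel_measurable ?P" "\<And>i. (\<lambda>x. x (2,k,i)) \<in> borel_measurable ?P"
         "\<And>i. (\<lambda>x. x (3,k,i)) \<in> borel_measurable ?P"
        by (rule measurable_component_singleton, simp add: G_def)+
      have "(\<lambda>x. iexp (\<Sum>i<nat \<lfloor>x (1,k,0)\<rfloor>. f (x (2,k,i), x (3,k,i)))) \<in> borel_measurable ?P"
        by (rule measurable_compose_countable[where f="\<lambda>n x. iexp (\<Sum>i<n. f (x (2,k,i), x (3,k,i)))" and g="\<lambda>x. nat \<lfloor>x (1,k,0)\<rfloor>"]) measurable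
      then show ?thesis unfolding Y_def Inr sum.case .
    qed
  qed
  have YL: "Y (Inl p) (restrict (\<lambda>p. R p \<omega>) (G (Inl p))) = iexp (w p * R (0,p) \<omega>)" for p \<omega>
    by (simp add: Y_def G_def)
  have YR: "Y (Inr k) (restrict (\<lambda>p. R p \<omega>) (G (Inr k))) = iexp (\<Sum>i<K k \<omega>. f (mark k i \<omega>))" for k \<omega>
    by (simp add: Y_def G_def K_def U_def J_def)
  have Bm: "(\<lambda>\<omega>. iexp (\<Sum>i<K k \<omega>. f (mark k i \<omega>))) \<in> borel_measurable M" for k
    by (rule measurable_compose_countable[where f="\<lambda>n \<omega>. iexp (\<Sum>i<n. f (U k i \<omega>, J k i \<omega>))", OF _ K_measurable]) measurable
  have int: "integrable M (\<lambda>\<omega>. Y l (restrict (\<lambda>p. R p \<omega>) (G l)))" for l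
  proof (cases l)
    case (Inl p)
    then show ?thesis by (simp only: YL) (rule integrable_bounded_complex[where C=1]; simp)
  next
    case (Inr k)
    then show ?thesis by (simp only: YR) (rule integrable_bounded_complex[OF Bm, where C=1]; simp)
  qed
  have pr: "(\<Prod>l\<in>?L. g l) = (\<Prod>p\<in>S. g (Inl p)) * (\<Prod>k<N. g (Inr k))" for g :: "_ \<Rightarrow> complex"
    using S by (subst prod.union_disjoint) (auto simp: prod.reindex)
  have "(CLINT \<omega>|M. iexp ((\<Sum>(n,j)\<in>S. w (n,j) * R (0, n, j) \<omega>) + PI N f \<omega>)) = 
     (CLINT \<omega>|M. (\<Prod>l\<in>?L. Y l (restrict (\<lambda>p. R p \<omega>) (G l))))"
    unfolding pr YL YR using S
    by (simp add: exp_add exp_sum[symmetric] PI_def ring_distribs sum_distrib_left case_prod_beta)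
  also have "\<dots> = (\<Prod>l\<in>?L. CLINT \<omega>|M. Y l (restrict (\<lambda>p. R p \<omega>) (G l)))"
    by (rule indep_vars_lebesgue_integral[OF _ ind int]) (use S in simp)
  also have "\<dots> = (\<Prod>p\<in>S. of_real (exp (- (w p)\<^sup>2 / 2))) * (\<Prod>k<N. exp (lam * phi f k))"
    unfolding pr YL YR block_cf[OF f] using gauss_cf by (simp add: split_paired_all)
  also have "(\<Prod>p\<in>S. complex_of_real (exp (- (w p)\<^sup>2 / 2))) = of_real (exp (- (\<Sum>p\<in>S. (w p)\<^sup>2) / 2))"
    using S by (simp only: of_real_prod[symmetric] exp_sum[symmetric] sum_negf[symmetric] sum_divide_distrib[symmetric])
  also have "(\<Prod>k<N. exp (lam * phi f k)) = exp (lam * (\<Sum>k<N. phi f k))"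
    by (simp add: exp_sum sum_distrib_left)
  finally show ?thesis .
qed

text \<open>The variance of \<open>Bsum T a\<close>, as \<open>min s t\<close> is the covariance of
  Brownian motion.\<close>

definition (in noise) bcov :: "real set \<Rightarrow> (real \<Rightarrow> real) \<Rightarrow> real" where
  "bcov T a = (\<Sum>s\<in>T. \<Sum>t\<in>T. a s * a t * min s t)"

definition (in noise) Bsum :: "real set \<Rightarrow> (real \<Rightarrow> real) \<Rightarrow> 'a \<Rightarrow> real" where
  "Bsum T a \<omega> = (\<Sum>t\<in>T. a t * B t \<omega>)"

lemma (in noise) Bsum_measurable[measurable]: "Bsum T a \<in> borel_measurable M"
  unfolding Bsum_def by measurable

text \<open>Cut after \<open>m\<close> levels, the Brownian series is a finite combination of
  coefficients whose variance is given by \<open>schauder_cov\<close>. That variance converges, and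
  dominated convergence carries the formula to the limit.\<close>

lemma (in noise) joint_cf:
  assumes T: "finite T" "T \<subseteq> {0..}" and f[measurable]: "f \<in> borel_measurable (borel \<Otimes>\<^sub>M borel)"
  shows "(CLINT \<omega>|M. iexp (Bsum T a \<omega> + PI N f \<omega>)) = of_real (exp (- bcov T a / 2)) * exp (lam * (\<Sum>k<N. phi f k))"
proof -
  define Nt where "Nt = nat \<lceil>Max (insert 0 T)\<rceil>"
  have Nt: "t \<le> real Nt" if "t \<in> T" for t
  proof -
    have "t \<le> Max (insert 0 T)" using T that by (intro Max_ge) auto
    then show ?thesis unfolding Nt_def by linarith
  qed
  define w where "w = (\<lambda>(n,j). \<Sum>t\<in>T. a t * schauder n j t)"
  define S where "S m = Sigma {..<m::nat} (\<lambda>n. {..<2^n*Nt})" for m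
  define L where "L m \<omega> = (\<Sum>(n,j)\<in>S m. w (n,j) * R (0, n, j) \<omega>)" for m \<omega>
  have fin: "finite (S m)" for m unfolding S_def by auto
  have [measurable]: "L m \<in> borel_measurable M" for m unfolding L_def by measurable
  have Leq: "L m \<omega> = (\<Sum>t\<in>T. a t * (\<Sum>n<m. bm_level (\<lambda>n j. R (0, n, j) \<omega>) t n))" for m \<omega>
  proof -
    have "L m \<omega> = (\<Sum>n<m. \<Sum>j<2^n*Nt. \<Sum>t\<in>T. a t * (R (0,n,j) \<omega> * schauder n j t))"
      unfolding L_def S_def w_def by (subst sum.Sigma[symmetric]) (auto simp: sum_distrib_left sum_distrib_right mult_ac)
    also have "\<dots> = (\<Sum>n<m. \<Sum>t\<in>T. \<Sum>j<2^n*Nt. a t * (R (0,n,j) \<omega> * schauder n j t))"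
      by (subst sum.swap) simp
    also have "\<dots> = (\<Sum>t\<in>T. \<Sum>n<m. \<Sum>j<2^n*Nt. a t * (R (0,n,j) \<omega> * schauder n j t))"
      by (rule sum.swap)
    also have "\<dots> = (\<Sum>t\<in>T. a t * (\<Sum>n<m. bm_level (\<lambda>n j. R (0, n, j) \<omega>) t n))"
      by (intro sum.cong refl) (simp add: bm_level_eq[OF Nt] sum_distrib_left)
    finally show ?thesis .
  qed
  have lim: "(\<lambda>m. L m \<omega>) \<longlonglongrightarrow> Bsum T a \<omega>" if "\<omega> \<in> space M" for \<omega>
  proof -
    have "bm_good (\<lambda>n j. R (0, n, j) \<omega>)" using good[OF that] by (simp add: noise_good_def)
    then have "(\<lambda>m. \<Sum>n<m. bm_level (\<lambda>n j. R (0, n, j) \<omega>) t n) \<longlonglongrightarrow> B t \<omega>" for t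
      unfolding B_def bm_def by (intro summable_LIMSEQ bm_summable)
    then show ?thesis unfolding Leq Bsum_def by (intro tendsto_intros)
  qed
  have wsum: "(\<Sum>p\<in>S m. (w p)\<^sup>2) = (\<Sum>s\<in>T. \<Sum>t\<in>T. a s * a t * schauder_cov m Nt s t)" for m
  proof -
    have "(\<Sum>p\<in>S m. (w p)\<^sup>2) = (\<Sum>(n,j)\<in>S m. (w (n,j))\<^sup>2)" by (intro sum.cong) auto
    also have "\<dots> = (\<Sum>n<m. \<Sum>j<2^n*Nt. \<Sum>s\<in>T. \<Sum>t\<in>T. a s * a t * (schauder n j s * schauder n j t))"
      unfolding S_def w_def by (subst sum.Sigma[symmetric]) (auto simp: power2_eq_square sum_product mult_ac)
    also have "\<dots> = (\<Sum>n<m. \<Sum>s\<in>T. \<Sum>t\<in>T. \<Sum>j<2^n*Nt. a s * a t * (schauder n j s * schauder n j t))"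
      by (subst sum.swap, subst (2) sum.swap) simp
    also have "\<dots> = (\<Sum>s\<in>T. \<Sum>t\<in>T. \<Sum>n<m. \<Sum>j<2^n*Nt. a s * a t * (schauder n j s * schauder n j t))"
      by (subst sum.swap, subst (2) sum.swap) simp
    also have "\<dots> = (\<Sum>s\<in>T. \<Sum>t\<in>T. a s * a t * schauder_cov m Nt s t)"
      by (simp add: schauder_cov_def sum_distrib_left)
    finally show ?thesis .
  qed
  have "(\<lambda>m. CLINT \<omega>|M. iexp (L m \<omega> + PI N f \<omega>)) \<longlonglongrightarrow> (CLINT \<omega>|M. iexp (Bsum T a \<omega> + PI N f \<omega>))"
  proof (rule integral_dominated_convergence[where w="\<lambda>_. 1"])
    show "AE \<omega> in M. (\<lambda>m. iexp (L m \<omega> + PI N f \<omega>)) \<longlonglongrightarrow> iexp (Bsum T a \<omega> + PI N f \<omega>)"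
      by (rule AE_I2) (intro tendsto_intros lim)
    show "AE \<omega> in M. norm (iexp (L m \<omega> + PI N f \<omega>)) \<le> 1" for m
      by (rule AE_I2) (simp only: norm_exp_i_times order_refl)
  qed auto
  moreover have "(\<lambda>m. CLINT \<omega>|M. iexp (L m \<omega> + PI N f \<omega>)) \<longlonglongrightarrow> of_real (exp (- bcov T a / 2)) * exp (lam * (\<Sum>k<N. phi f k))"
    unfolding L_def joint_cf_finite[OF f fin] wsum bcov_def
  proof (intro tendsto_intros)
    fix s t assume "s \<in> T" "t \<in> T"
    then show "(\<lambda>m. schauder_cov m Nt s t) \<longlonglongrightarrow> min s t" using Nt T by (intro schauder_cov_tendsto) auto
  qed simp
  ultimately show ?thesis by (rule LIMSEQ_unique)
qed

text \<open>Where one of the functions vanishes, \<open>iexp (f + g) - 1\<close> is the sum of the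
  two separate terms. This is how sums over disjoint parts of the jumps become independent.\<close>

lemma (in noise) phi_add:
  assumes [measurable]: "f \<in> borel_measurable (borel \<Otimes>\<^sub>M borel)" "g \<in> borel_measurable (borel \<Otimes>\<^sub>M borel)"
    and disj: "\<And>p. f p = 0 \<or> g p = 0"
  shows "phi (\<lambda>p. f p + g p) k = phi f k + phi g k"
proof -
  have b: "cmod (iexp x - 1) \<le> 2" for x using norm_triangle_ineq4[of "iexp x" 1] by simp
  have "iexp (f p + g p) - 1 = (iexp (f p) - 1) + (iexp (g p) - 1)" for p using disj[of p] by auto
  then have "phi (\<lambda>p. f p + g p) k = (CLINT \<omega>|M. (iexp (f (mark k 0 \<omega>)) - 1) + (iexp (g (mark k 0 \<omega>)) - 1))"
    unfolding phi_def by (simp only:)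
  also have "\<dots> = phi f k + phi g k" unfolding phi_def
    by (intro Bochner_Integration.integral_add integrable_bounded_complex[where C=2] b) measurable
  finally show ?thesis .
qed

lemma (in noise) PI_add: "PI N (\<lambda>p. f p + g p) \<omega> = PI N f \<omega> + PI N g \<omega>"
  by (simp add: PI_def sum.distrib)

lemma (in noise) PI_scale: "PI N (\<lambda>p. c * f p) \<omega> = c * PI N f \<omega>" for f :: "real \<times> real \<Rightarrow> real"
  by (simp add: PI_def sum_distrib_left)

section \<open>Past and future of the noise at a fixed time\<close>

text \<open>Coefficients that add \<open>\<gamma> * (B t - B s)\<close> to a combination over
  \<open>T\<close>. The conditionals are added up because \<open>s\<close> and \<open>t\<close> may
  already belong to \<open>T\<close> or coincide.\<close>

definition (in noise) shift_coef :: "real set \<Rightarrow> (real \<Rightarrow> real) \<Rightarrow> real \<Rightarrow> real \<Rightarrow> real \<Rightarrow> real \<Rightarrow> real" where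
  "shift_coef T a \<gamma> s t r = (if r \<in> T then a r else 0) + \<gamma> * ((if r = t then 1 else 0) - (if r = s then 1 else 0))"

lemma (in noise) sum_shift_coef:
  assumes T: "finite T"
  shows "(\<Sum>r\<in>insert t (insert s T). shift_coef T a \<gamma> s t r * h r) = (\<Sum>r\<in>T. a r * h r) + \<gamma> * (h t - h s)"
proof -
  let ?W = "insert t (insert s T)"
  have "(\<Sum>r\<in>?W. shift_coef T a \<gamma> s t r * h r) = (\<Sum>r\<in>?W. (if r \<in> T then a r * h r else 0)) + 
     \<gamma> * ((\<Sum>r\<in>?W. if r = t then h r else 0) - (\<Sum>r\<in>?W. if r = s then h r else 0))"
    unfolding sum_subtractf[symmetric] sum_distrib_left sum.distrib[symmetric]
    by (intro sum.cong refl) (auto simp: shift_coef_def algebra_simps)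
  also have "(\<Sum>r\<in>?W. (if r \<in> T then a r * h r else 0)) = (\<Sum>r\<in>T. a r * h r)"
    using T by (intro sum.mono_neutral_cong_right) auto
  finally show ?thesis using T by simp
qed

lemma (in noise) Bsum_shift: 
  "finite T \<Longrightarrow> Bsum (insert t (insert s T)) (shift_coef T a \<gamma> s t) \<omega> = Bsum T a \<omega> + \<gamma> * (B t \<omega> - B s \<omega>)"
  unfolding Bsum_def by (rule sum_shift_coef)

text \<open>For \<open>r \<le> s\<close> the covariances of \<open>B r\<close> with
  \<open>B s\<close> and with \<open>B t\<close> agree. The increment is therefore uncorrelated with
  the past, and its variance is simply added.\<close>

lemma (in noise) bcov_shift:
  assumes T: "finite T" "T \<subseteq> {0..s}" and st: "s \<le> t"
  shows "bcov (insert t (insert s T)) (shift_coef T a \<gamma> s t) = bcov T a + \<gamma>\<^sup>2 * (t - s)"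
proof -
  let ?W = "insert t (insert s T)" and ?c = "shift_coef T a \<gamma> s t"
  define h where "h r = (\<Sum>q\<in>?W. ?c q * min r q)" for r
  have h: "h r = (\<Sum>q\<in>T. a q * min r q) + \<gamma> * (min r t - min r s)" for r
    unfolding h_def by (rule sum_shift_coef[OF T(1)])
  have "bcov ?W ?c = (\<Sum>r\<in>?W. ?c r * h r)"
    by (simp only: bcov_def h_def sum_distrib_left mult.assoc)
  also have "\<dots> = (\<Sum>r\<in>T. a r * h r) + \<gamma> * (h t - h s)" by (rule sum_shift_coef[OF T(1)])
  also have "(\<Sum>r\<in>T. a r * h r) = bcov T a"
  proof -
    have "a r * h r = (\<Sum>q\<in>T. a r * a q * min r q)" if "r \<in> T" for r
    proof -
      have "r \<le> s" using T that by auto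
      then show ?thesis using st by (simp add: h sum_distrib_left mult.assoc min.absorb1)
    qed
    then show ?thesis by (simp add: bcov_def)
  qed
  also have "h t - h s = \<gamma> * (t - s)"
  proof -
    have "(\<Sum>q\<in>T. a q * min t q) = (\<Sum>q\<in>T. a q * min s q)"
      using T st by (intro sum.cong refl) (auto simp: min_def)
    then show ?thesis unfolding h using st by (simp add: algebra_simps min_def)
  qed
  finally show ?thesis by (simp add: power2_eq_square)
qed

text \<open>
  Additive functionals of the noise up to time \<open>s\<close>; their characteristic functions factorise against
  those of the increments after \<open>s\<close>, which gives independence without computing joint laws.
\<close>

definition (in noise) past :: "real \<Rightarrow> ('a \<Rightarrow> real) set" where
  "past s = {\<lambda>\<omega>. Bsum T a \<omega> + PI (nat \<lceil>s\<rceil>) f \<omega> | T a f. finite T \<and> T \<subseteq> {0..s} \<and>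
     f \<in> borel_measurable (borel \<Otimes>\<^sub>M borel) \<and> (\<forall>u x. s < u \<longrightarrow> f (u, x) = 0)}"

text \<open>Generated by the linear space \<open>past s\<close> of scalar functionals, which is the
  shape that \<open>indep_from_char\<close> expects of its generators.\<close>

definition (in noise) Filt :: "real \<Rightarrow> 'a measure" where
  "Filt s = sigma (space M) {X -` A \<inter> space M | X A. X \<in> past s \<and> A \<in> sets borel}"

lemma (in noise) past_measurable: "X \<in> past s \<Longrightarrow> X \<in> borel_measurable M"
  unfolding past_def by auto

lemma (in noise) past_zero: "(\<lambda>\<omega>. 0) \<in> past s"
proof -
  have "(\<lambda>\<omega>. 0) = (\<lambda>\<omega>. Bsum {} (\<lambda>_. 0) \<omega> + PI (nat \<lceil>s\<rceil>) (\<lambda>_. 0) \<omega>)" by (simp add: Bsum_def PI_def)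
  then show ?thesis unfolding past_def by (intro CollectI exI[of _ "{}"] exI[of _ "\<lambda>_. 0"]) auto
qed

lemma (in noise) past_scale:
  assumes "X \<in> past s" shows "(\<lambda>\<omega>. c * X \<omega>) \<in> past s"
proof -
  obtain T a f where *: "finite T" "T \<subseteq> {0..s}" "f \<in> borel_measurable (borel \<Otimes>\<^sub>M borel)" "\<forall>u x. s < u \<longrightarrow> f (u, x) = 0"
    and X: "X = (\<lambda>\<omega>. Bsum T a \<omega> + PI (nat \<lceil>s\<rceil>) f \<omega>)" using assms unfolding past_def by auto
  have "(\<lambda>\<omega>. c * X \<omega>) = (\<lambda>\<omega>. Bsum T (\<lambda>t. c * a t) \<omega> + PI (nat \<lceil>s\<rceil>) (\<lambda>p. c * f p) \<omega>)"
    by (simp add: X PI_scale Bsum_def sum_distrib_left ring_distribs mult.assoc)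
  then show ?thesis using * unfolding past_def 
    by (intro CollectI exI[of _ T] exI[of _ "\<lambda>t. c * a t"] exI[of _ "\<lambda>p. c * f p"]) auto
qed

lemma (in noise) past_add:
  assumes "X \<in> past s" "X' \<in> past s" shows "(\<lambda>\<omega>. X \<omega> + X' \<omega>) \<in> past s"
proof -
  obtain T a f where *: "finite T" "T \<subseteq> {0..s}" "f \<in> borel_measurable (borel \<Otimes>\<^sub>M borel)" "\<forall>u x. s < u \<longrightarrow> f (u, x) = 0"
    and X: "X = (\<lambda>\<omega>. Bsum T a \<omega> + PI (nat \<lceil>s\<rceil>) f \<omega>)" using assms unfolding past_def by auto
  obtain T' a' f' where hp: "finite T'" "T' \<subseteq> {0..s}" "f' \<in> borel_measurable (borel \<Otimes>\<^sub>M borel)" "\<forall>u x. s < u \<longrightarrow> f' (u, x) = 0"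
    and X': "X' = (\<lambda>\<omega>. Bsum T' a' \<omega> + PI (nat \<lceil>s\<rceil>) f' \<omega>)" using assms unfolding past_def by auto
  let ?a = "\<lambda>t. (if t \<in> T then a t else 0) + (if t \<in> T' then a' t else 0)"
  have "Bsum T a \<omega> + Bsum T' a' \<omega> = Bsum (T \<union> T') ?a \<omega>" for \<omega>
  proof -
    have "Bsum T a \<omega> = (\<Sum>t\<in>T\<union>T'. (if t \<in> T then a t else 0) * B t \<omega>)" 
      "Bsum T' a' \<omega> = (\<Sum>t\<in>T\<union>T'. (if t \<in> T' then a' t else 0) * B t \<omega>)"
      unfolding Bsum_def using *(1) hp(1) by (auto intro!: sum.mono_neutral_cong_left)
    then show ?thesis by (simp only: Bsum_def sum.distrib[symmetric] ring_distribs)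
  qed
  then have "(\<lambda>\<omega>. X \<omega> + X' \<omega>) = (\<lambda>\<omega>. Bsum (T \<union> T') ?a \<omega> + PI (nat \<lceil>s\<rceil>) (\<lambda>p. f p + f' p) \<omega>)"
    by (simp add: X X' PI_add fun_eq_iff algebra_simps)
  then show ?thesis using * hp unfolding past_def 
    by (intro CollectI exI[of _ "T \<union> T'"] exI[of _ ?a] exI[of _ "\<lambda>p. f p + f' p"]) auto
qed

lemma (in noise) space_Filt[simp]: "space (Filt s) = space M"
  unfolding Filt_def by (rule space_measure_of) auto

lemma (in noise) sets_Filt: "sets (Filt s) = sigma_sets (space M) {X -` A \<inter> space M | X A. X \<in> past s \<and> A \<in> sets borel}"
  unfolding Filt_def by (rule sets_measure_of) auto

lemma (in noise) Filt_subalgebra: "subalgebra M (Filt s)"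
  unfolding subalgebra_def sets_Filt using past_measurable 
  by (auto intro!: sets.sigma_sets_subset)

lemma (in noise) past_Filt: "X \<in> past s \<Longrightarrow> X \<in> borel_measurable (Filt s)"
  by (rule measurableI) (auto simp: sets_Filt)

text \<open>The later functional sums over more unit intervals. The two agree on the sample space,
  where jump times are known to lie in their intervals, so that the additional marks come after
  \<open>s\<close>.\<close>

lemma (in noise) past_mono:
  assumes "X \<in> past s" "s \<le> t"
  obtains X' where "X' \<in> past t" "\<And>\<omega>. \<omega> \<in> space M \<Longrightarrow> X \<omega> = X' \<omega>"
proof -
  obtain T a f where *: "finite T" "T \<subseteq> {0..s}" "f \<in> borel_measurable (borel \<Otimes>\<^sub>M borel)" "\<forall>u x. s < u \<longrightarrow> f (u, x) = 0"
    and X: "X = (\<lambda>\<omega>. Bsum T a \<omega> + PI (nat \<lceil>s\<rceil>) f \<omega>)" using assms unfolding past_def by auto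
  let ?X = "\<lambda>\<omega>. Bsum T a \<omega> + PI (nat \<lceil>t\<rceil>) f \<omega>"
  have "?X \<in> past t" unfolding past_def using * assms(2) by (intro CollectI exI[of _ T] exI[of _ a] exI[of _ f]) fastforce
  moreover have "X \<omega> = ?X \<omega>" if "\<omega> \<in> space M" for \<omega>
  proof -
    have "PI (nat \<lceil>t\<rceil>) f \<omega> = PI (nat \<lceil>s\<rceil>) f \<omega>"
    proof (rule PI_extend[OF that])
      show "nat \<lceil>s\<rceil> \<le> nat \<lceil>t\<rceil>" using assms(2) by (intro nat_mono ceiling_mono)
      fix u x assume "real (nat \<lceil>s\<rceil>) < u"
      then have "s < u" by linarith
      then show "f (u, x) = 0" using * by auto
    qed
    then show ?thesis by (simp add: X)
  qed
  ultimately show thesis by (rule that)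
qed

lemma (in noise) Filt_mono: "s \<le> t \<Longrightarrow> sets (Filt s) \<subseteq> sets (Filt t)"
proof -
  assume st: "s \<le> t"
  have "{X -` A \<inter> space M | X A. X \<in> past s \<and> A \<in> sets borel} \<subseteq> {X -` A \<inter> space M | X A. X \<in> past t \<and> A \<in> sets borel}"
  proof clarify
    fix X A assume X: "X \<in> past s" and A: "A \<in> sets (borel :: real measure)"
    obtain X' where "X' \<in> past t" "\<And>\<omega>. \<omega> \<in> space M \<Longrightarrow> X \<omega> = X' \<omega>" using past_mono[OF X st] by blast
    then show "\<exists>Xa Aa. X -` A \<inter> space M = Xa -` Aa \<inter> space M \<and> Xa \<in> past t \<and> Aa \<in> sets borel"
      using A by (intro exI[of _ X'] exI[of _ A]) auto
  qed
  then show ?thesis unfolding sets_Filt by (rule sigma_sets_mono')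
qed

lemma (in noise) filtered: "filtered_prob_space M Filt"
  unfolding filtered_prob_space_def using prob_space_axioms Filt_subalgebra Filt_mono
  by (auto intro!: filtration.intro)

definition (in noise) future :: "real \<Rightarrow> real \<Rightarrow> real \<Rightarrow> nat \<Rightarrow> (real \<times> real \<Rightarrow> real) \<Rightarrow> 'a \<Rightarrow> real" where
  "future \<beta> s t N g \<omega> = \<beta> * (B t \<omega> - B s \<omega>) + PI N g \<omega>"

lemma (in noise) future_measurable[measurable]:
  "g \<in> borel_measurable (borel \<Otimes>\<^sub>M borel) \<Longrightarrow> future \<beta> s t N g \<in> borel_measurable M"
  unfolding future_def by measurable

text \<open>A past functional plus a multiple of a future one is again a functional covered by
  \<open>joint_cf\<close>. Its Gaussian exponent splits by orthogonality of increments, its jump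
  exponent because \<open>f\<close> and \<open>g\<close> have disjoint supports; \<open>N'\<close>
  is a common number of unit intervals.\<close>

lemma (in noise) past_future_cf:
  assumes st: "0 \<le> s" "s \<le> t" and g[measurable]: "g \<in> borel_measurable (borel \<Otimes>\<^sub>M borel)"
    and g0: "\<And>u x. u \<le> s \<Longrightarrow> g (u, x) = 0" "\<And>u x. real N < u \<Longrightarrow> g (u, x) = 0"
    and T: "finite T" "T \<subseteq> {0..s}" and f[measurable]: "f \<in> borel_measurable (borel \<Otimes>\<^sub>M borel)"
    and f0: "\<And>u x. s < u \<Longrightarrow> f (u, x) = 0"
    and N': "N \<le> N'" "nat \<lceil>s\<rceil> \<le> N'"
  shows "(CLINT \<omega>|M. iexp ((Bsum T a \<omega> + PI (nat \<lceil>s\<rceil>) f \<omega>) + v * future \<beta> s t N g \<omega>)) = 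
    of_real (exp (- (bcov T a + (v * \<beta>)\<^sup>2 * (t - s)) / 2)) * exp (lam * ((\<Sum>k<N'. phi f k) + (\<Sum>k<N'. phi (\<lambda>p. v * g p) k)))"
proof -
  let ?W = "insert t (insert s T)" and ?c = "shift_coef T a (v * \<beta>) s t" and ?h = "\<lambda>p. f p + v * g p"
  have "(CLINT \<omega>|M. iexp ((Bsum T a \<omega> + PI (nat \<lceil>s\<rceil>) f \<omega>) + v * future \<beta> s t N g \<omega>)) = (CLINT \<omega>|M. iexp (Bsum ?W ?c \<omega> + PI N' ?h \<omega>))"
  proof (rule Bochner_Integration.integral_cong[OF refl])
    fix \<omega> assume \<omega>: "\<omega> \<in> space M"
    have "PI N' f \<omega> = PI (nat \<lceil>s\<rceil>) f \<omega>"
    proof (rule PI_extend[OF \<omega> N'(2)])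
      fix u x assume "real (nat \<lceil>s\<rceil>) < u"
      then have "s < u" by linarith
      then show "f (u, x) = 0" by (rule f0)
    qed
    moreover have "PI N' g \<omega> = PI N g \<omega>" by (rule PI_extend[OF \<omega> N'(1)], rule g0(2))
    moreover have "Bsum ?W ?c \<omega> = Bsum T a \<omega> + v * \<beta> * (B t \<omega> - B s \<omega>)" by (rule Bsum_shift[OF T(1)])
    ultimately have "(Bsum T a \<omega> + PI (nat \<lceil>s\<rceil>) f \<omega>) + v * future \<beta> s t N g \<omega> = Bsum ?W ?c \<omega> + PI N' ?h \<omega>"
      by (simp add: future_def PI_add PI_scale algebra_simps)
    then show "iexp ((Bsum T a \<omega> + PI (nat \<lceil>s\<rceil>) f \<omega>) + v * future \<beta> s t N g \<omega>) = iexp (Bsum ?W ?c \<omega> + PI N' ?h \<omega>)"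
      by (simp only:)
  qed
  also have "\<dots> = of_real (exp (- bcov ?W ?c / 2)) * exp (lam * (\<Sum>k<N'. phi ?h k))"
    using T st by (intro joint_cf) auto
  also have "bcov ?W ?c = bcov T a + (v * \<beta>)\<^sup>2 * (t - s)" by (rule bcov_shift[OF T st(2)])
  also have "(\<Sum>k<N'. phi ?h k) = (\<Sum>k<N'. phi f k) + (\<Sum>k<N'. phi (\<lambda>p. v * g p) k)"
  proof -
    have "f p = 0 \<or> v * g p = 0" for p using f0 g0(1) by (cases p) (metis mult_zero_right not_le)
    then show ?thesis by (subst phi_add) (auto simp: sum.distrib)
  qed
  finally show ?thesis .
qed

lemma (in noise) future_cf:
  assumes st: "0 \<le> s" "s \<le> t" and g[measurable]: "g \<in> borel_measurable (borel \<Otimes>\<^sub>M borel)"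
    and g0: "\<And>u x. u \<le> s \<Longrightarrow> g (u, x) = 0" "\<And>u x. real N < u \<Longrightarrow> g (u, x) = 0" and N': "N \<le> N'" "nat \<lceil>s\<rceil> \<le> N'"
  shows "(CLINT \<omega>|M. iexp (v * future \<beta> s t N g \<omega>)) = 
     of_real (exp (- ((v * \<beta>)\<^sup>2 * (t - s)) / 2)) * exp (lam * (\<Sum>k<N'. phi (\<lambda>p. v * g p) k))"
proof -
  have "phi (\<lambda>_. 0) k = 0" for k by (simp add: phi_def)
  then show ?thesis
    using past_future_cf[OF st g g0, where T="{}" and a="\<lambda>_. 0" and f="\<lambda>_. 0" and N'=N' and v=v and \<beta>=\<beta>] N' by (simp add: Bsum_def PI_def bcov_def)
qed

lemma (in noise) future_indep:
  assumes st: "0 \<le> s" "s \<le> t" and g[measurable]: "g \<in> borel_measurable (borel \<Otimes>\<^sub>M borel)"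
    and g0: "\<And>u x. u \<le> s \<Longrightarrow> g (u, x) = 0" "\<And>u x. real N < u \<Longrightarrow> g (u, x) = 0"
    and G: "G \<in> sets (Filt s)" and D: "D \<in> sets borel"
  shows "prob (G \<inter> (future \<beta> s t N g -` D \<inter> space M)) = prob G * prob (future \<beta> s t N g -` D \<inter> space M)"
proof (rule indep_from_char[where V="past s"])
  fix X v assume "X \<in> past s"
  then obtain T a f where *: "finite T" "T \<subseteq> {0..s}" "f \<in> borel_measurable (borel \<Otimes>\<^sub>M borel)" "\<And>u x. s < u \<Longrightarrow> f (u, x) = 0"
    and X: "X = (\<lambda>\<omega>. Bsum T a \<omega> + PI (nat \<lceil>s\<rceil>) f \<omega>)" unfolding past_def by auto
  let ?N = "max N (nat \<lceil>s\<rceil>)"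
  have "phi (\<lambda>p. 0 * g p) k = 0" for k by (simp add: phi_def)
  then have "(CLINT \<omega>|M. iexp (X \<omega>)) = of_real (exp (- bcov T a / 2)) * exp (lam * (\<Sum>k<?N. phi f k))"
    using past_future_cf[OF st g g0 *, where N'="?N" and a=a and v=0 and \<beta>=\<beta>] unfolding X by simp
  moreover have "(CLINT \<omega>|M. iexp (v * future \<beta> s t N g \<omega>)) = of_real (exp (- ((v * \<beta>)\<^sup>2 * (t - s)) / 2)) * exp (lam * (\<Sum>k<?N. phi (\<lambda>p. v * g p) k))"
    by (rule future_cf[OF st g g0]) auto
  moreover have "(CLINT \<omega>|M. iexp (X \<omega> + v * future \<beta> s t N g \<omega>)) = 
     of_real (exp (- (bcov T a + (v * \<beta>)\<^sup>2 * (t - s)) / 2)) * exp (lam * ((\<Sum>k<?N. phi f k) + (\<Sum>k<?N. phi (\<lambda>p. v * g p) k)))"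
    unfolding X by (rule past_future_cf[OF st g g0 *]) auto
  moreover have "exp (- (bcov T a + (v * \<beta>)\<^sup>2 * (t - s)) / 2) = exp (- bcov T a / 2) * exp (- ((v * \<beta>)\<^sup>2 * (t - s)) / 2)"
    by (simp only: mult_exp_exp) (simp add: add_divide_distrib)
  ultimately show "(CLINT \<omega>|M. iexp (X \<omega> + v * future \<beta> s t N g \<omega>)) = (CLINT \<omega>|M. iexp (X \<omega>)) * (CLINT \<omega>|M. iexp (v * future \<beta> s t N g \<omega>))"
    by (simp add: exp_add ring_distribs mult_ac)
qed (use past_measurable past_add past_scale past_zero g D G in \<open>auto simp: sets_Filt\<close>)

section \<open>Martingales from independent increments\<close>

text \<open>Independence in the event form delivered by characteristic functions becomes
  independence of two random variables, for which the expectation of the product factorises.\<close>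

lemma (in prob_space) indep_expectation_mult:
  fixes V Y :: "'a \<Rightarrow> real"
  assumes F: "subalgebra M F" and Y[measurable]: "Y \<in> borel_measurable M"
    and ind: "\<And>G D. G \<in> sets F \<Longrightarrow> D \<in> sets borel \<Longrightarrow> prob (G \<inter> (Y -` D \<inter> space M)) = prob G * prob (Y -` D \<inter> space M)"
    and V: "V \<in> borel_measurable F" and iV: "integrable M V" and iY: "integrable M Y"
  shows "integrable M (\<lambda>\<omega>. V \<omega> * Y \<omega>)" "expectation (\<lambda>\<omega>. V \<omega> * Y \<omega>) = expectation V * expectation Y"
proof -
  have spF: "space F = space M" and sF: "sets F \<subseteq> sets M" using F by (auto simp: subalgebra_def)
  have Vm[measurable]: "V \<in> borel_measurable M" using measurable_from_subalg[OF F V] .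
  have sig: "sigma_sets (space M) {X -` A \<inter> space M | A. A \<in> sets borel} = {X -` A \<inter> space M | A. A \<in> sets borel}" for X :: "'a \<Rightarrow> real"
    using sets_vimage_algebra[of "space M" X borel] sets_vimage_algebra2[of X "space M" borel] by auto
  have "indep_var borel V borel Y"
    unfolding indep_var_eq sig
  proof (intro conjI indep_setI)
    show "{V -` A \<inter> space M |A. A \<in> sets borel} \<subseteq> events" "{Y -` A \<inter> space M |A. A \<in> sets borel} \<subseteq> events" by auto
    fix a b assume "a \<in> {V -` A \<inter> space M |A. A \<in> sets borel}" "b \<in> {Y -` A \<inter> space M |A. A \<in> sets borel}"
    then obtain A D where a: "a = V -` A \<inter> space M" "A \<in> sets borel" and b: "b = Y -` D \<inter> space M" "D \<in> sets borel" by blast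
    have "a \<in> sets F" using measurable_sets[OF V a(2)] a(1) spF by simp
    then show "prob (a \<inter> b) = prob a * prob b" using ind b by simp
  qed auto
  then show "integrable M (\<lambda>\<omega>. V \<omega> * Y \<omega>)" "expectation (\<lambda>\<omega>. V \<omega> * Y \<omega>) = expectation V * expectation Y"
    using iV iY by (auto intro: indep_var_integrable indep_var_lebesgue_integral)
qed

text \<open>Conditional expectations are characterised by integrals over the sets of
  \<open>F s\<close>, so it suffices that increments are centred on each such set.\<close>

lemma martingale_by_increments:
  assumes fp: "filtered_prob_space M F" and ad: "adapted F X" and int: "\<And>t. 0 \<le> t \<Longrightarrow> integrable M (X t)"
    and inc: "\<And>s t G. 0 \<le> s \<Longrightarrow> s \<le> t \<Longrightarrow> G \<in> sets (F s) \<Longrightarrow> (\<integral>\<omega>. indicator G \<omega> * (X t \<omega> - X s \<omega>) \<partial>M) = 0"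
  shows "martingale M F X"
  unfolding martingale_def
proof (intro conjI allI impI ad int)
  fix s t :: real assume st: "0 \<le> s" "s \<le> t"
  interpret prob_space M using fp by (simp add: filtered_prob_space_def)
  have sub: "subalgebra M (F s)" using fp by (simp add: filtered_prob_space_def)
  interpret finite_measure_subalgebra M "F s" by (rule finite_measure_subalgebra.intro) (use sub in \<open>auto intro: finite_measure_subalgebra_axioms.intro finite_measure_axioms\<close>)
  show "AE \<omega> in M. real_cond_exp M (F s) (X t) \<omega> = X s \<omega>"
  proof (rule real_cond_exp_charact)
    fix G assume G: "G \<in> sets (F s)"
    then have [measurable]: "G \<in> sets M" using sub by (auto simp: subalgebra_def)
    have i: "integrable M (\<lambda>\<omega>. indicator G \<omega> * X t \<omega>)" "integrable M (\<lambda>\<omega>. indicator G \<omega> * X s \<omega>)"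
      using integrable_real_mult_indicator[of G M "X t"] integrable_real_mult_indicator[of G M "X s"] int st by (auto simp: mult.commute)
    have "(\<integral>\<omega>. indicator G \<omega> * X t \<omega> \<partial>M) - (\<integral>\<omega>. indicator G \<omega> * X s \<omega> \<partial>M) = 0"
      using inc[OF st G] by (subst Bochner_Integration.integral_diff[OF i, symmetric]) (simp add: right_diff_distrib)
    then show "(\<integral>x\<in>G. X t x \<partial>M) = (\<integral>x\<in>G. X s x \<partial>M)" by (simp add: set_lebesgue_integral_def)
  qed (use int st ad in \<open>auto simp: adapted_def\<close>)
qed

lemma adapted_stop_const: "filtered_prob_space M F \<Longrightarrow> adapted F X \<Longrightarrow> 0 \<le> k \<Longrightarrow> 0 \<le> t \<Longrightarrow> X (min k t) \<in> borel_measurable (F t)"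
proof -
  assume fp: "filtered_prob_space M F" and ad: "adapted F X" and kt: "0 \<le> k" "0 \<le> t"
  have "X (min k t) \<in> borel_measurable (F (min k t))" using ad kt by (simp add: adapted_def)
  moreover have "subalgebra (F t) (F (min k t))"
  proof -
    interpret filtration "space M" F using fp by (simp add: filtered_prob_space_def)
    show ?thesis using space_F sets_F_mono[of "min k t" t] by (auto simp: subalgebra_def)
  qed
  ultimately show ?thesis by (metis measurable_from_subalg)
qed

text \<open>The constants \<open>k\<close> localise. Stopping at a constant leaves a process that is
  already frozen at time \<open>s\<close>, or else reduces to the martingale property between
  \<open>s\<close> and \<open>min k t\<close>.\<close>

lemma martingale_imp_local:
  assumes fp: "filtered_prob_space M F" and ca: "cadlag_adapted M F X" and m: "martingale M F X"
  shows "local_martingale M F X"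
  unfolding local_martingale_def
proof (intro conjI ca exI[of _ "\<lambda>k \<omega>. real k"] allI)
  show "stopping_time F (\<lambda>\<omega>. real k)" for k by (rule stopping_time_const)
  show "AE \<omega> in M. mono real \<and> filterlim real at_top sequentially"
    by (auto simp: mono_def filterlim_real_sequentially)
  fix k
  have ad: "adapted F X" using ca by (simp add: cadlag_adapted_def)
  show "martingale M F (\<lambda>t \<omega>. X (min (real k) t) \<omega>)" unfolding martingale_def
  proof (intro conjI allI impI)
    show "adapted F (\<lambda>t \<omega>. X (min (real k) t) \<omega>)"
      unfolding adapted_def using adapted_stop_const[OF fp ad] by (auto simp: adapted_def)
    show "integrable M (X (min (real k) t))" if "0 \<le> t" for t using m that by (simp add: martingale_def)
    fix s t :: real assume st: "0 \<le> s" "s \<le> t"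
    interpret prob_space M using fp by (simp add: filtered_prob_space_def)
    have sub: "subalgebra M (F s)" using fp by (simp add: filtered_prob_space_def)
    interpret finite_measure_subalgebra M "F s" by (rule finite_measure_subalgebra.intro) (use sub in \<open>auto intro: finite_measure_subalgebra_axioms.intro finite_measure_axioms\<close>)
    show "AE \<omega> in M. real_cond_exp M (F s) (X (min (real k) t)) \<omega> = X (min (real k) s) \<omega>"
    proof (cases "real k \<le> s")
      case True
      then have "min (real k) t = min (real k) s" using st by simp
      moreover have "X (min (real k) s) \<in> borel_measurable (F s)" using adapted_stop_const[OF fp ad] st by simp
      moreover have "integrable M (X (min (real k) s))" using m st by (simp add: martingale_def)
      ultimately show ?thesis using real_cond_exp_F_meas by simp
    next
      case False
      then have "min (real k) s = s" "s \<le> min (real k) t" using st by auto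
      then show ?thesis using m st by (simp add: martingale_def)
    qed
  qed
qed auto

section \<open>Regularity of paths and deterministic processes\<close>

lemma cadlag_continuous: "continuous_on {0..} x \<Longrightarrow> cadlag x"
proof -
  assume c: "continuous_on {0..} x"
  have "continuous (at_right t) x" if "0 \<le> t" for t
  proof -
    have "continuous (at t within {0..}) x" using c that by (auto simp: continuous_on_eq_continuous_within)
    then show ?thesis by (rule continuous_within_subset) (use that in auto)
  qed
  moreover have "\<exists>l. (x \<longlongrightarrow> l) (at_left t)" if "0 < t" for t
  proof -
    have "isCont x t" using continuous_on_interior[OF c, of t] that by simp
    then have "(x \<longlongrightarrow> x t) (at_left t)" unfolding isCont_def by (rule tendsto_mono[OF at_le[OF subset_UNIV]])
    then show ?thesis by blast
  qed
  ultimately show ?thesis unfolding cadlag_def by blast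
qed

lemma cadlag_add: "cadlag x \<Longrightarrow> cadlag y \<Longrightarrow> cadlag (\<lambda>t. x t + y t)"
  unfolding cadlag_def by (blast intro: continuous_add tendsto_add)

lemma finite_variation_mono:
  assumes "mono_on {0..} x"
  shows "finite_variation x"
  unfolding finite_variation_def
proof (intro allI impI)
  fix t :: real assume t: "0 \<le> t"
  show "\<exists>K. \<forall>(s :: nat \<Rightarrow> real) m. mono s \<longrightarrow> range s \<subseteq> {0..t} \<longrightarrow> (\<Sum>i<m. \<bar>x (s (Suc i)) - x (s i)\<bar>) \<le> K"
  proof (intro exI allI impI)
    fix s :: "nat \<Rightarrow> real" and m assume s: "mono s" "range s \<subseteq> {0..t}"
    have r: "0 \<le> s i" "s i \<le> t" for i using s(2) by (auto simp: image_subset_iff)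
    have "(\<Sum>i<m. \<bar>x (s (Suc i)) - x (s i)\<bar>) = (\<Sum>i<m. x (s (Suc i)) - x (s i))"
    proof (rule sum.cong[OF refl])
      fix i
      have "x (s i) \<le> x (s (Suc i))" using assms r s(1) by (auto simp: mono_on_def mono_def)
      then show "\<bar>x (s (Suc i)) - x (s i)\<bar> = x (s (Suc i)) - x (s i)" by simp
    qed
    also have "\<dots> = x (s m) - x (s 0)" by (rule sum_lessThan_telescope)
    also have "\<dots> \<le> x t - x 0" using assms r t by (intro diff_mono) (auto simp: mono_on_def)
    finally show "(\<Sum>i<m. \<bar>x (s (Suc i)) - x (s i)\<bar>) \<le> x t - x 0" .
  qed
qed

lemma predictable_process_left_continuous:
  assumes "adapted F Y" "\<And>\<omega>. \<omega> \<in> space M \<Longrightarrow> left_continuous (\<lambda>t. Y t \<omega>)"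
  shows "predictable_process M F Y"
  unfolding predictable_process_def
proof (rule measurableI)
  have sp: "space (predictable_sigma M F) = space M \<times> {0..}"
    unfolding predictable_sigma_def by (rule space_measure_of) auto
  fix D :: "real set" assume D: "D \<in> sets borel"
  have "(\<lambda>(\<omega>, t). Y t \<omega>) -` D \<inter> space (predictable_sigma M F) = {(\<omega>, t). \<omega> \<in> space M \<and> 0 \<le> t \<and> Y t \<omega> \<in> D}"
    unfolding sp by auto
  also have "\<dots> \<in> sets (predictable_sigma M F)"
    unfolding predictable_sigma_def by (subst sets_measure_of, blast, rule sigma_sets.Basic) (use assms D in blast)
  finally show "(\<lambda>(\<omega>, t). Y t \<omega>) -` D \<inter> space (predictable_sigma M F) \<in> sets (predictable_sigma M F)" .
qed simp

lemma optional_process_const: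
  "filtered_prob_space M F \<Longrightarrow> optional_process M F (\<lambda>t \<omega>. c :: 'b :: topological_space)"
  by (simp add: optional_process_def case_prod_unfold)

lemma local_martingale_const:
  assumes "filtered_prob_space M F" shows "local_martingale M F (\<lambda>t \<omega>. c)"
proof (rule martingale_imp_local[OF assms])
  interpret prob_space M using assms by (simp add: filtered_prob_space_def)
  show "cadlag_adapted M F (\<lambda>t \<omega>. c)"
    by (auto simp: cadlag_adapted_def adapted_def intro!: cadlag_continuous)
  show "martingale M F (\<lambda>t \<omega>. c)"
    by (rule martingale_by_increments[OF assms]) (auto simp: adapted_def)
qed

section \<open>Jumps and paths\<close>

definition (in noise) cut :: "(real \<Rightarrow> 'b::zero) \<Rightarrow> real \<Rightarrow> real \<times> real \<Rightarrow> 'b" where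
  "cut h t = (\<lambda>(u, x). if u \<le> t then h x else 0)"

text \<open>The sum of \<open>h\<close> over the sizes of the jumps up to time \<open>t\<close>; for
  the identity \<open>h\<close> it is the compound Poisson process itself.\<close>

definition (in noise) Z :: "(real \<Rightarrow> 'b::comm_monoid_add) \<Rightarrow> real \<Rightarrow> 'a \<Rightarrow> 'b" where
  "Z h t \<omega> = PI (nat \<lceil>t\<rceil>) (cut h t) \<omega>"

definition (in noise) points :: "nat \<Rightarrow> 'a \<Rightarrow> (nat \<times> nat) set" where
  "points N \<omega> = Sigma {..<N} (\<lambda>k. {..<K k \<omega>})"

definition (in noise) u_of :: "'a \<Rightarrow> nat \<times> nat \<Rightarrow> real" where "u_of \<omega> p = U (fst p) (snd p) \<omega>"
definition (in noise) j_of :: "'a \<Rightarrow> nat \<times> nat \<Rightarrow> real" where "j_of \<omega> p = J (fst p) (snd p) \<omega>"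

lemma (in noise) finite_points[simp]: "finite (points N \<omega>)" by (simp add: points_def)

lemma (in noise) PI_points: "PI N f \<omega> = (\<Sum>p\<in>points N \<omega>. f (u_of \<omega> p, j_of \<omega> p))"
  unfolding PI_def points_def u_of_def j_of_def by (subst sum.Sigma) (auto intro: sum.cong)

lemma (in noise) u_of_inj: "\<omega> \<in> space M \<Longrightarrow> inj_on (u_of \<omega>) A"
  using U_inj unfolding u_of_def inj_on_def by (metis prod.collapse)

lemma (in noise) u_of_pos: "\<omega> \<in> space M \<Longrightarrow> 0 < u_of \<omega> p"
  using U_bounds(1)[of \<omega> "fst p" "snd p"] unfolding u_of_def by (meson of_nat_0_le_iff order_le_less_trans)

lemma (in noise) j_of_nz: "\<omega> \<in> space M \<Longrightarrow> j_of \<omega> p \<noteq> 0"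
  using J_nz by (simp add: j_of_def)

lemma (in noise) cut_measurable[measurable]:
  fixes h :: "real \<Rightarrow> 'b::{zero,topological_space}"
  assumes [measurable]: "h \<in> borel_measurable borel"
  shows "cut h t \<in> borel_measurable (borel \<Otimes>\<^sub>M borel)"
  unfolding cut_def by measurable

lemma (in noise) Z_eq_PI: 
  assumes "\<omega> \<in> space M" "t \<le> real N" shows "Z h t \<omega> = PI N (cut h t) \<omega>"
  unfolding Z_def
proof (rule PI_extend[symmetric, OF assms(1)])
  show "nat \<lceil>t\<rceil> \<le> N" using assms(2) by (simp add: ceiling_le_iff nat_le_iff)
  fix u x assume "real (nat \<lceil>t\<rceil>) < u"
  then have "t < u" by linarith
  then show "cut h t (u, x) = 0" by (simp add: cut_def)
qed

lemma (in noise) Z_points: 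
  assumes "\<omega> \<in> space M" "t \<le> real N" 
  shows "Z h t \<omega> = (\<Sum>p\<in>points N \<omega>. if u_of \<omega> p \<le> t then h (j_of \<omega> p) else 0)"
  unfolding Z_eq_PI[OF assms] PI_points by (simp add: cut_def)

lemma (in noise) Z_nonpos: "\<omega> \<in> space M \<Longrightarrow> t \<le> 0 \<Longrightarrow> Z h t \<omega> = 0"
  using Z_points[of \<omega> t 0 h] by (simp add: points_def)

lemma (in noise) Z_right:
  fixes h :: "real \<Rightarrow> real"
  assumes "\<omega> \<in> space M"
  shows "((\<lambda>s. Z h s \<omega>) \<longlongrightarrow> Z h t \<omega>) (at_right t)"
proof -
  obtain N where N: "t < real N" using reals_Archimedean2 by blast
  let ?f = "\<lambda>s. \<Sum>p\<in>points N \<omega>. if u_of \<omega> p \<le> s then h (j_of \<omega> p) else 0"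
  have "(?f \<longlongrightarrow> ?f t) (at_right t)"
  proof (rule tendsto_sum)
    fix p
    have "\<forall>\<^sub>F s in at_right t. (if u_of \<omega> p \<le> s then h (j_of \<omega> p) else 0) = (if u_of \<omega> p \<le> t then h (j_of \<omega> p) else 0)"
    proof (cases "u_of \<omega> p \<le> t")
      case True
      from eventually_at_right_less[of t] show ?thesis by eventually_elim (use True in auto)
    next
      case False
      then have "\<forall>\<^sub>F s in at_right t. s < u_of \<omega> p" by (intro eventually_at_right[THEN iffD2, of t "u_of \<omega> p"] exI[of _ "u_of \<omega> p"]) auto
      then show ?thesis by eventually_elim (use False in auto)
    qed
    then show "((\<lambda>s. if u_of \<omega> p \<le> s then h (j_of \<omega> p) else 0) \<longlongrightarrow> (if u_of \<omega> p \<le> t then h (j_of \<omega> p) else 0)) (at_right t)"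
      by (rule tendsto_eventually)
  qed
  moreover have "\<forall>\<^sub>F s in at_right t. ?f s = Z h s \<omega>"
  proof -
    have "\<forall>\<^sub>F s in at_right t. s < real N" using N by (auto simp: eventually_at_right)
    then show ?thesis by eventually_elim (rule Z_points[symmetric, OF assms], simp)
  qed
  ultimately have "((\<lambda>s. Z h s \<omega>) \<longlongrightarrow> ?f t) (at_right t)" by (rule Lim_transform_eventually)
  then show ?thesis using Z_points[OF assms, of t N h] N by simp
qed

lemma (in noise) Z_left:
  fixes h :: "real \<Rightarrow> real"
  assumes "\<omega> \<in> space M" "t \<le> real N"
  shows "((\<lambda>s. Z h s \<omega>) \<longlongrightarrow> (\<Sum>p\<in>points N \<omega>. if u_of \<omega> p < t then h (j_of \<omega> p) else 0)) (at_left t)"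
proof -
  let ?f = "\<lambda>s. \<Sum>p\<in>points N \<omega>. if u_of \<omega> p \<le> s then h (j_of \<omega> p) else 0"
  have "(?f \<longlongrightarrow> (\<Sum>p\<in>points N \<omega>. if u_of \<omega> p < t then h (j_of \<omega> p) else 0)) (at_left t)"
  proof (rule tendsto_sum)
    fix p
    have lt: "\<forall>\<^sub>F s in at_left t. s < t" by (simp add: eventually_at_filter)
    have "\<forall>\<^sub>F s in at_left t. (if u_of \<omega> p \<le> s then h (j_of \<omega> p) else 0) = (if u_of \<omega> p < t then h (j_of \<omega> p) else 0)"
    proof (cases "u_of \<omega> p < t")
      case True
      then have "\<forall>\<^sub>F s in at_left t. u_of \<omega> p < s" by (auto simp: eventually_at_left)
      then show ?thesis by eventually_elim (use True in auto)
    next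
      case False
      from lt show ?thesis by eventually_elim (use False in auto)
    qed
    then show "((\<lambda>s. if u_of \<omega> p \<le> s then h (j_of \<omega> p) else 0) \<longlongrightarrow> (if u_of \<omega> p < t then h (j_of \<omega> p) else 0)) (at_left t)"
      by (rule tendsto_eventually)
  qed
  moreover have "\<forall>\<^sub>F s in at_left t. ?f s = Z h s \<omega>"
  proof -
    have "\<forall>\<^sub>F s in at_left t. s < t" by (simp add: eventually_at_filter)
    then show ?thesis by eventually_elim (rule Z_points[symmetric, OF assms(1)], use assms(2) in simp)
  qed
  ultimately show ?thesis by (rule Lim_transform_eventually)
qed

lemma (in noise) B_continuous: "\<omega> \<in> space M \<Longrightarrow> continuous_on A (\<lambda>t. B t \<omega>)"
  using continuous_on_bm good unfolding B_def noise_good_def by (blast intro: continuous_on_subset)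

lemma (in noise) B_zero: "t \<le> 0 \<Longrightarrow> B t \<omega> = 0" by (simp add: B_def bm_nonpos)

lemma (in noise) Z_cadlag: "\<omega> \<in> space M \<Longrightarrow> cadlag (\<lambda>t. Z h t \<omega>)" for h :: "real \<Rightarrow> real"
  unfolding cadlag_def continuous_within
proof (intro conjI allI impI Z_right)
  fix t :: real assume "\<omega> \<in> space M"
  obtain N where N: "t < real N" using reals_Archimedean2 by blast
  then show "\<exists>l. ((\<lambda>t. Z h t \<omega>) \<longlongrightarrow> l) (at_left t)"
    using Z_left[OF \<open>\<omega> \<in> space M\<close>, of t N h] by auto
qed

definition (in noise) X :: "real \<Rightarrow> real \<Rightarrow> 'a \<Rightarrow> real" where
  "X \<sigma> t \<omega> = \<sigma> * B t \<omega> + Z (\<lambda>x. x) t \<omega>"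

lemma (in noise) X_jump:
  assumes \<omega>: "\<omega> \<in> space M" and t: "t \<le> real N"
  shows "jump (\<lambda>u. X \<sigma> u \<omega>) t = (\<Sum>p\<in>points N \<omega>. if u_of \<omega> p = t then j_of \<omega> p else 0)"
proof -
  let ?l = "\<sigma> * B t \<omega> + (\<Sum>p\<in>points N \<omega>. if u_of \<omega> p < t then j_of \<omega> p else 0)"
  have "isCont (\<lambda>t. B t \<omega>) t" using B_continuous[OF \<omega>, of UNIV] by (simp add: continuous_on_eq_continuous_at)
  then have "((\<lambda>t. B t \<omega>) \<longlongrightarrow> B t \<omega>) (at_left t)" unfolding isCont_def by (rule tendsto_mono[OF at_le[OF subset_UNIV]])
  then have "((\<lambda>u. X \<sigma> u \<omega>) \<longlongrightarrow> ?l) (at_left t)"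
    unfolding X_def by (intro tendsto_intros Z_left[OF \<omega> t])
  then have "Lim (at_left t) (\<lambda>u. X \<sigma> u \<omega>) = ?l" by (intro tendsto_Lim) (auto simp: trivial_limit_at_left_real)
  then have "jump (\<lambda>u. X \<sigma> u \<omega>) t = (\<Sum>p\<in>points N \<omega>. (if u_of \<omega> p \<le> t then j_of \<omega> p else 0) - (if u_of \<omega> p < t then j_of \<omega> p else 0))"
    unfolding jump_def by (simp add: X_def Z_points[OF \<omega> t] sum_subtractf)
  also have "\<dots> = (\<Sum>p\<in>points N \<omega>. if u_of \<omega> p = t then j_of \<omega> p else 0)"
    by (intro sum.cong) auto
  finally show ?thesis .
qed

definition (in noise) all_points :: "'a \<Rightarrow> (nat \<times> nat) set" where "all_points \<omega> = (\<Union>N. points N \<omega>)"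

lemma (in noise) X_jump_at:
  assumes \<omega>: "\<omega> \<in> space M" and p: "p \<in> all_points \<omega>"
  shows "jump (\<lambda>u. X \<sigma> u \<omega>) (u_of \<omega> p) = j_of \<omega> p"
proof -
  obtain N0 where N0: "p \<in> points N0 \<omega>" using p by (auto simp: all_points_def)
  obtain N1 where N1: "u_of \<omega> p < real N1" using reals_Archimedean2 by blast
  let ?N = "max N0 N1"
  have pN: "p \<in> points ?N \<omega>" using N0 by (auto simp: points_def)
  have "jump (\<lambda>u. X \<sigma> u \<omega>) (u_of \<omega> p) = (\<Sum>q\<in>points ?N \<omega>. if u_of \<omega> q = u_of \<omega> p then j_of \<omega> q else 0)"
    using N1 by (intro X_jump[OF \<omega>]) auto
  also have "\<dots> = (\<Sum>q\<in>points ?N \<omega>. if q = p then j_of \<omega> q else 0)"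
  proof (intro sum.cong refl if_cong)
    fix q show "(u_of \<omega> q = u_of \<omega> p) = (q = p)"
      using inj_onD[OF u_of_inj[OF \<omega>, of UNIV], of q p] by auto
  qed
  also have "\<dots> = j_of \<omega> p" using pN by simp
  finally show ?thesis .
qed

text \<open>Distinct jump times keep marks from cancelling, and nonzero sizes make every mark
  visible. Therefore the jumps of the path are exactly the coded marks.\<close>

lemma (in noise) X_jump_support:
  assumes \<omega>: "\<omega> \<in> space M" shows "{s. 0 < s \<and> jump (\<lambda>u. X \<sigma> u \<omega>) s \<noteq> 0} = u_of \<omega> ` all_points \<omega>"
proof (intro equalityI subsetI)
  fix s assume "s \<in> {s. 0 < s \<and> jump (\<lambda>u. X \<sigma> u \<omega>) s \<noteq> 0}"
  then have nz: "jump (\<lambda>u. X \<sigma> u \<omega>) s \<noteq> 0" by simp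
  obtain N where N: "s < real N" using reals_Archimedean2 by blast
  have nz': "(\<Sum>p\<in>points N \<omega>. if u_of \<omega> p = s then j_of \<omega> p else 0) \<noteq> 0" using nz X_jump[OF \<omega>, of s N \<sigma>] N by simp
  have "\<exists>p\<in>points N \<omega>. u_of \<omega> p = s"
  proof (rule ccontr)
    assume "\<not> (\<exists>p\<in>points N \<omega>. u_of \<omega> p = s)"
    then have "(\<Sum>p\<in>points N \<omega>. if u_of \<omega> p = s then j_of \<omega> p else 0) = 0" by (intro sum.neutral) auto
    with nz' show False by simp
  qed
  then obtain p where "p \<in> points N \<omega>" "u_of \<omega> p = s" by blast
  then show "s \<in> u_of \<omega> ` all_points \<omega>" by (auto simp: all_points_def)
next
  fix s assume "s \<in> u_of \<omega> ` all_points \<omega>"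
  then show "s \<in> {s. 0 < s \<and> jump (\<lambda>u. X \<sigma> u \<omega>) s \<noteq> 0}" 
    using X_jump_at[OF \<omega>] u_of_pos[OF \<omega>] j_of_nz[OF \<omega>] by auto
qed

lemma (in noise) points_upto:
  assumes \<omega>: "\<omega> \<in> space M" and t: "t \<le> real N" shows "{p\<in>all_points \<omega>. u_of \<omega> p \<le> t} = {p\<in>points N \<omega>. u_of \<omega> p \<le> t}"
proof -
  have "p \<in> points N \<omega>" if "p \<in> all_points \<omega>" "u_of \<omega> p \<le> t" for p
  proof -
    have "real (fst p) < real N" using U_bounds(1)[OF \<omega>, of "fst p" "snd p"] that(2) t by (simp add: u_of_def)
    then show ?thesis using that(1) by (auto simp: all_points_def points_def)
  qed
  then show ?thesis by (auto simp: all_points_def)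
qed

text \<open>Deleting the jumps larger than one means applying the odd truncation to each size. In
  this form the truncated process falls under the martingale criterion for odd
  \<open>h\<close>.\<close>

lemma (in noise) truncated_X:
  assumes \<omega>: "\<omega> \<in> space M" 
  shows "truncated (X \<sigma>) t \<omega> = \<sigma> * B t \<omega> + Z (\<lambda>x. if \<bar>x\<bar> \<le> 1 then x else 0) t \<omega>"
proof -
  obtain N where N: "t < real N" using reals_Archimedean2 by blast
  let ?P = "{p\<in>points N \<omega>. u_of \<omega> p \<le> t \<and> 1 < \<bar>j_of \<omega> p\<bar>}"
  have set: "{s. 0 < s \<and> s \<le> t \<and> 1 < \<bar>jump (\<lambda>u. X \<sigma> u \<omega>) s\<bar>} = u_of \<omega> ` ?P"
  proof (intro equalityI subsetI)
    fix s assume s: "s \<in> {s. 0 < s \<and> s \<le> t \<and> 1 < \<bar>jump (\<lambda>u. X \<sigma> u \<omega>) s\<bar>}"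
    then have "s \<in> {s. 0 < s \<and> jump (\<lambda>u. X \<sigma> u \<omega>) s \<noteq> 0}" by auto
    then obtain p where p: "p \<in> all_points \<omega>" "s = u_of \<omega> p" unfolding X_jump_support[OF \<omega>] by auto
    then have "p \<in> {p\<in>all_points \<omega>. u_of \<omega> p \<le> t}" using s by auto
    then show "s \<in> u_of \<omega> ` ?P" using s p X_jump_at[OF \<omega> p(1), of \<sigma>] unfolding points_upto[OF \<omega> less_imp_le[OF N]] by auto
  next
    fix s assume "s \<in> u_of \<omega> ` ?P"
    then obtain p where p: "p \<in> ?P" "s = u_of \<omega> p" by auto
    then have "p \<in> all_points \<omega>" by (auto simp: all_points_def)
    then show "s \<in> {s. 0 < s \<and> s \<le> t \<and> 1 < \<bar>jump (\<lambda>u. X \<sigma> u \<omega>) s\<bar>}"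
      using p X_jump_at[OF \<omega>, of p \<sigma>] u_of_pos[OF \<omega>, of p] by auto
  qed
  have "(\<Sum>s\<in>u_of \<omega> ` ?P. jump (\<lambda>u. X \<sigma> u \<omega>) s) = (\<Sum>p\<in>?P. jump (\<lambda>u. X \<sigma> u \<omega>) (u_of \<omega> p))"
    by (subst sum.reindex[OF u_of_inj[OF \<omega>]]) simp
  also have "\<dots> = (\<Sum>p\<in>?P. j_of \<omega> p)"
    by (intro sum.cong refl X_jump_at[OF \<omega>]) (auto simp: all_points_def)
  also have "\<dots> = (\<Sum>p\<in>points N \<omega>. if u_of \<omega> p \<le> t \<and> 1 < \<bar>j_of \<omega> p\<bar> then j_of \<omega> p else 0)"
    by (rule sum.inter_filter) simp
  finally have "truncated (X \<sigma>) t \<omega> = \<sigma> * B t \<omega> + (Z (\<lambda>x. x) t \<omega> - (\<Sum>p\<in>points N \<omega>. if u_of \<omega> p \<le> t \<and> 1 < \<bar>j_of \<omega> p\<bar> then j_of \<omega> p else 0))"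
    unfolding truncated_def set by (simp add: X_def)
  also have "Z (\<lambda>x. x) t \<omega> - (\<Sum>p\<in>points N \<omega>. if u_of \<omega> p \<le> t \<and> 1 < \<bar>j_of \<omega> p\<bar> then j_of \<omega> p else 0) = Z (\<lambda>x. if \<bar>x\<bar> \<le> 1 then x else 0) t \<omega>"
    unfolding Z_points[OF \<omega> less_imp_le[OF N]] sum_subtractf[symmetric] by (intro sum.cong) auto
  finally show ?thesis .
qed

text \<open>Each mark enters the sum once: its indicator is monotone in time, so along any partition
  its contribution telescopes to at most \<open>\<bar>h\<bar>\<close> at its size.\<close>

lemma (in noise) Z_finite_variation:
  fixes h :: "real \<Rightarrow> real"
  assumes \<omega>: "\<omega> \<in> space M" 
  shows "finite_variation (\<lambda>t. Z h t \<omega>)"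
  unfolding finite_variation_def
proof (intro allI impI)
  fix t :: real assume "0 \<le> t"
  obtain N where N: "t < real N" using reals_Archimedean2 by blast
  show "\<exists>C. \<forall>(s :: nat \<Rightarrow> real) m. mono s \<longrightarrow> range s \<subseteq> {0..t} \<longrightarrow> (\<Sum>i<m. \<bar>Z h (s (Suc i)) \<omega> - Z h (s i) \<omega>\<bar>) \<le> C"
  proof (intro exI allI impI)
    fix s :: "nat \<Rightarrow> real" and m assume s: "mono s" "range s \<subseteq> {0..t}"
    have sN: "s i \<le> real N" for i
    proof -
      have "s i \<le> t" using s(2) by (auto simp: image_subset_iff)
      then show ?thesis using N by linarith
    qed
    let ?i = "\<lambda>p r. if u_of \<omega> p \<le> r then 1 else 0 :: real"
    have step: "\<bar>Z h (s (Suc i)) \<omega> - Z h (s i) \<omega>\<bar> \<le> (\<Sum>p\<in>points N \<omega>. \<bar>h (j_of \<omega> p)\<bar> * (?i p (s (Suc i)) - ?i p (s i)))" for i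
    proof -
      have le: "s i \<le> s (Suc i)" using s(1) by (simp add: mono_def)
      have eq: "Z h (s (Suc i)) \<omega> - Z h (s i) \<omega> = (\<Sum>p\<in>points N \<omega>. h (j_of \<omega> p) * (?i p (s (Suc i)) - ?i p (s i)))"
        unfolding Z_points[OF \<omega> sN] sum_subtractf[symmetric] by (intro sum.cong) auto
      have "\<bar>Z h (s (Suc i)) \<omega> - Z h (s i) \<omega>\<bar> \<le> (\<Sum>p\<in>points N \<omega>. \<bar>h (j_of \<omega> p) * (?i p (s (Suc i)) - ?i p (s i))\<bar>)" unfolding eq by (rule sum_abs)
      also have "\<dots> = (\<Sum>p\<in>points N \<omega>. \<bar>h (j_of \<omega> p)\<bar> * (?i p (s (Suc i)) - ?i p (s i)))"
        using le by (intro sum.cong) (auto simp: abs_mult)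
      finally show ?thesis .
    qed
    have "(\<Sum>i<m. \<bar>Z h (s (Suc i)) \<omega> - Z h (s i) \<omega>\<bar>) \<le> (\<Sum>i<m. \<Sum>p\<in>points N \<omega>. \<bar>h (j_of \<omega> p)\<bar> * (?i p (s (Suc i)) - ?i p (s i)))"
      by (rule sum_mono[OF step])
    also have "\<dots> = (\<Sum>p\<in>points N \<omega>. \<bar>h (j_of \<omega> p)\<bar> * (\<Sum>i<m. ?i p (s (Suc i)) - ?i p (s i)))"
      by (subst sum.swap) (simp only: sum_distrib_left)
    also have "\<dots> = (\<Sum>p\<in>points N \<omega>. \<bar>h (j_of \<omega> p)\<bar> * (?i p (s m) - ?i p (s 0)))"
      using sum_lessThan_telescope[of "\<lambda>i. ?i p (s i)" m for p] by simp
    also have "\<dots> \<le> (\<Sum>p\<in>points N \<omega>. \<bar>h (j_of \<omega> p)\<bar> * 1)"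
      by (intro sum_mono mult_left_mono) auto
    finally show "(\<Sum>i<m. \<bar>Z h (s (Suc i)) \<omega> - Z h (s i) \<omega>\<bar>) \<le> (\<Sum>p\<in>points N \<omega>. \<bar>h (j_of \<omega> p)\<bar> * 1)" .
  qed
qed

section \<open>Increments over a time window and their intensity\<close>

lemma (in noise) BZ_past:
  assumes "0 \<le> t" and [measurable]: "h \<in> borel_measurable borel"
  shows "(\<lambda>\<omega>. \<sigma> * B t \<omega> + Z h t \<omega>) \<in> past t"
  unfolding past_def
proof (intro CollectI exI conjI)
  show "(\<lambda>\<omega>. \<sigma> * B t \<omega> + Z h t \<omega>) = (\<lambda>\<omega>. Bsum {t} (\<lambda>_. \<sigma>) \<omega> + PI (nat \<lceil>t\<rceil>) (cut h t) \<omega>)"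
    by (simp add: Bsum_def Z_def)
qed (use assms in \<open>auto simp: cut_def[of h t]\<close>, measurable)

definition (in noise) window :: "(real \<Rightarrow> 'b::zero) \<Rightarrow> real \<Rightarrow> real \<Rightarrow> real \<times> real \<Rightarrow> 'b" where
  "window h s t = (\<lambda>(u, x). if s < u \<and> u \<le> t then h x else 0)"

lemma (in noise) window_measurable[measurable]:
  fixes h :: "real \<Rightarrow> 'b::{zero,topological_space}"
  assumes [measurable]: "h \<in> borel_measurable borel"
  shows "window h s t \<in> borel_measurable (borel \<Otimes>\<^sub>M borel)"
  unfolding window_def by measurable

lemma (in noise) window_zero: "u \<le> s \<Longrightarrow> window h s t (u, x) = 0" "real (nat \<lceil>t\<rceil>) < u \<Longrightarrow> window h s t (u, x) = 0"
  by (auto simp: window_def dest: order.strict_trans1[OF real_nat_ceiling_ge])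

lemma (in noise) BZ_increment:
  fixes h :: "real \<Rightarrow> real"
  assumes \<omega>: "\<omega> \<in> space M" and st: "s \<le> t"
  shows "(\<sigma> * B t \<omega> + Z h t \<omega>) - (\<sigma> * B s \<omega> + Z h s \<omega>) = future \<sigma> s t (nat \<lceil>t\<rceil>) (window h s t) \<omega>"
proof -
  have t: "t \<le> real (nat \<lceil>t\<rceil>)" by linarith
  then have s: "s \<le> real (nat \<lceil>t\<rceil>)" using st by linarith
  have "Z h t \<omega> - Z h s \<omega> = PI (nat \<lceil>t\<rceil>) (window h s t) \<omega>"
    unfolding Z_points[OF \<omega> t] Z_points[OF \<omega> s] PI_points sum_subtractf[symmetric] window_def
    using st by (intro sum.cong) auto
  then show ?thesis by (simp add: future_def algebra_simps)
qed

lemma poisson0_mean: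
  assumes lam: "0 \<le> lam"
  shows "(\<integral>\<^sup>+n. of_nat n \<partial>measure_pmf (poisson0 lam)) = ennreal lam"
proof -
  let ?g = "\<lambda>n. pmf (poisson0 lam) n * real n"
  have "(\<lambda>n. lam * (exp (- lam) * (lam ^ n /\<^sub>R fact n))) sums (lam * (exp (- lam) * exp lam))"
    by (intro sums_mult exp_converges)
  moreover have "?g (Suc n) = lam * (exp (- lam) * (lam ^ n /\<^sub>R fact n))" for n
  proof -
    have "real (Suc n) / fact (Suc n) = 1 / fact n" by (simp add: fact_Suc del: of_nat_Suc)
    moreover have "?g (Suc n) = lam ^ Suc n * exp (- lam) * (real (Suc n) / fact (Suc n))"
      by (simp only: pmf_poisson0[OF lam]) simp
    ultimately show ?thesis by (simp only:) (simp add: field_simps)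
  qed
  ultimately have "(\<lambda>n. ?g (Suc n)) sums lam" by (simp add: mult_exp_exp)
  then have g: "?g sums lam" by (subst (asm) sums_Suc_iff) simp
  have "(\<integral>\<^sup>+n. of_nat n \<partial>measure_pmf (poisson0 lam)) = (\<Sum>n. ennreal (?g n))"
    by (simp add: nn_integral_measure_pmf nn_integral_count_space_nat ennreal_mult' ennreal_of_nat_eq_real_of_nat)
  also have "\<dots> = ennreal (\<Sum>n. ?g n)" using g by (intro suminf_ennreal2) (auto simp: sums_iff)
  finally show ?thesis using g by (simp add: sums_iff)
qed

text \<open>Campbell's formula. The count of a unit interval is independent of each of its marks,
  and all these marks share one law, so the expected sum is the mean count times the expectation for
  a single mark.\<close>

lemma (in noise) nn_PI:
  fixes h :: "real \<times> real \<Rightarrow> ennreal"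
  assumes h[measurable]: "h \<in> borel_measurable (borel \<Otimes>\<^sub>M borel)"
  shows "(\<integral>\<^sup>+\<omega>. PI N h \<omega> \<partial>M) = ennreal lam * (\<Sum>k<N. \<integral>\<^sup>+\<omega>. h (mark k 0 \<omega>) \<partial>M)"
proof -
  have block: "(\<integral>\<^sup>+\<omega>. (\<Sum>i<K k \<omega>. h (mark k i \<omega>)) \<partial>M) = ennreal lam * (\<integral>\<^sup>+\<omega>. h (mark k 0 \<omega>) \<partial>M)" for k
  proof -
    let ?I = "\<lambda>i \<omega>. if i < K k \<omega> then 1 else 0 :: ennreal"
    \<comment> \<open>The random sum is written as a series with the indicators of
      \<open>i < K k \<omega>\<close>, so that count and mark separate term by term.\<close>
    have eq: "(\<Sum>i<K k \<omega>. g i) = (\<Sum>i. ?I i \<omega> * g i)" for g :: "nat \<Rightarrow> ennreal" and \<omega>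
      by (subst suminf_finite[of "{..<K k \<omega>}"]) auto
    have Im: "?I i \<in> borel_measurable M" for i
      using measurable_compose[OF K_measurable[of k], of "\<lambda>n. if i < n then 1 else 0 :: ennreal" borel] by simp
    have prod: "(\<integral>\<^sup>+\<omega>. ?I i \<omega> * h (mark k i \<omega>) \<partial>M) = (\<integral>\<^sup>+\<omega>. ?I i \<omega> \<partial>M) * (\<integral>\<^sup>+\<omega>. h (mark k i \<omega>) \<partial>M)" for i
    proof -
      define G :: "bool \<Rightarrow> (nat \<times> nat \<times> nat) set" where 
        "G b = (if b then {(1,k,0)} else {(2,k,i),(3,k,i)})" for b
      define Y :: "bool \<Rightarrow> (nat \<times> nat \<times> nat \<Rightarrow> real) \<Rightarrow> ennreal" where 
        "Y b x = (if b then (if i < nat \<lfloor>x (1,k,0)\<rfloor> then 1 else 0) else h (x (2,k,i), x (3,k,i)))" for b x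
      have ind: "indep_vars (\<lambda>_. borel) (\<lambda>l \<omega>. Y l (restrict (\<lambda>p. R p \<omega>) (G l))) UNIV"
      proof (rule group_indep)
        show "disjoint_family_on G UNIV" by (auto simp: disjoint_family_on_def G_def split: if_splits)
        fix l show "Y l \<in> borel_measurable (PiM (G l) (\<lambda>_. borel))"
        proof (cases l)
          case True
          have [measurable]: "(\<lambda>x. x (1,k,0)) \<in> borel_measurable (PiM {(1::nat,k,0::nat)} (\<lambda>_. borel :: real measure))"
            by (rule measurable_component_singleton) simp
          show ?thesis using True unfolding Y_def G_def by simp
        next
          case False
          have [measurable]: "(\<lambda>x. x (2,k,i)) \<in> borel_measurable (PiM {(2::nat,k,i),(3,k,i)} (\<lambda>_. borel :: real measure))"
            "(\<lambda>x. x (3,k,i)) \<in> borel_measurable (PiM {(2::nat,k,i),(3,k,i)} (\<lambda>_. borel :: real measure))"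
            by (rule measurable_component_singleton, simp)+
          show ?thesis using False unfolding Y_def G_def by simp
        qed
      qed
      have YT: "Y True (restrict (\<lambda>p. R p \<omega>) (G True)) = ?I i \<omega>" for \<omega> by (simp add: Y_def G_def K_def)
      have YF: "Y False (restrict (\<lambda>p. R p \<omega>) (G False)) = h (mark k i \<omega>)" for \<omega> by (simp add: Y_def G_def U_def J_def)
      have "(\<integral>\<^sup>+\<omega>. (\<Prod>l\<in>UNIV. Y l (restrict (\<lambda>p. R p \<omega>) (G l))) \<partial>M) = (\<Prod>l\<in>UNIV. \<integral>\<^sup>+\<omega>. Y l (restrict (\<lambda>p. R p \<omega>) (G l)) \<partial>M)"
        by (rule indep_vars_nn_integral[OF _ ind]) auto
      then show ?thesis by (simp only: UNIV_bool prod.insert finite.intros YT YF) (simp add: YT YF mult.commute)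
    qed
    define H where "H = (\<integral>\<^sup>+\<omega>. h (mark k 0 \<omega>) \<partial>M)"
    have mH: "(\<integral>\<^sup>+\<omega>. h (mark k i \<omega>) \<partial>M) = H" for i unfolding H_def by (rule nn_integral_mark[OF h])
    have "(\<integral>\<^sup>+\<omega>. (\<Sum>i<K k \<omega>. h (mark k i \<omega>)) \<partial>M) = (\<Sum>i. \<integral>\<^sup>+\<omega>. ?I i \<omega> * h (mark k i \<omega>) \<partial>M)"
    proof -
      have "(\<lambda>\<omega>. ?I i \<omega> * h (mark k i \<omega>)) \<in> borel_measurable M" for i
        by (intro borel_measurable_times_ennreal Im) measurable
      then show ?thesis by (simp only: eq nn_integral_suminf)
    qed
    also have "\<dots> = (\<Sum>i. (\<integral>\<^sup>+\<omega>. ?I i \<omega> \<partial>M) * H)" by (simp only: prod mH)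
    also have "\<dots> = (\<Sum>i. (\<integral>\<^sup>+\<omega>. ?I i \<omega> \<partial>M)) * H" by (rule ennreal_suminf_multc)
    also have "(\<Sum>i. (\<integral>\<^sup>+\<omega>. ?I i \<omega> \<partial>M)) = (\<integral>\<^sup>+\<omega>. (\<Sum>i. ?I i \<omega>) \<partial>M)"
      by (rule nn_integral_suminf[symmetric, OF Im])
    also have "\<dots> = (\<integral>\<^sup>+\<omega>. of_nat (K k \<omega>) \<partial>M)"
    proof -
      have "(\<Sum>i. ?I i \<omega>) = of_nat (K k \<omega>)" for \<omega> using eq[of "\<lambda>_. 1" \<omega>, symmetric] by simp
      then show ?thesis by (simp only:)
    qed
    also have "\<dots> = (\<integral>\<^sup>+x. of_nat (nat \<lfloor>x\<rfloor>) \<partial>distr M borel (R (1,k,0)))"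
      unfolding K_def by (subst nn_integral_distr) auto
    also have "\<dots> = (\<integral>\<^sup>+n. of_nat n \<partial>measure_pmf (poisson0 lam))"
      unfolding law noise_law_def by (simp, subst nn_integral_distr) auto
    also have "\<dots> = ennreal lam" by (rule poisson0_mean[OF lam])
    finally show ?thesis by (simp only: H_def)
  qed
  have Bm: "(\<lambda>\<omega>. \<Sum>i<K k \<omega>. h (mark k i \<omega>)) \<in> borel_measurable M" for k
    by (rule measurable_compose_countable[where f="\<lambda>n \<omega>. \<Sum>i<n. h (U k i \<omega>, J k i \<omega>)", OF _ K_measurable]) measurable
  have "(\<integral>\<^sup>+\<omega>. PI N h \<omega> \<partial>M) = (\<Sum>k<N. \<integral>\<^sup>+\<omega>. (\<Sum>i<K k \<omega>. h (mark k i \<omega>)) \<partial>M)"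
    unfolding PI_def using Bm by (intro nn_integral_sum)
  then show ?thesis by (simp add: block sum_distrib_left)
qed

lemma (in noise) U_le_prob: "prob {\<omega>\<in>space M. U k i \<omega> \<le> t} = clamp (t - real k)"
proof -
  have "prob {\<omega>\<in>space M. U k i \<omega> \<le> t} = measure (distr M borel (R (2,k,i))) {..t}"
    by (subst measure_distr) (auto simp: U_def intro!: arg_cong[where f=prob])
  also have "\<dots> = measure lborel ({real k .. real k + 1} \<inter> {..t})"
    by (simp add: law noise_law_def measure_uniform_measure)
  also have "\<dots> = clamp (t - real k)"
  proof (cases "real k \<le> t")
    case True
    then have "{real k .. real k + 1} \<inter> {..t} = {real k .. min (real k + 1) t}" by auto
    then show ?thesis using True by (simp add: clamp_def min_def)
  next
    case False
    then have "{real k .. real k + 1} \<inter> {..t} = {}" by auto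
    then show ?thesis using False by (simp add: clamp_def)
  qed
  finally show ?thesis .
qed

lemma (in noise) U_window_prob:
  assumes "s \<le> t"
  shows "(\<integral>\<omega>. indicator {s<..t} (U k i \<omega>) \<partial>M) = clamp (t - real k) - clamp (s - real k)"
    and "(\<integral>\<^sup>+\<omega>. indicator {s<..t} (U k i \<omega>) \<partial>M) = ennreal (clamp (t - real k) - clamp (s - real k))"
proof -
  have e: "indicator {s<..t} (U k i \<omega>) = (indicator {\<omega>\<in>space M. U k i \<omega> \<le> t} \<omega> - indicator {\<omega>\<in>space M. U k i \<omega> \<le> s} \<omega> :: real)" if "\<omega> \<in> space M" for \<omega>
    using that assms by (auto simp: indicator_def)
  have "(\<integral>\<omega>. indicator {s<..t} (U k i \<omega>) \<partial>M) = (\<integral>\<omega>. indicator {\<omega>\<in>space M. U k i \<omega> \<le> t} \<omega> - indicator {\<omega>\<in>space M. U k i \<omega> \<le> s} \<omega> \<partial>M :: real)"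
    by (rule Bochner_Integration.integral_cong) (simp_all add: e)
  also have "\<dots> = clamp (t - real k) - clamp (s - real k)"
    by (subst Bochner_Integration.integral_diff) (auto simp: U_le_prob emeasure_eq_measure)
  finally show 1: "(\<integral>\<omega>. indicator {s<..t} (U k i \<omega>) \<partial>M) = clamp (t - real k) - clamp (s - real k)" .
  have "integrable M (\<lambda>\<omega>. indicator {s<..t} (U k i \<omega>) :: real)"
    by (rule integrable_const_bound[where B=1]) (auto simp: indicator_def)
  then have "(\<integral>\<^sup>+\<omega>. ennreal (indicator {s<..t} (U k i \<omega>)) \<partial>M) = ennreal (clamp (t - real k) - clamp (s - real k))"
    unfolding 1[symmetric] by (intro nn_integral_eq_integral) auto
  then show "(\<integral>\<^sup>+\<omega>. indicator {s<..t} (U k i \<omega>) \<partial>M) = ennreal (clamp (t - real k) - clamp (s - real k))"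
    by (simp add: ennreal_indicator)
qed

text \<open>Each term is the length of the part of \<open>{s<..t}\<close> in the \<open>k\<close>-th
  unit interval; the sums over unit intervals thus become elapsed time.\<close>

lemma (in noise) sum_window_prob:
  assumes "0 \<le> s" "s \<le> t" "t \<le> real N"
  shows "(\<Sum>k<N. clamp (t - real k) - clamp (s - real k)) = t - s"
  using assms by (simp add: sum_subtractf sum_clamp)

lemma (in noise) law_J: "distr M borel (J k i) = \<mu>"
  by (simp add: J_def law noise_law_def)

lemma (in noise) phi_window:
  assumes [measurable]: "h \<in> borel_measurable borel" and st: "s \<le> t"
  shows "phi (\<lambda>p. v * window h s t p) k = of_real (clamp (t - real k) - clamp (s - real k)) * (CLINT x|\<mu>. iexp (v * h x) - 1)"
proof -
  have iv: "indep_var borel (\<lambda>\<omega>. complex_of_real (indicator {s<..t} (U k 0 \<omega>))) borel (\<lambda>\<omega>. iexp (v * h (J k 0 \<omega>)) - 1)"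
    using indep_var_compose[OF indep_mark[of k 0], of "\<lambda>u. complex_of_real (indicator {s<..t} u)" borel "\<lambda>x. iexp (v * h x) - 1" borel]
    by (simp add: comp_def)
  have b: "cmod (iexp x - 1) \<le> 2" for x using norm_triangle_ineq4[of "iexp x" 1] by simp
  have "phi (\<lambda>p. v * window h s t p) k = (CLINT \<omega>|M. complex_of_real (indicator {s<..t} (U k 0 \<omega>)) * (iexp (v * h (J k 0 \<omega>)) - 1))"
    unfolding phi_def by (intro Bochner_Integration.integral_cong refl) (auto simp: window_def indicator_def)
  also have "\<dots> = (CLINT \<omega>|M. complex_of_real (indicator {s<..t} (U k 0 \<omega>))) * (CLINT \<omega>|M. iexp (v * h (J k 0 \<omega>)) - 1)"
    by (intro indep_var_lebesgue_integral iv integrable_bounded_complex[where C=1] integrable_bounded_complex[where C=2] b) (auto simp: indicator_def)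
  also have "(CLINT \<omega>|M. complex_of_real (indicator {s<..t} (U k 0 \<omega>))) = of_real (clamp (t - real k) - clamp (s - real k))"
    by (simp only: integral_complex_of_real U_window_prob[OF st])
  also have "(CLINT \<omega>|M. iexp (v * h (J k 0 \<omega>)) - 1) = (CLINT x|distr M borel (J k 0). iexp (v * h x) - 1)"
    by (subst integral_distr) auto
  finally show ?thesis by (simp only: law_J)
qed

lemma (in noise) nn_PI_window:
  fixes h :: "real \<Rightarrow> ennreal"
  assumes [measurable]: "h \<in> borel_measurable borel" and st: "0 \<le> s" "s \<le> t" "t \<le> real N"
  shows "(\<integral>\<^sup>+\<omega>. PI N (window h s t) \<omega> \<partial>M) = ennreal lam * ennreal (t - s) * (\<integral>\<^sup>+x. h x \<partial>\<mu>)"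
proof -
  have "(\<integral>\<^sup>+\<omega>. window h s t (mark k 0 \<omega>) \<partial>M) = ennreal (clamp (t - real k) - clamp (s - real k)) * (\<integral>\<^sup>+x. h x \<partial>\<mu>)" for k
  proof -
    interpret P: pair_sigma_finite "distr M borel (U k 0)" "distr M borel (J k 0)"
      by (intro pair_sigma_finite.intro prob_space_imp_sigma_finite prob_space_distr) auto
    have "(\<integral>\<^sup>+\<omega>. window h s t (mark k 0 \<omega>) \<partial>M) = (\<integral>\<^sup>+p. window h s t p \<partial>distr M (borel \<Otimes>\<^sub>M borel) (mark k 0))"
      by (subst nn_integral_distr) auto
    also have "distr M (borel \<Otimes>\<^sub>M borel) (mark k 0) = distr M borel (U k 0) \<Otimes>\<^sub>M distr M borel (J k 0)"
      using indep_var_distribution_eq[THEN iffD1, OF indep_mark[of k 0]] by simp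
    also have "(\<integral>\<^sup>+p. window h s t p \<partial>(distr M borel (U k 0) \<Otimes>\<^sub>M distr M borel (J k 0))) = 
        (\<integral>\<^sup>+u. \<integral>\<^sup>+x. indicator {s<..t} u * h x \<partial>distr M borel (J k 0) \<partial>distr M borel (U k 0))"
      by (subst P.M2.nn_integral_fst[symmetric], simp cong: measurable_cong_sets) (auto intro!: nn_integral_cong simp: window_def indicator_def)
    also have "\<dots> = (\<integral>\<^sup>+u. indicator {s<..t} u \<partial>distr M borel (U k 0)) * (\<integral>\<^sup>+x. h x \<partial>distr M borel (J k 0))"
      by (simp add: nn_integral_cmult nn_integral_multc law_J)
    also have "(\<integral>\<^sup>+u. indicator {s<..t} u \<partial>distr M borel (U k 0)) = (\<integral>\<^sup>+\<omega>. indicator {s<..t} (U k 0 \<omega>) \<partial>M)"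
      by (subst nn_integral_distr) auto
    finally show ?thesis by (simp only: law_J U_window_prob[OF st(2)])
  qed
  then have "(\<integral>\<^sup>+\<omega>. PI N (window h s t) \<omega> \<partial>M) = ennreal lam * ((\<Sum>k<N. ennreal (clamp (t - real k) - clamp (s - real k))) * (\<integral>\<^sup>+x. h x \<partial>\<mu>))"
    by (subst nn_PI) (auto simp: sum_distrib_right)
  also have "(\<Sum>k<N. ennreal (clamp (t - real k) - clamp (s - real k))) = ennreal (\<Sum>k<N. clamp (t - real k) - clamp (s - real k))"
    using clamp_mono st by (intro sum_ennreal) auto
  also have "(\<Sum>k<N. clamp (t - real k) - clamp (s - real k)) = t - s" by (rule sum_window_prob[OF st])
  finally show ?thesis by (simp add: mult.assoc)
qed

lemma (in noise) PI_window_integrable: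
  fixes h :: "real \<Rightarrow> real"
  assumes [measurable]: "h \<in> borel_measurable borel" and st: "0 \<le> s" "s \<le> t" "t \<le> real N" and ih: "integrable \<mu> h"
  shows "integrable M (PI N (window h s t))"
proof (subst integrable_iff_bounded, intro conjI)
  have "ennreal (norm (PI N (window h s t) \<omega>)) \<le> PI N (window (\<lambda>x. ennreal \<bar>h x\<bar>) s t) \<omega>" for \<omega>
  proof -
    have "\<bar>PI N (window h s t) \<omega>\<bar> \<le> (\<Sum>p\<in>points N \<omega>. \<bar>window h s t (u_of \<omega> p, j_of \<omega> p)\<bar>)"
      unfolding PI_points by (rule sum_abs)
    then have "ennreal (norm (PI N (window h s t) \<omega>)) \<le> ennreal (\<Sum>p\<in>points N \<omega>. \<bar>window h s t (u_of \<omega> p, j_of \<omega> p)\<bar>)"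
      by (simp add: ennreal_leI)
    also have "\<dots> = (\<Sum>p\<in>points N \<omega>. ennreal \<bar>window h s t (u_of \<omega> p, j_of \<omega> p)\<bar>)" by (rule sum_ennreal[symmetric]) simp
    also have "\<dots> = PI N (window (\<lambda>x. ennreal \<bar>h x\<bar>) s t) \<omega>"
      unfolding PI_points by (intro sum.cong) (auto simp: window_def)
    finally show ?thesis .
  qed
  then have "(\<integral>\<^sup>+\<omega>. ennreal (norm (PI N (window h s t) \<omega>)) \<partial>M) \<le> (\<integral>\<^sup>+\<omega>. PI N (window (\<lambda>x. ennreal \<bar>h x\<bar>) s t) \<omega> \<partial>M)"
    by (intro nn_integral_mono)
  also have "\<dots> = ennreal lam * ennreal (t - s) * (\<integral>\<^sup>+x. ennreal \<bar>h x\<bar> \<partial>\<mu>)" by (rule nn_PI_window[OF _ st]) measurable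
  also have "\<dots> < \<infinity>" using ih by (simp add: integrable_iff_bounded ennreal_mult_less_top)
  finally show "(\<integral>\<^sup>+\<omega>. ennreal (norm (PI N (window h s t) \<omega>)) \<partial>M) < \<infinity>" .
qed measurable

text \<open>The Levy-Khinchine formula. That it involves the times only through \<open>t - s\<close>
  will give the stationarity of increments.\<close>

lemma (in noise) future_cf_window:
  assumes [measurable]: "h \<in> borel_measurable borel" and st: "0 \<le> s" "s \<le> t"
  shows "(CLINT \<omega>|M. iexp (v * future \<beta> s t (nat \<lceil>t\<rceil>) (window h s t) \<omega>)) = 
     exp (of_real (t - s) * (lam * (CLINT x|\<mu>. iexp (v * h x) - 1) - of_real ((v * \<beta>)\<^sup>2 / 2)))"
proof -
  let ?N = "nat \<lceil>t\<rceil>" and ?c = "CLINT x|\<mu>. iexp (v * h x) - 1"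
  have tN: "t \<le> real ?N" by linarith
  have sN: "nat \<lceil>s\<rceil> \<le> ?N" using st by (intro nat_mono ceiling_mono)
  have "(\<Sum>k<?N. phi (\<lambda>p. v * window h s t p) k) = of_real (\<Sum>k<?N. clamp (t - real k) - clamp (s - real k)) * ?c"
    by (simp add: phi_window[OF _ st(2)] sum_distrib_right del: of_real_diff)
  also have "(\<Sum>k<?N. clamp (t - real k) - clamp (s - real k)) = t - s" by (rule sum_window_prob[OF st tN])
  finally have "(CLINT \<omega>|M. iexp (v * future \<beta> s t ?N (window h s t) \<omega>)) = 
    of_real (exp (- ((v * \<beta>)\<^sup>2 * (t - s)) / 2)) * exp (lam * (of_real (t - s) * ?c))"
    using future_cf[where g="window h s t" and N="?N" and N'="?N" and v=v and \<beta>=\<beta>, OF st _ _ _ order_refl sN] window_zero[of _ s h t] window_zero[where t=t and h=h and s=s] by simp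
  also have "\<dots> = exp (of_real (- ((v * \<beta>)\<^sup>2 * (t - s)) / 2) + lam * (of_real (t - s) * ?c))"
    by (simp only: exp_of_real exp_add)
  also have "of_real (- ((v * \<beta>)\<^sup>2 * (t - s)) / 2) + lam * (of_real (t - s) * ?c) = of_real (t - s) * (lam * ?c - of_real ((v * \<beta>)\<^sup>2 / 2))"
    by (simp add: algebra_simps diff_divide_distrib)
  finally show ?thesis .
qed

lemma (in noise) B_increment_law:
  assumes "0 \<le> s" "s < t"
  shows "distr M borel (\<lambda>\<omega>. (B t \<omega> - B s \<omega>) / sqrt (t - s)) = std_normal_distribution"
proof -
  let ?Y = "\<lambda>\<omega>. (B t \<omega> - B s \<omega>) / sqrt (t - s)"
  have c: "char (distr M borel ?Y) v = of_real (exp (- v\<^sup>2 / 2))" for v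
  proof -
    \<comment> \<open>The normalised Brownian increment is a future functional whose jump part is
      zero.\<close>
    have Y: "?Y \<omega> = future (1 / sqrt (t - s)) s t (nat \<lceil>t\<rceil>) (window (\<lambda>_. 0) s t) \<omega>" for \<omega>
    proof -
      have "window (\<lambda>_. 0) s t = (\<lambda>_. 0 :: real)" by (auto simp: window_def)
      then show ?thesis by (simp add: future_def PI_def)
    qed
    have "char (distr M borel ?Y) v = (CLINT \<omega>|M. iexp (v * ?Y \<omega>))"
      unfolding char_def by (subst integral_distr) auto
    also have "\<dots> = exp (of_real (t - s) * (lam * (CLINT x|\<mu>. iexp (v * 0) - 1) - of_real ((v * (1 / sqrt (t - s)))\<^sup>2 / 2)))"
      unfolding Y using assms by (intro future_cf_window) auto
    also have "\<dots> = exp (of_real (- v\<^sup>2 / 2))"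
    proof -
      have z: "(CLINT x|\<mu>. iexp (v * 0) - 1) = 0" by simp
      have e: "of_real (t - s) * (lam * (CLINT x|\<mu>. iexp (v * 0) - 1) - of_real ((v * (1 / sqrt (t - s)))\<^sup>2 / 2)) = of_real (- (t - s) * ((v * (1 / sqrt (t - s)))\<^sup>2 / 2))"
        unfolding z by (simp only: mult_zero_right diff_0 of_real_mult of_real_minus mult_minus_left mult_minus_right)
      have "- r * ((v * (1 / sqrt r))\<^sup>2 / 2) = - v\<^sup>2 / 2" if "r > 0" for r
        using that by (simp add: power_mult_distrib power_divide)
      from this[of "t - s"] have "- (t - s) * ((v * (1 / sqrt (t - s)))\<^sup>2 / 2) = - v\<^sup>2 / 2" using assms by simp
      then show ?thesis by (simp only: e)
    qed
    finally show ?thesis by (simp only: exp_of_real)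
  qed
  show ?thesis
    by (intro Levy_uniqueness ext real_distribution_distr real_dist_normal_dist) (simp_all add: c char_std_normal_distribution)
qed

lemma (in noise) B_increment_moments:
  assumes st: "0 \<le> s" "s \<le> t"
  shows "integrable M (\<lambda>\<omega>. B t \<omega> - B s \<omega>)" "expectation (\<lambda>\<omega>. B t \<omega> - B s \<omega>) = 0"
    "integrable M (\<lambda>\<omega>. (B t \<omega> - B s \<omega>)\<^sup>2)" "expectation (\<lambda>\<omega>. (B t \<omega> - B s \<omega>)\<^sup>2) = t - s"
proof -
  have "integrable M (\<lambda>\<omega>. B t \<omega> - B s \<omega>) \<and> expectation (\<lambda>\<omega>. B t \<omega> - B s \<omega>) = 0 \<and>
    integrable M (\<lambda>\<omega>. (B t \<omega> - B s \<omega>)\<^sup>2) \<and> expectation (\<lambda>\<omega>. (B t \<omega> - B s \<omega>)\<^sup>2) = t - s"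
  proof (cases "s = t")
    case False
    then have st': "s < t" using st by simp
    let ?Y = "\<lambda>\<omega>. (B t \<omega> - B s \<omega>) / sqrt (t - s)"
    have r: "sqrt (t - s) > 0" using st' by simp
    have law: "distr M borel ?Y = std_normal_distribution" by (rule B_increment_law[OF st(1) st'])
    have i: "integrable M (\<lambda>\<omega>. ?Y \<omega> ^ k)" for k
    proof -
      have "integrable (distr M borel ?Y) (\<lambda>x. x ^ k)" unfolding law by (rule integrable_std_normal_distribution_moment)
      then show ?thesis by (subst (asm) integrable_distr_eq) auto
    qed
    have e: "expectation (\<lambda>\<omega>. ?Y \<omega> ^ k) = (\<integral>x. x ^ k \<partial>std_normal_distribution)" for k
      unfolding law[symmetric] by (subst integral_distr) auto
    have Y: "B t \<omega> - B s \<omega> = sqrt (t - s) * ?Y \<omega> ^ 1" for \<omega> using r by simp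
    have Y2: "(B t \<omega> - B s \<omega>)\<^sup>2 = (t - s) * ?Y \<omega> ^ 2" for \<omega> using st' by (simp add: power_divide)
    have e1: "expectation (\<lambda>\<omega>. ?Y \<omega> ^ 1) = 0" unfolding e by (rule integral_std_normal_distribution_moment_odd) simp
    have "integrable M (\<lambda>\<omega>. sqrt (t - s) * ?Y \<omega> ^ 1)" by (intro integrable_mult_right i)
    moreover have "expectation (\<lambda>\<omega>. sqrt (t - s) * ?Y \<omega> ^ 1) = 0"
      by (simp only: integral_mult_right_zero e1 mult_zero_right)
    moreover have "integrable M (\<lambda>\<omega>. (t - s) * ?Y \<omega> ^ 2)" using i[of 2] by (intro integrable_mult_right)
    moreover have "expectation (\<lambda>\<omega>. (t - s) * ?Y \<omega> ^ 2) = t - s"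
      using e[of 2] std_normal_distribution_even_moments(1)[of 1] by (subst integral_mult_right_zero) simp
    ultimately show ?thesis unfolding Y2 by (subst (1 2) Y) blast
  qed simp
  then show "integrable M (\<lambda>\<omega>. B t \<omega> - B s \<omega>)" "expectation (\<lambda>\<omega>. B t \<omega> - B s \<omega>) = 0"
    "integrable M (\<lambda>\<omega>. (B t \<omega> - B s \<omega>)\<^sup>2)" "expectation (\<lambda>\<omega>. (B t \<omega> - B s \<omega>)\<^sup>2) = t - s" by auto
qed

section \<open>Processes with symmetric jumps\<close>

text \<open>Symmetry of the jump law centres every odd jump functional, so that sums of small jumps
  are martingales without compensation and the drift is zero.\<close>

locale sym_noise = noise +
  assumes mu_sym: "distr \<mu> borel uminus = \<mu>"

text \<open>By symmetry of \<open>\<mu>\<close> and oddness of \<open>h\<close>, the sum and its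
  negative have the same characteristic function, hence the same law and the same
  expectation.\<close>

lemma (in sym_noise) PI_window_mean_zero:
  fixes h :: "real \<Rightarrow> real"
  assumes h[measurable]: "h \<in> borel_measurable borel" and odd: "\<And>x. h (- x) = - h x" and st: "0 \<le> s" "s \<le> t"
  shows "expectation (PI (nat \<lceil>t\<rceil>) (window h s t)) = 0"
proof -
  let ?Y = "PI (nat \<lceil>t\<rceil>) (window h s t)" and ?c = "\<lambda>v. CLINT x|\<mu>. iexp (v * h x) - 1"
  have Y: "?Y \<omega> = future 0 s t (nat \<lceil>t\<rceil>) (window h s t) \<omega>" for \<omega> by (simp add: future_def)
  have cf: "(CLINT \<omega>|M. iexp (v * ?Y \<omega>)) = exp (of_real (t - s) * (lam * ?c v))" for v
    using future_cf_window[OF h st, of v 0] by (simp add: Y)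
  have sym: "?c (- v) = ?c v" for v
  proof -
    have "?c v = (CLINT x|distr \<mu> borel uminus. iexp (v * h x) - 1)" by (simp only: mu_sym)
    also have "\<dots> = (CLINT x|\<mu>. iexp (v * h (- x)) - 1)" by (subst integral_distr) auto
    finally show ?thesis by (simp add: odd)
  qed
  have "distr M borel ?Y = distr M borel (\<lambda>\<omega>. - ?Y \<omega>)"
  proof (intro Levy_uniqueness real_distribution_distr ext)
    fix v
    have "char (distr M borel ?Y) v = (CLINT \<omega>|M. iexp (v * ?Y \<omega>))"
      unfolding char_def by (subst integral_distr) auto
    also have "\<dots> = (CLINT \<omega>|M. iexp ((- v) * ?Y \<omega>))" unfolding cf sym ..
    also have "\<dots> = char (distr M borel (\<lambda>\<omega>. - ?Y \<omega>)) v"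
      unfolding char_def by (subst integral_distr) auto
    finally show "char (distr M borel ?Y) v = char (distr M borel (\<lambda>\<omega>. - ?Y \<omega>)) v" .
  qed auto
  then have "(\<integral>x. x \<partial>distr M borel ?Y) = (\<integral>x. x \<partial>distr M borel (\<lambda>\<omega>. - ?Y \<omega>))" by simp
  then have "expectation ?Y = expectation (\<lambda>\<omega>. - ?Y \<omega>)" by (subst (asm) (1 2) integral_distr) auto
  then show ?thesis by simp
qed

lemma (in sym_noise) future_window_moments:
  fixes h :: "real \<Rightarrow> real"
  assumes h[measurable]: "h \<in> borel_measurable borel" and odd: "\<And>x. h (- x) = - h x" and ih: "integrable \<mu> h" and st: "0 \<le> s" "s \<le> t"
  shows "integrable M (future \<sigma> s t (nat \<lceil>t\<rceil>) (window h s t))" "expectation (future \<sigma> s t (nat \<lceil>t\<rceil>) (window h s t)) = 0"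
proof -
  have tN: "t \<le> real (nat \<lceil>t\<rceil>)" by linarith
  have i: "integrable M (\<lambda>\<omega>. \<sigma> * (B t \<omega> - B s \<omega>))" "integrable M (PI (nat \<lceil>t\<rceil>) (window h s t))"
    using B_increment_moments(1)[OF st] PI_window_integrable[OF h st tN ih] by auto
  show "integrable M (future \<sigma> s t (nat \<lceil>t\<rceil>) (window h s t))" unfolding future_def using i by (rule Bochner_Integration.integrable_add)
  show "expectation (future \<sigma> s t (nat \<lceil>t\<rceil>) (window h s t)) = 0"
    unfolding future_def Bochner_Integration.integral_add[OF i]
    using B_increment_moments(2)[OF st] PI_window_mean_zero[OF h odd st] by simp
qed

lemma (in sym_noise) future_window_indep:
  assumes h[measurable]: "h \<in> borel_measurable borel" and st: "0 \<le> s" "s \<le> t" and "G \<in> sets (Filt s)" "D \<in> sets borel"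
  shows "prob (G \<inter> (future \<sigma> s t (nat \<lceil>t\<rceil>) (window h s t) -` D \<inter> space M)) = 
    prob G * prob (future \<sigma> s t (nat \<lceil>t\<rceil>) (window h s t) -` D \<inter> space M)"
  using assms by (intro future_indep window_zero) auto

lemma (in sym_noise) BZ_zero: "\<omega> \<in> space M \<Longrightarrow> \<sigma> * B 0 \<omega> + Z h 0 \<omega> = (0::real)"
  by (simp add: B_zero Z_nonpos)

lemma (in sym_noise) BZ_cadlag_adapted:
  fixes h :: "real \<Rightarrow> real"
  assumes "h \<in> borel_measurable borel"
  shows "cadlag_adapted M Filt (\<lambda>t \<omega>. \<sigma> * B t \<omega> + Z h t \<omega>)"
  unfolding cadlag_adapted_def adapted_def
proof (intro conjI allI impI ballI)
  show "(\<lambda>\<omega>. \<sigma> * B t \<omega> + Z h t \<omega>) \<in> borel_measurable (Filt t)" if "0 \<le> t" for t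
    using that assms by (intro past_Filt BZ_past)
  fix \<omega> assume \<omega>: "\<omega> \<in> space M"
  have "continuous_on {0..} (\<lambda>t. \<sigma> * B t \<omega>)" by (intro continuous_intros B_continuous[OF \<omega>])
  then show "cadlag (\<lambda>t. \<sigma> * B t \<omega> + Z h t \<omega>)" by (intro cadlag_add Z_cadlag[OF \<omega>] cadlag_continuous)
qed

lemma (in sym_noise) indicator_Filt: "G \<in> sets (Filt s) \<Longrightarrow> indicator G \<in> borel_measurable (Filt s)"
  by simp

lemma (in sym_noise) sets_Filt_M: "G \<in> sets (Filt s) \<Longrightarrow> G \<in> sets M"
  using Filt_subalgebra by (auto simp: subalgebra_def)

lemma (in sym_noise) BZ_martingale:
  fixes h :: "real \<Rightarrow> real"
  assumes h: "h \<in> borel_measurable borel" and odd: "\<And>x. h (- x) = - h x" and ih: "integrable \<mu> h"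
  shows "martingale M Filt (\<lambda>t \<omega>. \<sigma> * B t \<omega> + Z h t \<omega>)"
proof (rule martingale_by_increments[OF filtered])
  show "adapted Filt (\<lambda>t \<omega>. \<sigma> * B t \<omega> + Z h t \<omega>)" using BZ_cadlag_adapted[OF h] by (simp add: cadlag_adapted_def)
  show "integrable M (\<lambda>\<omega>. \<sigma> * B t \<omega> + Z h t \<omega>)" if t: "0 \<le> t" for t
  proof (rule Bochner_Integration.integrable_cong[THEN iffD1, OF refl _ future_window_moments(1)[OF h odd ih order_refl t, of \<sigma>]])
    fix \<omega> assume \<omega>: "\<omega> \<in> space M"
    show "future \<sigma> 0 t (nat \<lceil>t\<rceil>) (window h 0 t) \<omega> = \<sigma> * B t \<omega> + Z h t \<omega>"
      using BZ_increment[OF \<omega> t, of \<sigma> h] BZ_zero[OF \<omega>, of \<sigma> h] by simp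
  qed
  fix s t G assume st: "0 \<le> s" "s \<le> t" and G: "G \<in> sets (Filt s)"
  note [measurable] = h
  let ?Y = "future \<sigma> s t (nat \<lceil>t\<rceil>) (window h s t)"
  have GM: "G \<in> sets M" using G by (rule sets_Filt_M)
  have "(\<integral>\<omega>. indicator G \<omega> * ((\<sigma> * B t \<omega> + Z h t \<omega>) - (\<sigma> * B s \<omega> + Z h s \<omega>)) \<partial>M) = (\<integral>\<omega>. indicator G \<omega> * ?Y \<omega> \<partial>M)"
    by (intro Bochner_Integration.integral_cong refl) (simp only: BZ_increment[OF _ st(2)])
  also have "\<dots> = (\<integral>\<omega>. indicator G \<omega> \<partial>M) * expectation ?Y"
    using GM G st by (intro indep_expectation_mult(2)[OF Filt_subalgebra[of s]] future_window_indep future_window_moments h odd ih) (auto simp: emeasure_eq_measure)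
  also have "\<dots> = 0" using future_window_moments(2)[OF h odd ih st] by simp
  finally show "(\<integral>\<omega>. indicator G \<omega> * ((\<sigma> * B t \<omega> + Z h t \<omega>) - (\<sigma> * B s \<omega> + Z h s \<omega>)) \<partial>M) = 0" .
qed

lemma (in sym_noise) Z_zero_fun: "Z (\<lambda>_. 0) t \<omega> = (0::real)"
  by (simp add: Z_def PI_def cut_def case_prod_beta)

lemma (in sym_noise) B_past: "0 \<le> t \<Longrightarrow> (\<lambda>\<omega>. \<sigma> * B t \<omega>) \<in> past t"
  using BZ_past[of t "\<lambda>_. 0" \<sigma>] by (simp add: Z_zero_fun)

lemma (in sym_noise) B_square_martingale: "martingale M Filt (\<lambda>t \<omega>. (\<sigma> * B t \<omega>)\<^sup>2 - \<sigma>\<^sup>2 * t)"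
proof (rule martingale_by_increments[OF filtered])
  show "adapted Filt (\<lambda>t \<omega>. (\<sigma> * B t \<omega>)\<^sup>2 - \<sigma>\<^sup>2 * t)"
    unfolding adapted_def using past_Filt[OF B_past] by auto
  have iB: "integrable M (\<lambda>\<omega>. B t \<omega>)" "integrable M (\<lambda>\<omega>. (B t \<omega>)\<^sup>2)" if "0 \<le> t" for t
    using B_increment_moments(1,3)[OF order_refl that] by (simp_all add: B_zero)
  show "integrable M (\<lambda>\<omega>. (\<sigma> * B t \<omega>)\<^sup>2 - \<sigma>\<^sup>2 * t)" if t: "0 \<le> t" for t
    using iB[OF t] by (simp add: power_mult_distrib)
  fix s t G assume st: "0 \<le> s" "s \<le> t" and G: "G \<in> sets (Filt s)"
  have GM[measurable]: "G \<in> sets M" using G by (rule sets_Filt_M)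
  let ?D = "\<lambda>\<omega>. B t \<omega> - B s \<omega>"
  have D: "?D = future 1 s t (nat \<lceil>t\<rceil>) (window (\<lambda>_. 0) s t)"
    by (auto simp: future_def PI_def window_def case_prod_beta fun_eq_iff)
  have ind: "prob (G \<inter> (?D -` A \<inter> space M)) = prob G * prob (?D -` A \<inter> space M)" if "G \<in> sets (Filt s)" "A \<in> sets borel" for G A
    unfolding D using st that by (intro future_window_indep) auto
  have ind2: "prob (G \<inter> ((\<lambda>\<omega>. (?D \<omega>)\<^sup>2) -` A \<inter> space M)) = prob G * prob ((\<lambda>\<omega>. (?D \<omega>)\<^sup>2) -` A \<inter> space M)" 
    if "G \<in> sets (Filt s)" "A \<in> sets borel" for G A
  proof -
    have "(\<lambda>x::real. x\<^sup>2) -` A \<inter> space borel \<in> sets borel" using that(2) by (intro measurable_sets[of _ borel borel]) auto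
    moreover have "(\<lambda>\<omega>. (?D \<omega>)\<^sup>2) -` A \<inter> space M = ?D -` ((\<lambda>x::real. x\<^sup>2) -` A \<inter> space borel) \<inter> space M" by auto
    ultimately show ?thesis using ind[OF that(1)] by simp
  qed
  note mom = B_increment_moments[OF st]
  have iG: "integrable M (indicator G :: 'a \<Rightarrow> real)" by (simp add: emeasure_eq_measure)
  have iGB: "integrable M (\<lambda>\<omega>. indicator G \<omega> * B s \<omega>)" 
    using integrable_real_mult_indicator[OF GM iB(1)[OF st(1)]] by (simp add: mult.commute)
  have Bs: "B s \<in> borel_measurable (Filt s)" using past_Filt[OF B_past[OF st(1), of 1]] by simp
  have e1: "integrable M (\<lambda>\<omega>. indicator G \<omega> * (?D \<omega>)\<^sup>2)" "(\<integral>\<omega>. indicator G \<omega> * (?D \<omega>)\<^sup>2 \<partial>M) = prob G * (t - s)"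
  proof -
    have Dm: "(\<lambda>\<omega>. (?D \<omega>)\<^sup>2) \<in> borel_measurable M" by measurable
    show "integrable M (\<lambda>\<omega>. indicator G \<omega> * (?D \<omega>)\<^sup>2)"
      by (rule indep_expectation_mult(1)[OF Filt_subalgebra[of s] Dm ind2 indicator_Filt[OF G] iG mom(3)])
    have "(\<integral>\<omega>. indicator G \<omega> * (?D \<omega>)\<^sup>2 \<partial>M) = expectation (indicator G) * expectation (\<lambda>\<omega>. (?D \<omega>)\<^sup>2)"
      by (rule indep_expectation_mult(2)[OF Filt_subalgebra[of s] Dm ind2 indicator_Filt[OF G] iG mom(3)])
    then show "(\<integral>\<omega>. indicator G \<omega> * (?D \<omega>)\<^sup>2 \<partial>M) = prob G * (t - s)" by (simp add: mom(4))
  qed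
  have e2: "integrable M (\<lambda>\<omega>. (indicator G \<omega> * B s \<omega>) * ?D \<omega>)" "(\<integral>\<omega>. (indicator G \<omega> * B s \<omega>) * ?D \<omega> \<partial>M) = 0"
  proof -
    have Dm: "?D \<in> borel_measurable M" by measurable
    have Gm: "(\<lambda>\<omega>. indicator G \<omega> * B s \<omega>) \<in> borel_measurable (Filt s)"
      by (intro borel_measurable_times indicator_Filt[OF G] Bs)
    show "integrable M (\<lambda>\<omega>. (indicator G \<omega> * B s \<omega>) * ?D \<omega>)"
      by (rule indep_expectation_mult(1)[OF Filt_subalgebra[of s] Dm ind Gm iGB mom(1)])
    have "(\<integral>\<omega>. (indicator G \<omega> * B s \<omega>) * ?D \<omega> \<partial>M) = expectation (\<lambda>\<omega>. indicator G \<omega> * B s \<omega>) * expectation ?D"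
      by (rule indep_expectation_mult(2)[OF Filt_subalgebra[of s] Dm ind Gm iGB mom(1)])
    then show "(\<integral>\<omega>. (indicator G \<omega> * B s \<omega>) * ?D \<omega> \<partial>M) = 0" by (simp only: mom(2) mult_zero_right)
  qed
  \<comment> \<open>Expands \<open>B t\<close> as \<open>B s\<close> plus the increment. The squared
    increment has mean \<open>t - s\<close> on every set of the past, and the cross term is centred
    because the increment is independent of \<open>B s\<close>.\<close>
  have "indicator G \<omega> * (((\<sigma> * B t \<omega>)\<^sup>2 - \<sigma>\<^sup>2 * t) - ((\<sigma> * B s \<omega>)\<^sup>2 - \<sigma>\<^sup>2 * s)) = 
    \<sigma>\<^sup>2 * ((indicator G \<omega> * (?D \<omega>)\<^sup>2 + 2 * ((indicator G \<omega> * B s \<omega>) * ?D \<omega>)) - (t - s) * indicator G \<omega>)" for \<omega>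
    by (simp add: power2_eq_square algebra_simps)
  then have "(\<integral>\<omega>. indicator G \<omega> * (((\<sigma> * B t \<omega>)\<^sup>2 - \<sigma>\<^sup>2 * t) - ((\<sigma> * B s \<omega>)\<^sup>2 - \<sigma>\<^sup>2 * s)) \<partial>M) = 
     (\<integral>\<omega>. \<sigma>\<^sup>2 * ((indicator G \<omega> * (?D \<omega>)\<^sup>2 + 2 * ((indicator G \<omega> * B s \<omega>) * ?D \<omega>)) - (t - s) * indicator G \<omega>) \<partial>M)"
    by (simp only:)
  also have "\<dots> = \<sigma>\<^sup>2 * (((\<integral>\<omega>. indicator G \<omega> * (?D \<omega>)\<^sup>2 \<partial>M) + 2 * (\<integral>\<omega>. (indicator G \<omega> * B s \<omega>) * ?D \<omega> \<partial>M)) - (t - s) * (\<integral>\<omega>. indicator G \<omega> \<partial>M))"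
    using e1(1) e2(1) iG by (simp only: integral_mult_right_zero Bochner_Integration.integral_diff Bochner_Integration.integral_add 
       Bochner_Integration.integrable_add integrable_mult_right)
  also have "\<dots> = 0" by (simp add: e1(2) e2(2))
  finally show "(\<integral>\<omega>. indicator G \<omega> * (((\<sigma> * B t \<omega>)\<^sup>2 - \<sigma>\<^sup>2 * t) - ((\<sigma> * B s \<omega>)\<^sup>2 - \<sigma>\<^sup>2 * s)) \<partial>M) = 0" .
qed

lemma (in sym_noise) X_increment:
  assumes "\<omega> \<in> space M" "s \<le> t"
  shows "X \<sigma> t \<omega> - X \<sigma> s \<omega> = future \<sigma> s t (nat \<lceil>t\<rceil>) (window (\<lambda>x. x) s t) \<omega>"
  unfolding X_def by (rule BZ_increment[OF assms])

lemma (in sym_noise) X_cadlag_adapted: "cadlag_adapted M Filt (X \<sigma>)"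
proof -
  have "X \<sigma> = (\<lambda>t \<omega>. \<sigma> * B t \<omega> + Z (\<lambda>x. x) t \<omega>)" by (auto simp: X_def fun_eq_iff)
  then show ?thesis using BZ_cadlag_adapted[of "\<lambda>x. x" \<sigma>] by simp
qed

lemma (in sym_noise) X_zero: "\<omega> \<in> space M \<Longrightarrow> X \<sigma> 0 \<omega> = 0"
  unfolding X_def by (rule BZ_zero)

lemma (in sym_noise) X_measurable: "0 \<le> t \<Longrightarrow> X \<sigma> t \<in> borel_measurable M"
  using X_cadlag_adapted[of \<sigma>] measurable_from_subalg[OF Filt_subalgebra] unfolding cadlag_adapted_def adapted_def by blast

lemma (in sym_noise) char_minus_1: "(CLINT x|\<mu>. iexp (v * x) - 1) = char \<mu> v - 1"
  unfolding char_def by (subst Bochner_Integration.integral_diff) (auto intro: mu.integrable_iexp simp: mu.prob_space[simplified])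

lemma (in sym_noise) X_increment_char:
  assumes st: "0 \<le> s" "s \<le> t"
  shows "char (distr M borel (\<lambda>\<omega>. X \<sigma> t \<omega> - X \<sigma> s \<omega>)) v = exp (of_real (t - s) * (lam * (char \<mu> v - 1) - of_real ((v * \<sigma>)\<^sup>2 / 2)))"
proof -
  have [measurable]: "X \<sigma> t \<in> borel_measurable M" "X \<sigma> s \<in> borel_measurable M" using X_measurable st by auto
  have "char (distr M borel (\<lambda>\<omega>. X \<sigma> t \<omega> - X \<sigma> s \<omega>)) v = (CLINT \<omega>|M. iexp (v * (X \<sigma> t \<omega> - X \<sigma> s \<omega>)))"
    unfolding char_def by (subst integral_distr) auto
  also have "\<dots> = (CLINT \<omega>|M. iexp (v * future \<sigma> s t (nat \<lceil>t\<rceil>) (window (\<lambda>x. x) s t) \<omega>))"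
    by (intro Bochner_Integration.integral_cong refl) (simp only: X_increment[OF _ st(2)])
  finally show ?thesis using future_cf_window[of "\<lambda>x. x" s t v \<sigma>] st by (simp only: char_minus_1 measurable_ident_sets simp_thms)
qed

lemma (in sym_noise) X_char:
  assumes "0 \<le> t"
  shows "char (distr M borel (X \<sigma> t)) v = exp (of_real t * (lam * (char \<mu> v - 1) - of_real ((v * \<sigma>)\<^sup>2 / 2)))"
proof -
  have "distr M borel (X \<sigma> t) = distr M borel (\<lambda>\<omega>. X \<sigma> t \<omega> - X \<sigma> 0 \<omega>)"
    by (intro distr_cong) (auto simp: X_zero)
  then show ?thesis using X_increment_char[OF order_refl assms, of \<sigma> v] by simp
qed

lemma (in sym_noise) X_levy: "levy_process M Filt (X \<sigma>)"
  unfolding levy_process_def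
proof (intro conjI allI impI X_cadlag_adapted)
  show "AE \<omega> in M. X \<sigma> 0 \<omega> = 0" by (auto intro!: AE_I2 X_zero)
  fix s t :: real assume st: "0 \<le> s" "s \<le> t"
  have [measurable]: "X \<sigma> t \<in> borel_measurable M" "X \<sigma> s \<in> borel_measurable M" "X \<sigma> (t - s) \<in> borel_measurable M" using X_measurable st by auto
  show "indep_set (sets (Filt s)) {(\<lambda>\<omega>. X \<sigma> t \<omega> - X \<sigma> s \<omega>) -` D \<inter> space M |D. D \<in> sets borel}"
  proof (rule indep_setI)
    show "sets (Filt s) \<subseteq> events" using Filt_subalgebra by (auto simp: subalgebra_def)
    show "{(\<lambda>\<omega>. X \<sigma> t \<omega> - X \<sigma> s \<omega>) -` D \<inter> space M |D. D \<in> sets borel} \<subseteq> events" by auto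
    fix a b assume a: "a \<in> sets (Filt s)" and "b \<in> {(\<lambda>\<omega>. X \<sigma> t \<omega> - X \<sigma> s \<omega>) -` D \<inter> space M |D. D \<in> sets borel}"
    then obtain D where D: "D \<in> sets borel" and b: "b = (\<lambda>\<omega>. X \<sigma> t \<omega> - X \<sigma> s \<omega>) -` D \<inter> space M" by auto
    have "b = future \<sigma> s t (nat \<lceil>t\<rceil>) (window (\<lambda>x. x) s t) -` D \<inter> space M"
      unfolding b using X_increment[OF _ st(2), of _ \<sigma>] by auto
    then show "prob (a \<inter> b) = prob a * prob b" using future_window_indep[of "\<lambda>x. x" s t a D \<sigma>] st a D by simp
  qed
  show "distr M borel (\<lambda>\<omega>. X \<sigma> t \<omega> - X \<sigma> s \<omega>) = distr M borel (X \<sigma> (t - s))"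
    by (intro Levy_uniqueness real_distribution_distr ext) (use st in \<open>simp_all add: X_increment_char X_char del: of_real_diff\<close>)
qed

section \<open>Predictable rectangles\<close>

text \<open>The classical rectangles behind the predictable sets: left-open in time, with the side
  in the sample space known at the left endpoint, and time zero treated apart. They are stable under
  intersection, so measures can be compared on them.\<close>

definition pred_rects :: "'a measure \<Rightarrow> (real \<Rightarrow> 'a measure) \<Rightarrow> ('a \<times> real) set set" where
  "pred_rects M F = {A \<times> {0} | A. A \<in> sets (F 0)} \<union> {A \<times> {s<..t} | A s t. 0 \<le> s \<and> A \<in> sets (F s)}"

definition rect_sigma :: "'a measure \<Rightarrow> (real \<Rightarrow> 'a measure) \<Rightarrow> ('a \<times> real) measure" where
  "rect_sigma M F = sigma (space M \<times> {0..}) (pred_rects M F)"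

locale filtered_space =
  fixes M :: "'a measure" and F :: "real \<Rightarrow> 'a measure"
  assumes fp: "filtered_prob_space M F"

lemma (in filtered_space) F_space: "space (F t) = space M"
  using fp unfolding filtered_prob_space_def subalgebra_def by auto

lemma (in filtered_space) F_sub: "A \<in> sets (F t) \<Longrightarrow> A \<in> sets M"
  using fp unfolding filtered_prob_space_def subalgebra_def by auto

lemma (in filtered_space) F_mono: "s \<le> t \<Longrightarrow> A \<in> sets (F s) \<Longrightarrow> A \<in> sets (F t)"
  using fp filtration.sets_F_mono unfolding filtered_prob_space_def by blast

lemma (in filtered_space) pred_rects_subset: "pred_rects M F \<subseteq> Pow (space M \<times> {0..})"
  unfolding pred_rects_def using sets.sets_into_space F_space by fastforce

lemma (in filtered_space) space_rect_sigma[simp]: "space (rect_sigma M F) = space M \<times> {0..}"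
  unfolding rect_sigma_def by (rule space_measure_of[OF pred_rects_subset])

lemma (in filtered_space) sets_rect_sigma: "sets (rect_sigma M F) = sigma_sets (space M \<times> {0..}) (pred_rects M F)"
  unfolding rect_sigma_def by (rule sets_measure_of[OF pred_rects_subset])

lemma (in filtered_space) rect_in: "R \<in> pred_rects M F \<Longrightarrow> R \<in> sets (rect_sigma M F)"
  unfolding sets_rect_sigma by (rule sigma_sets.Basic)

lemma (in filtered_space) Int_stable_pred_rects: "Int_stable (pred_rects M F)"
proof (rule Int_stableI)
  have dich: "(\<exists>A. x = A \<times> {0} \<and> A \<in> sets (F 0)) \<or> (\<exists>A s t. x = A \<times> {s<..t} \<and> 0 \<le> s \<and> A \<in> sets (F s))"
    if "x \<in> pred_rects M F" for x using that unfolding pred_rects_def by blast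
  have point: "A \<times> {0} \<in> pred_rects M F" if "A \<in> sets (F 0)" for A using that unfolding pred_rects_def by blast
  have empty: "{} \<in> pred_rects M F" using point[of "{}"] by simp
  fix a b assume "a \<in> pred_rects M F" "b \<in> pred_rects M F"
  from dich[OF this(1)] dich[OF this(2)] show "a \<inter> b \<in> pred_rects M F"
  proof (elim disjE exE conjE)
    fix A B assume *: "a = A \<times> {0}" "A \<in> sets (F 0)" "b = B \<times> {0}" "B \<in> sets (F 0)"
    have "a \<inter> b = (A \<inter> B) \<times> {0}" using * by auto
    then show ?thesis using point[of "A \<inter> B"] * by auto
  next
    fix A B s t assume *: "a = A \<times> {0}" "b = B \<times> {s<..t}" "0 \<le> s"
    then have "a \<inter> b = {}" by auto
    then show ?thesis using empty by simp
  next
    fix A B s t assume *: "b = A \<times> {0}" "a = B \<times> {s<..t}" "0 \<le> s"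
    then have "a \<inter> b = {}" by auto
    then show ?thesis using empty by simp
  next
    fix A B s t s' t' assume *: "a = A \<times> {s<..t}" "0 \<le> s" "A \<in> sets (F s)" "b = B \<times> {s'<..t'}" "0 \<le> s'" "B \<in> sets (F s')"
    have "a \<inter> b = (A \<inter> B) \<times> {max s s'<..min t t'}" unfolding * by auto
    moreover have "A \<inter> B \<in> sets (F (max s s'))" 
      using F_mono[of s "max s s'" A] F_mono[of s' "max s s'" B] * by auto
    moreover have "0 \<le> max s s'" using * by auto
    ultimately show ?thesis unfolding pred_rects_def by blast
  qed
qed

text \<open>Freezing \<open>Y\<close> at the left endpoints of dyadic intervals yields processes
  whose preimages are countable unions of rectangles; left continuity makes them converge to
  \<open>Y\<close>.\<close>

lemma (in filtered_space) left_continuous_rect_measurable: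
  assumes ad: "adapted F Y" and lc: "\<And>\<omega>. \<omega> \<in> space M \<Longrightarrow> left_continuous (\<lambda>t. Y t \<omega>)"
  shows "(\<lambda>(\<omega>, t). Y t \<omega>) \<in> borel_measurable (rect_sigma M F)"
proof -
  \<comment> \<open>For \<open>t > 0\<close>, the largest grid point strictly below
    \<open>t\<close>. Ceiling minus one instead of the floor matches the left-open intervals and
    keeps the approximation on the left also when \<open>t\<close> is a grid point.\<close>
  define \<tau> where "\<tau> k t = (if t \<le> 0 then 0 else (real_of_int \<lceil>2^k * t\<rceil> - 1) / 2^k)" for k :: nat and t :: real
  have appr: "(\<lambda>(\<omega>, t). Y (\<tau> k t) \<omega>) \<in> borel_measurable (rect_sigma M F)" for k
  proof (rule measurableI)
    fix D :: "real set" assume D: "D \<in> sets borel"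
    have pre: "Y s -` D \<inter> space M \<in> sets (F s)" if "0 \<le> s" for s
      using ad that D F_space[of s] measurable_sets[of "Y s" "F s" borel D] by (simp add: adapted_def)
    have "(\<lambda>(\<omega>, t). Y (\<tau> k t) \<omega>) -` D \<inter> space (rect_sigma M F) = 
       (Y 0 -` D \<inter> space M) \<times> {0} \<union> (\<Union>j::nat. (Y (real j / 2^k) -` D \<inter> space M) \<times> {real j / 2^k <.. (real j + 1) / 2^k})" (is "?L = ?R")
    proof (intro set_eqI iffI)
      fix p assume p: "p \<in> ?L"
      obtain \<omega> t where pp: "p = (\<omega>, t)" by force
      then have \<omega>: "\<omega> \<in> space M" "0 \<le> t" "Y (\<tau> k t) \<omega> \<in> D" using p by auto
      show "p \<in> ?R"
      proof (cases "t = 0")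
        case True
        then show ?thesis using \<omega> pp by (simp add: \<tau>_def)
      next
        case False
        then have t: "t > 0" using \<omega> by simp
        define j where "j = nat (\<lceil>2^k * t\<rceil> - 1)"
        have "0 < \<lceil>2^k * t\<rceil>" using t by simp
        then have j: "real j = real_of_int \<lceil>2^k * t\<rceil> - 1" unfolding j_def by simp
        have "real j < 2^k * t" "2^k * t \<le> real j + 1" unfolding j by linarith+
        then have "t \<in> {real j / 2^k <.. (real j + 1) / 2^k}" by (auto simp: field_simps)
        moreover have "\<tau> k t = real j / 2^k" using t by (simp add: \<tau>_def j)
        ultimately show ?thesis using \<omega> pp by auto
      qed
    next
      fix p assume p: "p \<in> ?R"
      obtain \<omega> t where pp: "p = (\<omega>, t)" by force
      from p consider "p \<in> (Y 0 -` D \<inter> space M) \<times> {0}" | j where "p \<in> (Y (real j / 2^k) -` D \<inter> space M) \<times> {real j / 2^k <.. (real j + 1) / 2^k}" by blast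
      then show "p \<in> ?L"
      proof cases
        case 1
        then show ?thesis using pp by (simp add: \<tau>_def)
      next
        case 2
        then have *: "\<omega> \<in> space M" "Y (real j / 2^k) \<omega> \<in> D" "real j / 2^k < t" "t \<le> (real j + 1) / 2^k" using pp by auto
        have t: "0 < t" by (rule le_less_trans[OF _ *(3)]) simp
        have "real j < 2^k * t" "2^k * t \<le> real j + 1" using *(3,4) by (auto simp: field_simps)
        then have "\<lceil>2^k * t\<rceil> = int j + 1" by (intro ceiling_unique) auto
        then have "\<tau> k t = real j / 2^k" using t by (simp add: \<tau>_def)
        then show ?thesis using pp * t by simp
      qed
    qed
    also have "\<dots> \<in> sets (rect_sigma M F)"
    proof (intro sets.Un sets.countable_UN subsetI)
      show "(Y 0 -` D \<inter> space M) \<times> {0} \<in> sets (rect_sigma M F)"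
        using pre[of 0] by (intro rect_in) (auto simp: pred_rects_def)
    next
      fix x assume "x \<in> range (\<lambda>j::nat. (Y (real j / 2^k) -` D \<inter> space M) \<times> {real j / 2^k <.. (real j + 1) / 2^k})"
      then obtain j :: nat where x: "x = (Y (real j / 2^k) -` D \<inter> space M) \<times> {real j / 2^k <.. (real j + 1) / 2^k}" by auto
      have "0 \<le> real j / 2^k" by simp
      then show "x \<in> sets (rect_sigma M F)" unfolding x pred_rects_def using pre
        by (intro rect_in) (unfold pred_rects_def, blast)
    qed
    finally show "(\<lambda>(\<omega>, t). Y (\<tau> k t) \<omega>) -` D \<inter> space (rect_sigma M F) \<in> sets (rect_sigma M F)" .
  qed simp
  show ?thesis
  proof (rule borel_measurable_LIMSEQ_real[OF _ appr])
    fix p assume "p \<in> space (rect_sigma M F)"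
    then obtain \<omega> t where p: "p = (\<omega>, t)" "\<omega> \<in> space M" "0 \<le> t" by (cases p) auto
    have "(\<lambda>k. Y (\<tau> k t) \<omega>) \<longlonglongrightarrow> Y t \<omega>"
    proof (cases "t = 0")
      case True then show ?thesis by (simp add: \<tau>_def)
    next
      case False
      then have t: "t > 0" using p by simp
      have b: "\<tau> k t < t" "t - (1/2)^k \<le> \<tau> k t" for k
      proof -
        have "real_of_int \<lceil>2^k * t\<rceil> - 1 < 2^k * t" "2^k * t \<le> real_of_int \<lceil>2^k * t\<rceil>" by linarith+
        then show "\<tau> k t < t" "t - (1/2)^k \<le> \<tau> k t" using t by (auto simp: \<tau>_def field_simps power_one_over)
      qed
      have "(\<lambda>k. \<tau> k t) \<longlonglongrightarrow> t"
      proof (rule tendsto_sandwich[OF _ _ _ tendsto_const])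
        show "(\<lambda>k. t - (1/2)^k) \<longlonglongrightarrow> t" using tendsto_diff[OF tendsto_const LIMSEQ_power_zero[of "1/2::real"], of t] by simp
      qed (auto intro!: always_eventually less_imp_le b)
      then have "filterlim (\<lambda>k. \<tau> k t) (at_left t) sequentially"
      proof -
        have "\<tau> k t \<noteq> t" for k using b(1)[of k] by simp
        then show ?thesis using \<open>(\<lambda>k. \<tau> k t) \<longlonglongrightarrow> t\<close> b(1) unfolding filterlim_at by (auto intro!: always_eventually)
      qed
      moreover have "((\<lambda>t. Y t \<omega>) \<longlongrightarrow> Y t \<omega>) (at_left t)"
        using lc[OF p(2)] t by (simp add: left_continuous_def continuous_within)
      ultimately show ?thesis by (rule filterlim_compose[rotated])
    qed
    then show "(\<lambda>k. (case p of (\<omega>, t) \<Rightarrow> Y (\<tau> k t) \<omega>)) \<longlonglongrightarrow> (case p of (\<omega>, t) \<Rightarrow> Y t \<omega>)" by (simp add: p)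
  qed
qed

lemma (in filtered_space) space_predictable_sigma: "space (predictable_sigma M F) = space M \<times> {0..}"
  unfolding predictable_sigma_def by (rule space_measure_of) auto

lemma (in filtered_space) rect_to_predictable: "(\<lambda>p. p) \<in> measurable (rect_sigma M F) (predictable_sigma M F)"
proof (rule measurable_sigma_sets)
  let ?E = "{{(\<omega>, t). \<omega> \<in> space M \<and> 0 \<le> t \<and> Y t \<omega> \<in> D} | Y D.
        adapted F Y \<and> (\<forall>\<omega>\<in>space M. left_continuous (\<lambda>t. Y t \<omega>)) \<and> D \<in> sets borel}"
  show "sets (predictable_sigma M F) = sigma_sets (space M \<times> {0..}) ?E"
    unfolding predictable_sigma_def by (rule sets_measure_of) auto
  show "?E \<subseteq> Pow (space M \<times> {0..})" by auto
  fix y assume "y \<in> ?E"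
  then obtain Y D where y: "y = {(\<omega>, t). \<omega> \<in> space M \<and> 0 \<le> t \<and> Y t \<omega> \<in> D}" and Y: "adapted F Y" "\<forall>\<omega>\<in>space M. left_continuous (\<lambda>t. Y t \<omega>)" "D \<in> sets borel" by blast
  have "(\<lambda>(\<omega>, t). Y t \<omega>) \<in> borel_measurable (rect_sigma M F)" by (rule left_continuous_rect_measurable) (use Y in auto)
  from measurable_sets[OF this Y(3)] have "(\<lambda>(\<omega>, t). Y t \<omega>) -` D \<inter> space (rect_sigma M F) \<in> sets (rect_sigma M F)" .
  moreover have "(\<lambda>(\<omega>, t). Y t \<omega>) -` D \<inter> space (rect_sigma M F) = (\<lambda>p. p) -` y \<inter> space (rect_sigma M F)"
    unfolding y by auto
  ultimately show "(\<lambda>p. p) -` y \<inter> space (rect_sigma M F) \<in> sets (rect_sigma M F)" by simp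
qed auto

text \<open>\<open>rect_sigma\<close> lives on nonnegative times only. The absolute value maps the
  whole line into them, so that the usual product measurability and Fubini arguments apply.\<close>

lemma (in filtered_space) abs_rect_measurable: "(\<lambda>(\<omega>, s). (\<omega>, \<bar>s\<bar>)) \<in> measurable (M \<Otimes>\<^sub>M borel) (rect_sigma M F)"
proof (rule measurable_sigma_sets[OF sets_rect_sigma pred_rects_subset])
  fix y assume "y \<in> pred_rects M F"
  then consider A where "y = A \<times> {0}" "A \<in> sets (F 0)" | A s t where "y = A \<times> {s<..t}" "A \<in> sets (F s)"
    unfolding pred_rects_def by blast
  then show "(\<lambda>(\<omega>, s). (\<omega>, \<bar>s\<bar>)) -` y \<inter> space (M \<Otimes>\<^sub>M borel) \<in> sets (M \<Otimes>\<^sub>M borel)"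
  proof cases
    case 1
    then have "A \<in> sets M" using F_sub by blast
    moreover have "(\<lambda>(\<omega>, s). (\<omega>, \<bar>s\<bar>)) -` y \<inter> space (M \<Otimes>\<^sub>M borel) = A \<times> {0::real}"
      using sets.sets_into_space[OF \<open>A \<in> sets M\<close>] 1 by (auto simp: space_pair_measure)
    ultimately show ?thesis by simp
  next
    case 2
    then have "A \<in> sets M" using F_sub by blast
    moreover have "(\<lambda>(\<omega>, s). (\<omega>, \<bar>s\<bar>)) -` y \<inter> space (M \<Otimes>\<^sub>M borel) = A \<times> {r. \<bar>r\<bar> \<in> {s<..t}}"
      using sets.sets_into_space[OF \<open>A \<in> sets M\<close>] 2 by (auto simp: space_pair_measure)
    moreover have "{r::real. \<bar>r\<bar> \<in> {s<..t}} \<in> sets borel" by measurable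
    ultimately show ?thesis by simp
  qed
qed (auto simp: space_pair_measure)

text \<open>Progressive measurability: with time frozen at \<open>t\<close>, a rectangle starting at
  \<open>a\<close> is met only if \<open>a < t\<close>, and then its side already belongs to
  \<open>F t\<close>.\<close>

lemma (in filtered_space) stop_rect_measurable:
  assumes t: "0 \<le> t"
  shows "(\<lambda>(\<omega>, s). (\<omega>, min \<bar>s\<bar> t)) \<in> measurable (F t \<Otimes>\<^sub>M borel) (rect_sigma M F)"
proof (rule measurable_sigma_sets[OF sets_rect_sigma pred_rects_subset])
  fix y assume "y \<in> pred_rects M F"
  then consider A where "y = A \<times> {0}" "A \<in> sets (F 0)" | A a b where "y = A \<times> {a<..b}" "A \<in> sets (F a)" "0 \<le> a"
    unfolding pred_rects_def by blast
  then show "(\<lambda>(\<omega>, s). (\<omega>, min \<bar>s\<bar> t)) -` y \<inter> space (F t \<Otimes>\<^sub>M borel) \<in> sets (F t \<Otimes>\<^sub>M borel)"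
  proof cases
    case 1
    then have A: "A \<in> sets (F t)" using F_mono[OF t] by blast
    moreover have "(\<lambda>(\<omega>, s). (\<omega>, min \<bar>s\<bar> t)) -` y \<inter> space (F t \<Otimes>\<^sub>M borel) = A \<times> {r. min \<bar>r\<bar> t \<in> {0}}"
      using sets.sets_into_space[OF A] 1 by (auto simp: space_pair_measure)
    moreover have "{r::real. min \<bar>r\<bar> t \<in> {0}} \<in> sets borel" by measurable
    ultimately show ?thesis by simp
  next
    case 2
    show ?thesis
    proof (cases "a < t")
      case True
      then have A: "A \<in> sets (F t)" using F_mono[of a t] 2 by auto
      moreover have "(\<lambda>(\<omega>, s). (\<omega>, min \<bar>s\<bar> t)) -` y \<inter> space (F t \<Otimes>\<^sub>M borel) = A \<times> {r. min \<bar>r\<bar> t \<in> {a<..b}}"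
        using sets.sets_into_space[OF A] 2 by (auto simp: space_pair_measure)
      moreover have "{r::real. min \<bar>r\<bar> t \<in> {a<..b}} \<in> sets borel" by measurable
      ultimately show ?thesis by simp
    next
      case False
      then have "(\<lambda>(\<omega>, s). (\<omega>, min \<bar>s\<bar> t)) -` y \<inter> space (F t \<Otimes>\<^sub>M borel) = {}" using 2 by auto
      then show ?thesis by simp
    qed
  qed
qed (use t in \<open>auto simp: space_pair_measure F_space\<close>)

text \<open>Cutting the integrand at height \<open>k\<close> makes the integral Lipschitz in time;
  it is then adapted and left-continuous, hence predictable. Monotone convergence removes the
  cut.\<close>

lemma (in filtered_space) predictable_time_integral:
  fixes V :: "'a \<times> real \<Rightarrow> ennreal"
  assumes V: "V \<in> borel_measurable (rect_sigma M F)"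
  shows "predictable_process M F (\<lambda>t \<omega>. \<integral>\<^sup>+s. V (\<omega>, \<bar>s\<bar>) * indicator {0<..t} s \<partial>lborel)"
proof -
  define Ik where "Ik k t \<omega> = (\<integral>\<^sup>+s. min (V (\<omega>, \<bar>s\<bar>)) (of_nat k) * indicator {0<..t} s \<partial>lborel)" for k :: nat and t \<omega>
  have Vm: "(\<lambda>(\<omega>, s). V (\<omega>, \<bar>s\<bar>)) \<in> borel_measurable (M \<Otimes>\<^sub>M borel)"
    using measurable_compose[OF abs_rect_measurable V] by (simp add: case_prod_beta)
  have V\<omega>[measurable]: "(\<lambda>s. V (\<omega>, \<bar>s\<bar>)) \<in> borel_measurable borel" if "\<omega> \<in> space M" for \<omega>
    using measurable_Pair2[OF Vm that] by simp
  have bound: "Ik k t \<omega> \<le> ennreal (real k * t)" if "0 \<le> t" for k t \<omega>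
  proof -
    have "Ik k t \<omega> \<le> (\<integral>\<^sup>+s. of_nat k * indicator {0<..t} s \<partial>lborel)"
      unfolding Ik_def by (intro nn_integral_mono mult_right_mono) auto
    also have "\<dots> = of_nat k * ennreal t" using that by (simp add: nn_integral_cmult_indicator)
    finally show ?thesis using that by (simp add: ennreal_mult' ennreal_of_nat_eq_real_of_nat)
  qed
  have incr: "Ik k t \<omega> \<le> Ik k s \<omega> + ennreal (real k * (t - s))" if "s \<le> t" "\<omega> \<in> space M" for k s t \<omega>
  proof -
    have [measurable]: "(\<lambda>s. V (\<omega>, \<bar>s\<bar>)) \<in> borel_measurable borel" using V\<omega> that by simp
    have "Ik k t \<omega> \<le> (\<integral>\<^sup>+r. min (V (\<omega>, \<bar>r\<bar>)) (of_nat k) * indicator {0<..s} r + of_nat k * indicator {s<..t} r \<partial>lborel)"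
      unfolding Ik_def by (intro nn_integral_mono) (auto simp: indicator_def)
    also have "\<dots> = Ik k s \<omega> + of_nat k * ennreal (t - s)"
      unfolding Ik_def using that by (subst nn_integral_add) (auto simp: nn_integral_cmult_indicator)
    finally show ?thesis using that by (simp add: ennreal_mult' ennreal_of_nat_eq_real_of_nat)
  qed
  have mono: "Ik k s \<omega> \<le> Ik k t \<omega>" if "s \<le> t" for k s t \<omega>
    unfolding Ik_def using that by (intro nn_integral_mono mult_left_mono) (auto simp: indicator_def)
  define Y where "Y k t \<omega> = enn2real (Ik k t \<omega>)" for k t \<omega>
  have fin: "Ik k t \<omega> = ennreal (Y k t \<omega>)" if "0 \<le> t" for k t \<omega>
    using bound[OF that, of k \<omega>] unfolding Y_def by (metis ennreal_enn2real ennreal_less_top le_less_trans)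
  have "predictable_process M F (Y k)" for k
  proof (rule predictable_process_left_continuous)
    show "adapted F (Y k)" unfolding adapted_def
    proof (intro allI impI)
      fix t :: real assume t: "0 \<le> t"
      have [measurable]: "(\<lambda>(\<omega>, s). V (\<omega>, min \<bar>s\<bar> t)) \<in> borel_measurable (F t \<Otimes>\<^sub>M borel)"
        using measurable_compose[OF stop_rect_measurable[OF t] V] by (simp add: case_prod_beta)
      have [measurable]: "(\<lambda>(\<omega>, s). V (\<omega>, min \<bar>s\<bar> t)) \<in> borel_measurable (F t \<Otimes>\<^sub>M lborel)"
        by (simp cong: measurable_cong_sets)
      have "(\<lambda>\<omega>. \<integral>\<^sup>+s. min (V (\<omega>, min \<bar>s\<bar> t)) (of_nat k) * indicator {0<..t} s \<partial>lborel) \<in> borel_measurable (F t)"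
        by measurable
      moreover have "Ik k t \<omega> = (\<integral>\<^sup>+s. min (V (\<omega>, min \<bar>s\<bar> t)) (of_nat k) * indicator {0<..t} s \<partial>lborel)" for \<omega>
        unfolding Ik_def by (intro nn_integral_cong) (auto simp: indicator_def)
      ultimately show "Y k t \<in> borel_measurable (F t)" unfolding Y_def by simp
    qed
    fix \<omega> assume \<omega>: "\<omega> \<in> space M"
    have lip: "\<bar>Y k t \<omega> - Y k s \<omega>\<bar> \<le> real k * (t - s)" if "0 \<le> s" "s \<le> t" for s t
    proof -
      have "ennreal (Y k s \<omega>) \<le> ennreal (Y k t \<omega>)" using mono[of s t k \<omega>] fin that by simp
      then have "Y k s \<omega> \<le> Y k t \<omega>" by (simp add: Y_def)
      moreover have "ennreal (Y k t \<omega>) \<le> ennreal (Y k s \<omega> + real k * (t - s))"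
      proof -
        have "ennreal (Y k t \<omega>) \<le> ennreal (Y k s \<omega>) + ennreal (real k * (t - s))"
          using incr[OF that(2) \<omega>, of k] fin[of t k \<omega>] fin[of s k \<omega>] that by simp
        then show ?thesis using that by (subst ennreal_plus) (auto simp: Y_def)
      qed
      then have "Y k t \<omega> \<le> Y k s \<omega> + real k * (t - s)" 
        using that by (subst (asm) ennreal_le_iff) (auto simp: Y_def)
      ultimately show ?thesis by simp
    qed
    show "left_continuous (\<lambda>t. Y k t \<omega>)" unfolding left_continuous_def continuous_within
    proof (intro allI impI)
      fix t :: real assume t: "0 < t"
      have "((\<lambda>s. Y k s \<omega> - Y k t \<omega>) \<longlongrightarrow> 0) (at_left t)"
      proof (rule tendsto_rabs_zero_cancel, rule tendsto_sandwich[OF _ _ tendsto_const])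
        have "\<forall>\<^sub>F s in at_left t. 0 < s" using t by (auto simp: eventually_at_left)
        moreover have "\<forall>\<^sub>F s in at_left t. s < t" by (simp add: eventually_at_filter)
        ultimately show "\<forall>\<^sub>F s in at_left t. \<bar>Y k s \<omega> - Y k t \<omega>\<bar> \<le> real k * (t - s)"
          by eventually_elim (use lip in \<open>auto simp: abs_minus_commute\<close>)
        have "((\<lambda>s. real k * (t - s)) \<longlongrightarrow> real k * (t - t)) (at_left t)" by (intro tendsto_intros)
        then show "((\<lambda>s. real k * (t - s)) \<longlongrightarrow> 0) (at_left t)" by simp
      qed simp
      then show "((\<lambda>s. Y k s \<omega>) \<longlongrightarrow> Y k t \<omega>) (at_left t)" by (simp add: LIM_zero_iff)
    qed
  qed
  then have Ym: "(\<lambda>(\<omega>, t). Y k t \<omega>) \<in> borel_measurable (predictable_sigma M F)" for k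
    unfolding predictable_process_def .
  have "(\<lambda>p. SUP k. ennreal (case p of (\<omega>, t) \<Rightarrow> Y k t \<omega>)) \<in> borel_measurable (predictable_sigma M F)"
    using Ym by (intro borel_measurable_SUP) auto
  moreover have "(SUP k. ennreal (case p of (\<omega>, t) \<Rightarrow> Y k t \<omega>)) = (case p of (\<omega>, t) \<Rightarrow> \<integral>\<^sup>+s. V (\<omega>, \<bar>s\<bar>) * indicator {0<..t} s \<partial>lborel)"
    if "p \<in> space (predictable_sigma M F)" for p
  proof -
    obtain \<omega> t where p1: "p = (\<omega>, t)" by (cases p)
    then have p: "p = (\<omega>, t)" "\<omega> \<in> space M" "0 \<le> t" using that unfolding space_predictable_sigma by auto
    have [measurable]: "(\<lambda>s. V (\<omega>, \<bar>s\<bar>)) \<in> borel_measurable borel" using V\<omega> p by simp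
    have "(SUP k. ennreal (Y k t \<omega>)) = (SUP k. Ik k t \<omega>)" using fin[OF p(3)] by simp
    also have "\<dots> = (\<integral>\<^sup>+s. (SUP k. min (V (\<omega>, \<bar>s\<bar>)) (of_nat k) * indicator {0<..t} s) \<partial>lborel)"
      unfolding Ik_def 
    proof (rule nn_integral_monotone_convergence_SUP[symmetric])
      show "incseq (\<lambda>k s. min (V (\<omega>, \<bar>s\<bar>)) (of_nat k) * indicator {0<..t} s)"
        by (auto simp: incseq_def le_fun_def intro!: mult_right_mono min.mono)
    qed measurable
    also have "\<dots> = (\<integral>\<^sup>+s. V (\<omega>, \<bar>s\<bar>) * indicator {0<..t} s \<partial>lborel)"
    proof (intro nn_integral_cong)
      fix s
      have "(SUP k. min x (of_nat k)) = x" for x :: ennreal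
      proof -
        have "(SUP k. min x (of_nat k)) = min x (SUP k. of_nat k)"
          using inf_SUP[of x "of_nat :: nat \<Rightarrow> ennreal" UNIV] by (simp add: inf_min)
        then show ?thesis by (simp add: ennreal_SUP_of_nat_eq_top)
      qed
      then show "(SUP k. min (V (\<omega>, \<bar>s\<bar>)) (of_nat k) * indicator {0<..t} s) = V (\<omega>, \<bar>s\<bar>) * indicator {0<..t} s"
        by (simp add: indicator_def)
    qed
    finally show ?thesis by (simp add: p)
  qed
  ultimately show ?thesis unfolding predictable_process_def by (subst measurable_cong[symmetric]) auto
qed

lemmas (in sym_noise) filtered_rects = filtered_space.intro[OF filtered]

section \<open>The compensator of the jumps\<close>

definition (in sym_noise) lev :: "real measure" where "lev = scale_measure (ennreal lam) \<mu>"

lemma (in sym_noise) sets_lev[simp, measurable_cong]: "sets lev = sets borel"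
  by (simp add: lev_def)

lemma (in sym_noise) space_lev[simp]: "space lev = UNIV"
  by (simp add: lev_def space_scale_measure)

lemma (in sym_noise) nn_lev: "h \<in> borel_measurable borel \<Longrightarrow> (\<integral>\<^sup>+x. h x \<partial>lev) = ennreal lam * (\<integral>\<^sup>+x. h x \<partial>\<mu>)"
  unfolding lev_def by (rule nn_integral_scale_measure) simp

lemma (in sym_noise) finite_lev: "finite_measure lev"
  by (rule finite_measureI) (simp add: lev_def space_scale_measure mu.emeasure_space_1[simplified] ennreal_mult_less_top)

lemmas (in sym_noise) sigma_finite_lev = finite_measure.axioms(1)[OF finite_lev]

definition (in sym_noise) time_meas :: "real measure" where "time_meas = density lborel (indicator {0<..})"

lemma (in sym_noise) sets_time_meas[simp, measurable_cong]: "sets time_meas = sets borel" by (simp add: time_meas_def)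
lemma (in sym_noise) space_time_meas[simp]: "space time_meas = UNIV" by (simp add: time_meas_def)

lemma (in sym_noise) sigma_finite_time: "sigma_finite_measure time_meas"
  unfolding time_meas_def
  by (subst sigma_finite_measure.sigma_finite_iff_density_finite[OF sigma_finite_lborel]) (auto simp: indicator_def)

definition (in sym_noise) comp_meas :: "(real \<times> real) measure" where "comp_meas = time_meas \<Otimes>\<^sub>M lev"

lemma (in sym_noise) sets_comp_meas[measurable_cong]: "sets comp_meas = sets (borel \<Otimes>\<^sub>M borel)"
  unfolding comp_meas_def by (intro sets_pair_measure_cong) simp_all

lemma (in sym_noise) nn_time: "h \<in> borel_measurable borel \<Longrightarrow> (\<integral>\<^sup>+s. h s \<partial>time_meas) = (\<integral>\<^sup>+s. h s * indicator {0<..} s \<partial>lborel)"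
  unfolding time_meas_def by (subst nn_integral_density) (auto simp: mult.commute)

lemma (in sym_noise) nn_comp: 
  assumes [measurable]: "g \<in> borel_measurable (borel \<Otimes>\<^sub>M borel)"
  shows "(\<integral>\<^sup>+p. g p \<partial>comp_meas) = (\<integral>\<^sup>+s. (\<integral>\<^sup>+x. g (s, x) \<partial>lev) * indicator {0<..} s \<partial>lborel)"
proof -
  have [measurable]: "g \<in> borel_measurable (borel \<Otimes>\<^sub>M lev)" by (simp cong: measurable_cong_sets)
  have "(\<integral>\<^sup>+p. g p \<partial>comp_meas) = (\<integral>\<^sup>+s. (\<integral>\<^sup>+x. g (s, x) \<partial>lev) \<partial>time_meas)"
    unfolding comp_meas_def by (subst sigma_finite_measure.nn_integral_fst[OF sigma_finite_lev, symmetric]) (simp_all cong: measurable_cong_sets)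
  also have "\<dots> = (\<integral>\<^sup>+s. (\<integral>\<^sup>+x. g (s, x) \<partial>lev) * indicator {0<..} s \<partial>lborel)"
    by (rule nn_time, rule sigma_finite_measure.borel_measurable_nn_integral_fst[OF sigma_finite_lev]) fact
  finally show ?thesis .
qed

lemma (in sym_noise) comp_meas_emeasure:
  assumes D: "D \<in> sets borel"
  shows "emeasure comp_meas D = (\<integral>\<^sup>+ s\<in>{0..}. emeasure lev {x. (s, x) \<in> D} \<partial>lborel)"
proof -
  have D'[measurable]: "D \<in> sets (borel \<Otimes>\<^sub>M borel)" using D by (simp only: borel_prod)
  have "emeasure comp_meas D = (\<integral>\<^sup>+p. indicator D p \<partial>comp_meas)" by (simp add: sets_comp_meas)
  also have "\<dots> = (\<integral>\<^sup>+s. (\<integral>\<^sup>+x. indicator D (s, x) \<partial>lev) * indicator {0<..} s \<partial>lborel)"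
    by (rule nn_comp) measurable
  also have "\<dots> = (\<integral>\<^sup>+ s\<in>{0..}. emeasure lev {x. (s, x) \<in> D} \<partial>lborel)"
  proof (rule nn_integral_cong_AE)
    show "AE s in lborel. (\<integral>\<^sup>+x. indicator D (s, x) \<partial>lev) * indicator {0<..} s = emeasure lev {x. (s, x) \<in> D} * indicator {0..} s"
      using AE_lborel_singleton[of 0]
    proof eventually_elim
      fix s :: real assume "s \<noteq> 0"
      have "{x. (s, x) \<in> D} \<in> sets lev" using sets_Pair1[OF D', of s] by (simp add: vimage_def)
      moreover have "(\<lambda>x. indicator D (s, x) :: ennreal) = indicator {x. (s, x) \<in> D}" by (auto simp: indicator_def)
      ultimately have "(\<integral>\<^sup>+x. indicator D (s, x) \<partial>lev) = emeasure lev {x. (s, x) \<in> D}" by simp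
      with \<open>s \<noteq> 0\<close> show "(\<integral>\<^sup>+x. indicator D (s, x) \<partial>lev) * indicator {0<..} s = emeasure lev {x. (s, x) \<in> D} * indicator {0..} s"
        by (auto simp: indicator_def)
    qed
  qed
  finally show ?thesis .
qed

lemma (in sym_noise) comp_meas_nonpos: "emeasure comp_meas ({..0} \<times> UNIV) = 0"
proof -
  have "{..0} \<times> UNIV \<in> sets (borel :: (real \<times> real) measure)" by (simp add: borel_prod[symmetric])
  then have "emeasure comp_meas ({..0} \<times> UNIV) = (\<integral>\<^sup>+ (s::real)\<in>{0..}. emeasure lev {x. (s, x) \<in> {..0} \<times> (UNIV::real set)} \<partial>lborel)"
    by (rule comp_meas_emeasure)
  also have "\<dots> = (\<integral>\<^sup>+ (s::real). 0 \<partial>lborel)"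
    by (rule nn_integral_cong_AE) (use AE_lborel_singleton[of 0] in \<open>auto simp: indicator_def elim!: eventually_mono\<close>)
  finally show ?thesis by simp
qed

lemma (in sym_noise) AE_comp_pos: "AE p in comp_meas. 0 < fst p"
proof (rule AE_I[where N="{..0} \<times> UNIV"])
  show "{..0} \<times> UNIV \<in> sets comp_meas" unfolding sets_comp_meas by simp
qed (auto simp: comp_meas_nonpos)

lemma (in sym_noise) AE_jump_pos: "AE p in jump_measure (X \<sigma>) \<omega>. 0 < fst p"
proof -
  have "{p\<in>space borel. 0 < fst p} \<in> sets (borel :: (real \<times> real) measure)" 
    unfolding borel_prod[symmetric] by measurable
  then show ?thesis unfolding jump_measure_def by (subst AE_distr_iff) auto
qed

lemma (in sym_noise) nn_jump:
  assumes \<omega>: "\<omega> \<in> space M" and g: "g \<in> borel_measurable (borel \<Otimes>\<^sub>M borel)"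
  shows "(\<integral>\<^sup>+p. g p \<partial>jump_measure (X \<sigma>) \<omega>) = (\<integral>\<^sup>+(k, i). (if i < K k \<omega> then g (mark k i \<omega>) else 0) \<partial>count_space UNIV)"
proof -
  let ?S = "{s. 0 < s \<and> jump (\<lambda>u. X \<sigma> u \<omega>) s \<noteq> 0}"
  have ap: "all_points \<omega> = {(k, i). i < K k \<omega>}" by (auto simp: all_points_def points_def)
  have bij: "bij_betw (u_of \<omega>) (all_points \<omega>) ?S"
    unfolding X_jump_support[OF \<omega>] using u_of_inj[OF \<omega>] by (rule inj_on_imp_bij_betw)
  have "(\<integral>\<^sup>+p. g p \<partial>jump_measure (X \<sigma>) \<omega>) = (\<integral>\<^sup>+s. g (s, jump (\<lambda>u. X \<sigma> u \<omega>) s) \<partial>count_space ?S)"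
    unfolding jump_measure_def using g by (subst nn_integral_distr) (auto simp: borel_prod)
  also have "\<dots> = (\<integral>\<^sup>+p. g (u_of \<omega> p, jump (\<lambda>u. X \<sigma> u \<omega>) (u_of \<omega> p)) \<partial>count_space (all_points \<omega>))"
    by (rule nn_integral_bij_count_space[OF bij, symmetric])
  also have "\<dots> = (\<integral>\<^sup>+p. g (u_of \<omega> p, j_of \<omega> p) \<partial>count_space (all_points \<omega>))"
    by (intro nn_integral_cong) (simp add: X_jump_at[OF \<omega>])
  also have "\<dots> = (\<integral>\<^sup>+p. g (u_of \<omega> p, j_of \<omega> p) * indicator (all_points \<omega>) p \<partial>count_space UNIV)"
    by (rule nn_integral_count_space_indicator) simp
  also have "\<dots> = (\<integral>\<^sup>+(k, i). (if i < K k \<omega> then g (mark k i \<omega>) else 0) \<partial>count_space UNIV)"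
    by (intro nn_integral_cong) (auto simp: ap u_of_def j_of_def indicator_def)
  finally show ?thesis .
qed

abbreviation (in sym_noise) "RS \<equiv> rect_sigma M Filt"

lemma (in sym_noise) mark_rect_measurable: "(\<lambda>(\<omega>, (k, i)). ((\<omega>, U k i \<omega>), J k i \<omega>)) \<in> measurable (M \<Otimes>\<^sub>M count_space UNIV) (RS \<Otimes>\<^sub>M borel)"
proof -
  have s: "(\<lambda>\<omega>. ((\<omega>, U k i \<omega>), J k i \<omega>)) \<in> measurable M (RS \<Otimes>\<^sub>M borel)" for k i
  proof -
    have "(\<lambda>\<omega>. (\<omega>, U k i \<omega>)) \<in> measurable M RS"
    proof (rule measurable_cong[THEN iffD1])
      show "(\<lambda>\<omega>. (\<lambda>(\<omega>, s). (\<omega>, \<bar>s\<bar>)) (\<omega>, U k i \<omega>)) \<in> measurable M RS"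
        by (rule measurable_compose[OF _ filtered_space.abs_rect_measurable[OF filtered_rects]]) measurable
      fix \<omega> assume "\<omega> \<in> space M"
      then have "0 < U k i \<omega>" using U_bounds(1)[of \<omega> k i] by (meson of_nat_0_le_iff order_le_less_trans)
      then show "(\<lambda>(\<omega>, s). (\<omega>, \<bar>s\<bar>)) (\<omega>, U k i \<omega>) = (\<omega>, U k i \<omega>)" by simp
    qed
    then show ?thesis by measurable
  qed
  have "(\<lambda>p. (\<lambda>n \<omega>. ((\<omega>, U (fst n) (snd n) \<omega>), J (fst n) (snd n) \<omega>)) (snd p) (fst p)) \<in> measurable (M \<Otimes>\<^sub>M count_space UNIV) (RS \<Otimes>\<^sub>M borel)"
    by (rule measurable_compose_countable[where g=snd]) (use measurable_compose[OF measurable_fst s] in auto)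
  then show ?thesis by (simp add: case_prod_beta)
qed

text \<open>The measure on triples of sample point, time and size induced by the jumps.
  \<open>comp_law\<close> is its analogue for the candidate compensator, and the compensation
  identity for all predictable integrands says that the two measures agree.\<close>

definition (in sym_noise) jump_law :: "(('a \<times> real) \<times> real) measure" where
  "jump_law = distr (density (M \<Otimes>\<^sub>M count_space UNIV) (\<lambda>(\<omega>, (k, i)). if i < K k \<omega> then 1 else 0)) (RS \<Otimes>\<^sub>M borel)
     (\<lambda>(\<omega>, (k, i)). ((\<omega>, U k i \<omega>), J k i \<omega>))"

definition (in sym_noise) comp_law :: "(('a \<times> real) \<times> real) measure" where
  "comp_law = distr ((M \<Otimes>\<^sub>M time_meas) \<Otimes>\<^sub>M lev) (RS \<Otimes>\<^sub>M borel) (\<lambda>((\<omega>, s), x). ((\<omega>, \<bar>s\<bar>), x))"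

lemma (in sym_noise) nn_jump_law:
  assumes W[measurable]: "W \<in> borel_measurable (RS \<Otimes>\<^sub>M borel)"
  shows "(\<integral>\<^sup>+p. W p \<partial>jump_law) = (\<integral>\<^sup>+\<omega>. \<integral>\<^sup>+(k, i). (if i < K k \<omega> then W ((\<omega>, U k i \<omega>), J k i \<omega>) else 0) \<partial>count_space UNIV \<partial>M)"
proof -
  interpret C: sigma_finite_measure "count_space UNIV :: (nat \<times> nat) measure"
    by (rule sigma_finite_measure_count_space_countable) simp
  have dm[measurable]: "(\<lambda>(\<omega>, (k, i)). if i < K k \<omega> then 1 else 0 :: ennreal) \<in> borel_measurable (M \<Otimes>\<^sub>M count_space UNIV)"
  proof -
    have s: "(\<lambda>\<omega>. if i < K k \<omega> then 1 else 0 :: ennreal) \<in> borel_measurable M" for k i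
      using measurable_compose[OF K_measurable[of k], of "\<lambda>n. if i < n then 1 else 0 :: ennreal" borel] by simp
    have "(\<lambda>p. (\<lambda>n \<omega>. if snd n < K (fst n) \<omega> then 1 else 0 :: ennreal) (snd p) (fst p)) \<in> borel_measurable (M \<Otimes>\<^sub>M count_space UNIV)"
      by (rule measurable_compose_countable[where g=snd]) (use measurable_compose[OF measurable_fst s] in auto)
    then show ?thesis by (simp add: case_prod_beta)
  qed
  have Wm[measurable]: "(\<lambda>p. W ((\<lambda>(\<omega>, (k, i)). ((\<omega>, U k i \<omega>), J k i \<omega>)) p)) \<in> borel_measurable (M \<Otimes>\<^sub>M count_space UNIV)"
    by (rule measurable_compose[OF mark_rect_measurable W])
  have "(\<integral>\<^sup>+p. W p \<partial>jump_law) = (\<integral>\<^sup>+p. W ((\<lambda>(\<omega>, (k, i)). ((\<omega>, U k i \<omega>), J k i \<omega>)) p) \<partial>density (M \<Otimes>\<^sub>M count_space UNIV) (\<lambda>(\<omega>, (k, i)). if i < K k \<omega> then 1 else 0))"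
    unfolding jump_law_def by (rule nn_integral_distr) (use mark_rect_measurable W in simp_all)
  also have "\<dots> = (\<integral>\<^sup>+p. (\<lambda>(\<omega>, (k, i)). if i < K k \<omega> then 1 else 0) p * W ((\<lambda>(\<omega>, (k, i)). ((\<omega>, U k i \<omega>), J k i \<omega>)) p) \<partial>(M \<Otimes>\<^sub>M count_space UNIV))"
    by (rule nn_integral_density[OF dm Wm])
  also have "\<dots> = (\<integral>\<^sup>+\<omega>. \<integral>\<^sup>+n. (\<lambda>(\<omega>, (k, i)). if i < K k \<omega> then 1 else 0) (\<omega>, n) * W ((\<lambda>(\<omega>, (k, i)). ((\<omega>, U k i \<omega>), J k i \<omega>)) (\<omega>, n)) \<partial>count_space UNIV \<partial>M)"
    by (rule C.nn_integral_fst[symmetric]) (intro borel_measurable_times_ennreal dm Wm)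
  also have "\<dots> = (\<integral>\<^sup>+\<omega>. \<integral>\<^sup>+(k, i). (if i < K k \<omega> then W ((\<omega>, U k i \<omega>), J k i \<omega>) else 0) \<partial>count_space UNIV \<partial>M)"
    by (intro nn_integral_cong) (auto split: prod.splits)
  finally show ?thesis .
qed

lemma (in sym_noise) abs_rect_measurable2: "(\<lambda>((\<omega>, s), x). ((\<omega>, \<bar>s\<bar>), x)) \<in> measurable ((M \<Otimes>\<^sub>M borel) \<Otimes>\<^sub>M (borel :: real measure)) (RS \<Otimes>\<^sub>M borel)"
proof -
  have "(\<lambda>p. (\<lambda>(\<omega>, s). (\<omega>, \<bar>s\<bar>)) (fst p)) \<in> measurable ((M \<Otimes>\<^sub>M borel) \<Otimes>\<^sub>M (borel :: real measure)) RS"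
    by (rule measurable_compose[OF measurable_fst filtered_space.abs_rect_measurable[OF filtered_rects]])
  then have "(\<lambda>p. ((\<lambda>(\<omega>, s). (\<omega>, \<bar>s\<bar>)) (fst p), snd p)) \<in> measurable ((M \<Otimes>\<^sub>M borel) \<Otimes>\<^sub>M (borel :: real measure)) (RS \<Otimes>\<^sub>M borel)"
    by (intro measurable_Pair measurable_snd)
  then show ?thesis by (simp add: case_prod_unfold)
qed

lemma (in sym_noise) nn_comp_law:
  assumes W: "W \<in> borel_measurable (RS \<Otimes>\<^sub>M borel)"
  shows "(\<integral>\<^sup>+p. W p \<partial>comp_law) = (\<integral>\<^sup>+\<omega>. \<integral>\<^sup>+(s, x). W ((\<omega>, \<bar>s\<bar>), x) \<partial>comp_meas \<partial>M)"
proof -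
  let ?T = "\<lambda>((\<omega>, s), x). ((\<omega>, \<bar>s\<bar>), x) :: ('a \<times> real) \<times> real"
  have sets1: "sets ((M \<Otimes>\<^sub>M time_meas) \<Otimes>\<^sub>M lev) = sets ((M \<Otimes>\<^sub>M borel) \<Otimes>\<^sub>M borel)"
    by (intro sets_pair_measure_cong) simp_all
  have T: "?T \<in> measurable ((M \<Otimes>\<^sub>M time_meas) \<Otimes>\<^sub>M lev) (RS \<Otimes>\<^sub>M borel)"
    using abs_rect_measurable2 by (simp only: measurable_cong_sets[OF sets1 refl])
  have WT0: "(\<lambda>p. W (?T p)) \<in> borel_measurable ((M \<Otimes>\<^sub>M borel) \<Otimes>\<^sub>M borel)"
    by (rule measurable_compose[OF abs_rect_measurable2 W])
  have WT: "(\<lambda>p. W (?T p)) \<in> borel_measurable ((M \<Otimes>\<^sub>M time_meas) \<Otimes>\<^sub>M lev)"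
    by (rule measurable_compose[OF T W])
  have "(\<lambda>q. (\<integral>\<^sup>+x. W (?T (q, x)) \<partial>lev)) \<in> borel_measurable (M \<Otimes>\<^sub>M time_meas)"
    using sigma_finite_measure.borel_measurable_nn_integral_fst[OF sigma_finite_lev WT] by simp
  have "(\<integral>\<^sup>+p. W p \<partial>comp_law) = (\<integral>\<^sup>+p. W (?T p) \<partial>((M \<Otimes>\<^sub>M time_meas) \<Otimes>\<^sub>M lev))"
    unfolding comp_law_def using W by (intro nn_integral_distr[OF T]) simp
  also have "\<dots> = (\<integral>\<^sup>+q. \<integral>\<^sup>+x. W (?T (q, x)) \<partial>lev \<partial>(M \<Otimes>\<^sub>M time_meas))"
    by (rule sigma_finite_measure.nn_integral_fst[OF sigma_finite_lev WT, symmetric])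
  also have "\<dots> = (\<integral>\<^sup>+\<omega>. \<integral>\<^sup>+s. \<integral>\<^sup>+x. W (?T ((\<omega>, s), x)) \<partial>lev \<partial>time_meas \<partial>M)"
    by (rule sigma_finite_measure.nn_integral_fst[OF sigma_finite_time, symmetric]) fact
  also have "\<dots> = (\<integral>\<^sup>+\<omega>. \<integral>\<^sup>+(s, x). W ((\<omega>, \<bar>s\<bar>), x) \<partial>comp_meas \<partial>M)"
  proof (rule nn_integral_cong)
    fix \<omega> assume \<omega>: "\<omega> \<in> space M"
    have "(\<lambda>q. ((\<omega>, fst q), snd q)) \<in> measurable (borel \<Otimes>\<^sub>M borel) ((M \<Otimes>\<^sub>M borel) \<Otimes>\<^sub>M borel)"
      using \<omega> by measurable
    from measurable_compose[OF this WT0] have "(\<lambda>(s, x). W ((\<omega>, \<bar>s\<bar>), x)) \<in> borel_measurable (borel \<Otimes>\<^sub>M borel)"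
      by (simp add: case_prod_beta)
    then have "(\<lambda>(s, x). W ((\<omega>, \<bar>s\<bar>), x)) \<in> borel_measurable (time_meas \<Otimes>\<^sub>M lev)"
      using sets_comp_meas by (simp cong: measurable_cong_sets add: comp_meas_def)
    from sigma_finite_measure.nn_integral_fst[OF sigma_finite_lev this] show "(\<integral>\<^sup>+s. \<integral>\<^sup>+x. W (?T ((\<omega>, s), x)) \<partial>lev \<partial>time_meas) = (\<integral>\<^sup>+(s, x). W ((\<omega>, \<bar>s\<bar>), x) \<partial>comp_meas)"
      by (simp add: comp_meas_def)
  qed
  finally show ?thesis .
qed

lemma (in sym_noise) comp_law_rect:
  assumes A: "A \<in> sets (Filt s)" and st: "0 \<le> s" "s \<le> t" and D[measurable]: "D \<in> sets borel"
  shows "emeasure comp_law ((A \<times> {s<..t}) \<times> D) = ennreal (prob A) * (ennreal lam * ennreal (t - s) * emeasure \<mu> D)"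
proof -
  have AM[measurable]: "A \<in> sets M" by (rule sets_Filt_M[OF A])
  let ?S = "(A \<times> {s<..t}) \<times> D"
  have R: "A \<times> {s<..t} \<in> sets RS" using A st by (intro filtered_space.rect_in[OF filtered_rects]) (auto simp: pred_rects_def)
  have S: "?S \<in> sets (RS \<Otimes>\<^sub>M borel)" using R by simp
  have "emeasure comp_law ?S = (\<integral>\<^sup>+p. indicator ?S p \<partial>comp_law)" using S by (simp add: comp_law_def)
  also have "\<dots> = (\<integral>\<^sup>+\<omega>. \<integral>\<^sup>+(r, x). indicator ?S ((\<omega>, \<bar>r\<bar>), x) \<partial>comp_meas \<partial>M)"
    using S by (intro nn_comp_law) simp
  also have "\<dots> = (\<integral>\<^sup>+\<omega>. indicator A \<omega> * (ennreal (t - s) * emeasure lev D) \<partial>M)"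
  proof (rule nn_integral_cong)
    fix \<omega>
    have "(\<integral>\<^sup>+(r, x). indicator ?S ((\<omega>, \<bar>r\<bar>), x) \<partial>comp_meas) = (\<integral>\<^sup>+p. indicator A \<omega> * indicator {s<..t} \<bar>fst p\<bar> * indicator D (snd p) \<partial>comp_meas)"
      by (intro nn_integral_cong) (auto simp: indicator_def)
    also have "\<dots> = (\<integral>\<^sup>+r. (\<integral>\<^sup>+x. indicator A \<omega> * indicator {s<..t} \<bar>r\<bar> * indicator D x \<partial>lev) * indicator {0<..} r \<partial>lborel)"
      by (subst nn_comp) auto
    also have "\<dots> = (\<integral>\<^sup>+r. (indicator A \<omega> * emeasure lev D) * indicator {s<..t} r \<partial>lborel)"
    proof (rule nn_integral_cong)
      fix r :: real
      have "(\<integral>\<^sup>+x. indicator A \<omega> * indicator {s<..t} \<bar>r\<bar> * indicator D x \<partial>lev) = indicator A \<omega> * indicator {s<..t} \<bar>r\<bar> * emeasure lev D"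
        by (rule nn_integral_cmult_indicator) simp
      then show "(\<integral>\<^sup>+x. indicator A \<omega> * indicator {s<..t} \<bar>r\<bar> * indicator D x \<partial>lev) * indicator {0<..} r = (indicator A \<omega> * emeasure lev D) * indicator {s<..t} r"
        using st by (auto simp: indicator_def)
    qed
    also have "\<dots> = (indicator A \<omega> * emeasure lev D) * ennreal (t - s)"
      using st by (subst nn_integral_cmult_indicator) auto
    finally show "(\<integral>\<^sup>+(r, x). indicator ?S ((\<omega>, \<bar>r\<bar>), x) \<partial>comp_meas) = indicator A \<omega> * (ennreal (t - s) * emeasure lev D)"
      by (simp add: mult_ac)
  qed
  also have "\<dots> = emeasure M A * (ennreal (t - s) * emeasure lev D)" by (simp add: nn_integral_multc)
  finally show ?thesis by (simp add: emeasure_eq_measure lev_def mult_ac)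
qed

text \<open>The number of jumps in \<open>{s<..t}\<close> with size in \<open>D\<close> is a
  functional of the future of \<open>s\<close>. It is independent of the event \<open>A\<close>, and
  its mean is given by Campbell's formula.\<close>

lemma (in sym_noise) jump_law_rect:
  assumes A: "A \<in> sets (Filt s)" and st: "0 \<le> s" "s \<le> t" and D[measurable]: "D \<in> sets borel"
  shows "emeasure jump_law ((A \<times> {s<..t}) \<times> D) = ennreal (prob A) * (ennreal lam * ennreal (t - s) * emeasure \<mu> D)"
proof -
  have AM[measurable]: "A \<in> sets M" by (rule sets_Filt_M[OF A])
  let ?S = "(A \<times> {s<..t}) \<times> D" and ?N = "nat \<lceil>t\<rceil>"
  let ?f = "PI ?N (window (indicator D :: real \<Rightarrow> real) s t)"
  have tN: "t \<le> real ?N" by linarith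
  have R: "A \<times> {s<..t} \<in> sets RS" using A st by (intro filtered_space.rect_in[OF filtered_rects]) (auto simp: pred_rects_def)
  have S: "?S \<in> sets (RS \<Otimes>\<^sub>M borel)" using R by simp
  have ih: "integrable \<mu> (indicator D :: real \<Rightarrow> real)" by (simp add: mu.emeasure_eq_measure)
  have if': "integrable M ?f" by (rule PI_window_integrable[OF _ st tN ih]) measurable
  have f0: "0 \<le> ?f \<omega>" for \<omega> unfolding PI_points by (intro sum_nonneg) (auto simp: window_def)
  have fut: "?f = future 0 s t ?N (window (indicator D) s t)" by (auto simp: future_def fun_eq_iff)
  have ef: "ennreal (?f \<omega>) = PI ?N (window (indicator D) s t) \<omega>" for \<omega>
  proof -
    have "ennreal (?f \<omega>) = (\<Sum>p\<in>points ?N \<omega>. ennreal (window (indicator D) s t (u_of \<omega> p, j_of \<omega> p)))"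
      unfolding PI_points by (rule sum_ennreal[symmetric]) (auto simp: window_def)
    also have "\<dots> = PI ?N (window (indicator D) s t) \<omega>"
      unfolding PI_points by (intro sum.cong) (auto simp: window_def ennreal_indicator)
    finally show ?thesis .
  qed
  have Ef: "ennreal (expectation ?f) = ennreal lam * ennreal (t - s) * emeasure \<mu> D"
  proof -
    have "ennreal (expectation ?f) = (\<integral>\<^sup>+\<omega>. ennreal (?f \<omega>) \<partial>M)" using if' f0 by (intro nn_integral_eq_integral[symmetric]) auto
    also have "\<dots> = (\<integral>\<^sup>+\<omega>. PI ?N (window (indicator D) s t) \<omega> \<partial>M)" by (simp only: ef)
    also have "\<dots> = ennreal lam * ennreal (t - s) * (\<integral>\<^sup>+x. indicator D x \<partial>\<mu>)" by (rule nn_PI_window[OF _ st tN]) measurable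
    finally show ?thesis by simp
  qed
  have "emeasure jump_law ?S = (\<integral>\<^sup>+p. indicator ?S p \<partial>jump_law)" using S by (simp add: jump_law_def)
  also have "\<dots> = (\<integral>\<^sup>+\<omega>. \<integral>\<^sup>+(k, i). (if i < K k \<omega> then indicator ?S ((\<omega>, U k i \<omega>), J k i \<omega>) else 0) \<partial>count_space UNIV \<partial>M)"
    using S by (intro nn_jump_law) simp
  also have "\<dots> = (\<integral>\<^sup>+\<omega>. ennreal (indicator A \<omega> * ?f \<omega>) \<partial>M)"
  proof (rule nn_integral_cong)
    fix \<omega> assume \<omega>: "\<omega> \<in> space M"
    let ?g = "\<lambda>(k, i). (if i < K k \<omega> then indicator ?S ((\<omega>, U k i \<omega>), J k i \<omega>) else 0 :: ennreal)"
    have "(\<integral>\<^sup>+n. ?g n \<partial>count_space UNIV) = (\<Sum>n\<in>points ?N \<omega>. ?g n)"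
    proof (rule nn_integral_count_space')
      fix n :: "nat \<times> nat" assume n: "n \<notin> points ?N \<omega>"
      obtain k i where ki: "n = (k, i)" by force
      show "?g n = 0"
      proof (cases "i < K k \<omega>")
        case True
        then have "real ?N \<le> real k" using n by (auto simp: ki points_def not_less simp del: of_nat_nat nat_le_iff)
        then have "t < U k i \<omega>" using order.trans[OF tN] U_bounds(1)[OF \<omega>, of k i] by (blast intro: order.strict_trans1)
        then show ?thesis by (simp add: ki)
      qed (simp add: ki)
    qed auto
    also have "\<dots> = (\<Sum>n\<in>points ?N \<omega>. ennreal (indicator A \<omega> * window (indicator D) s t (u_of \<omega> n, j_of \<omega> n)))"
      by (intro sum.cong) (auto simp: points_def u_of_def j_of_def window_def indicator_def)
    also have "\<dots> = ennreal (indicator A \<omega> * ?f \<omega>)"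
      unfolding PI_points sum_distrib_left by (intro sum_ennreal) (auto simp: window_def)
    finally show "(\<integral>\<^sup>+n. ?g n \<partial>count_space UNIV) = ennreal (indicator A \<omega> * ?f \<omega>)" .
  qed
  also have "\<dots> = ennreal (\<integral>\<omega>. indicator A \<omega> * ?f \<omega> \<partial>M)"
    using integrable_real_mult_indicator[OF AM if'] f0 by (intro nn_integral_eq_integral) (auto simp: mult.commute)
  also have "(\<integral>\<omega>. indicator A \<omega> * ?f \<omega> \<partial>M) = expectation (indicator A) * expectation ?f"
  proof (rule indep_expectation_mult(2)[OF Filt_subalgebra[of s]])
    show "prob (G \<inter> (?f -` E \<inter> space M)) = prob G * prob (?f -` E \<inter> space M)" if "G \<in> sets (Filt s)" "E \<in> sets borel" for G E
      unfolding fut using st that by (intro future_window_indep) auto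
  qed (use A if' in \<open>auto simp: emeasure_eq_measure\<close>)
  also have "ennreal (expectation (indicator A) * expectation ?f) = ennreal (prob A) * ennreal (expectation ?f)"
    by (subst ennreal_mult') (auto intro: Bochner_Integration.integral_nonneg f0)
  finally show ?thesis by (simp only: Ef)
qed

text \<open>Jump times are strictly positive, and the time component of the compensator lives on
  \<open>{0<..}\<close>.\<close>

lemma (in sym_noise) laws_null:
  assumes A: "A \<in> sets (Filt 0)" and D: "D \<in> sets borel"
  shows "emeasure jump_law ((A \<times> {0}) \<times> D) = 0" "emeasure comp_law ((A \<times> {0}) \<times> D) = 0"
proof -
  let ?S = "(A \<times> {0::real}) \<times> D"
  have R: "A \<times> {0} \<in> sets RS" using A by (intro filtered_space.rect_in[OF filtered_rects]) (auto simp: pred_rects_def)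
  have S: "?S \<in> sets (RS \<Otimes>\<^sub>M borel)" using R D by simp
  have "emeasure jump_law ?S = (\<integral>\<^sup>+p. indicator ?S p \<partial>jump_law)" using S by (simp add: jump_law_def)
  also have "\<dots> = (\<integral>\<^sup>+\<omega>. \<integral>\<^sup>+(k, i). (if i < K k \<omega> then indicator ?S ((\<omega>, U k i \<omega>), J k i \<omega>) else 0) \<partial>count_space UNIV \<partial>M)"
    using S by (intro nn_jump_law) simp
  also have "\<dots> = (\<integral>\<^sup>+\<omega>. 0 \<partial>M)"
  proof (rule nn_integral_cong)
    fix \<omega> assume \<omega>: "\<omega> \<in> space M"
    have "U k i \<omega> \<noteq> 0" for k i using U_bounds(1)[OF \<omega>, of k i] by auto
    then have "(\<lambda>(k, i). (if i < K k \<omega> then indicator ?S ((\<omega>, U k i \<omega>), J k i \<omega>) else 0 :: ennreal)) = (\<lambda>_. 0)"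
      by (auto simp: fun_eq_iff)
    then show "(\<integral>\<^sup>+(k, i). (if i < K k \<omega> then indicator ?S ((\<omega>, U k i \<omega>), J k i \<omega>) else 0) \<partial>count_space UNIV) = 0"
      by (simp only: nn_integral_const) simp
  qed
  finally show "emeasure jump_law ?S = 0" by simp
  have "emeasure comp_law ?S = (\<integral>\<^sup>+p. indicator ?S p \<partial>comp_law)" using S by (simp add: comp_law_def)
  also have "\<dots> = (\<integral>\<^sup>+\<omega>. \<integral>\<^sup>+(r, x). indicator ?S ((\<omega>, \<bar>r\<bar>), x) \<partial>comp_meas \<partial>M)"
    using S by (intro nn_comp_law) simp
  also have "\<dots> = (\<integral>\<^sup>+\<omega>. \<integral>\<^sup>+p. 0 \<partial>comp_meas \<partial>M)"
    using AE_comp_pos by (intro nn_integral_cong nn_integral_cong_AE) (auto elim!: eventually_mono simp: indicator_def)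
  finally show "emeasure comp_law ?S = 0" by simp
qed

lemma (in sym_noise) jump_law_eq_comp_law: "jump_law = comp_law"
proof -
  \<comment> \<open>A countable cover by rectangles of finite mass, on which uniqueness of measures
    rests. Time zero has its own member because the other rectangles are left-open.\<close>
  let ?C = "insert (space M \<times> {0}) (range (\<lambda>k. space M \<times> {0<..real k}))"
  let ?E = "{a \<times> b | a b. a \<in> pred_rects M Filt \<and> b \<in> sets (borel :: real measure)}"
  have spaceF: "space M \<in> sets (Filt s)" for s using sets.top[of "Filt s"] by simp
  have C1: "countable ?C" by (intro countable_insert countable_image) simp
  have C2: "?C \<subseteq> pred_rects M Filt"
  proof (intro insert_subsetI subsetI)
    show "space M \<times> {0} \<in> pred_rects M Filt" using spaceF unfolding pred_rects_def by blast
    fix x assume "x \<in> range (\<lambda>k. space M \<times> {0<..real k})"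
    then obtain k where "x = space M \<times> {0<..real k}" by blast
    then show "x \<in> pred_rects M Filt" using spaceF[of 0] unfolding pred_rects_def by blast
  qed
  note C = C1 C2
  have U: "\<Union>?C = space M \<times> {0::real..}"
  proof (intro equalityI subsetI)
    fix p assume "p \<in> space M \<times> {0::real..}"
    then obtain \<omega> t where p: "p = (\<omega>, t)" "\<omega> \<in> space M" "0 \<le> t" by auto
    obtain k :: nat where "t \<le> real k" using real_arch_simple by blast
    then have "p \<in> space M \<times> {0} \<or> p \<in> space M \<times> {0<..real k}" using p by auto
    then show "p \<in> \<Union>?C" by blast
  qed auto
  have sE: "sets (RS \<Otimes>\<^sub>M borel) = sets (sigma (space RS \<times> space borel) ?E)"
  proof (rule sets_pair_eq)
    show "pred_rects M Filt \<subseteq> Pow (space RS)" using filtered_space.pred_rects_subset[OF filtered_rects] filtered_space.space_rect_sigma[OF filtered_rects] by simp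
    show "sets RS = sigma_sets (space RS) (pred_rects M Filt)" using filtered_space.sets_rect_sigma[OF filtered_rects] filtered_space.space_rect_sigma[OF filtered_rects] by simp
    show "\<Union>?C = space RS" using U filtered_space.space_rect_sigma[OF filtered_rects] by simp
    show "sets borel = sigma_sets (space borel) (sets (borel :: real measure))" by (rule sets.sigma_sets_eq[symmetric])
    show "sets borel \<subseteq> Pow (space (borel :: real measure))" by (rule sets.space_closed)
    show "countable ?C" by (rule C1)
    show "?C \<subseteq> pred_rects M Filt" by (rule C2)
    show "countable {UNIV :: real set}" "{UNIV} \<subseteq> sets (borel :: real measure)" "\<Union>{UNIV} = space (borel :: real measure)" by auto
  qed
  let ?\<Omega> = "(space M \<times> {0..}) \<times> (UNIV :: real set)"
  have EP: "?E \<subseteq> Pow ?\<Omega>" using filtered_space.pred_rects_subset[OF filtered_rects] by blast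
  have sE': "sets (RS \<Otimes>\<^sub>M borel) = sigma_sets ?\<Omega> ?E"
    unfolding sE using EP filtered_space.space_rect_sigma[OF filtered_rects] by (simp add: sets_measure_of)
  show ?thesis
  proof (rule measure_eqI_generator_eq_countable[where E="?E" and \<Omega>="?\<Omega>" and A="(\<lambda>c. c \<times> (UNIV :: real set)) ` ?C"])
    show "Int_stable ?E"
    proof (rule Int_stableI)
      fix x y assume "x \<in> ?E" "y \<in> ?E"
      then obtain a b a' b' where *: "x = a \<times> b" "a \<in> pred_rects M Filt" "b \<in> sets borel" "y = a' \<times> b'" "a' \<in> pred_rects M Filt" "b' \<in> sets borel" by blast
      have "x \<inter> y = (a \<inter> a') \<times> (b \<inter> b')" using * by auto
      moreover have "a \<inter> a' \<in> pred_rects M Filt" using filtered_space.Int_stable_pred_rects[OF filtered_rects] * by (auto simp: Int_stable_def)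
      moreover have "b \<inter> b' \<in> sets borel" using * by auto
      ultimately show "x \<inter> y \<in> ?E" by blast
    qed
    show "emeasure jump_law x = emeasure comp_law x" if "x \<in> ?E" for x
    proof -
      from that obtain a D where x: "x = a \<times> D" "a \<in> pred_rects M Filt" and D: "D \<in> sets borel" by blast
      then consider A where "a = A \<times> {0}" "A \<in> sets (Filt 0)" | A s t where "a = A \<times> {s<..t}" "0 \<le> s" "A \<in> sets (Filt s)"
        unfolding pred_rects_def by blast
      then show ?thesis
      proof cases
        case 1
        then show ?thesis using laws_null[OF 1(2) D] x by simp
      next
        case 2
        show ?thesis
        proof (cases "s \<le> t")
          case True
          then show ?thesis using jump_law_rect[OF 2(3) 2(2) True D] comp_law_rect[OF 2(3) 2(2) True D] x 2 by simp
        next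
          case False
          then have "x = {}" using x 2 by auto
          then show ?thesis by simp
        qed
      qed
    qed
    show "emeasure jump_law c \<noteq> \<infinity>" if "c \<in> (\<lambda>c. c \<times> (UNIV :: real set)) ` ?C" for c
    proof -
      from that consider "c = (space M \<times> {0}) \<times> UNIV" | k :: nat where "c = (space M \<times> {0<..real k}) \<times> UNIV" by blast
      then show ?thesis
      proof cases
        case 1
        then show ?thesis using laws_null(1)[OF spaceF, of UNIV] by simp
      next
        case 2
        then show ?thesis using jump_law_rect[OF spaceF order_refl, of "real k" UNIV] 
          by (simp add: ennreal_mult_eq_top_iff)
      qed
    qed
    show "sets jump_law = sigma_sets ?\<Omega> ?E" "sets comp_law = sigma_sets ?\<Omega> ?E"
      unfolding jump_law_def comp_law_def sE'[symmetric] by simp_all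
    show "\<Union>((\<lambda>c. c \<times> (UNIV :: real set)) ` ?C) = ?\<Omega>" using U by blast
    show "countable ((\<lambda>c. c \<times> (UNIV :: real set)) ` ?C)" by (intro countable_image C1)
    show "?E \<subseteq> Pow ?\<Omega>" by (rule EP)
    show "(\<lambda>c. c \<times> (UNIV :: real set)) ` ?C \<subseteq> ?E"
    proof
      fix x assume "x \<in> (\<lambda>c. c \<times> (UNIV :: real set)) ` ?C"
      then obtain c where "x = c \<times> UNIV" "c \<in> ?C" by (rule imageE)
      moreover have "UNIV \<in> sets (borel :: real measure)" by simp
      ultimately show "x \<in> ?E" using C2 by blast
    qed
  qed
qed

lemma (in sym_noise) X_compensator: "compensator M Filt (jump_measure (X \<sigma>)) (\<lambda>_. comp_meas)"
  unfolding compensator_def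
proof (intro conjI ballI allI impI)
  show "sets comp_meas = sets borel" by (simp only: sets_comp_meas borel_prod)
  show "emeasure comp_meas ({..0} \<times> UNIV) = 0" by (rule comp_meas_nonpos)
  fix W :: "('a \<times> real) \<times> real \<Rightarrow> ennreal"
  assume W0: "W \<in> borel_measurable (predictable_sigma M Filt \<Otimes>\<^sub>M borel)"
  have W: "W \<in> borel_measurable (RS \<Otimes>\<^sub>M borel)"
  proof -
    have "(\<lambda>p. fst p) \<in> measurable (RS \<Otimes>\<^sub>M (borel :: real measure)) (predictable_sigma M Filt)"
      by (rule measurable_compose[OF measurable_fst filtered_space.rect_to_predictable[OF filtered_rects]])
    then have "(\<lambda>p. (fst p, snd p)) \<in> measurable (RS \<Otimes>\<^sub>M (borel :: real measure)) (predictable_sigma M Filt \<Otimes>\<^sub>M borel)"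
      by (intro measurable_Pair measurable_snd)
    from measurable_compose[OF this W0] show ?thesis by simp
  qed
  have Wg: "(\<lambda>(s, x). W ((\<omega>, \<bar>s\<bar>), x)) \<in> borel_measurable (borel \<Otimes>\<^sub>M borel)" if "\<omega> \<in> space M" for \<omega>
  proof -
    have "(\<lambda>q. ((\<omega>, fst q), snd q)) \<in> measurable (borel \<Otimes>\<^sub>M borel) ((M \<Otimes>\<^sub>M borel) \<Otimes>\<^sub>M borel)"
      using that by measurable
    from measurable_compose[OF this measurable_compose[OF abs_rect_measurable2 W]] show ?thesis
      by (simp add: case_prod_beta)
  qed
  \<comment> \<open>Both measures are carried by positive times, where the absolute value changes
    nothing. Inserting it makes the integrand measurable on the full product space.\<close>
  have absW: "(\<integral>\<^sup>+(s, x). W ((\<omega>, s), x) * c s \<partial>N) = (\<integral>\<^sup>+(s, x). W ((\<omega>, \<bar>s\<bar>), x) * c s \<partial>N)"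
    if "AE p in N. 0 < fst p" for N :: "(real \<times> real) measure" and c \<omega>
    using that by (intro nn_integral_cong_AE) (auto elim!: eventually_mono)
  define V where "V p = (\<integral>\<^sup>+x. W (p, x) \<partial>lev)" for p
  have "W \<in> borel_measurable (RS \<Otimes>\<^sub>M lev)"
    using W by (simp cong: measurable_cong_sets)
  then have V: "V \<in> borel_measurable RS" unfolding V_def by (rule sigma_finite_measure.borel_measurable_nn_integral_fst[OF sigma_finite_lev])
  have "(\<integral>\<^sup>+(s, x). W ((\<omega>, s), x) * indicator {0..t} s \<partial>comp_meas) = (\<integral>\<^sup>+s. V (\<omega>, \<bar>s\<bar>) * indicator {0<..t} s \<partial>lborel)" 
    if \<omega>: "\<omega> \<in> space M" for \<omega> t
  proof -
    have g: "(\<lambda>p. W ((\<omega>, \<bar>fst p\<bar>), snd p) * indicator {0..t} (fst p)) \<in> borel_measurable (borel \<Otimes>\<^sub>M borel)"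
      using Wg[OF \<omega>] by (intro borel_measurable_times_ennreal) (simp_all add: case_prod_beta)
    have gs: "(\<lambda>x. W ((\<omega>, \<bar>s\<bar>), x)) \<in> borel_measurable lev" for s
      using measurable_Pair2[OF Wg[OF \<omega>], of s] by (simp cong: measurable_cong_sets)
    have "(\<integral>\<^sup>+(s, x). W ((\<omega>, s), x) * indicator {0..t} s \<partial>comp_meas) = (\<integral>\<^sup>+p. W ((\<omega>, \<bar>fst p\<bar>), snd p) * indicator {0..t} (fst p) \<partial>comp_meas)"
      unfolding absW[OF AE_comp_pos] by (simp add: case_prod_unfold)
    also have "\<dots> = (\<integral>\<^sup>+s. (\<integral>\<^sup>+x. W ((\<omega>, \<bar>s\<bar>), x) * indicator {0..t} s \<partial>lev) * indicator {0<..} s \<partial>lborel)"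
      unfolding nn_comp[OF g] by simp
    also have "\<dots> = (\<integral>\<^sup>+s. V (\<omega>, \<bar>s\<bar>) * indicator {0<..t} s \<partial>lborel)"
      unfolding V_def using gs by (intro nn_integral_cong) (auto simp: nn_integral_multc indicator_def)
    finally show ?thesis .
  qed
  then show "predictable_process M Filt (\<lambda>t \<omega>. \<integral>\<^sup>+(s, x). W ((\<omega>, s), x) * indicator {0..t} s \<partial>comp_meas)"
    using filtered_space.predictable_time_integral[OF filtered_rects V] unfolding predictable_process_def
    by (subst measurable_cong[where g="\<lambda>(\<omega>, t). \<integral>\<^sup>+s. V (\<omega>, \<bar>s\<bar>) * indicator {0<..t} s \<partial>lborel"])
       (auto simp: filtered_space.space_predictable_sigma[OF filtered_rects])
  have one: "(\<integral>\<^sup>+(s, x). W ((\<omega>, s), x) \<partial>N) = (\<integral>\<^sup>+(s, x). W ((\<omega>, \<bar>s\<bar>), x) \<partial>N)" if "AE p in N. 0 < fst p" for N :: "(real \<times> real) measure" and \<omega>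
    using absW[OF that, of \<omega> "\<lambda>_. 1"] by simp
  have "(\<integral>\<^sup>+ \<omega>. (\<integral>\<^sup>+ (s, x). W ((\<omega>, s), x) \<partial>comp_meas) \<partial>M) = (\<integral>\<^sup>+p. W p \<partial>comp_law)"
    unfolding nn_comp_law[OF W] one[OF AE_comp_pos] ..
  also have "\<dots> = (\<integral>\<^sup>+p. W p \<partial>jump_law)" by (simp only: jump_law_eq_comp_law)
  also have "\<dots> = (\<integral>\<^sup>+\<omega>. \<integral>\<^sup>+(k, i). (if i < K k \<omega> then W ((\<omega>, U k i \<omega>), J k i \<omega>) else 0) \<partial>count_space UNIV \<partial>M)"
    by (rule nn_jump_law[OF W])
  also have "\<dots> = (\<integral>\<^sup>+ \<omega>. (\<integral>\<^sup>+ (s, x). W ((\<omega>, s), x) \<partial>jump_measure (X \<sigma>) \<omega>) \<partial>M)"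
  proof (rule nn_integral_cong)
    fix \<omega> assume \<omega>: "\<omega> \<in> space M"
    have "U k i \<omega> > 0" for k i using U_bounds(1)[OF \<omega>, of k i] by (meson of_nat_0_le_iff order_le_less_trans)
    then have [simp]: "\<bar>U k i \<omega>\<bar> = U k i \<omega>" for k i by (simp add: less_imp_le)
    then show "(\<integral>\<^sup>+(k, i). (if i < K k \<omega> then W ((\<omega>, U k i \<omega>), J k i \<omega>) else 0) \<partial>count_space UNIV) = (\<integral>\<^sup>+ (s, x). W ((\<omega>, s), x) \<partial>jump_measure (X \<sigma>) \<omega>)"
      unfolding one[OF AE_jump_pos] nn_jump[OF \<omega> Wg[OF \<omega>]] by (intro nn_integral_cong) (auto split: prod.splits)
  qed
  finally show "(\<integral>\<^sup>+ \<omega>. (\<integral>\<^sup>+ (s, x). W ((\<omega>, s), x) \<partial>comp_meas) \<partial>M) = (\<integral>\<^sup>+ \<omega>. (\<integral>\<^sup>+ (s, x). W ((\<omega>, s), x) \<partial>jump_measure (X \<sigma>) \<omega>) \<partial>M)" .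
qed

section \<open>Membership in the class\<close>

definition (in sym_noise) lev_semimart :: "real \<Rightarrow> 'a semimart" where
  "lev_semimart \<sigma> = \<lparr>sp = M, filt = Filt, proc = X \<sigma>, drift = (\<lambda>_ _. 0), vol = (\<lambda>_ _. \<sigma>\<^sup>2), levy = (\<lambda>_ _. lev)\<rparr>"

lemma (in sym_noise) sigmaB_cadlag_adapted: "cadlag_adapted M Filt (\<lambda>t \<omega>. \<sigma> * B t \<omega>)"
  using BZ_cadlag_adapted[of "\<lambda>_. 0" \<sigma>] by (simp add: Z_zero_fun)

lemma (in sym_noise) sigmaB_local_martingale: "local_martingale0 M Filt (\<lambda>t \<omega>. \<sigma> * B t \<omega>)"
  unfolding local_martingale0_def
proof (intro conjI martingale_imp_local[OF filtered sigmaB_cadlag_adapted])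
  show "martingale M Filt (\<lambda>t \<omega>. \<sigma> * B t \<omega>)"
    using BZ_martingale[of "\<lambda>_. 0" \<sigma>] by (simp add: Z_zero_fun)
qed (simp add: B_zero)

lemma (in sym_noise) Z_fv_process: "h \<in> borel_measurable borel \<Longrightarrow> fv_process M Filt (Z h)" for h :: "real \<Rightarrow> real"
  unfolding fv_process_def using BZ_cadlag_adapted[of h 0] by (auto simp: Z_nonpos Z_finite_variation)

lemma (in sym_noise) deterministic_fv:
  assumes "continuous_on {0..} c" "mono_on {0..} c" "c 0 = 0"
  shows "fv_process M Filt (\<lambda>t \<omega>. c t)"
  unfolding fv_process_def cadlag_adapted_def adapted_def
  using assms by (auto intro!: cadlag_continuous finite_variation_mono)

lemma (in sym_noise) deterministic_predictable:
  assumes "continuous_on UNIV c"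
  shows "predictable_process M Filt (\<lambda>t \<omega>. c t :: real)"
proof (rule predictable_process_left_continuous)
  show "left_continuous (\<lambda>t. c t)" unfolding left_continuous_def
    using assms by (auto simp: continuous_on_eq_continuous_at intro: continuous_within_subset)
qed (auto simp: adapted_def)

lemma (in sym_noise) sigmaB_continuous_local_martingale: "continuous_local_martingale M Filt (\<lambda>t \<omega>. \<sigma> * B t \<omega>)"
  unfolding continuous_local_martingale_def using sigmaB_local_martingale[of \<sigma>]
  by (auto simp: local_martingale0_def intro!: continuous_intros B_continuous)

lemma (in sym_noise) zero_purely_discontinuous: "purely_discontinuous M Filt (\<lambda>t \<omega>. 0)"
  unfolding purely_discontinuous_def local_martingale0_def
  using local_martingale_const[OF filtered, of 0] by simp

text \<open>With finitely many jumps in bounded time, the whole jump sum has finite variation and is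
  taken as the finite-variation part; the purely discontinuous martingale is then zero.\<close>

lemma (in sym_noise) X_continuous_part: "continuous_martingale_part M Filt (X \<sigma>) (\<lambda>t \<omega>. \<sigma> * B t \<omega>)"
  unfolding continuous_martingale_part_def
proof (intro conjI sigmaB_continuous_local_martingale exI zero_purely_discontinuous)
  show "purely_discontinuous M Filt (\<lambda>t \<omega>. 0)" by (rule zero_purely_discontinuous)
  show "fv_process M Filt (Z (\<lambda>x. x))" by (rule Z_fv_process) simp
  show "AE \<omega> in M. \<forall>t\<ge>0. X \<sigma> t \<omega> = X \<sigma> 0 \<omega> + \<sigma> * B t \<omega> + 0 + Z (\<lambda>x. x) t \<omega>"
    by (rule AE_I2) (simp add: X_zero, simp add: X_def)
qed (simp add: B_zero)

lemma (in sym_noise) sigmaB_quadratic_variation: "quadratic_variation M Filt (\<lambda>t \<omega>. \<sigma> * B t \<omega>) (\<lambda>t \<omega>. \<sigma>\<^sup>2 * t)"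
  unfolding quadratic_variation_def
proof (intro conjI ballI)
  show mono: "mono_on {0..} (\<lambda>t. \<sigma>\<^sup>2 * t)" by (auto simp: mono_on_def intro: mult_left_mono)
  show "predictable_process M Filt (\<lambda>t \<omega>. \<sigma>\<^sup>2 * t)" by (rule deterministic_predictable) (intro continuous_intros)
  show fv: "fv_process M Filt (\<lambda>t \<omega>. \<sigma>\<^sup>2 * t)" by (rule deterministic_fv[OF _ mono]) (auto intro!: continuous_intros)
  show "local_martingale M Filt (\<lambda>t \<omega>. (\<sigma> * B t \<omega>)\<^sup>2 - \<sigma>\<^sup>2 * t)"
  proof (rule martingale_imp_local[OF filtered _ B_square_martingale])
    show "cadlag_adapted M Filt (\<lambda>t \<omega>. (\<sigma> * B t \<omega>)\<^sup>2 - \<sigma>\<^sup>2 * t)"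
      unfolding cadlag_adapted_def
    proof (intro conjI ballI)
      show "adapted Filt (\<lambda>t \<omega>. (\<sigma> * B t \<omega>)\<^sup>2 - \<sigma>\<^sup>2 * t)"
        unfolding adapted_def using past_Filt[OF B_past] by auto
      fix \<omega> assume "\<omega> \<in> space M"
      then show "cadlag (\<lambda>t. (\<sigma> * B t \<omega>)\<^sup>2 - \<sigma>\<^sup>2 * t)"
        by (intro cadlag_continuous continuous_intros B_continuous)
    qed
  qed
qed

text \<open>The first characteristic vanishes because the truncated process is already a martingale:
  truncation is odd and the jump law symmetric.\<close>

lemma (in sym_noise) X_characteristics: "characteristics M Filt (X \<sigma>) (\<lambda>t \<omega>. 0) (\<lambda>t \<omega>. \<sigma>\<^sup>2 * t) (\<lambda>_. comp_meas)"
  unfolding characteristics_def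
proof (intro conjI exI X_continuous_part sigmaB_quadratic_variation X_compensator)
  show "continuous_martingale_part M Filt (X \<sigma>) (\<lambda>t \<omega>. \<sigma> * B t \<omega>)" by (rule X_continuous_part)
  show "quadratic_variation M Filt (\<lambda>t \<omega>. \<sigma> * B t \<omega>) (\<lambda>t \<omega>. \<sigma>\<^sup>2 * t)" by (rule sigmaB_quadratic_variation)
  let ?h = "\<lambda>x::real. if \<bar>x\<bar> \<le> 1 then x else 0"
  have ih: "integrable \<mu> ?h" by (rule mu.integrable_const_bound[where B=1]) auto
  show "predictable_process M Filt (\<lambda>t \<omega>. 0 :: real)" by (rule deterministic_predictable) simp
  show "fv_process M Filt (\<lambda>t \<omega>. 0)" by (rule deterministic_fv) (auto simp: mono_on_def)
  show "local_martingale0 M Filt (\<lambda>t \<omega>. \<sigma> * B t \<omega> + Z ?h t \<omega>)"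
    unfolding local_martingale0_def
  proof (intro conjI ballI martingale_imp_local[OF filtered] BZ_cadlag_adapted BZ_martingale ih BZ_zero)
    show "?h \<in> borel_measurable borel" by measurable
    then show "?h \<in> borel_measurable borel" .
  qed auto
  show "AE \<omega> in M. \<forall>t\<ge>0. truncated (X \<sigma>) t \<omega> = X \<sigma> 0 \<omega> + (\<sigma> * B t \<omega> + Z ?h t \<omega>) + 0"
    by (rule AE_I2) (simp add: truncated_X X_zero)
qed

lemma (in sym_noise) X_semimartingale: "semimartingale M Filt (X \<sigma>)"
  unfolding semimartingale_def
proof (intro conjI X_cadlag_adapted exI)
  show "local_martingale0 M Filt (\<lambda>t \<omega>. \<sigma> * B t \<omega>)" by (rule sigmaB_local_martingale)
  show "fv_process M Filt (Z (\<lambda>x. x))" by (rule Z_fv_process) simp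
  show "AE \<omega> in M. \<forall>t\<ge>0. X \<sigma> t \<omega> = X \<sigma> 0 \<omega> + \<sigma> * B t \<omega> + Z (\<lambda>x. x) t \<omega>"
    by (rule AE_I2) (simp add: X_zero, simp add: X_def)
qed

lemma (in sym_noise) lev_zero: 
  assumes "emeasure \<mu> {0} = 0" shows "emeasure lev {0} = 0"
  using assms by (simp add: lev_def)

lemma (in sym_noise) lev_semimart_ito:
  assumes mu0: "emeasure \<mu> {0} = 0"
  shows "ito_semimartingale (lev_semimart \<sigma>)"
  unfolding ito_semimartingale_def lev_semimart_def semimart.simps
proof (intro conjI filtered X_semimartingale exI ballI allI impI AE_I2 optional_process_const[OF filtered] lev_zero[OF mu0])
  show "characteristics M Filt (X \<sigma>) (\<lambda>t \<omega>. 0) (\<lambda>t \<omega>. \<sigma>\<^sup>2 * t) (\<lambda>_. comp_meas)" by (rule X_characteristics)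
  fix t :: real assume t: "0 \<le> t"
  show "set_integrable lborel {0..t} (\<lambda>s. 0 :: real)" by (auto simp: set_integrable_def)
  show "set_integrable lborel {0..t} (\<lambda>s. \<sigma>\<^sup>2)" unfolding set_integrable_def using t by (intro integrable_scaleR_left integrable_real_indicator) auto
  show "0 = (LBINT s:{0..t}. 0)" by (simp add: set_lebesgue_integral_def)
  show "\<sigma>\<^sup>2 * t = (LBINT s:{0..t}. \<sigma>\<^sup>2)" using t by (simp add: set_lebesgue_integral_def)
next
  fix D :: "(real \<times> real) set" assume "D \<in> sets borel"
  then show "emeasure comp_meas D = (\<integral>\<^sup>+ s\<in>{0..}. emeasure lev {x. (s, x) \<in> D} \<partial>lborel)" by (rule comp_meas_emeasure)
qed auto

lemma (in sym_noise) lev_semimart_class: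
  assumes mu0: "emeasure \<mu> {0} = 0"
    and A: "ennreal (\<sigma>\<^sup>2) + ennreal lam * (\<integral>\<^sup>+ x. ennreal (min (\<bar>x\<bar> powr r) 1) \<partial>\<mu>) \<le> ennreal A"
  shows "lev_semimart \<sigma> \<in> levy_class r A"
  unfolding levy_class_def ito_class_def
proof (intro CollectI conjI ballI allI impI lev_semimart_ito[OF mu0])
  show "levy_process (sp (lev_semimart \<sigma>)) (filt (lev_semimart \<sigma>)) (proc (lev_semimart \<sigma>))"
    using X_levy by (simp add: lev_semimart_def)
  fix t \<omega>
  have "(\<integral>\<^sup>+ x. ennreal (min (\<bar>x\<bar> powr r) 1) \<partial>lev) = ennreal lam * (\<integral>\<^sup>+ x. ennreal (min (\<bar>x\<bar> powr r) 1) \<partial>\<mu>)"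
    by (rule nn_lev) measurable
  then show "ennreal \<bar>drift (lev_semimart \<sigma>) t \<omega>\<bar> + ennreal (vol (lev_semimart \<sigma>) t \<omega>) +
        (\<integral>\<^sup>+ x. ennreal (min (\<bar>x\<bar> powr r) 1) \<partial>levy (lev_semimart \<sigma>) t \<omega>) \<le> ennreal A"
    using A by (simp add: lev_semimart_def)
qed

text \<open>Exports the construction: class membership and the one-dimensional laws are what the
  statistical comparison uses of a process.\<close>

lemma levy_exists:
  assumes type: "(UNIV :: real set) \<lesssim> (UNIV :: 'a set)"
    and mu: "real_distribution \<mu>" and mu0: "emeasure \<mu> {0} = 0" and sym: "distr \<mu> borel uminus = \<mu>"
    and lam: "0 \<le> lam" and c: "0 \<le> c"
    and A: "ennreal c + ennreal lam * (\<integral>\<^sup>+ x. ennreal (min (\<bar>x\<bar> powr r) 1) \<partial>\<mu>) \<le> ennreal A"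
  obtains X :: "'a semimart" where "X \<in> levy_class r A" "prob_space (sp X)" "vol X = (\<lambda>_ _. c)" 
    "\<And>\<omega>. \<omega> \<in> space (sp X) \<Longrightarrow> proc X 0 \<omega> = 0"
    "\<And>t. 0 \<le> t \<Longrightarrow> proc X t \<in> borel_measurable (sp X)"
    "\<And>t v. 0 \<le> t \<Longrightarrow> char (distr (sp X) borel (proc X t)) v = exp (of_real t * (lam * (char \<mu> v - 1) - of_real (v\<^sup>2 * c / 2)))"
proof -
  have G: "AE \<omega> in N. noise_good (\<lambda>p. X p \<omega>)"
    if "prob_space N" "prob_space.indep_vars N (\<lambda>_. borel) X UNIV" "\<And>p. distr N borel (X p) = noise_law lam \<mu> p"
    for N :: "(nat \<times> nat \<times> nat \<Rightarrow> real) measure" and X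
    using that mu mu0 by (rule noise_good_AE)
  obtain M :: "'a measure" and R where M: "prob_space M" "prob_space.indep_vars M (\<lambda>_. borel) R UNIV"
    "\<And>p. distr M borel (R p) = noise_law lam \<mu> p" "\<And>\<omega>. \<omega> \<in> space M \<Longrightarrow> noise_good (\<lambda>p. R p \<omega>)"
    using independent_family_exists[of "noise_law lam \<mu>" noise_good, OF noise_law_distribution[OF mu] type G] by blast
  interpret prob_space M by fact
  interpret sym_noise M \<mu> R lam
    by (intro sym_noise.intro noise.intro noise_axioms.intro sym_noise_axioms.intro) (use M mu lam sym in auto)
  have s: "(sqrt c)\<^sup>2 = c" using c by simp
  show thesis
  proof (rule that[of "lev_semimart (sqrt c)"])
    show "lev_semimart (sqrt c) \<in> levy_class r A" by (rule lev_semimart_class[OF mu0]) (simp only: s A)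
    show "char (distr (sp (lev_semimart (sqrt c))) borel (proc (lev_semimart (sqrt c)) t)) v = exp (of_real t * (lam * (char \<mu> v - 1) - of_real (v\<^sup>2 * c / 2)))"
      if "0 \<le> t" for t v
      using X_char[OF that, of "sqrt c" v] by (simp only: lev_semimart_def semimart.simps power_mult_distrib s)
  qed (use M(1) c X_zero X_measurable in \<open>auto simp: lev_semimart_def\<close>)
qed

section \<open>Reduction to increments\<close>

text \<open>A path with prescribed increments between grid points, constant in between. Through it
  an estimator, which acts on paths, becomes a function of \<open>n\<close> real numbers.\<close>

definition step_path :: "nat \<Rightarrow> (nat \<Rightarrow> real) \<Rightarrow> real \<Rightarrow> real" where
  "step_path n y t = (\<Sum>j<n. if real (Suc j) / real n \<le> t then y j else 0)"

lemma cadlag_step: "cadlag (\<lambda>t. if a \<le> t then c else 0)"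
  unfolding cadlag_def
proof (intro conjI allI impI)
  fix t :: real
  have "eventually (\<lambda>u. (if a \<le> u then c else 0) = (if a \<le> t then c else 0)) (at_right t)"
  proof (cases "a \<le> t")
    case True
    then show ?thesis by (auto simp: eventually_at_right_field intro!: exI[of _ "t + 1"])
  next
    case False
    then show ?thesis by (auto simp: eventually_at_right_field intro!: exI[of _ a])
  qed
  then show "continuous (at_right t) (\<lambda>t. if a \<le> t then c else 0)"
    unfolding continuous_within by (intro tendsto_eventually)
  have "eventually (\<lambda>u. (if a \<le> u then c else 0) = (if a < t then c else 0)) (at_left t)"
  proof (cases "a < t")
    case True
    then show ?thesis by (auto simp: eventually_at_left_field intro!: exI[of _ a])
  next
    case False
    then show ?thesis by (auto simp: eventually_at_left_field intro!: exI[of _ "t - 1"])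
  qed
  then show "\<exists>l. ((\<lambda>t. if a \<le> t then c else 0) \<longlongrightarrow> l) (at_left t)"
    by (intro exI tendsto_eventually)
qed

lemma cadlag_sum: "finite I \<Longrightarrow> (\<And>i. i \<in> I \<Longrightarrow> cadlag (f i)) \<Longrightarrow> cadlag (\<lambda>t. \<Sum>i\<in>I. f i t)"
proof (induction I rule: finite_induct)
  case empty
  then show ?case by (auto simp: cadlag_def)
next
  case (insert i I)
  then show ?case by (simp add: cadlag_add)
qed

lemma cadlag_step_path: "cadlag (step_path n y)"
  unfolding step_path_def by (intro cadlag_sum cadlag_step) auto

lemma step_path_grid:
  assumes "i \<le> n"
  shows "step_path n y (real i / real n) = (\<Sum>j<i. y j)"
proof -
  have "step_path n y (real i / real n) = (\<Sum>j<n. if j < i then y j else 0)"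
    unfolding step_path_def
  proof (intro sum.cong refl)
    fix j assume "j \<in> {..<n}"
    then have "(real (Suc j) / real n \<le> real i / real n) = (j < i)" by (auto simp: divide_le_cancel)
    then show "(if real (Suc j) / real n \<le> real i / real n then y j else 0) = (if j < i then y j else 0)" by simp
  qed
  also have "\<dots> = (\<Sum>j\<in>{j\<in>{..<n}. j < i}. y j)" by (rule sum.inter_filter[symmetric]) simp
  also have "{j\<in>{..<n}. j < i} = {..<i}" using assms by auto
  finally show ?thesis .
qed

lemma obs_generator: "{{x \<in> skorokhod_space. x (real i / real n) \<in> D} | i D. i \<le> n \<and> D \<in> sets borel} \<subseteq> Pow skorokhod_space"
  by auto

lemma space_obs_sigma: "space (obs_sigma n) = skorokhod_space"
  unfolding obs_sigma_def by (rule space_measure_of[OF obs_generator])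

lemma sets_obs_sigma: "sets (obs_sigma n) = sigma_sets skorokhod_space
     {{x \<in> skorokhod_space. x (real i / real n) \<in> D} | i D. i \<le> n \<and> D \<in> sets borel}"
  unfolding obs_sigma_def by (rule sets_measure_of[OF obs_generator])

text \<open>No set of \<open>obs_sigma n\<close> separates two paths with the same grid values; in
  particular the level set of \<open>f\<close> through \<open>x\<close> contains
  \<open>y\<close>.\<close>

lemma obs_sigma_grid:
  assumes f: "f \<in> borel_measurable (obs_sigma n)" and x: "cadlag x" "cadlag y"
    and eq: "\<And>i. i \<le> n \<Longrightarrow> x (real i / real n) = y (real i / real n)"
  shows "f x = (f y :: real)"
proof -
  have *: "x \<in> S \<longleftrightarrow> y \<in> S" if "S \<in> sigma_sets skorokhod_space
     {{x \<in> skorokhod_space. x (real i / real n) \<in> D} | i D. i \<le> n \<and> D \<in> sets borel}" for S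
    using that
  proof (induction S rule: sigma_sets.induct)
    case (Basic a)
    then show ?case using eq x by (auto simp: skorokhod_space_def)
  next
    case (Compl a)
    then show ?case using x by (auto simp: skorokhod_space_def)
  qed auto
  have "f -` {f x} \<inter> space (obs_sigma n) \<in> sets (obs_sigma n)" using f by (rule measurable_sets) simp
  from *[OF this[unfolded sets_obs_sigma]] show ?thesis
    using x by (auto simp: space_obs_sigma skorokhod_space_def)
qed

lemma step_path_measurable: "step_path n \<in> measurable (PiM {..<n} (\<lambda>_. borel)) (obs_sigma n)"
  unfolding obs_sigma_def
proof (rule measurable_measure_of[OF obs_generator])
  show "step_path n \<in> space (PiM {..<n} (\<lambda>_. borel)) \<rightarrow> skorokhod_space"
    using cadlag_step_path by (auto simp: skorokhod_space_def)
  fix S assume "S \<in> {{x \<in> skorokhod_space. x (real i / real n) \<in> D} | i D. i \<le> n \<and> D \<in> sets (borel :: real measure)}"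
  then obtain i D where S: "S = {x \<in> skorokhod_space. x (real i / real n) \<in> D}" and i: "i \<le> n" and D: "D \<in> sets borel" by blast
  have m: "(\<lambda>y. \<Sum>j<i. y j) \<in> borel_measurable (PiM {..<n} (\<lambda>_. borel :: real measure))"
    using i by (intro borel_measurable_sum measurable_component_singleton) auto
  have "step_path n -` S \<inter> space (PiM {..<n} (\<lambda>_. borel)) = (\<lambda>y. \<Sum>j<i. y j) -` D \<inter> space (PiM {..<n} (\<lambda>_. borel :: real measure))"
    unfolding S using cadlag_step_path by (auto simp: step_path_grid[OF i] skorokhod_space_def)
  then show "step_path n -` S \<inter> space (PiM {..<n} (\<lambda>_. borel)) \<in> sets (PiM {..<n} (\<lambda>_. borel))"
    using measurable_sets[OF m D] by simp
qed

text \<open>Each increment is independent of the filtration at its left endpoint, so the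
  probabilities of boxes factorise one increment at a time. The induction also has to carry that the
  event built so far belongs to that filtration.\<close>

lemma levy_increments_law:
  fixes M :: "'a measure" and X :: "real \<Rightarrow> 'a \<Rightarrow> real"
  assumes fp: "filtered_prob_space M F" and lp: "levy_process M F X" and n: "1 \<le> n"
  defines "\<Delta> \<equiv> \<lambda>i \<omega>. X (real (Suc i) / real n) \<omega> - X (real i / real n) \<omega>"
  shows "(\<lambda>\<omega>. \<lambda>i\<in>{..<n}. \<Delta> i \<omega>) \<in> measurable M (PiM {..<n} (\<lambda>_. borel))"
    and "distr M (PiM {..<n} (\<lambda>_. borel)) (\<lambda>\<omega>. \<lambda>i\<in>{..<n}. \<Delta> i \<omega>) = PiM {..<n} (\<lambda>_. distr M borel (X (1 / real n)))"
proof -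
  interpret prob_space M using fp by (simp add: filtered_prob_space_def)
  interpret filtration "space M" F using fp by (simp add: filtered_prob_space_def)
  have sub: "subalgebra M (F t)" for t using fp by (simp add: filtered_prob_space_def)
  have ad: "X t \<in> borel_measurable (F t)" if "0 \<le> t" for t
    using lp that by (simp add: levy_process_def cadlag_adapted_def adapted_def)
  have XF: "X s \<in> borel_measurable (F t)" if "0 \<le> s" "s \<le> t" for s t
  proof -
    have "subalgebra (F t) (F s)"
      using sets_F_mono[OF that(2)] space_F by (auto simp: subalgebra_def)
    then show ?thesis using ad[OF that(1)] by (rule measurable_from_subalg)
  qed
  have XM: "X t \<in> borel_measurable M" if "0 \<le> t" for t using ad[OF that] sub by (rule measurable_from_subalg[rotated])
  have \<Delta>M: "\<Delta> i \<in> borel_measurable M" for i unfolding \<Delta>_def by (intro borel_measurable_diff XM) auto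
  show meas: "(\<lambda>\<omega>. \<lambda>i\<in>{..<n}. \<Delta> i \<omega>) \<in> measurable M (PiM {..<n} (\<lambda>_. borel))"
    by (intro measurable_restrict \<Delta>M)
  let ?\<nu> = "distr M borel (X (1 / real n))"
  interpret \<nu>: prob_space ?\<nu> by (intro prob_space_distr XM) simp
  interpret P: product_prob_space "\<lambda>_. ?\<nu>" "{..<n}" ..
  have box: "{\<omega> \<in> space M. \<forall>i<k. \<Delta> i \<omega> \<in> A i} \<in> sets (F (real k / real n)) \<and>
      prob {\<omega> \<in> space M. \<forall>i<k. \<Delta> i \<omega> \<in> A i} = (\<Prod>i<k. measure ?\<nu> (A i))"
    if A: "\<And>i. i < n \<Longrightarrow> A i \<in> sets borel" and "k \<le> n" for A k
    using \<open>k \<le> n\<close>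
  proof (induction k)
    case 0
    have "space M \<in> sets (F (real 0 / real n))" using sets.top[of "F (real 0 / real n)"] space_F by simp
    then show ?case by (simp add: prob_space)
  next
    case (Suc k)
    let ?S = "{\<omega> \<in> space M. \<forall>i<k. \<Delta> i \<omega> \<in> A i}"
    let ?D = "\<Delta> k -` A k \<inter> space M"
    have Ak: "A k \<in> sets borel" using A Suc.prems by simp
    have IH: "?S \<in> sets (F (real k / real n))" "prob ?S = (\<Prod>i<k. measure ?\<nu> (A i))"
      using Suc.IH Suc_leD[OF Suc.prems] by (blast, blast)
    have kk: "0 \<le> real k / real n" "real k / real n \<le> real (Suc k) / real n" by (auto intro: divide_right_mono)
    have eq: "{\<omega> \<in> space M. \<forall>i<Suc k. \<Delta> i \<omega> \<in> A i} = ?S \<inter> ?D" unfolding less_Suc_eq by blast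
    have SF: "?S \<in> sets (F (real (Suc k) / real n))" using IH(1) sets_F_mono[OF kk(2)] by blast
    have "\<Delta> k \<in> borel_measurable (F (real (Suc k) / real n))"
      unfolding \<Delta>_def using kk by (intro borel_measurable_diff XF) auto
    from measurable_sets[OF this Ak] have DF: "?D \<in> sets (F (real (Suc k) / real n))" using space_F by simp
    have ind: "indep_set (sets (F (real k / real n)))
        {(\<lambda>\<omega>. X (real (Suc k) / real n) \<omega> - X (real k / real n) \<omega>) -` D \<inter> space M | D. D \<in> sets borel}"
      and law: "distr M borel (\<lambda>\<omega>. X (real (Suc k) / real n) \<omega> - X (real k / real n) \<omega>) = distr M borel (X (real (Suc k) / real n - real k / real n))"
      using lp kk unfolding levy_process_def by blast+
    have "?D \<in> {(\<lambda>\<omega>. X (real (Suc k) / real n) \<omega> - X (real k / real n) \<omega>) -` D \<inter> space M | D. D \<in> sets borel}"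
      using Ak unfolding \<Delta>_def by blast
    from indep_setD[OF ind IH(1) this] have "prob (?S \<inter> ?D) = prob ?S * prob ?D" .
    moreover have "real (Suc k) / real n - real k / real n = 1 / real n" by (simp add: diff_divide_distrib[symmetric])
    then have "distr M borel (\<Delta> k) = ?\<nu>" using law unfolding \<Delta>_def by simp
    then have "prob ?D = measure ?\<nu> (A k)" using measure_distr[OF \<Delta>M[of k] Ak] by simp
    ultimately have "prob (?S \<inter> ?D) = (\<Prod>i<Suc k. measure ?\<nu> (A i))" by (simp add: IH(2))
    then show ?case unfolding eq using SF DF by blast
  qed
  show "distr M (PiM {..<n} (\<lambda>_. borel)) (\<lambda>\<omega>. \<lambda>i\<in>{..<n}. \<Delta> i \<omega>) = PiM {..<n} (\<lambda>_. ?\<nu>)" (is "?L = ?R")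
  proof (rule P.PiM_eqI)
    show "sets ?L = sets ?R" by (simp, intro sets_PiM_cong) auto
    fix A assume A0: "\<And>i. i \<in> {..<n} \<Longrightarrow> A i \<in> sets ?\<nu>"
    then have A: "\<And>i. i < n \<Longrightarrow> A i \<in> sets borel" by simp
    have vm: "(\<lambda>\<omega>. \<lambda>i\<in>{..<n}. \<Delta> i \<omega>) -` (Pi\<^sub>E {..<n} A) \<inter> space M = {\<omega> \<in> space M. \<forall>i<n. \<Delta> i \<omega> \<in> A i}"
    proof (rule set_eqI)
      fix \<omega>
      have "(\<lambda>i\<in>{..<n}. \<Delta> i \<omega>) \<in> Pi\<^sub>E {..<n} A \<longleftrightarrow> (\<forall>i<n. \<Delta> i \<omega> \<in> A i)"
        unfolding PiE_iff by (simp add: Ball_def)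
      then show "\<omega> \<in> (\<lambda>\<omega>. \<lambda>i\<in>{..<n}. \<Delta> i \<omega>) -` (Pi\<^sub>E {..<n} A) \<inter> space M \<longleftrightarrow> \<omega> \<in> {\<omega> \<in> space M. \<forall>i<n. \<Delta> i \<omega> \<in> A i}"
        by blast
    qed
    have pr: "prob {\<omega> \<in> space M. \<forall>i<n. \<Delta> i \<omega> \<in> A i} = (\<Prod>i<n. measure ?\<nu> (A i))"
      by (rule conjunct2[OF box[of A n, OF A order_refl]])
    have "Pi\<^sub>E {..<n} A \<in> sets (PiM {..<n} (\<lambda>_. borel :: real measure))" using A by (intro sets_PiM_I_finite) auto
    then have "emeasure ?L (Pi\<^sub>E {..<n} A) = emeasure M ((\<lambda>\<omega>. \<lambda>i\<in>{..<n}. \<Delta> i \<omega>) -` (Pi\<^sub>E {..<n} A) \<inter> space M)"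
      by (rule emeasure_distr[OF meas])
    then have 1: "emeasure ?L (Pi\<^sub>E {..<n} A) = ennreal (\<Prod>i<n. measure ?\<nu> (A i))"
      by (simp only: vm emeasure_eq_measure pr)
    have 2: "ennreal (\<Prod>i<n. measure ?\<nu> (A i)) = (\<Prod>i\<in>{..<n}. emeasure ?\<nu> (A i))"
      unfolding \<nu>.emeasure_eq_measure by (rule prod_ennreal[symmetric]) simp
    show "emeasure ?L (Pi\<^sub>E {..<n} A) = (\<Prod>i\<in>{..<n}. emeasure ?\<nu> (A i))" using 1 2 by (rule trans)
  qed simp
qed

section \<open>Comparison of two processes\<close>

text \<open>The start at zero is required at every sample point, while \<open>levy_process\<close>
  grants it almost surely; the increments then reproduce the observations exactly.\<close>

definition centred_levy :: "real \<Rightarrow> real \<Rightarrow> real \<Rightarrow> 'a semimart \<Rightarrow> bool" where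
  "centred_levy r A c X \<longleftrightarrow> X \<in> levy_class r A \<and> vol X = (\<lambda>_ _. c) \<and> (\<forall>\<omega>\<in>space (sp X). proc X 0 \<omega> = 0)"

lemma estimation_error_law:
  fixes w m :: real
  assumes X: "centred_levy r A c X" and n: "1 \<le> n" and E: "E \<in> borel_measurable (obs_sigma n)"
  defines "S \<equiv> {y \<in> space (PiM {..<n} (\<lambda>_. borel)). w * \<bar>E (step_path n y) - c\<bar> > m}"
  shows "S \<in> sets (PiM {..<n} (\<lambda>_. borel))"
    and "emeasure (sp X) {\<omega> \<in> space (sp X). w * \<bar>E (\<lambda>t. proc X t \<omega>) - integrated_volatility X \<omega>\<bar> > m} =
      emeasure (PiM {..<n} (\<lambda>_. distr (sp X) borel (proc X (1 / real n)))) S"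
proof -
  have fp: "filtered_prob_space (sp X) (filt X)" and lp: "levy_process (sp X) (filt X) (proc X)" 
    using X unfolding centred_levy_def levy_class_def ito_class_def ito_semimartingale_def by blast+
  have [measurable]: "(\<lambda>y. E (step_path n y)) \<in> borel_measurable (PiM {..<n} (\<lambda>_. borel))"
    by (rule measurable_compose[OF step_path_measurable E])
  show S: "S \<in> sets (PiM {..<n} (\<lambda>_. borel))" unfolding S_def by measurable
  let ?\<Delta> = "\<lambda>\<omega>. \<lambda>i\<in>{..<n}. proc X (real (Suc i) / real n) \<omega> - proc X (real i / real n) \<omega>"
  note inc = levy_increments_law[OF fp lp n]
  have IV: "integrated_volatility X \<omega> = c" for \<omega>
    using X by (simp add: integrated_volatility_def centred_levy_def set_lebesgue_integral_def)
  have path: "E (\<lambda>t. proc X t \<omega>) = E (step_path n (?\<Delta> \<omega>))" if \<omega>: "\<omega> \<in> space (sp X)" for \<omega>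
  proof (rule obs_sigma_grid[OF E])
    show "cadlag (\<lambda>t. proc X t \<omega>)" using lp \<omega> by (simp add: levy_process_def cadlag_adapted_def)
    show "cadlag (step_path n (?\<Delta> \<omega>))" by (rule cadlag_step_path)
    fix i assume i: "i \<le> n"
    have "step_path n (?\<Delta> \<omega>) (real i / real n) = (\<Sum>j<i. ?\<Delta> \<omega> j)" by (rule step_path_grid[OF i])
    also have "\<dots> = (\<Sum>j<i. proc X (real (Suc j) / real n) \<omega> - proc X (real j / real n) \<omega>)"
      using i by (intro sum.cong) auto
    also have "\<dots> = proc X (real i / real n) \<omega> - proc X (real 0 / real n) \<omega>"
      by (rule sum_lessThan_telescope)
    finally show "proc X (real i / real n) \<omega> = step_path n (?\<Delta> \<omega>) (real i / real n)"
      using X \<omega> by (simp add: centred_levy_def)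
  qed
  have "{\<omega> \<in> space (sp X). w * \<bar>E (\<lambda>t. proc X t \<omega>) - integrated_volatility X \<omega>\<bar> > m} = ?\<Delta> -` S \<inter> space (sp X)"
    using path IV measurable_space[OF inc(1)] unfolding S_def by auto
  then have "emeasure (sp X) {\<omega> \<in> space (sp X). w * \<bar>E (\<lambda>t. proc X t \<omega>) - integrated_volatility X \<omega>\<bar> > m} =
     emeasure (distr (sp X) (PiM {..<n} (\<lambda>_. borel)) ?\<Delta>) S"
    by (simp only: emeasure_distr[OF inc(1) S])
  then show "emeasure (sp X) {\<omega> \<in> space (sp X). w * \<bar>E (\<lambda>t. proc X t \<omega>) - integrated_volatility X \<omega>\<bar> > m} =
      emeasure (PiM {..<n} (\<lambda>_. distr (sp X) borel (proc X (1 / real n)))) S"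
    by (simp only: inc(2))
qed

text \<open>\<open>a\<close> bounds the affinity of one increment from below. Affinities multiply
  over independent increments, so the last condition keeps that of the whole sample above one
  half.\<close>

definition close_increments :: "nat \<Rightarrow> 'a semimart \<Rightarrow> 'a semimart \<Rightarrow> bool" where
  "close_increments n X Y \<longleftrightarrow> (\<exists>p q a. p \<in> borel_measurable borel \<and> q \<in> borel_measurable borel \<and>
     (\<forall>x. 0 \<le> p x) \<and> (\<forall>x. 0 \<le> q x) \<and>
     distr (sp X) borel (proc X (1 / real n)) = density lborel p \<and>
     distr (sp Y) borel (proc Y (1 / real n)) = density lborel q \<and>
     ennreal a \<le> (\<integral>\<^sup>+x. ennreal (sqrt (p x) * sqrt (q x)) \<partial>lborel) \<and> 0 \<le> a \<and> 1/2 \<le> a ^ n)"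

lemma centred_levy_distr:
  assumes "centred_levy r A c X" "0 \<le> t"
  shows "prob_space (distr (sp X) borel (proc X t))"
proof -
  have fp: "filtered_prob_space (sp X) (filt X)" and lp: "levy_process (sp X) (filt X) (proc X)" 
    using assms unfolding centred_levy_def levy_class_def ito_class_def ito_semimartingale_def by blast+
  interpret prob_space "sp X" using fp by (simp add: filtered_prob_space_def)
  have "proc X t \<in> borel_measurable (filt X t)" "subalgebra (sp X) (filt X t)"
    using fp lp assms(2) by (auto simp: filtered_prob_space_def levy_process_def cadlag_adapted_def adapted_def)
  then have "proc X t \<in> borel_measurable (sp X)" by (blast intro: measurable_from_subalg)
  then show ?thesis by (rule prob_space_distr)
qed

text \<open>If the volatilities were more than \<open>2 * m / w\<close> apart, an estimate could not
  be within \<open>m / w\<close> of both. The event of an error under the first process would then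
  be a test whose two error probabilities are at most \<open>e\<close>, which yields
  \<open>1/2 \<le> 2 * sqrt e\<close> and contradicts \<open>e < 1/16\<close>.\<close>

lemma two_point_bound:
  assumes X: "centred_levy r A c X" and Y: "centred_levy r A d Y" and close: "close_increments n X Y"
    and n: "1 \<le> n" and E: "E \<in> borel_measurable (obs_sigma n)" and w: "0 < w"
    and eX: "emeasure (sp X) {\<omega> \<in> space (sp X). w * \<bar>E (\<lambda>t. proc X t \<omega>) - integrated_volatility X \<omega>\<bar> > m} \<le> ennreal e"
    and eY: "emeasure (sp Y) {\<omega> \<in> space (sp Y). w * \<bar>E (\<lambda>t. proc Y t \<omega>) - integrated_volatility Y \<omega>\<bar> > m} \<le> ennreal e"
    and e: "0 \<le> e" "e < 1/16"
  shows "w * \<bar>c - d\<bar> \<le> 2 * m"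
proof (rule ccontr)
  assume sep: "\<not> w * \<bar>c - d\<bar> \<le> 2 * m"
  from close obtain p q a where pq: "p \<in> borel_measurable borel" "q \<in> borel_measurable borel" 
     "\<And>x. 0 \<le> p x" "\<And>x. 0 \<le> q x" 
     "distr (sp X) borel (proc X (1 / real n)) = density lborel p"
     "distr (sp Y) borel (proc Y (1 / real n)) = density lborel q"
     "ennreal a \<le> (\<integral>\<^sup>+x. ennreal (sqrt (p x) * sqrt (q x)) \<partial>lborel)" "0 \<le> a" "1/2 \<le> a ^ n"
    unfolding close_increments_def by blast
  let ?P = "PiM {..<n} (\<lambda>_. borel :: real measure)"
  let ?S = "\<lambda>c. {y \<in> space ?P. w * \<bar>E (step_path n y) - c\<bar> > m}"
  note LX = estimation_error_law[OF X n E, where w=w and m=m] and LY = estimation_error_law[OF Y n E, where w=w and m=m]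
  have P: "emeasure (PiM {..<n} (\<lambda>_. density lborel p)) (?S c) \<le> ennreal e" using eX LX(2) pq(5) by simp
  have incl: "space ?P - ?S c \<subseteq> ?S d"
  proof
    fix y assume y: "y \<in> space ?P - ?S c"
    have "w * \<bar>c - d\<bar> \<le> w * \<bar>E (step_path n y) - c\<bar> + w * \<bar>E (step_path n y) - d\<bar>"
      using w by (simp add: distrib_left[symmetric])
    then show "y \<in> ?S d" using y sep by auto
  qed
  have "emeasure (PiM {..<n} (\<lambda>_. density lborel q)) (space ?P - ?S c) \<le> emeasure (PiM {..<n} (\<lambda>_. density lborel q)) (?S d)"
  proof (rule emeasure_mono[OF incl])
    have "sets (PiM {..<n} (\<lambda>_. density lborel q)) = sets ?P" by (intro sets_PiM_cong) auto
    then show "?S d \<in> sets (PiM {..<n} (\<lambda>_. density lborel q))" using LY(1) by simp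
  qed
  also have "\<dots> \<le> ennreal e" using eY LY(2) pq(6) by simp
  finally have Q: "emeasure (PiM {..<n} (\<lambda>_. density lborel q)) (space ?P - ?S c) \<le> ennreal e" .
  have "a ^ card {..<n} \<le> 2 * sqrt e"
    using centred_levy_distr[OF X, of "1 / real n"] centred_levy_distr[OF Y, of "1 / real n"]
    by (intro affinity_test_bound[OF pq(1,3) _ pq(2,4) _ finite_lessThan LX(1) P Q e(1) pq(7,8)]) (simp_all add: pq(5,6))
  moreover have "sqrt e < sqrt (1/16)" using e by (intro real_sqrt_less_mono)
  moreover have "sqrt (1/16) = (1/4 :: real)" by (rule real_sqrt_unique) (auto simp: power2_eq_square)
  ultimately show False using pq(9) by simp
qed

lemma rate_bound:
  assumes rate: "uniform_rate w (levy_class r A :: 'a semimart set)" and w: "\<forall>n\<ge>1. 0 < w n"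
    and hyp: "0 < \<kappa>" "\<And>n. N \<le> n \<Longrightarrow> \<exists>(X :: 'a semimart) Y c d. centred_levy r A c X \<and> centred_levy r A d Y \<and> \<bar>c - d\<bar> = \<kappa> / v n \<and> close_increments n X Y"
    and v: "\<And>n. 2 \<le> n \<Longrightarrow> 0 < v n"
  shows "\<exists>K. \<forall>n\<ge>2. w n \<le> K * v n"
proof -
  from rate obtain E where E: "estimators E" and ach: "achieves_rate E w (levy_class r A :: 'a semimart set)"
    unfolding uniform_rate_def by blast
  let ?err = "\<lambda>m n (X :: 'a semimart). emeasure (sp X) {\<omega> \<in> space (sp X). w n * \<bar>E n (\<lambda>t. proc X t \<omega>) - integrated_volatility X \<omega>\<bar> > m}"
  \<comment> \<open>Any positive level below the threshold \<open>1/16\<close> of the two-point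
    bound would do.\<close>
  have "eventually (\<lambda>m :: real. limsup (\<lambda>n. SUP X\<in>levy_class r A. ?err m n X) < ennreal (1/64)) at_top"
    using ach unfolding achieves_rate_def by (rule order_tendstoD(2)) simp
  then have "eventually (\<lambda>m :: real. limsup (\<lambda>n. SUP X\<in>levy_class r A. ?err m n X) < ennreal (1/64) \<and> 0 \<le> m) at_top"
    using eventually_ge_at_top[of "0::real"] by (rule eventually_conj)
  then obtain m :: real where m: "limsup (\<lambda>n. SUP X\<in>levy_class r A. ?err m n X) < ennreal (1/64)" "0 \<le> m"
    using eventually_happens'[OF trivial_limit_at_top_linorder] by blast
  have "eventually (\<lambda>n. (SUP X\<in>levy_class r A. ?err m n X) < ennreal (1/64)) sequentially"
    using m(1) by (rule Limsup_lessD)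
  then obtain N1 where N1: "\<And>n. N1 \<le> n \<Longrightarrow> (SUP X\<in>levy_class r A. ?err m n X) < ennreal (1/64)"
    unfolding eventually_sequentially by blast
  define N2 where "N2 = max (max N N1) 2"
  have large: "w n \<le> (2 * m / \<kappa>) * v n" if "N2 \<le> n" for n
  proof -
    have n: "N \<le> n" "N1 \<le> n" "2 \<le> n" "1 \<le> n" using that by (auto simp: N2_def)
    obtain X Y :: "'a semimart" and c d where XY: "centred_levy r A c X" "centred_levy r A d Y" "\<bar>c - d\<bar> = \<kappa> / v n" "close_increments n X Y"
      using hyp(2)[OF n(1)] by blast
    have err: "?err m n X \<le> ennreal (1/64)" if "X \<in> levy_class r A" for X
      using SUP_upper[OF that, of "?err m n"] N1[OF n(2)] by (meson less_imp_le order_trans)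
    have "E n \<in> borel_measurable (obs_sigma n)" "0 < w n" using E w n(4) by (auto simp: estimators_def)
    then have "w n * \<bar>c - d\<bar> \<le> 2 * m"
      using XY(1,2) by (intro two_point_bound[OF XY(1,2,4) n(4) _ _ err err]) (auto simp: centred_levy_def)
    then show ?thesis using hyp(1) v[OF n(3)] by (simp add: XY(3) field_simps)
  qed
  \<comment> \<open>The sum absorbs the finitely many \<open>n\<close> to which the comparison does
    not apply.\<close>
  define K where "K = 2 * m / \<kappa> + (\<Sum>n\<in>{2..N2}. w n / v n)"
  have pos: "0 \<le> w n / v n" if "2 \<le> n" for n using w v[OF that] that by (intro divide_nonneg_pos less_imp_le) auto
  have "w n \<le> K * v n" if n: "2 \<le> n" for n
  proof (cases "N2 \<le> n")
    case True
    have "2 * m / \<kappa> \<le> K" unfolding K_def using pos by (auto intro!: sum_nonneg)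
    then have "(2 * m / \<kappa>) * v n \<le> K * v n" using v[OF n] by (intro mult_right_mono) auto
    then show ?thesis using large[OF True] by simp
  next
    case False
    then have "w n / v n \<le> (\<Sum>n\<in>{2..N2}. w n / v n)" using n pos by (intro member_le_sum) auto
    also have "\<dots> \<le> K" unfolding K_def using m(2) hyp(1) by simp
    finally show ?thesis using v[OF n] by (simp add: field_simps)
  qed
  then show ?thesis by blast
qed

section \<open>The two hypotheses\<close>

lemma char_scale:
  assumes "real_distribution \<mu>"
  shows "char (distr \<mu> borel (\<lambda>x. a * x)) v = char \<mu> (a * v)"
proof -
  interpret real_distribution \<mu> by fact
  have "char (distr \<mu> borel (\<lambda>x. a * x)) v = (CLINT x|\<mu>. iexp (v * (a * x)))"
    unfolding char_def by (rule integral_distr) measurable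
  then show ?thesis unfolding char_def by (simp only: ac_simps)
qed

text \<open>As \<open>h\<close> tends to zero, \<open>2 * (1 - cos (h * x)) / h^2\<close> converges
  to \<open>x^2\<close>, while its expectation is controlled by the characteristic function at
  \<open>h\<close>. Fatou's lemma gives the bound, with no prior knowledge that the moment is
  finite.\<close>

lemma second_moment_le:
  assumes M: "real_distribution M" and \<epsilon>: "0 < \<epsilon>"
    and ch: "\<And>v. \<bar>v\<bar> \<le> \<epsilon> \<Longrightarrow> 1 - Re (char M v) \<le> a * v\<^sup>2 / 2"
  shows "(\<integral>\<^sup>+x. ennreal (x\<^sup>2) \<partial>M) \<le> ennreal a"
proof -
  interpret real_distribution M by fact
  have [simp]: "sets M = sets borel" by simp
  let ?f = "\<lambda>k::nat. \<lambda>x::real. 2 * (real (Suc k))\<^sup>2 * (1 - cos (x / real (Suc k)))"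
  have f0: "0 \<le> ?f k x" for k x by simp
  have lim: "(\<lambda>k. ?f k x) \<longlonglongrightarrow> x\<^sup>2" for x :: real
  proof -
    have "(\<lambda>k. ?f k x) \<longlonglongrightarrow> x * x" by real_asymp
    then show ?thesis by (simp only: power2_eq_square)
  qed
  have "(\<integral>\<^sup>+x. ennreal (x\<^sup>2) \<partial>M) = (\<integral>\<^sup>+x. liminf (\<lambda>k. ennreal (?f k x)) \<partial>M)"
    using lim by (intro nn_integral_cong lim_imp_Liminf[symmetric] tendsto_ennrealI) auto
  also have "\<dots> \<le> liminf (\<lambda>k. \<integral>\<^sup>+x. ennreal (?f k x) \<partial>M)"
    by (rule nn_integral_liminf) simp
  also have "\<dots> \<le> ennreal a"
  proof (rule Liminf_le)
    obtain N where N: "1 / \<epsilon> < real N" using reals_Archimedean2 by blast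
    have "(\<integral>\<^sup>+x. ennreal (?f k x) \<partial>M) \<le> ennreal a" if "N \<le> k" for k
    proof -
      define h where "h = 1 / real (Suc k)"
      have h: "0 < h" "h \<le> \<epsilon>"
      proof -
        have "1 / \<epsilon> < real (Suc k)" using N that by linarith
        then show "h \<le> \<epsilon>" using \<epsilon> by (simp add: h_def field_simps)
      qed (simp add: h_def)
      have ic: "integrable M (\<lambda>x. cos (h * x))" by (rule integrable_const_bound[where B=1]) auto
      have i1: "integrable M (\<lambda>x. iexp (h * x))" by (rule integrable_const_bound[where B=1]) auto
      have re: "Re (char M h) = expectation (\<lambda>x. cos (h * x))"
      proof -
        have "Re (char M h) = expectation (\<lambda>x. Re (iexp (h * x)))" unfolding char_def by (rule integral_Re[symmetric, OF i1])
        then show ?thesis by (simp add: Re_exp)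
      qed
      have "(\<integral>\<^sup>+x. ennreal (?f k x) \<partial>M) = ennreal (expectation (?f k))"
      proof (rule nn_integral_eq_integral)
        show "integrable M (?f k)"
          using ic by (simp add: h_def)
      qed (simp add: f0)
      also have "expectation (?f k) = 2 * (real (Suc k))\<^sup>2 * (1 - Re (char M h))"
        unfolding re using ic prob_space by (simp add: h_def)
      also have "\<dots> \<le> 2 * (real (Suc k))\<^sup>2 * (a * h\<^sup>2 / 2)"
        using ch[of h] h by (intro mult_left_mono) auto
      also have "\<dots> = a" by (simp add: h_def power_divide)
      finally show ?thesis by (simp add: ennreal_leI)
    qed
    then show "eventually (\<lambda>k. (\<integral>\<^sup>+x. ennreal (?f k x) \<partial>M) \<le> ennreal a) sequentially"
      by (auto simp: eventually_sequentially)
  qed simp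
  finally show ?thesis .
qed

lemma tail_le:
  assumes M: "real_distribution M" and m2: "(\<integral>\<^sup>+x. ennreal (x\<^sup>2) \<partial>M) \<le> ennreal a" and R: "0 < R" and a: "0 \<le> a"
  shows "emeasure M {x. R < \<bar>x\<bar>} \<le> ennreal (a / R\<^sup>2)"
proof -
  interpret real_distribution M by fact
  have "emeasure M {x. R < \<bar>x\<bar>} = (\<integral>\<^sup>+x. indicator {x. R < \<bar>x\<bar>} x \<partial>M)" by (rule nn_integral_indicator[symmetric]) simp
  also have "\<dots> \<le> (\<integral>\<^sup>+x. ennreal (1 / R\<^sup>2) * ennreal (x\<^sup>2) \<partial>M)"
  proof (rule nn_integral_mono)
    fix x
    have "1 \<le> 1 / R\<^sup>2 * x\<^sup>2" if "R < \<bar>x\<bar>"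
    proof -
      have "R\<^sup>2 \<le> \<bar>x\<bar>\<^sup>2" using that R by (intro power_mono) auto
      then show ?thesis using R by simp
    qed
    then have "indicator {x. R < \<bar>x\<bar>} x \<le> ennreal (1 / R\<^sup>2 * x\<^sup>2)" by (auto simp: indicator_def)
    also have "\<dots> = ennreal (1 / R\<^sup>2) * ennreal (x\<^sup>2)" by (rule ennreal_mult'') simp
    finally show "indicator {x. R < \<bar>x\<bar>} x \<le> ennreal (1 / R\<^sup>2) * ennreal (x\<^sup>2)" .
  qed
  also have "\<dots> = ennreal (1 / R\<^sup>2) * (\<integral>\<^sup>+x. ennreal (x\<^sup>2) \<partial>M)" by (rule nn_integral_cmult) simp
  also have "\<dots> \<le> ennreal (1 / R\<^sup>2) * ennreal a" by (intro mult_left_mono m2) simp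
  also have "\<dots> = ennreal (a / R\<^sup>2)" using a by (simp add: ennreal_mult'[symmetric])
  finally show ?thesis .
qed

text \<open>The uniform bound \<open>d\<close> is spent on \<open>{-R..R}\<close>, of length
  \<open>2 * R\<close>. Outside, the difference is dominated by \<open>p + q\<close>, whose mass
  there is at most \<open>2 * e\<close>.\<close>

lemma L1_le:
  assumes [measurable]: "p \<in> borel_measurable borel" "q \<in> borel_measurable borel" and p0: "\<And>x. 0 \<le> p x" "\<And>x. 0 \<le> q x"
    and d: "\<And>x. \<bar>p x - q x\<bar> \<le> d" and R: "0 < R"
    and t: "emeasure (density lborel p) {x. R < \<bar>x\<bar>} \<le> ennreal e" "emeasure (density lborel q) {x. R < \<bar>x\<bar>} \<le> ennreal e" and e: "0 \<le> e"
  shows "(\<integral>\<^sup>+x. ennreal \<bar>p x - q x\<bar> \<partial>lborel) \<le> ennreal (2 * R * d + 2 * e)"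
proof -
  let ?T = "{x. R < \<bar>x\<bar>} :: real set"
  have d0: "0 \<le> d" using d[of 0] by simp
  have "(\<integral>\<^sup>+x. ennreal \<bar>p x - q x\<bar> \<partial>lborel) \<le> (\<integral>\<^sup>+x. ennreal d * indicator {-R..R} x + (ennreal (p x) * indicator ?T x + ennreal (q x) * indicator ?T x) \<partial>lborel)"
  proof (rule nn_integral_mono)
    fix x
    show "ennreal \<bar>p x - q x\<bar> \<le> ennreal d * indicator {-R..R} x + (ennreal (p x) * indicator ?T x + ennreal (q x) * indicator ?T x)"
    proof (cases "R < \<bar>x\<bar>")
      case True
      have "\<bar>p x - q x\<bar> \<le> p x + q x" using p0[of x] by simp
      then have "ennreal \<bar>p x - q x\<bar> \<le> ennreal (p x) + ennreal (q x)" using p0 by (simp add: ennreal_plus[symmetric] ennreal_leI del: ennreal_plus)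
      then show ?thesis using True by (auto simp: indicator_def)
    next
      case False
      then show ?thesis using ennreal_leI[OF d[of x]] by (auto simp: indicator_def)
    qed
  qed
  also have "\<dots> = ennreal d * emeasure lborel {-R..R} + (emeasure (density lborel p) ?T + emeasure (density lborel q) ?T)"
    by (subst nn_integral_add, simp, simp, subst nn_integral_add) (simp_all add: emeasure_density nn_integral_cmult_indicator)
  also have "\<dots> \<le> ennreal d * ennreal (2 * R) + (ennreal e + ennreal e)"
    using R by (intro add_mono t mult_left_mono) auto
  also have "\<dots> = ennreal (2 * R * d + 2 * e)"
    using d0 R e by (simp add: ennreal_mult'[symmetric] ennreal_plus[symmetric] mult.commute del: ennreal_plus)
  finally show ?thesis .
qed

text \<open>The volatility is split as \<open>c + e\<close>: the part \<open>c\<close> acts as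
  Gaussian smoothing of the law \<open>N\<close> of a process with the same jumps and volatility
  \<open>e\<close>. Two hypotheses can thus share the smoothing and differ only in
  \<open>N\<close>.\<close>

lemma levy_exists_smooth:
  assumes type: "(UNIV :: real set) \<lesssim> (UNIV :: 'a set)"
    and mu: "real_distribution \<mu>" and mu0: "emeasure \<mu> {0} = 0" and sym: "distr \<mu> borel uminus = \<mu>"
    and lam: "0 \<le> lam" and c: "0 < c" and e: "0 \<le> e" and t: "0 < t"
    and A: "ennreal (c + e) + ennreal lam * (\<integral>\<^sup>+ x. ennreal (min (\<bar>x\<bar> powr r) 1) \<partial>\<mu>) \<le> ennreal A"
  obtains X :: "'a semimart" and N where "centred_levy r A (c + e) X" "real_distribution N"
    "\<And>v. char N v = exp (of_real t * (lam * (char \<mu> v - 1) - of_real (v\<^sup>2 * e / 2)))"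
    "distr (sp X) borel (proc X t) = density lborel (smooth (sqrt (t * c)) N)"
proof -
  obtain X :: "'a semimart" where X: "X \<in> levy_class r A" "prob_space (sp X)" "vol X = (\<lambda>_ _. c + e)" 
    "\<And>\<omega>. \<omega> \<in> space (sp X) \<Longrightarrow> proc X 0 \<omega> = 0" "\<And>t. 0 \<le> t \<Longrightarrow> proc X t \<in> borel_measurable (sp X)"
    "\<And>t v. 0 \<le> t \<Longrightarrow> char (distr (sp X) borel (proc X t)) v = exp (of_real t * (lam * (char \<mu> v - 1) - of_real (v\<^sup>2 * (c + e) / 2)))"
    using levy_exists[OF type mu mu0 sym lam _ A] c e by (auto simp del: of_real_divide of_real_mult of_real_add)
  have "ennreal e + ennreal lam * (\<integral>\<^sup>+ x. ennreal (min (\<bar>x\<bar> powr r) 1) \<partial>\<mu>) \<le> ennreal A"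
    using c by (intro order_trans[OF add_right_mono A] ennreal_leI) simp
  note Ye = this
  \<comment> \<open>An auxiliary process whose law at time \<open>t\<close> provides
    \<open>N\<close>: it guarantees that the remaining exponent belongs to a probability
    measure.\<close>
  obtain Y :: "'a semimart" where "Y \<in> levy_class r A" and Y: "prob_space (sp Y)" and "vol Y = (\<lambda>_ _. e)"
    and "\<And>\<omega>. \<omega> \<in> space (sp Y) \<Longrightarrow> proc Y 0 \<omega> = 0"
    and Y': "\<And>t. 0 \<le> t \<Longrightarrow> proc Y t \<in> borel_measurable (sp Y)"
    and YC: "\<And>t v. 0 \<le> t \<Longrightarrow> char (distr (sp Y) borel (proc Y t)) v = exp (of_real t * (lam * (char \<mu> v - 1) - of_real (v\<^sup>2 * e / 2)))"
    by (rule levy_exists[OF type mu mu0 sym lam e Ye], rule that)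
  let ?N = "distr (sp Y) borel (proc Y t)"
  have N: "real_distribution ?N" using Y Y' t by (intro prob_space.real_distribution_distr) auto
  have s: "0 < sqrt (t * c)" using t c by simp
  note sm = real_distribution.smooth_distribution[OF N s]
  have XD: "real_distribution (distr (sp X) borel (proc X t))" using X t by (intro prob_space.real_distribution_distr) auto
  have "char (distr (sp X) borel (proc X t)) v = char (density lborel (smooth (sqrt (t * c)) ?N)) v" for v
  proof -
    have sq: "(sqrt (t * c) * v)\<^sup>2 = t * c * v\<^sup>2" using t c by (simp add: power_mult_distrib)
    have e1: "complex_of_real (exp (-(t * c * v\<^sup>2)/2)) = exp (of_real (-(t * c * v\<^sup>2)/2))" by (rule exp_of_real[symmetric])
    show ?thesis
      unfolding sm(2) X(6)[OF less_imp_le[OF t]] YC[OF less_imp_le[OF t]] sq e1 exp_add[symmetric]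
      by (rule arg_cong[where f=exp]) (simp add: algebra_simps add_divide_distrib)
  qed
  then have "distr (sp X) borel (proc X t) = density lborel (smooth (sqrt (t * c)) ?N)"
    by (intro Levy_uniqueness XD sm(1) ext)
  then show thesis using X t YC[of t] N by (intro that[of X ?N]) (auto simp: centred_levy_def)
qed

section \<open>The Gaussian pair\<close>

text \<open>Explains the target affinity \<open>1 - 1 / (2 * n)\<close> of one increment: its
  \<open>n\<close>-th power stays above one half.\<close>

lemma bernoulli_half: "1 \<le> n \<Longrightarrow> 1/2 \<le> (1 - 1 / (2 * real n)) ^ n"
  using Bernoulli_inequality[of "- (1 / (2 * real n))" n] by (simp add: field_simps)

text \<open>With \<open>g\<close> the geometric mean of \<open>c\<close> and \<open>d\<close>, the
  product of \<open>c + d - 2 * g\<close> and \<open>c + d + 2 * g\<close> is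
  \<open>(d - c)^2\<close>. The loss of affinity is therefore quadratic in the gap, which is why a
  gap of order \<open>1 / sqrt n\<close> goes unnoticed.\<close>

lemma gauss_affinity:
  assumes c: "0 < c" and d: "c \<le> d" and n: "1 \<le> n" and cl: "n * (d - c)\<^sup>2 \<le> 4 * c\<^sup>2"
  shows "1 - 1 / (2 * real n) \<le> sqrt (2 * sqrt (1 / n * c) * sqrt (1 / n * d) / ((sqrt (1 / n * c))\<^sup>2 + (sqrt (1 / n * d))\<^sup>2))"
proof -
  have npos: "0 < real n" using n by simp
  have eq: "2 * sqrt (1 / n * c) * sqrt (1 / n * d) / ((sqrt (1 / n * c))\<^sup>2 + (sqrt (1 / n * d))\<^sup>2) = 2 * (sqrt c * sqrt d) / (c + d)"
    using npos c d by (simp add: real_sqrt_divide field_simps)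
  define g where "g = sqrt c * sqrt d"
  have g: "c \<le> g" "g\<^sup>2 = c * d" using c d real_sqrt_le_mono[of "c*c" "c*d"] 
    by (auto simp: g_def power_mult_distrib real_sqrt_mult)
  have "(c + d - 2 * g) * (4 * c) \<le> (c + d - 2 * g) * (c + d + 2 * g)"
  proof (rule mult_left_mono)
    have "0 \<le> (sqrt c - sqrt d)\<^sup>2" by simp
    also have "\<dots> = c + d - 2 * g" using c d by (simp add: power2_diff g_def)
    finally show "0 \<le> c + d - 2 * g" .
  qed (use g d in auto)
  also have "\<dots> = (c + d)\<^sup>2 - 4 * g\<^sup>2" by (simp add: power2_eq_square algebra_simps)
  also have "\<dots> = (d - c)\<^sup>2" unfolding g(2) by (simp add: power2_eq_square algebra_simps)
  finally have "n * ((c + d - 2 * g) * (4 * c)) \<le> n * (d - c)\<^sup>2" using npos by (intro mult_left_mono) auto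
  also have "\<dots> \<le> (4 * c) * c" using cl by (simp add: power2_eq_square)
  finally have "(4 * c) * (n * (c + d - 2 * g)) \<le> (4 * c) * c" by (simp add: ac_simps)
  then have "n * (c + d - 2 * g) \<le> c" using c by (simp only: mult_le_cancel_left_pos)
  then have "2 * (n * (c + d - 2 * g)) \<le> c + d" using d by simp
  then have le: "n * (2 * (c + d - 2 * g)) \<le> c + d" by (simp only: mult.left_commute)
  \<comment> \<open>The square root is avoided: for a number in the unit interval the square is at
    most the number itself.\<close>
  have "(1 - 1 / (2 * real n))\<^sup>2 \<le> 1 - 1 / (2 * real n)"
    using n by (simp add: power2_eq_square field_simps)
  also have "\<dots> \<le> 2 * g / (c + d)"
    using le npos c d by (simp add: field_simps)
  finally show ?thesis unfolding eq g_def by (rule real_le_rsqrt)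
qed

lemma gauss_hypotheses:
  assumes type: "(UNIV :: real set) \<lesssim> (UNIV :: 'a set)" and A: "0 < A" and n: "1 \<le> n"
  shows "\<exists>(X :: 'a semimart) Y c d. centred_levy r A c X \<and> centred_levy r A d Y \<and> \<bar>c - d\<bar> = (A / 4) / sqrt (real n) \<and> close_increments n X Y"
proof -
  \<comment> \<open>The intensity will be zero, so any symmetric law without an atom at zero can
    take the place of the jump law.\<close>
  obtain \<mu> :: "real measure" where mu: "real_distribution \<mu>" "distr \<mu> borel uminus = \<mu>" "emeasure \<mu> {0} = 0"
    using spline_kernel by metis
  \<comment> \<open>Base level and gap are chosen so that both volatilities stay below
    \<open>A\<close>.\<close>
  define c d where "c = A / 2" and "d = A / 2 + (A / 4) / sqrt (real n)"
  have npos: "0 < real n" using n by simp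
  have "(A / 4) / sqrt (real n) \<le> A / 4" using n A by (simp add: divide_le_eq)
  then have cd: "0 < c" "c \<le> d" "d \<le> A" using A by (auto simp: c_def d_def)
  then have d0: "0 < d" by simp
  have ex: "\<exists>X :: 'a semimart. centred_levy r A a X \<and> distr (sp X) borel (proc X (1/n)) = density lborel (normal_density 0 (sqrt (1 / n * a)))"
    if a: "0 < a" "a \<le> A" for a
  proof -
    have "ennreal (a + 0) + ennreal 0 * (\<integral>\<^sup>+ x. ennreal (min (\<bar>x\<bar> powr r) 1) \<partial>\<mu>) \<le> ennreal A"
      using a by (simp add: ennreal_leI)
    note Acond = this
    have tpos: "0 < 1 / real n" using npos by simp
    obtain X :: "'a semimart" and N where X: "centred_levy r A (a + 0) X" "real_distribution N"
      "\<And>v. char N v = exp (of_real (1/n) * (complex_of_real 0 * (char \<mu> v - 1) - of_real (v\<^sup>2 * 0 / 2)))"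
      "distr (sp X) borel (proc X (1/n)) = density lborel (smooth (sqrt (1/n * a)) N)"
      by (rule levy_exists_smooth[OF type mu(1,3,2) order_refl a(1) order_refl tpos Acond], rule that)
    have R: "real_distribution (return borel (0::real))"
      by (intro real_distribution.intro prob_space_return real_distribution_axioms.intro) auto
    have "char N = char (return borel 0)"
    proof
      fix v
      have "char (return borel 0) v = 1" unfolding char_def by (subst integral_return) auto
      then show "char N v = char (return borel 0) v" by (simp add: X(3))
    qed
    \<comment> \<open>With no jumps and no residual volatility the law \<open>N\<close> is a point
      mass, and its smoothing is the normal density itself.\<close>
    then have N: "N = return borel 0" by (rule Levy_uniqueness[OF X(2) R])
    have "smooth s N = normal_density 0 s" for s
      unfolding N smooth_def by (auto simp: integral_return)
    then show ?thesis using X(1,4) by auto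
  qed
  obtain X Y :: "'a semimart" where X: "centred_levy r A c X" "distr (sp X) borel (proc X (1/n)) = density lborel (normal_density 0 (sqrt (1 / n * c)))"
    and Y: "centred_levy r A d Y" "distr (sp Y) borel (proc Y (1/n)) = density lborel (normal_density 0 (sqrt (1 / n * d)))"
    using ex[of c] ex[of d] cd d0 by auto
  have "n * (d - c)\<^sup>2 \<le> 4 * c\<^sup>2" using npos by (simp add: c_def d_def power_divide)
  then have "1 - 1 / (2 * real n) \<le> sqrt (2 * sqrt (1 / n * c) * sqrt (1 / n * d) / ((sqrt (1 / n * c))\<^sup>2 + (sqrt (1 / n * d))\<^sup>2))"
    by (rule gauss_affinity[OF cd(1,2) n])
  then have "ennreal (1 - 1 / (2 * real n)) \<le> (\<integral>\<^sup>+x. ennreal (sqrt (normal_density 0 (sqrt (1/n*c)) x) * sqrt (normal_density 0 (sqrt (1/n*d)) x)) \<partial>lborel)"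
    using npos cd d0 by (subst affinity_gauss) (auto intro!: ennreal_leI)
  then have "close_increments n X Y"
    unfolding close_increments_def using X(2) Y(2) n bernoulli_half[OF n]
    by (intro exI[of _ "normal_density 0 (sqrt (1/n*c))"] exI[of _ "normal_density 0 (sqrt (1/n*d))"] exI[of _ "1 - 1 / (2 * real n)"] conjI allI) auto
  moreover have "\<bar>c - d\<bar> = (A / 4) / sqrt (real n)" using A by (simp add: c_def d_def)
  ultimately show ?thesis using X(1) Y(1) by blast
qed

text \<open>
  The cubic terms cancel, so dilating the jump law changes the characteristic exponent near zero
  by a pure Gaussian term.
\<close>

lemma bspline_dilation:
  assumes "\<bar>x\<bar> \<le> 1/2"
  shows "8 * (1 - 3/2 * bspline x) = 6 * x\<^sup>2 + (1 - 3/2 * bspline (2 * x))"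
proof -
  have b: "bspline x = 2/3 - x\<^sup>2 + \<bar>x\<bar>^3/2" "bspline (2 * x) = 2/3 - (2 * x)\<^sup>2 + \<bar>2 * x\<bar>^3/2"
    using assms by (simp_all add: bspline_def abs_mult)
  have "\<bar>2 * x\<bar>^3 = 8 * \<bar>x\<bar>^3" "(2 * x)\<^sup>2 = 4 * x\<^sup>2" by (simp_all add: abs_mult power_mult_distrib)
  then show ?thesis unfolding b by (simp add: field_simps)
qed

section \<open>The pair with jumps\<close>

text \<open>Since \<open>r < 2\<close>, the \<open>r\<close>-th absolute power is at most
  \<open>1 + x^2\<close>; the finite second moment then lets the contribution of jumps of scale
  \<open>a\<close> to the class bound shrink like \<open>a powr r\<close>.\<close>

lemma scaled_kernel:
  assumes mu: "real_distribution \<mu>" and sym: "\<mu> = distr \<mu> borel uminus" and mu0: "emeasure \<mu> {0} = 0"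
    and m2: "integrable \<mu> (\<lambda>x. x\<^sup>2)" and a: "0 < a" and r: "0 \<le> r" "r < 2"
  defines "\<nu> \<equiv> distr \<mu> borel (\<lambda>x. a * x)"
  shows "real_distribution \<nu>" "distr \<nu> borel uminus = \<nu>" "emeasure \<nu> {0} = 0"
    "(\<integral>\<^sup>+ x. ennreal (min (\<bar>x\<bar> powr r) 1) \<partial>\<nu>) \<le> ennreal (a powr r * (1 + (\<integral>x. x\<^sup>2 \<partial>\<mu>)))"
proof -
  interpret real_distribution \<mu> by fact
  show "real_distribution \<nu>" unfolding \<nu>_def by (rule real_distribution_distr) simp
  have "distr \<nu> borel uminus = distr \<mu> borel (\<lambda>x. a * (- x))"
    unfolding \<nu>_def by (subst distr_distr) (simp_all add: comp_def)
  also have "\<dots> = distr (distr \<mu> borel uminus) borel (\<lambda>x. a * x)"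
    by (subst distr_distr) (simp_all add: comp_def)
  also have "\<dots> = \<nu>" unfolding \<nu>_def sym[symmetric] by (rule refl)
  finally show "distr \<nu> borel uminus = \<nu>" .
  have "emeasure \<nu> {0} = emeasure \<mu> ((\<lambda>x. a * x) -` {0} \<inter> space \<mu>)" unfolding \<nu>_def by (rule emeasure_distr) auto
  also have "(\<lambda>x. a * x) -` {0} \<inter> space \<mu> = {0}" using a by auto
  finally show "emeasure \<nu> {0} = 0" using mu0 by simp
  have "(\<integral>\<^sup>+ x. ennreal (min (\<bar>x\<bar> powr r) 1) \<partial>\<nu>) = (\<integral>\<^sup>+ x. ennreal (min (\<bar>a * x\<bar> powr r) 1) \<partial>\<mu>)"
    unfolding \<nu>_def by (rule nn_integral_distr) auto
  also have "\<dots> \<le> (\<integral>\<^sup>+ x. ennreal (a powr r * (1 + x\<^sup>2)) \<partial>\<mu>)"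
  proof (intro nn_integral_mono ennreal_leI)
    fix x :: real
    have "\<bar>x\<bar> powr r \<le> 1 + x\<^sup>2"
    proof (cases "\<bar>x\<bar> \<le> 1")
      case True
      then have "\<bar>x\<bar> powr r \<le> 1" using powr_mono2[OF r(1) abs_ge_zero True] by simp
      then show ?thesis by (rule order_trans) simp
    next
      case False
      then have "\<bar>x\<bar> powr r \<le> \<bar>x\<bar> powr 2" using r by (intro powr_mono) auto
      also have "\<dots> = x\<^sup>2" using False by (simp add: powr_numeral)
      finally show ?thesis by simp
    qed
    then have "a powr r * \<bar>x\<bar> powr r \<le> a powr r * (1 + x\<^sup>2)" by (intro mult_left_mono) auto
    moreover have "\<bar>a * x\<bar> powr r = a powr r * \<bar>x\<bar> powr r" using a by (simp add: abs_mult powr_mult)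
    ultimately show "min (\<bar>a * x\<bar> powr r) 1 \<le> a powr r * (1 + x\<^sup>2)" by simp
  qed
  also have "\<dots> = ennreal (\<integral>x. a powr r * (1 + x\<^sup>2) \<partial>\<mu>)"
    using m2 by (intro nn_integral_eq_integral) auto
  also have "(\<integral>x. a powr r * (1 + x\<^sup>2) \<partial>\<mu>) = a powr r * (1 + (\<integral>x. x\<^sup>2 \<partial>\<mu>))"
    using m2 prob_space by simp
  finally show "(\<integral>\<^sup>+ x. ennreal (min (\<bar>x\<bar> powr r) 1) \<partial>\<nu>) \<le> ennreal (a powr r * (1 + (\<integral>x. x\<^sup>2 \<partial>\<mu>)))" .
qed

text \<open>By \<open>1 - exp (- z) \<le> z\<close>, a quadratic bound on the exponent near zero
  bounds the second moment by \<open>A / n\<close>. Chebyshev's inequality at the radius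
  \<open>2 * sqrt A\<close> turns this into \<open>1 / (4 * n)\<close>.\<close>

lemma smooth_tail:
  assumes N: "real_distribution N" and u: "0 < u" and n: "1 \<le> n" and A: "0 < A" and g: "\<And>v. \<bar>v\<bar> \<le> u \<Longrightarrow> char N v = exp (of_real (- g v))"
    and gle: "\<And>v. \<bar>v\<bar> \<le> u \<Longrightarrow> g v \<le> 1 / real n * (A / 4 * v\<^sup>2)"
  shows "emeasure (density lborel (smooth (sqrt (1 / real n * (A / 2))) N)) {x. 2 * sqrt A < \<bar>x\<bar>} \<le> ennreal (1 / (4 * real n))"
proof -
  let ?s = "sqrt (1 / real n * (A / 2))"
  have npos: "0 < real n" using n by simp
  have s: "0 < ?s" using npos A by simp
  note sm = real_distribution.smooth_distribution[OF N s]
  let ?P = "density lborel (smooth ?s N)"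
  have "1 - Re (char ?P v) \<le> (A / real n) * v\<^sup>2 / 2" if v: "\<bar>v\<bar> \<le> u" for v
  proof -
    have sq: "(?s * v)\<^sup>2 = 1 / real n * (A / 2) * v\<^sup>2" using npos A by (simp add: power_mult_distrib)
    define z where "z = (?s * v)\<^sup>2 / 2 + g v"
    have "char ?P v = of_real (exp (- z))"
      unfolding sm(2) g[OF v] exp_of_real of_real_mult[symmetric] mult_exp_exp z_def by simp
    then have "1 - Re (char ?P v) = 1 - exp (- z)" by simp
    also have "\<dots> \<le> z" using exp_ge_add_one_self[of "- z"] by simp
    also have "\<dots> \<le> 1 / real n * (A / 2) * v\<^sup>2 / 2 + 1 / real n * (A / 4 * v\<^sup>2)" unfolding z_def sq using gle[OF v] by simp
    also have "\<dots> = (A / real n) * v\<^sup>2 / 2" by (simp add: field_simps)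
    finally show ?thesis .
  qed
  then have "(\<integral>\<^sup>+x. ennreal (x\<^sup>2) \<partial>?P) \<le> ennreal (A / real n)" by (rule second_moment_le[OF sm(1) u])
  then have "emeasure ?P {x. 2 * sqrt A < \<bar>x\<bar>} \<le> ennreal (A / real n / (2 * sqrt A)\<^sup>2)"
    by (rule tail_le[OF sm(1)]) (use A in auto)
  moreover have "A / real n / (2 * sqrt A)\<^sup>2 = 1 / (4 * real n)" using A by (simp add: power_mult_distrib)
  ultimately show ?thesis by simp
qed

text \<open>\<open>X\<close> has the larger volatility and jumps of scale \<open>1 / u\<close> with
  intensity \<open>L\<close>; \<open>Y\<close> has the smaller one and jumps of half that scale with
  intensity \<open>8 * L\<close>. The hypothesis \<open>cls\<close> keeps both in the class, and
  \<open>D\<close> makes the densities uniformly close.\<close>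

lemma jump_pair:
  assumes type: "(UNIV :: real set) \<lesssim> (UNIV :: 'a set)" and A: "0 < A" and n: "1 \<le> n" and r: "0 \<le> r" "r < 2"
    and kap: "real_distribution \<kappa>" "\<kappa> = distr \<kappa> borel uminus" "emeasure \<kappa> {0} = 0" "integrable \<kappa> (\<lambda>x. x\<^sup>2)"
    and ch: "\<And>u. char \<kappa> u = of_real (3/2 * bspline u)"
    and u: "0 < u" and \<delta>: "0 \<le> \<delta>" "\<delta> \<le> A / 4"
    and cls: "8 * (\<delta> * u\<^sup>2 / 3) * ((1 / u) powr r * (1 + (\<integral>x. x\<^sup>2 \<partial>\<kappa>))) \<le> A / 4"
    and D: "4 * sqrt A * (2 * exp (- (sqrt (1 / real n * (A / 2)) * u)\<^sup>2 / 4) / sqrt (1 / real n * (A / 2))) \<le> 1 / (2 * real n)"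
  shows "\<exists>(X :: 'a semimart) Y. centred_levy r A (A / 2 + \<delta>) X \<and> centred_levy r A (A / 2) Y \<and> close_increments n X Y"
proof -
  \<comment> \<open>The intensity is dictated by the spline identity: at
    \<open>x = v / (2 * u)\<close> its quadratic term contributes
    \<open>3 * L * v^2 / (2 * u^2)\<close>, which must equal
    \<open>v^2 * \<delta> / 2\<close>.\<close>
  define L m where "L = \<delta> * u\<^sup>2 / 3" and "m = 1 + (\<integral>x. x\<^sup>2 \<partial>\<kappa>)"
  define s where "s = sqrt (1 / real n * (A / 2))"
  have npos: "0 < real n" using n by simp
  have tpos: "0 < 1 / real n" and c: "0 < A / 2" and s: "0 < s" using npos A by (simp_all add: s_def)
  have L: "0 \<le> L" using \<delta> by (simp add: L_def)
  have L8: "0 \<le> 8 * L" using L by simp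
  have m: "0 \<le> m" by (simp add: m_def)
  have a: "0 < 1 / u" "0 < 1 / (2 * u)" using u by simp_all
  have cls': "8 * L * ((1 / u) powr r * m) \<le> A / 4" using cls by (simp add: L_def m_def)
  note k1 = scaled_kernel[OF kap a(1) r] and k2 = scaled_kernel[OF kap a(2) r]
  let ?\<mu>1 = "distr \<kappa> borel (\<lambda>x. 1 / u * x)" and ?\<mu>2 = "distr \<kappa> borel (\<lambda>x. 1 / (2 * u) * x)"
  let ?J = "\<lambda>\<mu>. \<integral>\<^sup>+ x. ennreal (min (\<bar>x\<bar> powr r) 1) \<partial>\<mu>"
  have J1: "?J ?\<mu>1 \<le> ennreal ((1 / u) powr r * m)" using k1(4) by (simp only: m_def)
  have J2: "?J ?\<mu>2 \<le> ennreal ((1 / u) powr r * m)"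
  proof (rule order_trans[OF k2(4)])
    show "ennreal ((1 / (2 * u)) powr r * (1 + (\<integral>x. x\<^sup>2 \<partial>\<kappa>))) \<le> ennreal ((1 / u) powr r * m)"
      using u r m by (intro ennreal_leI) (auto simp: m_def intro!: mult_right_mono powr_mono2 divide_left_mono)
  qed
  have c1: "ennreal (A / 2 + \<delta>) + ennreal L * ?J ?\<mu>1 \<le> ennreal A"
  proof -
    have "ennreal (A / 2 + \<delta>) + ennreal L * ?J ?\<mu>1 \<le> ennreal (A / 2 + \<delta>) + ennreal L * ennreal ((1 / u) powr r * m)"
      by (intro add_mono mult_left_mono J1) auto
    also have "\<dots> = ennreal (A / 2 + \<delta> + L * ((1 / u) powr r * m))"
      using A \<delta> L m by (simp add: ennreal_mult' ennreal_plus)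
    also have "\<dots> \<le> ennreal A"
    proof (rule ennreal_leI)
      have "0 \<le> L * ((1 / u) powr r * m)" using L m by simp
      then show "A / 2 + \<delta> + L * ((1 / u) powr r * m) \<le> A" using cls' \<delta>(2) A by linarith
    qed
    finally show ?thesis .
  qed
  have c2: "ennreal (A / 2 + 0) + ennreal (8 * L) * ?J ?\<mu>2 \<le> ennreal A"
  proof -
    have "ennreal (A / 2 + 0) + ennreal (8 * L) * ?J ?\<mu>2 \<le> ennreal (A / 2 + 0) + ennreal (8 * L) * ennreal ((1 / u) powr r * m)"
      by (intro add_mono mult_left_mono J2) auto
    also have "\<dots> = ennreal (A / 2 + 0 + 8 * L * ((1 / u) powr r * m))"
      using A L8 m by (simp add: ennreal_mult' ennreal_plus)
    also have "\<dots> \<le> ennreal A" using cls' A by (intro ennreal_leI) linarith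
    finally show ?thesis .
  qed
  obtain X :: "'a semimart" and N1 where X: "centred_levy r A (A / 2 + \<delta>) X" "real_distribution N1"
      "\<And>v. char N1 v = exp (of_real (1 / real n) * (complex_of_real L * (char ?\<mu>1 v - 1) - of_real (v\<^sup>2 * \<delta> / 2)))"
      "distr (sp X) borel (proc X (1 / real n)) = density lborel (smooth (sqrt (1 / real n * (A / 2))) N1)"
    by (rule levy_exists_smooth[OF type k1(1,3,2) L c \<delta>(1) tpos c1], rule that)
  obtain Y :: "'a semimart" and N2 where Y: "centred_levy r A (A / 2 + 0) Y" "real_distribution N2"
      "\<And>v. char N2 v = exp (of_real (1 / real n) * (complex_of_real (8 * L) * (char ?\<mu>2 v - 1) - of_real (v\<^sup>2 * 0 / 2)))"
      "distr (sp Y) borel (proc Y (1 / real n)) = density lborel (smooth (sqrt (1 / real n * (A / 2))) N2)"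
    by (rule levy_exists_smooth[OF type k2(1,3,2) L8 c order_refl tpos c2], rule that)
  \<comment> \<open>\<open>- g\<close> is the exponent of \<open>N2\<close> at every frequency, and
    also that of \<open>N1\<close> as long as \<open>\<bar>v\<bar> \<le> u\<close>.\<close>
  define g where "g v = 1 / real n * (8 * L * (1 - 3/2 * bspline (v / (2 * u))))" for v
  have N2: "char N2 v = exp (of_real (- g v))" for v
    unfolding Y(3) char_scale[OF kap(1)] ch g_def by (rule arg_cong[where f=exp]) (simp add: algebra_simps)
  have N1: "char N1 v = exp (of_real (- g v))" if v: "\<bar>v\<bar> \<le> u" for v
  proof -
    have "\<bar>v / (2 * u)\<bar> \<le> 1/2" using v u by (simp add: abs_mult divide_le_eq)
    from bspline_dilation[OF this] have d: "8 * (1 - 3/2 * bspline (v / (2 * u))) = 6 * (v / (2 * u))\<^sup>2 + (1 - 3/2 * bspline (v / u))"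
      by simp
    have "8 * L * (1 - 3/2 * bspline (v / (2 * u))) = L * (8 * (1 - 3/2 * bspline (v / (2 * u))))" by (simp only: ac_simps)
    also have "\<dots> = L * (6 * (v / (2 * u))\<^sup>2) + L * (1 - 3/2 * bspline (v / u))" unfolding d by (rule distrib_left)
    also have "L * (6 * (v / (2 * u))\<^sup>2) = v\<^sup>2 * \<delta> / 2" using u by (simp add: L_def power_divide power_mult_distrib)
    finally have e: "8 * L * (1 - 3/2 * bspline (v / (2 * u))) = v\<^sup>2 * \<delta> / 2 + L * (1 - 3/2 * bspline (v / u))" .
    have "complex_of_real L * (char ?\<mu>1 v - 1) - of_real (v\<^sup>2 * \<delta> / 2) = of_real (- (8 * L * (1 - 3/2 * bspline (v / (2 * u)))))"
      unfolding e char_scale[OF kap(1)] ch by (simp add: algebra_simps)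
    then show ?thesis unfolding X(3) g_def by (simp only: of_real_mult[symmetric] mult_minus_right)
  qed
  have gle: "g v \<le> 1 / real n * (A / 4 * v\<^sup>2)" if v: "\<bar>v\<bar> \<le> u" for v
    unfolding g_def
  proof (rule mult_left_mono)
    have x: "\<bar>v / (2 * u)\<bar> \<le> 1" using v u by (simp add: abs_mult divide_le_eq)
    have "bspline (v / (2 * u)) = 2/3 - (v / (2 * u))\<^sup>2 + \<bar>v / (2 * u)\<bar>^3/2" unfolding bspline_def by (rule if_P[OF x])
    moreover have "0 \<le> \<bar>v / (2 * u)\<bar>^3" by (intro zero_le_power abs_ge_zero)
    ultimately have "1 - 3/2 * bspline (v / (2 * u)) \<le> 3/2 * (v / (2 * u))\<^sup>2" by linarith
    then have "8 * L * (1 - 3/2 * bspline (v / (2 * u))) \<le> 8 * L * (3/2 * (v / (2 * u))\<^sup>2)" by (rule mult_left_mono) (rule L8)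
    also have "\<dots> = \<delta> * v\<^sup>2" using u by (simp add: L_def power_divide power_mult_distrib)
    also have "\<dots> \<le> A / 4 * v\<^sup>2" using \<delta>(2) by (intro mult_right_mono) auto
    finally show "8 * L * (1 - 3/2 * bspline (v / (2 * u))) \<le> A / 4 * v\<^sup>2" .
  qed simp
  let ?p = "smooth s N1" and ?q = "smooth s N2"
  have sup: "\<bar>?p x - ?q x\<bar> \<le> 2 * exp (- (s * u)\<^sup>2 / 4) / s" for x
    using N1 N2 by (intro smooth_diff_le X(2) Y(2) s less_imp_le[OF u]) simp
  note sm1 = real_distribution.smooth_distribution(1)[OF X(2) s] real_distribution.smooth_nonneg[OF X(2)] real_distribution.smooth_measurable[OF X(2)]
  note sm2 = real_distribution.smooth_distribution(1)[OF Y(2) s] real_distribution.smooth_nonneg[OF Y(2)] real_distribution.smooth_measurable[OF Y(2)]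
  have meas: "?p \<in> borel_measurable borel" "?q \<in> borel_measurable borel" by (rule sm1(3), rule sm2(3))
  have prob: "prob_space (density lborel ?p)" "prob_space (density lborel ?q)"
    using sm1(1) sm2(1) by (simp_all add: real_distribution_def)
  have t1: "emeasure (density lborel ?p) {x. 2 * sqrt A < \<bar>x\<bar>} \<le> ennreal (1 / (4 * real n))"
    unfolding s_def by (rule smooth_tail[OF X(2) u n A N1 gle])
  have t2: "emeasure (density lborel ?q) {x. 2 * sqrt A < \<bar>x\<bar>} \<le> ennreal (1 / (4 * real n))"
    unfolding s_def by (rule smooth_tail[OF Y(2) u n A N2 gle])
  \<comment> \<open>Half of the allowed distance \<open>1 / n\<close> is spent on the uniform bound
    over the central interval, the other half on the two tails.\<close>
  have "(\<integral>\<^sup>+x. ennreal \<bar>?p x - ?q x\<bar> \<partial>lborel) \<le> ennreal (2 * (2 * sqrt A) * (2 * exp (- (s * u)\<^sup>2 / 4) / s) + 2 * (1 / (4 * real n)))"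
    using A by (intro L1_le meas sm1(2) sm2(2) sup t1 t2) auto
  also have "\<dots> \<le> ennreal (2 * (1 / (2 * real n)))"
  proof (rule ennreal_leI)
    have "2 * (2 * sqrt A) * (2 * exp (- (s * u)\<^sup>2 / 4) / s) \<le> 1 / (2 * real n)" using D by (simp add: s_def)
    then show "2 * (2 * sqrt A) * (2 * exp (- (s * u)\<^sup>2 / 4) / s) + 2 * (1 / (4 * real n)) \<le> 2 * (1 / (2 * real n))" by simp
  qed
  finally have "ennreal (1 - 1 / (2 * real n)) \<le> (\<integral>\<^sup>+x. ennreal (sqrt (?p x) * sqrt (?q x)) \<partial>lborel)"
    by (intro affinity_ge_L1 meas sm1(2) sm2(2) prob) auto
  then have "close_increments n X Y"
    unfolding close_increments_def using X(4) Y(4) n bernoulli_half[OF n] sm1(2) sm2(2) meas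
    by (intro exI[of _ ?p] exI[of _ ?q] exI[of _ "1 - 1 / (2 * real n)"] conjI allI) (auto simp: s_def)
  then show ?thesis using X(1) Y(1) by auto
qed

text \<open>All constants are fixed here: the frequency \<open>u\<close> by the smallness of the
  Gaussian factor, and the size \<open>\<kappa>\<close> of the perturbation by the class bound at
  that frequency.\<close>

lemma jump_hypotheses:
  assumes type: "(UNIV :: real set) \<lesssim> (UNIV :: 'a set)" and A: "0 < A" and r: "0 \<le> r" "r < 2"
  shows "\<exists>\<kappa>>0. \<forall>n\<ge>32. \<exists>(X :: 'a semimart) Y c d. centred_levy r A c X \<and> centred_levy r A d Y \<and>
    \<bar>c - d\<bar> = \<kappa> / (real n * ln (real n)) powr ((2 - r) / 2) \<and> close_increments n X Y"
proof -
  obtain \<mu> :: "real measure" where kap: "real_distribution \<mu>" "\<mu> = distr \<mu> borel uminus" "emeasure \<mu> {0} = 0" "integrable \<mu> (\<lambda>x. x\<^sup>2)"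
    and ch: "\<And>u. char \<mu> u = of_real (3/2 * bspline u)"
    by (rule spline_kernel, rule that)
  \<comment> \<open>\<open>\<kappa>\<close> meets two demands at once: it is at most
    \<open>A / 4\<close>, and the jump term of the class bound, which reduces to
    \<open>8 / 3 * \<kappa> * (H * m)\<close>, is at most \<open>A / 4\<close> as well.\<close>
  define m H \<kappa> where "m = 1 + (\<integral>x. x\<^sup>2 \<partial>\<mu>)" and "H = (24 / A) powr ((2 - r) / 2)" and "\<kappa> = A / (4 + 16 * (H * m))"
  have m: "0 \<le> m" and H: "0 \<le> H" by (simp_all add: m_def H_def)
  have Hm: "0 \<le> H * m" using H m by simp
  have \<kappa>: "0 < \<kappa>" "\<kappa> \<le> A / 4" "8 / 3 * \<kappa> * (H * m) \<le> A / 4"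
  proof -
    show "0 < \<kappa>" using A Hm by (simp add: \<kappa>_def add_pos_nonneg)
    show "\<kappa> \<le> A / 4" unfolding \<kappa>_def using A Hm by (intro divide_left_mono) (auto intro: mult_pos_pos add_pos_nonneg)
    have "8 / 3 * (H * m) \<le> 1 / 4 * (4 + 16 * (H * m))" using Hm by simp
    then have "A * (8 / 3 * (H * m)) \<le> A * (1 / 4 * (4 + 16 * (H * m)))" using A by (intro mult_left_mono) auto
    then show "8 / 3 * \<kappa> * (H * m) \<le> A / 4" unfolding \<kappa>_def using Hm by (simp add: field_simps)
  qed
  have "\<exists>(X :: 'a semimart) Y c d. centred_levy r A c X \<and> centred_levy r A d Y \<and>
    \<bar>c - d\<bar> = \<kappa> / (real n * ln (real n)) powr ((2 - r) / 2) \<and> close_increments n X Y" if n32: "32 \<le> n" for n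
  proof -
    have n: "1 \<le> n" "32 \<le> real n" using n32 by simp_all
    have npos: "0 < real n" using n by simp
    \<comment> \<open>A logarithm of at least one makes \<open>l\<close> and \<open>\<rho>\<close>
      at least one, so that \<open>\<delta>\<close> does not exceed \<open>\<kappa>\<close>.\<close>
    have "exp 1 \<le> real n" using exp_le n by linarith
    then have ln1: "1 \<le> ln (real n)" using npos by (simp add: ln_ge_iff)
    define l where "l = real n * ln (real n)"
    have l1: "1 \<le> l" unfolding l_def using n ln1 mult_mono[of 1 "real n" 1 "ln (real n)"] by simp
    define \<rho> where "\<rho> = l powr ((2 - r) / 2)"
    have \<rho>1: "1 \<le> \<rho>" unfolding \<rho>_def using l1 r by (intro ge_one_powr_ge_zero) auto
    \<comment> \<open>The factor \<open>24 / A\<close> makes the exponent in the uniform bound equal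
      to \<open>- 3 * ln n\<close>. The resulting \<open>1 / n^3\<close> outweighs the growth of the
      reciprocal of the smoothing scale and still leaves less than
      \<open>1 / (2 * n)\<close>.\<close>
    define u where "u = sqrt (24 / A * l)"
    have u: "0 < u" "u\<^sup>2 = 24 / A * l" using A l1 by (simp_all add: u_def)
    define \<delta> where "\<delta> = \<kappa> / \<rho>"
    have \<delta>0: "0 \<le> \<delta>" using \<kappa> \<rho>1 by (simp add: \<delta>_def)
    have \<delta>1: "\<delta> \<le> A / 4"
    proof -
      have "\<kappa> / \<rho> \<le> \<kappa>" using \<kappa>(1) \<rho>1 by (simp add: divide_le_eq)
      then show ?thesis unfolding \<delta>_def using \<kappa>(2) by (rule order_trans)
    qed
    \<comment> \<open>The powers balance here: \<open>u powr (2 - r)\<close> is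
      \<open>\<rho>\<close> up to the constant \<open>H\<close>, so
      \<open>\<delta> = \<kappa> / \<rho>\<close> turns the class bound into a condition that is
      independent of \<open>n\<close>.\<close>
    have pw: "u\<^sup>2 * (1 / u) powr r = H * \<rho>"
    proof -
      have "u\<^sup>2 * (1 / u) powr r = u powr 2 * u powr (- r)" using u(1) by (simp add: powr_numeral powr_minus powr_divide inverse_eq_divide)
      also have "\<dots> = u powr (2 - r)" by (simp add: powr_add[symmetric])
      also have "\<dots> = ((24 / A * l) powr (1/2)) powr (2 - r)" using A l1 by (simp add: u_def powr_half_sqrt)
      also have "\<dots> = (24 / A * l) powr ((2 - r) / 2)" by (simp add: powr_powr)
      also have "\<dots> = H * \<rho>" unfolding H_def \<rho>_def by (rule powr_mult)
      finally show ?thesis .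
    qed
    have cls: "8 * (\<delta> * u\<^sup>2 / 3) * ((1 / u) powr r * (1 + (\<integral>x. x\<^sup>2 \<partial>\<mu>))) \<le> A / 4"
    proof -
      have "8 * (\<delta> * u\<^sup>2 / 3) * ((1 / u) powr r * (1 + (\<integral>x. x\<^sup>2 \<partial>\<mu>))) = 8 / 3 * \<delta> * (u\<^sup>2 * (1 / u) powr r) * m"
        by (simp add: m_def)
      also have "\<dots> = 8 / 3 * (\<delta> * \<rho>) * (H * m)" unfolding pw by simp
      also have "\<delta> * \<rho> = \<kappa>" using \<rho>1 by (simp add: \<delta>_def)
      finally show ?thesis using \<kappa>(3) by simp
    qed
    have D: "4 * sqrt A * (2 * exp (- (sqrt (1 / real n * (A / 2)) * u)\<^sup>2 / 4) / sqrt (1 / real n * (A / 2))) \<le> 1 / (2 * real n)"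
    proof -
      have "(sqrt (1 / real n * (A / 2)) * u)\<^sup>2 = (1 / real n * (A / 2)) * u\<^sup>2" using A npos by (simp add: power_mult_distrib)
      also have "\<dots> = 12 * ln (real n)" unfolding u(2) l_def using A npos by simp
      finally have "exp (- (sqrt (1 / real n * (A / 2)) * u)\<^sup>2 / 4) = exp (- (3 * ln (real n)))" by simp
      also have "\<dots> = 1 / real n ^ 3" using npos by (simp add: exp_minus exp_of_nat_mult[of 3, simplified] inverse_eq_divide)
      finally have ex: "exp (- (sqrt (1 / real n * (A / 2)) * u)\<^sup>2 / 4) = 1 / real n ^ 3" .
      \<comment> \<open>A crude lower bound for the smoothing scale; it cancels the square root of
        \<open>A\<close> and leaves a pure power of \<open>n\<close>.\<close>
      have "sqrt (A / (2 * real n)) \<ge> sqrt A / (2 * real n)"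
      proof (rule real_le_rsqrt)
        have "A \<le> A * (2 * real n)" using A n by simp
        then show "(sqrt A / (2 * real n))\<^sup>2 \<le> A / (2 * real n)" using A npos by (simp add: power_divide power2_eq_square field_simps)
      qed
      then have s: "sqrt A / (2 * real n) \<le> sqrt (1 / real n * (A / 2))" by (simp add: mult.commute)
      have "4 * sqrt A * (2 * (1 / real n ^ 3) / sqrt (1 / real n * (A / 2))) \<le> 4 * sqrt A * (2 * (1 / real n ^ 3) / (sqrt A / (2 * real n)))"
        using s A npos by (intro mult_left_mono divide_left_mono) auto
      also have "\<dots> = 16 / real n ^ 2" using A npos by (simp add: field_simps power2_eq_square power3_eq_cube)
      \<comment> \<open>This comparison of \<open>16 / n^2\<close> with \<open>1 / (2 * n)\<close>
        is the origin of the threshold 32.\<close>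
      also have "\<dots> \<le> 1 / (2 * real n)" using n by (simp add: field_simps power2_eq_square)
      finally show ?thesis unfolding ex .
    qed
    obtain X Y :: "'a semimart" where "centred_levy r A (A / 2 + \<delta>) X" "centred_levy r A (A / 2) Y" "close_increments n X Y"
      using jump_pair[OF type A n(1) r kap ch u(1) \<delta>0 \<delta>1 cls D] by blast
    moreover have "\<bar>A / 2 + \<delta> - A / 2\<bar> = \<kappa> / (real n * ln (real n)) powr ((2 - r) / 2)"
      using \<delta>0 unfolding \<delta>_def \<rho>_def l_def by linarith
    ultimately show ?thesis by blast
  qed
  then show ?thesis using \<kappa>(1) by blast
qed

section \<open>From the two hypotheses to the rate\<close>

lemma rho_pos: "2 \<le> n \<Longrightarrow> 0 < rho r n"
  by (auto simp: rho_def)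

lemma hypotheses:
  assumes type: "(UNIV :: real set) \<lesssim> (UNIV :: 'a set)" and A: "0 < A" and r: "0 \<le> r" "r < 2"
  obtains \<kappa> where "0 < \<kappa>"
    "\<And>n. 32 \<le> n \<Longrightarrow> \<exists>(X :: 'a semimart) Y c d. centred_levy r A c X \<and> centred_levy r A d Y \<and>
      \<bar>c - d\<bar> = \<kappa> / rho r n \<and> close_increments n X Y"
proof (cases "r \<le> 1")
  case True
  have "\<exists>(X :: 'a semimart) Y c d. centred_levy r A c X \<and> centred_levy r A d Y \<and>
    \<bar>c - d\<bar> = (A / 4) / rho r n \<and> close_increments n X Y" if "32 \<le> n" for n
    unfolding rho_def if_P[OF True] using that by (intro gauss_hypotheses[OF type A]) simp
  then show ?thesis using A by (intro that[of "A / 4"]) simp_all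
next
  case False
  have "\<exists>\<kappa>>0. \<forall>n\<ge>32. \<exists>(X :: 'a semimart) Y c d. centred_levy r A c X \<and> centred_levy r A d Y \<and>
    \<bar>c - d\<bar> = \<kappa> / rho r n \<and> close_increments n X Y"
    unfolding rho_def if_not_P[OF False] by (rule jump_hypotheses[OF type A r])
  then show ?thesis using that by blast
qed

lemma levy_class_rate:
  assumes type: "(UNIV :: real set) \<lesssim> (UNIV :: 'a set)" and A: "0 < A" and r: "0 \<le> r" "r < 2"
    and w: "\<forall>n\<ge>1. 0 < w n" and rate: "uniform_rate w (levy_class r A :: 'a semimart set)"
  shows "\<exists>K. \<forall>n\<ge>2. w n \<le> K * rho r n"
proof -
  obtain \<kappa> where \<kappa>: "0 < \<kappa>" "\<And>n. 32 \<le> n \<Longrightarrow> \<exists>(X :: 'a semimart) Y c d. centred_levy r A c X \<and> centred_levy r A d Y \<and>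
      \<bar>c - d\<bar> = \<kappa> / rho r n \<and> close_increments n X Y"
    by (rule hypotheses[OF type A r], rule that)
  show ?thesis by (rule rate_bound[OF rate w \<kappa> rho_pos])
qed

text \<open>The same estimators serve the subclass, as the supremum of the error probabilities can
  only decrease.\<close>

lemma uniform_rate_mono:
  assumes "S \<subseteq> T" "uniform_rate w T"
  obtains E where "estimators E" "achieves_rate E w S"
proof -
  from assms(2) obtain E where E: "estimators E" "achieves_rate E w T" unfolding uniform_rate_def by blast
  have "achieves_rate E w S"
    unfolding achieves_rate_def
  proof (rule tendsto_sandwich[OF _ _ tendsto_const E(2)[unfolded achieves_rate_def]])
    show "eventually (\<lambda>m. limsup (\<lambda>n. SUP X\<in>S. emeasure (sp X) {\<omega> \<in> space (sp X). m < w n * \<bar>E n (\<lambda>t. proc X t \<omega>) - integrated_volatility X \<omega>\<bar>})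
      \<le> limsup (\<lambda>n. SUP X\<in>T. emeasure (sp X) {\<omega> \<in> space (sp X). m < w n * \<bar>E n (\<lambda>t. proc X t \<omega>) - integrated_volatility X \<omega>\<bar>})) at_top"
      by (intro Limsup_mono always_eventually allI SUP_subset_mono assms order_refl)
  qed simp
  then show thesis by (rule that[OF E(1)])
qed (sleep 150)

theorem theorem3p1:
  fixes r A :: real and w :: "nat \<Rightarrow> real"
  assumes "0 \<le> r" and "r < 2" and "0 < A"
    and "\<forall>n\<ge>1. 0 < w n" and "filterlim w at_top sequentially"
    and sample_type: "(UNIV :: real set) \<lesssim> (UNIV :: 'a set)"
  shows "(uniform_rate w (levy_class r A :: 'a semimart set) \<longrightarrow>
            (\<exists>K. \<forall>n\<ge>2. w n \<le> K * rho r n)) \<and>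
         (uniform_rate w (ito_class r A :: 'a semimart set) \<longrightarrow>
            (\<exists>K. \<forall>n\<ge>2. w n \<le> K * rho r n))"
proof (intro conjI impI)
  show "\<exists>K. \<forall>n\<ge>2. w n \<le> K * rho r n" if "uniform_rate w (levy_class r A :: 'a semimart set)"
    by (rule levy_class_rate[OF sample_type assms(3,1,2,4) that])
  assume ito: "uniform_rate w (ito_class r A :: 'a semimart set)"
  have "levy_class r A \<subseteq> (ito_class r A :: 'a semimart set)" by (auto simp: levy_class_def)
  then obtain E where "estimators E" "achieves_rate E w (levy_class r A :: 'a semimart set)"
    using ito by (rule uniform_rate_mono)
  then have "uniform_rate w (levy_class r A :: 'a semimart set)" unfolding uniform_rate_def by blast
  then show "\<exists>K. \<forall>n\<ge>2. w n \<le> K * rho r n"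
    by (rule levy_class_rate[OF sample_type assms(3,1,2,4)])
qed

end
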